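(* Let $K$ be a field of characteristic zero and let a Poisson algebra $\mathcal{A}=S^{-1}(P_n/I)$ be a regular domain of essentially finite type over $K$, where $I=(f_1,\ldots,f_m)$ is a prime but not maximal ideal of $P_n=K[x_1,\ldots,x_n]$, and let $d$ be the rank of $\mathcal{C}_{\mathcal{A}}=(\{x_i,x_j\})$. Then the following statements are equivalent: (1) The homomorphism $\pi_{\mathcal{A}}:\mathcal{U}(\mathcal{A})\to\mathcal{D}(\mathcal{A})$ is an isomorphism. (2) $\kappa_{\mathcal{A}}=0$ and $\mathfrak{c}_{\mathcal{A},d}=\mathcal{A}$. If one of the equivalent conditions holds then $\ker(\pi_{\mathcal{A}})=0$ and $\mathcal{U}(\mathcal{A})=P\mathcal{D}(\mathcal{A})=\mathcal{D}(\mathcal{A})$ (the identifications being via $\pi_{\mathcal{A}}$).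
   Context: A Poisson algebra over $K$ is a commutative associative (unital) $K$-algebra with a $K$-bilinear Lie bracket $\{\cdot,\cdot\}$ satisfying $\{a,xy\}=\{a,x\}y+x\{a,y\}$. An algebra of essentially finite type is a localization of an affine commutative algebra. $\mathcal{D}(\mathcal{A})$ is the algebra of ($K$-linear, Grothendieck) differential operators on $\mathcal{A}$. Poisson enveloping algebra: $(\mathcal{U}(\mathcal{A}),\alpha,\beta)$ is the universal triple with $\mathcal{U}(\mathcal{A})$ an associative algebra, $\alpha:\mathcal{A}\to\mathcal{U}(\mathcal{A})$ an algebra homomorphism, $\beta:\mathcal{A}\to\mathcal{U}(\mathcal{A})$ a Lie algebra homomorphism, $[\beta(a),\alpha(b)]=\alpha(\{a,b\})$ and $\beta(ab)=\beta(a)\alpha(b)+\alpha(a)\beta(b)$. One writes $a=\alpha(a)$, $\delta_a=\beta(a)$, $\delta_i=\delta_{x_i}$. $\pi_{\mathcal{A}}:\mathcal{U}(\mathcal{A})\to\mathcal{D}(\mathcal{A})$ is the homomorphism $a\mapsto a$, $\delta_b\mapsto\{b,\cdot\}$; its image is the algebra $P\mathcal{D}(\mathcal{A})$ of Poisson differential operators, i.e. the subalgebra of $\mathrm{End}_K(\mathcal{A})$ generated by the multiplications by elements of $\mathcal{A}$ and all derivations $\{a,\cdot\}$, $a\in\mathcal{A}$. The rank $d$ is over the field of fractions of $\mathcal{A}$, and $\mathfrak{c}_{\mathcal{A},d}$ is the ideal of $\mathcal{A}$ generated by all the $d\times d$ minors of $\mathcal{C}_{\mathcal{A}}$. For increasing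 $d$-tuples $\mathbf{i},\mathbf{j}$ of elements of $\{1,\ldots,n\}$ let $\mu(\mathbf{i},\mathbf{j})=\det(\{x_{i_s},x_{j_t}\})_{s,t=1}^d$. Let $\mathbb{I}_{\mathcal{A}}(d)$ be the set of $\mathbf{i}$ with $\mu(\mathbf{i},\mathbf{j})\neq0$ for some $\mathbf{j}$. For $\mathbf{i},\mathbf{j}\in\mathbb{I}_{\mathcal{A}}(d)$ and $i_\nu\in\{1,\ldots,n\}\setminus\{i_1,\ldots,i_d\}$, $$\delta_{\mathbf{i},i_\nu;\mathbf{j}}=\mu(\mathbf{i},\mathbf{j})\delta_{i_\nu}+\sum_{s=1}^d(-1)^{s+d+1}\mu(i_1,\ldots,\widehat{i_s},\ldots,i_d,i_\nu;\mathbf{j})\,\delta_{i_s}\in\mathcal{U}(\mathcal{A}),$$ i.e. the determinant of the $(d+1)\times(d+1)$ matrix with rows $(\{x_{i},x_{j_1}\},\ldots,\{x_{i},x_{j_d}\},\delta_{i})$, $i=i_1,\ldots,i_d,i_\nu$. $\kappa_{\mathcal{A}}$ is the two-sided ideal of $\mathcal{U}(\mathcal{A})$ generated by all these elements. (If $d=0$ the tuples are empty and the empty minor is $1$.)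
   Formalization: U(A) is defined with the relation β(ab)=α(a)β(b)+α(b)β(a) instead of β(ab)=β(a)α(b)+α(a)β(b); the latter forces 2α({a,b})=0, so that π_A would not exist unless the bracket is zero. *)

theory Defs
  imports
    "HOL-Algebra.QuotRing"
    "HOL-Algebra.Generated_Rings"
    "HOL-Algebra.Ring_Divisibility"
    "HOL-Library.Poly_Mapping"
    "HOL-Library.Extended_Nat"
    "HOL-Computational_Algebra.Fraction_Field"
    "HOL-Computational_Algebra.Polynomial_Factorial"
    "Jordan_Normal_Form.Determinant"
    "Jordan_Normal_Form.DL_Rank"
begin

hide_const (open) Ring_Hom.ring_hom

text \<open>
  The field \<open>K\<close> and the domain \<open>\<A>\<close> are types of class \<open>field\<close> and \<open>idom\<close>; the
  \<open>K\<close>-algebra structure of \<open>\<A>\<close> is a scalar multiplication.  Whatever depends on the bracket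
  (the enveloping algebra, the ring of differential operators, ...) is a record of
  HOL-Algebra; \<open>class_ring\<close> is the record of a type-class ring.
\<close>

section \<open>Poisson algebras\<close>

locale comm_algebra = vector_space scale
  for scale :: "'k::field \<Rightarrow> 'a::comm_ring_1 \<Rightarrow> 'a" +
  assumes scale_mult_left: "scale c a * b = scale c (a * b)"

locale poisson_algebra = comm_algebra scale
  for scale :: "'k::field \<Rightarrow> 'a::comm_ring_1 \<Rightarrow> 'a" +
  fixes br :: "'a \<Rightarrow> 'a \<Rightarrow> 'a"
  assumes br_linear_right: "Vector_Spaces.linear scale scale (\<lambda>b. br a b)"
    and br_linear_left: "Vector_Spaces.linear scale scale (\<lambda>a. br a b)"
    and br_alternating: "br a a = 0"
    and br_jacobi: "br a (br b c) + br b (br c a) + br c (br a b) = 0"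
    and br_leibniz: "br a (b * c) = br a b * c + b * br a c"


section \<open>Polynomial rings and localizations\<close>

text \<open>\<open>K[X\<^sub>0,\<dots>,X\<^sub>n\<^sub>-\<^sub>1]\<close>; the variables are numbered from \<open>0\<close>.\<close>

definition mpoly_ring :: "nat \<Rightarrow> ((nat \<Rightarrow>\<^sub>0 nat) \<Rightarrow>\<^sub>0 'k::field) ring" where
  "mpoly_ring n = class_ring\<lparr>carrier := {p. \<forall>m \<in> Poly_Mapping.keys p. Poly_Mapping.keys m \<subseteq> {..<n}}\<rparr>"

definition pconst :: "'k::field \<Rightarrow> (nat \<Rightarrow>\<^sub>0 nat) \<Rightarrow>\<^sub>0 'k" where
  "pconst c = Poly_Mapping.single 0 c"

definition pvar :: "nat \<Rightarrow> (nat \<Rightarrow>\<^sub>0 nat) \<Rightarrow>\<^sub>0 'k::field" where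
  "pvar i = Poly_Mapping.single (Poly_Mapping.single i 1) 1"

text \<open>\<open>\<phi> : R \<rightarrow> A\<close> exhibits \<open>A\<close> as the localization \<open>S\<^sup>-\<^sup>1R\<close> of the commutative ring \<open>R\<close>.\<close>

definition is_localization ::
    "('r, 'c) ring_scheme \<Rightarrow> 'r set \<Rightarrow> ('a, 'd) ring_scheme \<Rightarrow> ('r \<Rightarrow> 'a) \<Rightarrow> bool" where
  "is_localization R S A \<phi> \<longleftrightarrow>
     submonoid S R \<and> \<phi> \<in> ring_hom R A \<and>
     (\<forall>s\<in>S. \<phi> s \<in> Units A) \<and>
     (\<forall>a\<in>carrier A. \<exists>r\<in>carrier R. \<exists>s\<in>S. a \<otimes>\<^bsub>A\<^esub> \<phi> s = \<phi> r) \<and>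
     (\<forall>r\<in>carrier R. \<phi> r = \<zero>\<^bsub>A\<^esub> \<longleftrightarrow> (\<exists>s\<in>S. s \<otimes>\<^bsub>R\<^esub> r = \<zero>\<^bsub>R\<^esub>))"


section \<open>Regular domains\<close>

definition krull_dim :: "('a, 'b) ring_scheme \<Rightarrow> enat" where
  "krull_dim R = (SUP k \<in> {k. \<exists>P :: nat \<Rightarrow> 'a set.
      (\<forall>i\<le>k. primeideal (P i) R) \<and> (\<forall>i<k. P i \<subset> P (Suc i))}. enat k)"

definition regular_local_ring :: "('a, 'b) ring_scheme \<Rightarrow> bool" where
  "regular_local_ring R \<longleftrightarrow>
     cring R \<and> noetherian_ring R \<and> (\<exists>!M. maximalideal M R) \<and>
     (\<exists>M G. maximalideal M R \<and> G \<subseteq> carrier R \<and> finite G \<and>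
        enat (card G) = krull_dim R \<and> M = Idl\<^bsub>R\<^esub> G)"

text \<open>The localization \<open>\<A>\<^sub>p\<close> of a domain, as a subring of its field of fractions.\<close>

definition local_ring_at :: "'a::idom set \<Rightarrow> 'a fract ring" where
  "local_ring_at p = class_ring\<lparr>carrier := {Fract a b | a b. b \<notin> p}\<rparr>"

definition regular_domain :: "'a::idom itself \<Rightarrow> bool" where
  "regular_domain _ \<longleftrightarrow>
     noetherian_ring (class_ring :: 'a ring) \<and>
     (\<forall>p :: 'a set. primeideal p class_ring \<longrightarrow> regular_local_ring (local_ring_at p))"


section \<open>Differential operators\<close>

definition End_ring :: "('k::field \<Rightarrow> 'a::comm_ring_1 \<Rightarrow> 'a) \<Rightarrow> ('a \<Rightarrow> 'a) ring" where
  "End_ring scale = \<lparr>carrier = {f. Vector_Spaces.linear scale scale f},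
     monoid.mult = (\<circ>), one = id, ring.zero = (\<lambda>_. 0), add = (\<lambda>f g a. f a + g a)\<rparr>"

fun diff_ops_upto :: "('k::field \<Rightarrow> 'a::comm_ring_1 \<Rightarrow> 'a) \<Rightarrow> nat \<Rightarrow> ('a \<Rightarrow> 'a) set" where
  "diff_ops_upto scale 0 =
     {f \<in> carrier (End_ring scale). \<forall>a. (\<lambda>b. f (a * b) - a * f b) = (\<lambda>_. 0)}"
| "diff_ops_upto scale (Suc k) =
     {f \<in> carrier (End_ring scale). \<forall>a. (\<lambda>b. f (a * b) - a * f b) \<in> diff_ops_upto scale k}"

definition diff_ops :: "('k::field \<Rightarrow> 'a::comm_ring_1 \<Rightarrow> 'a) \<Rightarrow> ('a \<Rightarrow> 'a) ring" where
  "diff_ops scale = (End_ring scale)\<lparr>carrier := (\<Union>k. diff_ops_upto scale k)\<rparr>"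

text \<open>The generated subring is a \<open>K\<close>-subalgebra, as the generators include the
  multiplications by scalars.\<close>

definition poisson_diff_ops ::
    "('k::field \<Rightarrow> 'a::comm_ring_1 \<Rightarrow> 'a) \<Rightarrow> ('a \<Rightarrow> 'a \<Rightarrow> 'a) \<Rightarrow> ('a \<Rightarrow> 'a) ring" where
  "poisson_diff_ops scale br = (End_ring scale)\<lparr>carrier :=
     generate_ring (End_ring scale) (range (\<lambda>a b. a * b) \<union> range br)\<rparr>"


section \<open>The Poisson enveloping algebra\<close>

text \<open>\<open>\<U>(\<A>)\<close> is constructed as the quotient of the free \<open>K\<close>-algebra on symbols
  \<open>Mul a\<close> (for \<open>\<alpha>(a)\<close>) and \<open>Ham a\<close> (for \<open>\<beta>(a)\<close>) by the relations that \<open>\<alpha>\<close> and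
  \<open>\<beta>\<close> have to satisfy; its universal property is proved below.
  The last relation is \<open>\<beta>(ab) = \<alpha>(a)\<beta>(b) + \<alpha>(b)\<beta>(a)\<close>.  The variant
  \<open>\<beta>(ab) = \<beta>(a)\<alpha>(b) + \<alpha>(a)\<beta>(b)\<close> found in places is not meant: antisymmetrizing it in
  \<open>a\<close> and \<open>b\<close> gives \<open>2\<alpha>({a,b}) = 0\<close>, and the operators \<open>b \<mapsto> ab\<close>, \<open>{a,\<cdot>}\<close> violate it.
  The free algebra is the monoid algebra of the free monoid, written additively.\<close>

datatype 'x free_monoid = Word (letters: "'x list")

instantiation free_monoid :: (type) monoid_add
begin
definition "0 = Word []"
definition "v + w = Word (letters v @ letters w)"
instance by intro_classes (auto simp: zero_free_monoid_def plus_free_monoid_def)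
end

datatype 'a gen = Mul 'a | Ham 'a

type_synonym ('k, 'a) free_alg = "'a gen free_monoid \<Rightarrow>\<^sub>0 'k"

definition fconst :: "'k::field \<Rightarrow> ('k, 'a) free_alg" where
  "fconst c = Poly_Mapping.single 0 c"

definition fgen :: "'a gen \<Rightarrow> ('k::field, 'a) free_alg" where
  "fgen g = Poly_Mapping.single (Word [g]) 1"

definition U_relations ::
    "('k::field \<Rightarrow> 'a::comm_ring_1 \<Rightarrow> 'a) \<Rightarrow> ('a \<Rightarrow> 'a \<Rightarrow> 'a) \<Rightarrow> ('k, 'a) free_alg set" where
  "U_relations scale br =
     {fgen (Mul 1) - 1}
   \<union> {fgen (Mul (a + b)) - (fgen (Mul a) + fgen (Mul b)) | a b. True}
   \<union> {fgen (Mul (scale c a)) - fconst c * fgen (Mul a) | c a. True}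
   \<union> {fgen (Mul (a * b)) - fgen (Mul a) * fgen (Mul b) | a b. True}
   \<union> {fgen (Ham (a + b)) - (fgen (Ham a) + fgen (Ham b)) | a b. True}
   \<union> {fgen (Ham (scale c a)) - fconst c * fgen (Ham a) | c a. True}
   \<union> {fgen (Ham (br a b)) - (fgen (Ham a) * fgen (Ham b) - fgen (Ham b) * fgen (Ham a)) | a b. True}
   \<union> {fgen (Ham a) * fgen (Mul b) - fgen (Mul b) * fgen (Ham a) - fgen (Mul (br a b)) | a b. True}
   \<union> {fgen (Ham (a * b)) - (fgen (Mul a) * fgen (Ham b) + fgen (Mul b) * fgen (Ham a)) | a b. True}"

definition U_ideal ::
    "('k::field \<Rightarrow> 'a::comm_ring_1 \<Rightarrow> 'a) \<Rightarrow> ('a \<Rightarrow> 'a \<Rightarrow> 'a) \<Rightarrow> ('k, 'a) free_alg set" where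
  "U_ideal scale br = Idl\<^bsub>class_ring\<^esub> (U_relations scale br)"

definition U ::
    "('k::field \<Rightarrow> 'a::comm_ring_1 \<Rightarrow> 'a) \<Rightarrow> ('a \<Rightarrow> 'a \<Rightarrow> 'a) \<Rightarrow> ('k, 'a) free_alg set ring" where
  "U scale br = class_ring Quot (U_ideal scale br)"

definition U_const :: "('k::field \<Rightarrow> 'a::comm_ring_1 \<Rightarrow> 'a) \<Rightarrow> ('a \<Rightarrow> 'a \<Rightarrow> 'a) \<Rightarrow> 'k \<Rightarrow>
    ('k, 'a) free_alg set" where
  "U_const scale br c = U_ideal scale br +>\<^bsub>class_ring\<^esub> fconst c"

definition U_alpha :: "('k::field \<Rightarrow> 'a::comm_ring_1 \<Rightarrow> 'a) \<Rightarrow> ('a \<Rightarrow> 'a \<Rightarrow> 'a) \<Rightarrow> 'a \<Rightarrow>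
    ('k, 'a) free_alg set" where
  "U_alpha scale br a = U_ideal scale br +>\<^bsub>class_ring\<^esub> fgen (Mul a)"

definition U_beta :: "('k::field \<Rightarrow> 'a::comm_ring_1 \<Rightarrow> 'a) \<Rightarrow> ('a \<Rightarrow> 'a \<Rightarrow> 'a) \<Rightarrow> 'a \<Rightarrow>
    ('k, 'a) free_alg set" where
  "U_beta scale br a = U_ideal scale br +>\<^bsub>class_ring\<^esub> fgen (Ham a)"

text \<open>A triple \<open>(R, \<alpha>, \<beta>)\<close> as in the definition of \<open>\<U>(\<A>)\<close>; \<open>\<iota> : K \<rightarrow> R\<close> is the structure
  map of the \<open>K\<close>-algebra \<open>R\<close>.\<close>

locale poisson_triple = ring R
  for scale :: "'k::field \<Rightarrow> 'a::comm_ring_1 \<Rightarrow> 'a" and br :: "'a \<Rightarrow> 'a \<Rightarrow> 'a"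
    and R :: "'r ring" (structure) +
  fixes \<iota> :: "'k \<Rightarrow> 'r" and \<alpha> \<beta> :: "'a \<Rightarrow> 'r"
  assumes iota_hom: "\<iota> \<in> ring_hom class_ring R"
    and iota_central: "r \<in> carrier R \<Longrightarrow> \<iota> c \<otimes> r = r \<otimes> \<iota> c"
    and alpha_hom: "\<alpha> \<in> ring_hom class_ring R"
    and alpha_scale: "\<alpha> (scale c a) = \<iota> c \<otimes> \<alpha> a"
    and beta_closed: "\<beta> a \<in> carrier R"
    and beta_add: "\<beta> (a + b) = \<beta> a \<oplus> \<beta> b"
    and beta_scale: "\<beta> (scale c a) = \<iota> c \<otimes> \<beta> a"
    and beta_br: "\<beta> (br a b) = \<beta> a \<otimes> \<beta> b \<ominus> \<beta> b \<otimes> \<beta> a"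
    and beta_alpha: "\<beta> a \<otimes> \<alpha> b \<ominus> \<alpha> b \<otimes> \<beta> a = \<alpha> (br a b)"
    and beta_mult: "\<beta> (a * b) = \<alpha> a \<otimes> \<beta> b \<oplus> \<alpha> b \<otimes> \<beta> a"

text \<open>The homomorphism \<open>\<U>(\<A>) \<rightarrow> R\<close> induced by a triple, via evaluation on the free algebra.\<close>

definition free_eval :: "'r ring \<Rightarrow> ('k::field \<Rightarrow> 'r) \<Rightarrow> ('a \<Rightarrow> 'r) \<Rightarrow> ('a \<Rightarrow> 'r) \<Rightarrow>
    ('k, 'a) free_alg \<Rightarrow> 'r" where
  "free_eval R \<iota> \<alpha> \<beta> p = (\<Oplus>\<^bsub>R\<^esub>w\<in>Poly_Mapping.keys p. \<iota> (Poly_Mapping.lookup p w) \<otimes>\<^bsub>R\<^esub>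
     foldr (\<lambda>g r. case_gen \<alpha> \<beta> g \<otimes>\<^bsub>R\<^esub> r) (letters w) \<one>\<^bsub>R\<^esub>)"

definition U_lift :: "'r ring \<Rightarrow> ('k::field \<Rightarrow> 'r) \<Rightarrow> ('a \<Rightarrow> 'r) \<Rightarrow> ('a \<Rightarrow> 'r) \<Rightarrow>
    ('k, 'a) free_alg set \<Rightarrow> 'r" where
  "U_lift R \<iota> \<alpha> \<beta> Y = the_elem (free_eval R \<iota> \<alpha> \<beta> ` Y)"

definition poisson_pi :: "('k::field \<Rightarrow> 'a::comm_ring_1 \<Rightarrow> 'a) \<Rightarrow> ('a \<Rightarrow> 'a \<Rightarrow> 'a) \<Rightarrow>
    ('k, 'a) free_alg set \<Rightarrow> ('a \<Rightarrow> 'a)" where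
  "poisson_pi scale br = U_lift (End_ring scale) scale (\<lambda>a b. a * b) br"

lemma free_alg_ring: "ring (class_ring :: ('k::field, 'a) free_alg ring)"
  by (rule class_ring.ring_axioms)

lemma U_ideal_ideal: "ideal (U_ideal scale br) class_ring"
  unfolding U_ideal_def by (rule ring.genideal_ideal[OF free_alg_ring]) simp

lemma U_ring: "ring (U scale br)"
  unfolding U_def by (rule ideal.quotient_is_ring[OF U_ideal_ideal])

lemma U_proj_hom_ring:
  "ring_hom_ring class_ring (U scale br) (\<lambda>p. U_ideal scale br +>\<^bsub>class_ring\<^esub> p)"
  unfolding U_def by (rule ideal.rcos_ring_hom_ring[OF U_ideal_ideal])

lemma U_proj_surj:
  "carrier (U scale br) = range (\<lambda>p. U_ideal scale br +>\<^bsub>class_ring\<^esub> p)"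
  by (auto simp: U_def FactRing_def A_RCOSETS_defs a_r_coset_def)

lemma U_proj_cong:
  assumes "p - q \<in> U_relations scale br"
  shows "U_ideal scale br +>\<^bsub>class_ring\<^esub> p = U_ideal scale br +>\<^bsub>class_ring\<^esub> q"
proof -
  interpret I: ideal "U_ideal scale br" class_ring by (rule U_ideal_ideal)
  have "p - q \<in> U_ideal scale br"
    unfolding U_ideal_def using ring.genideal_self[OF free_alg_ring, of "U_relations scale br"] assms
    by auto
  then have "p \<in> U_ideal scale br +>\<^bsub>class_ring\<^esub> q"
    by (force simp: a_r_coset_def r_coset_def)
  then show ?thesis
    using I.a_repr_independence'[of p q] by simp
qed

lemma update_eq_add:
  assumes "w \<notin> Poly_Mapping.keys f"
  shows "Poly_Mapping.update w b f = Poly_Mapping.single w b + f"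
  using assms
  by (intro poly_mapping_eqI) (auto simp: lookup_update lookup_add lookup_single in_keys_iff when_def)

lemma fconst_central: "fconst c * p = p * fconst c"
proof (induction p rule: update_induct)
  case const
  then show ?case by simp
next
  case (update f w b)
  have "fconst c * Poly_Mapping.single w b = Poly_Mapping.single w b * fconst c"
    by (simp add: fconst_def mult_single mult.commute)
  with update show ?case
    by (simp add: update_eq_add distrib_left distrib_right)
qed

lemma U_poisson_triple:
  fixes scale :: "'k::field \<Rightarrow> 'a::comm_ring_1 \<Rightarrow> 'a"
  shows "poisson_triple scale br (U scale br) (U_const scale br) (U_alpha scale br) (U_beta scale br)"
proof -
  define q :: "('k, 'a) free_alg \<Rightarrow> _" where "q = (\<lambda>p. U_ideal scale br +>\<^bsub>class_ring\<^esub> p)"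
  interpret Q: ring_hom_ring class_ring "U scale br" q
    unfolding q_def by (rule U_proj_hom_ring)
  have add: "q (u + v) = q u \<oplus>\<^bsub>U scale br\<^esub> q v"
    and mult: "q (u * v) = q u \<otimes>\<^bsub>U scale br\<^esub> q v"
    and diff: "q (u - v) = q u \<ominus>\<^bsub>U scale br\<^esub> q v"
    and one: "q 1 = \<one>\<^bsub>U scale br\<^esub>"
    and closed: "q u \<in> carrier (U scale br)" for u v
  proof -
    show add: "q (u + v) = q u \<oplus>\<^bsub>U scale br\<^esub> q v" for u v
      using Q.hom_add[of u v] by simp
    show closed: "q u \<in> carrier (U scale br)" for u
      using Q.hom_closed[of u] by simp
    show "q (u * v) = q u \<otimes>\<^bsub>U scale br\<^esub> q v"
      using Q.hom_mult[of u v] by simp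
    show "q 1 = \<one>\<^bsub>U scale br\<^esub>"
      using Q.hom_one by simp
    show "q (u - v) = q u \<ominus>\<^bsub>U scale br\<^esub> q v"
      using add[of "u - v" v] closed by (simp add: Q.S.minus_eq Q.S.a_assoc Q.S.r_neg)
  qed
  have const: "U_const scale br c = q (fconst c)" for c
    by (simp add: U_const_def q_def)
  have alpha: "U_alpha scale br a = q (fgen (Mul a))" for a
    by (simp add: U_alpha_def q_def)
  have beta: "U_beta scale br a = q (fgen (Ham a))" for a
    by (simp add: U_beta_def q_def)
  have surj: "\<exists>u. r = q u" if "r \<in> carrier (U scale br)" for r
    using that unfolding U_proj_surj q_def by blast
  have cong: "q u = q v" if "u - v \<in> U_relations scale br" for u v
    using U_proj_cong[OF that] by (simp add: q_def)
  have c1: "fconst (c + d) = fconst c + fconst d" "fconst (c * d) = fconst c * fconst d"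
    "fconst (1::'k) = (1 :: ('k, 'a) free_alg)" for c d :: 'k
    by (simp_all add: fconst_def single_add mult_single)
  have r1: "q (fgen (Mul 1)) = q 1"
    by (rule cong) (simp add: U_relations_def)
  have r2: "q (fgen (Mul (a + b))) = q (fgen (Mul a) + fgen (Mul b))" for a b
    by (rule cong) (unfold U_relations_def, blast)
  have r3: "q (fgen (Mul (scale c a))) = q (fconst c * fgen (Mul a))" for c a
    by (rule cong) (unfold U_relations_def, blast)
  have r4: "q (fgen (Mul (a * b))) = q (fgen (Mul a) * fgen (Mul b))" for a b
    by (rule cong) (unfold U_relations_def, blast)
  have r5: "q (fgen (Ham (a + b))) = q (fgen (Ham a) + fgen (Ham b))" for a b
    by (rule cong) (unfold U_relations_def, blast)
  have r6: "q (fgen (Ham (scale c a))) = q (fconst c * fgen (Ham a))" for c a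
    by (rule cong) (unfold U_relations_def, blast)
  have r7: "q (fgen (Ham (br a b))) = q (fgen (Ham a) * fgen (Ham b) - fgen (Ham b) * fgen (Ham a))"
    for a b by (rule cong) (unfold U_relations_def, blast)
  have r8: "q (fgen (Ham a) * fgen (Mul b) - fgen (Mul b) * fgen (Ham a)) = q (fgen (Mul (br a b)))"
    for a b by (rule cong) (unfold U_relations_def, blast)
  have r9: "q (fgen (Ham (a * b))) = q (fgen (Mul a) * fgen (Ham b) + fgen (Mul b) * fgen (Ham a))"
    for a b by (rule cong) (unfold U_relations_def, blast)
  show ?thesis
  proof (intro poisson_triple.intro poisson_triple_axioms.intro U_ring)
    show "U_const scale br \<in> ring_hom class_ring (U scale br)"
      by (rule ring_hom_memI) (simp_all add: const c1 add mult one closed)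
    show "U_const scale br c \<otimes>\<^bsub>U scale br\<^esub> r = r \<otimes>\<^bsub>U scale br\<^esub> U_const scale br c"
      if r: "r \<in> carrier (U scale br)" for r c
    proof -
      obtain u where "r = q u" using surj[OF r] by blast
      then show ?thesis by (simp add: const mult[symmetric] fconst_central)
    qed
    show "U_alpha scale br \<in> ring_hom class_ring (U scale br)"
      by (rule ring_hom_memI) (simp_all add: alpha r1 r2 r4 add mult one closed)
  qed (simp_all only: alpha beta const r3 r5 r6 r7 r8[symmetric] r9 add mult diff closed)
qed

context poisson_triple
begin

abbreviation (input) word_eval :: "'a gen free_monoid \<Rightarrow> 'r" where
  "word_eval w \<equiv> foldr (\<lambda>g r. case_gen \<alpha> \<beta> g \<otimes> r) (letters w) \<one>"

lemma iota_simps [simp]: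
  "\<iota> c \<in> carrier R" "\<iota> 0 = \<zero>" "\<iota> 1 = \<one>"
  "\<iota> (c + d) = \<iota> c \<oplus> \<iota> d" "\<iota> (c * d) = \<iota> c \<otimes> \<iota> d"
proof -
  interpret h: ring_hom_ring class_ring R \<iota>
    by (rule ring_hom_ringI2[OF class_ring.ring_axioms ring_axioms iota_hom])
  show "\<iota> c \<in> carrier R" "\<iota> 0 = \<zero>" "\<iota> 1 = \<one>"
    "\<iota> (c + d) = \<iota> c \<oplus> \<iota> d" "\<iota> (c * d) = \<iota> c \<otimes> \<iota> d"
    using h.hom_closed[of c] h.hom_zero h.hom_one h.hom_add[of c d] h.hom_mult[of c d] by simp_all
qed

lemma alpha_simps:
  "\<alpha> a \<in> carrier R" "\<alpha> 1 = \<one>" "\<alpha> (a + b) = \<alpha> a \<oplus> \<alpha> b" "\<alpha> (a * b) = \<alpha> a \<otimes> \<alpha> b"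
  using ring_hom_closed[OF alpha_hom, of a] ring_hom_one[OF alpha_hom]
    ring_hom_add[OF alpha_hom, of a b] ring_hom_mult[OF alpha_hom, of a b] by simp_all

lemma gen_closed [simp]: "case_gen \<alpha> \<beta> g \<in> carrier R"
  by (cases g) (simp_all add: alpha_simps beta_closed)

lemma word_eval_closed [simp]: "foldr (\<lambda>g r. case_gen \<alpha> \<beta> g \<otimes> r) gs \<one> \<in> carrier R"
  by (induction gs) simp_all

lemma word_eval_append:
  "foldr (\<lambda>g r. case_gen \<alpha> \<beta> g \<otimes> r) (gs @ hs) \<one> =
   foldr (\<lambda>g r. case_gen \<alpha> \<beta> g \<otimes> r) gs \<one> \<otimes> foldr (\<lambda>g r. case_gen \<alpha> \<beta> g \<otimes> r) hs \<one>"
proof (induction gs)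
  case Nil
  have "foldr (\<lambda>g r. case_gen \<alpha> \<beta> g \<otimes> r) hs \<one> \<in> carrier R" by (rule word_eval_closed)
  then show ?case by simp
next
  case (Cons g gs)
  then show ?case
    by (simp only: append_Cons foldr.simps o_apply m_assoc gen_closed word_eval_closed)
qed

lemma word_eval_add: "word_eval (v + w) = word_eval v \<otimes> word_eval w"
  by (simp only: plus_free_monoid_def free_monoid.sel word_eval_append)

lemma free_eval_superset:
  assumes "finite W" "Poly_Mapping.keys p \<subseteq> W"
  shows "free_eval R \<iota> \<alpha> \<beta> p = (\<Oplus>w\<in>W. \<iota> (Poly_Mapping.lookup p w) \<otimes> word_eval w)"
  unfolding free_eval_def using assms
  by (intro add.finprod_mono_neutral_cong_left) (auto simp: in_keys_iff)

lemma free_eval_closed [simp]: "free_eval R \<iota> \<alpha> \<beta> p \<in> carrier R"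
  unfolding free_eval_def by (intro finsum_closed) auto

lemma free_eval_add: "free_eval R \<iota> \<alpha> \<beta> (p + q) = free_eval R \<iota> \<alpha> \<beta> p \<oplus> free_eval R \<iota> \<alpha> \<beta> q"
proof -
  let ?W = "Poly_Mapping.keys p \<union> Poly_Mapping.keys q"
  have "free_eval R \<iota> \<alpha> \<beta> (p + q) =
      (\<Oplus>w\<in>?W. \<iota> (Poly_Mapping.lookup p w) \<otimes> word_eval w \<oplus> \<iota> (Poly_Mapping.lookup q w) \<otimes> word_eval w)"
    by (subst free_eval_superset[of ?W])
      (auto simp: keys_add lookup_add l_distr intro!: add.finprod_cong')
  also have "\<dots> = free_eval R \<iota> \<alpha> \<beta> p \<oplus> free_eval R \<iota> \<alpha> \<beta> q"
    by (subst finsum_addf) (auto simp: free_eval_superset[of ?W])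
  finally show ?thesis .
qed

lemma free_eval_single:
  "free_eval R \<iota> \<alpha> \<beta> (Poly_Mapping.single w c) = \<iota> c \<otimes> word_eval w"
  by (subst free_eval_superset[of "{w}"]) (auto simp: add.finprod_insert)

lemma free_eval_zero [simp]: "free_eval R \<iota> \<alpha> \<beta> 0 = \<zero>"
  by (simp add: free_eval_def)

lemma free_eval_single_mult:
  "free_eval R \<iota> \<alpha> \<beta> (Poly_Mapping.single w c * q) =
   free_eval R \<iota> \<alpha> \<beta> (Poly_Mapping.single w c) \<otimes> free_eval R \<iota> \<alpha> \<beta> q"
proof (induction q rule: update_induct)
  case const
  then show ?case by (simp add: free_eval_single)
next
  case (update f v b)
  have "\<iota> c \<otimes> \<iota> b \<otimes> (word_eval w \<otimes> word_eval v) = (\<iota> c \<otimes> word_eval w) \<otimes> (\<iota> b \<otimes> word_eval v)"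
  proof -
    have "\<iota> c \<otimes> \<iota> b \<otimes> (word_eval w \<otimes> word_eval v) = \<iota> c \<otimes> (\<iota> b \<otimes> word_eval w) \<otimes> word_eval v"
      by (simp add: m_assoc)
    also have "\<dots> = \<iota> c \<otimes> (word_eval w \<otimes> \<iota> b) \<otimes> word_eval v"
      by (simp only: iota_central[OF word_eval_closed])
    finally show ?thesis
      by (simp add: m_assoc)
  qed
  with update show ?case
    by (simp add: update_eq_add distrib_left free_eval_add mult_single free_eval_single
        word_eval_add r_distr)
qed

lemma free_eval_mult: "free_eval R \<iota> \<alpha> \<beta> (p * q) = free_eval R \<iota> \<alpha> \<beta> p \<otimes> free_eval R \<iota> \<alpha> \<beta> q"
proof (induction p rule: update_induct)
  case const
  then show ?case by simp
next
  case (update f v b)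
  then show ?case
    by (simp add: update_eq_add distrib_right free_eval_add free_eval_single_mult l_distr)
qed

lemma free_eval_one: "free_eval R \<iota> \<alpha> \<beta> 1 = \<one>"
proof -
  have "free_eval R \<iota> \<alpha> \<beta> (Poly_Mapping.single 0 1) = \<one>"
    by (simp only: free_eval_single) (simp add: zero_free_monoid_def)
  then show ?thesis by simp
qed

lemma free_eval_hom: "free_eval R \<iota> \<alpha> \<beta> \<in> ring_hom class_ring R"
  by (rule ring_hom_memI) (simp_all add: free_eval_add free_eval_mult free_eval_one)

lemma free_eval_diff: "free_eval R \<iota> \<alpha> \<beta> (p - q) = free_eval R \<iota> \<alpha> \<beta> p \<ominus> free_eval R \<iota> \<alpha> \<beta> q"
  using free_eval_add[of "p - q" q] free_eval_closed by (simp add: minus_eq a_assoc r_neg)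

lemma free_eval_gen:
  "free_eval R \<iota> \<alpha> \<beta> (fgen (Mul a)) = \<alpha> a" "free_eval R \<iota> \<alpha> \<beta> (fgen (Ham a)) = \<beta> a"
  "free_eval R \<iota> \<alpha> \<beta> (fconst c) = \<iota> c"
  by (simp_all add: fgen_def fconst_def free_eval_single alpha_simps beta_closed zero_free_monoid_def)

lemma free_eval_relation:
  assumes "u \<in> U_relations scale br"
  shows "free_eval R \<iota> \<alpha> \<beta> u = \<zero>"
proof -
  have eq: "free_eval R \<iota> \<alpha> \<beta> (v - w) = \<zero>"
    if "free_eval R \<iota> \<alpha> \<beta> v = free_eval R \<iota> \<alpha> \<beta> w" for v w
    unfolding free_eval_diff that minus_eq by (rule r_neg[OF free_eval_closed])
  show ?thesis
    using assms unfolding U_relations_def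
    apply (elim UnE CollectE exE conjE singletonE)
    by (hypsubst, rule eq, simp only: free_eval_add free_eval_mult free_eval_diff free_eval_gen
      free_eval_one alpha_simps alpha_scale beta_add beta_scale beta_br beta_alpha beta_mult)+
qed

lemma free_eval_ideal:
  assumes "p \<in> U_ideal scale br"
  shows "free_eval R \<iota> \<alpha> \<beta> p = \<zero>"
proof -
  have h: "ring_hom_ring class_ring R (free_eval R \<iota> \<alpha> \<beta>)"
    by (rule ring_hom_ringI2[OF class_ring.ring_axioms ring_axioms free_eval_hom])
  have "U_relations scale br \<subseteq> a_kernel class_ring R (free_eval R \<iota> \<alpha> \<beta>)"
    unfolding a_kernel_def' using free_eval_relation by simp blast
  then have "U_ideal scale br \<subseteq> a_kernel class_ring R (free_eval R \<iota> \<alpha> \<beta>)"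
    unfolding U_ideal_def
    by (rule ring.genideal_minimal[OF class_ring.ring_axioms ring_hom_ring.kernel_is_ideal[OF h]])
  with assms show ?thesis
    unfolding a_kernel_def' by blast
qed

lemma U_lift_proj:
  "U_lift R \<iota> \<alpha> \<beta> (U_ideal scale br +>\<^bsub>class_ring\<^esub> p) = free_eval R \<iota> \<alpha> \<beta> p"
proof -
  have "free_eval R \<iota> \<alpha> \<beta> ` (U_ideal scale br +>\<^bsub>class_ring\<^esub> p) = {free_eval R \<iota> \<alpha> \<beta> p}"
  proof -
    interpret I: ideal "U_ideal scale br" class_ring by (rule U_ideal_ideal)
    have "(0 :: ('k, 'a) free_alg) \<in> U_ideal scale br"
      using I.zero_closed by simp
    then show ?thesis
      by (force simp: a_r_coset_def r_coset_def free_eval_add free_eval_ideal)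
  qed
  then show ?thesis by (simp add: U_lift_def)
qed

text \<open>The universal property of \<open>\<U>(\<A>)\<close>.\<close>

theorem U_universal:
  "U_lift R \<iota> \<alpha> \<beta> \<in> ring_hom (U scale br) R"
  "U_lift R \<iota> \<alpha> \<beta> (U_const scale br c) = \<iota> c"
  "U_lift R \<iota> \<alpha> \<beta> (U_alpha scale br a) = \<alpha> a"
  "U_lift R \<iota> \<alpha> \<beta> (U_beta scale br a) = \<beta> a"
proof -
  interpret Q: ring_hom_ring class_ring "U scale br"
      "\<lambda>p :: ('k, 'a) free_alg. U_ideal scale br +>\<^bsub>class_ring\<^esub> p"
    by (rule U_proj_hom_ring)
  have add: "(U_ideal scale br +>\<^bsub>class_ring\<^esub> p) \<oplus>\<^bsub>U scale br\<^esub> (U_ideal scale br +>\<^bsub>class_ring\<^esub> q)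
      = U_ideal scale br +>\<^bsub>class_ring\<^esub> (p + q)" for p q
    using Q.hom_add[of p q] by simp
  have mult: "(U_ideal scale br +>\<^bsub>class_ring\<^esub> p) \<otimes>\<^bsub>U scale br\<^esub> (U_ideal scale br +>\<^bsub>class_ring\<^esub> q)
      = U_ideal scale br +>\<^bsub>class_ring\<^esub> (p * q)" for p q
    using Q.hom_mult[of p q] by simp
  have one: "\<one>\<^bsub>U scale br\<^esub> = U_ideal scale br +>\<^bsub>class_ring\<^esub> 1"
    using Q.hom_one by simp
  show "U_lift R \<iota> \<alpha> \<beta> \<in> ring_hom (U scale br) R"
    by (rule ring_hom_memI)
      (auto simp: U_proj_surj add mult one U_lift_proj free_eval_add free_eval_mult free_eval_one)
qed (simp_all add: U_const_def U_alpha_def U_beta_def U_lift_proj free_eval_gen)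

theorem U_universal_unique:
  assumes h: "h \<in> ring_hom (U scale br) R"
    and h_const: "\<And>c. h (U_const scale br c) = \<iota> c"
    and h_alpha: "\<And>a. h (U_alpha scale br a) = \<alpha> a"
    and h_beta: "\<And>a. h (U_beta scale br a) = \<beta> a"
    and u: "u \<in> carrier (U scale br)"
  shows "h u = U_lift R \<iota> \<alpha> \<beta> u"
proof -
  define g where "g = (\<lambda>p. h (U_ideal scale br +>\<^bsub>class_ring\<^esub> p))"
  interpret H: ring_hom_ring "U scale br" R h
    by (rule ring_hom_ringI2[OF U_ring ring_axioms h])
  interpret Q: ring_hom_ring class_ring "U scale br"
      "\<lambda>p :: ('k, 'a) free_alg. U_ideal scale br +>\<^bsub>class_ring\<^esub> p"
    by (rule U_proj_hom_ring)
  have cl: "U_ideal scale br +>\<^bsub>class_ring\<^esub> p \<in> carrier (U scale br)" for p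
    by (simp add: U_proj_surj)
  have add: "g (p + q) = g p \<oplus> g q" and mult: "g (p * q) = g p \<otimes> g q" and one: "g 1 = \<one>"
    and zero: "g 0 = \<zero>" for p q
    using Q.hom_add[of p q] Q.hom_mult[of p q] Q.hom_one Q.hom_zero cl
    by (simp_all add: g_def)
  have const: "g (Poly_Mapping.single 0 c) = \<iota> c" for c
    using h_const[of c] by (simp add: g_def U_const_def fconst_def)
  have gen: "g (Poly_Mapping.single (Word [x]) 1) = case_gen \<alpha> \<beta> x" for x
    using h_alpha h_beta by (cases x) (simp_all add: g_def U_alpha_def U_beta_def fgen_def)
  have word: "g (Poly_Mapping.single (Word gs) 1) = foldr (\<lambda>g r. case_gen \<alpha> \<beta> g \<otimes> r) gs \<one>" for gs
  proof (induction gs)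
    case Nil
    then show ?case using one by (simp add: zero_free_monoid_def[symmetric])
  next
    case (Cons x gs)
    have "Poly_Mapping.single (Word (x # gs)) (1::'k)
        = Poly_Mapping.single (Word [x]) 1 * Poly_Mapping.single (Word gs) 1"
      by (simp add: mult_single plus_free_monoid_def)
    then show ?case by (simp add: mult gen Cons)
  qed
  have single: "g (Poly_Mapping.single w c) = free_eval R \<iota> \<alpha> \<beta> (Poly_Mapping.single w c)" for w c
  proof -
    have "Poly_Mapping.single w c = Poly_Mapping.single 0 c * Poly_Mapping.single (Word (letters w)) 1"
      by (simp add: mult_single)
    then have "g (Poly_Mapping.single w c)
        = g (Poly_Mapping.single 0 c) \<otimes> g (Poly_Mapping.single (Word (letters w)) 1)"
      by (simp only: mult)
    then show ?thesis by (simp only: const word free_eval_single)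
  qed
  have "g p = free_eval R \<iota> \<alpha> \<beta> p" for p
    by (induction p rule: update_induct) (simp_all add: zero update_eq_add add single free_eval_add)
  moreover obtain p where "u = U_ideal scale br +>\<^bsub>class_ring\<^esub> p"
    using u by (auto simp: U_proj_surj)
  ultimately show ?thesis by (simp add: g_def U_lift_proj)
qed

end

context poisson_algebra
begin

lemma End_ring_carrier:
  "f \<in> carrier (End_ring scale) \<longleftrightarrow>
    (\<forall>a b. f (a + b) = f a + f b) \<and> (\<forall>c a. f (scale c a) = scale c (f a))"
proof -
  have "vector_space scale" by unfold_locales
  then show ?thesis by (simp add: End_ring_def Vector_Spaces.linear_iff)
qed

lemma End_ring_simps:
  "f \<otimes>\<^bsub>End_ring scale\<^esub> g = f \<circ> g" "\<one>\<^bsub>End_ring scale\<^esub> = id"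
  "f \<oplus>\<^bsub>End_ring scale\<^esub> g = (\<lambda>a. f a + g a)" "\<zero>\<^bsub>End_ring scale\<^esub> = (\<lambda>_. 0)"
  by (simp_all add: End_ring_def)

lemma End_ring_ring: "ring (End_ring scale)"
proof (rule ringI)
  note [simp] = End_ring_carrier End_ring_simps scale_right_distrib
  show "abelian_group (End_ring scale)"
  proof (rule abelian_groupI)
    fix f assume f: "f \<in> carrier (End_ring scale)"
    then show "\<exists>g\<in>carrier (End_ring scale). g \<oplus>\<^bsub>End_ring scale\<^esub> f = \<zero>\<^bsub>End_ring scale\<^esub>"
      by (intro bexI[of _ "\<lambda>a. - f a"]) auto
  qed (auto simp: algebra_simps)
  show "Group.monoid (End_ring scale)"
    by (rule monoidI) (auto simp: comp_assoc)
qed (auto simp: End_ring_carrier End_ring_simps fun_eq_iff)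

lemma br_simps:
  "br a (b + c) = br a b + br a c" "br a (scale k b) = scale k (br a b)"
  "br (a + b) c = br a c + br b c" "br (scale k a) b = scale k (br a b)"
  using br_linear_right[of a] br_linear_left[of c] br_linear_left[of b]
  by (simp_all add: Vector_Spaces.linear_iff)

lemma br_anti: "br b a = - br a b"
proof -
  have "br (a + b) (a + b) = (br b a + br a b)"
    by (simp only: br_simps) (simp add: br_alternating)
  then have "br b a + br a b = 0"
    by (metis br_alternating)
  then show ?thesis
    by (simp only: eq_neg_iff_add_eq_0)
qed

lemma br_minus: "br a (- b) = - br a b"
  using br_simps(1)[of a b "- b"] br_simps(1)[of a 0 0] by (simp add: eq_neg_iff_add_eq_0 add.commute)

lemma scale_mult_right: "a * scale c b = scale c (a * b)"
  using scale_mult_left[of c b a] by (simp add: mult.commute)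

lemma End_ring_minus:
  assumes "f \<in> carrier (End_ring scale)" "g \<in> carrier (End_ring scale)"
  shows "f \<ominus>\<^bsub>End_ring scale\<^esub> g = (\<lambda>a. f a - g a)"
proof -
  interpret E: ring "End_ring scale" by (rule End_ring_ring)
  have n: "(\<lambda>a. - g a) \<in> carrier (End_ring scale)"
    using assms(2) by (auto simp: End_ring_carrier)
  have "\<ominus>\<^bsub>End_ring scale\<^esub> g = (\<lambda>a. - g a)"
    using n assms(2) by (intro E.minus_equality) (simp_all add: End_ring_simps)
  then show ?thesis by (simp add: a_minus_def End_ring_simps)
qed

lemma End_poisson_triple: "poisson_triple scale br (End_ring scale) scale (\<lambda>a b. a * b) br"
proof -
  have br_in: "br a \<in> carrier (End_ring scale)" for a
    by (simp add: End_ring_carrier br_simps)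
  have mult_in: "(\<lambda>b. a * b) \<in> carrier (End_ring scale)" for a
    by (simp add: End_ring_carrier algebra_simps scale_mult_right)
  have scale_in: "scale c \<in> carrier (End_ring scale)" for c
    by (simp add: End_ring_carrier scale_right_distrib mult.commute)
  have comp_in: "f \<circ> g \<in> carrier (End_ring scale)"
    if "f \<in> carrier (End_ring scale)" "g \<in> carrier (End_ring scale)" for f g
    using that by (auto simp: End_ring_carrier)
  have jac: "br (br a b) c = br a (br b c) - br b (br a c)" for a b c
  proof -
    have "br a (br b c) + br b (br c a) + br c (br a b) = 0" by (rule br_jacobi)
    moreover have "br b (br c a) = - br b (br a c)"
      by (metis br_anti br_minus)
    moreover have "br c (br a b) = - br (br a b) c" by (rule br_anti)
    ultimately show ?thesis by (simp add: algebra_simps)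
  qed
  have leib: "br (a * b) c = a * br b c + b * br a c" for a b c
    using br_leibniz[of c a b] by (simp add: br_anti[of c] algebra_simps)
  show ?thesis
  proof (intro poisson_triple.intro poisson_triple_axioms.intro End_ring_ring)
    show "scale \<in> ring_hom class_ring (End_ring scale)"
      by (rule ring_hom_memI) (auto simp: scale_in End_ring_simps scale_left_distrib fun_eq_iff)
    show "(\<lambda>a b. a * b) \<in> ring_hom class_ring (End_ring scale)"
      by (rule ring_hom_memI) (auto simp: mult_in End_ring_simps fun_eq_iff algebra_simps)
    fix f c assume "f \<in> carrier (End_ring scale)"
    then show "scale c \<otimes>\<^bsub>End_ring scale\<^esub> f = f \<otimes>\<^bsub>End_ring scale\<^esub> scale c"
      by (auto simp: End_ring_simps End_ring_carrier)
  next
    fix a b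
    show "br (br a b) = br a \<otimes>\<^bsub>End_ring scale\<^esub> br b \<ominus>\<^bsub>End_ring scale\<^esub> br b \<otimes>\<^bsub>End_ring scale\<^esub> br a"
      by (simp add: End_ring_simps End_ring_minus comp_in br_in fun_eq_iff jac)
    show "br a \<otimes>\<^bsub>End_ring scale\<^esub> (*) b \<ominus>\<^bsub>End_ring scale\<^esub> (*) b \<otimes>\<^bsub>End_ring scale\<^esub> br a = (*) (br a b)"
      by (simp add: End_ring_simps End_ring_minus comp_in br_in mult_in fun_eq_iff br_leibniz)
    show "br (a * b) = (*) a \<otimes>\<^bsub>End_ring scale\<^esub> br b \<oplus>\<^bsub>End_ring scale\<^esub> (*) b \<otimes>\<^bsub>End_ring scale\<^esub> br a"
      by (simp add: End_ring_simps fun_eq_iff leib)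
  qed (auto simp: End_ring_simps fun_eq_iff br_simps br_in scale_mult_left)
qed

theorem poisson_pi:
  "poisson_pi scale br \<in> ring_hom (U scale br) (End_ring scale)"
  "poisson_pi scale br (U_const scale br c) = scale c"
  "poisson_pi scale br (U_alpha scale br a) = (\<lambda>b. a * b)"
  "poisson_pi scale br (U_beta scale br a) = br a"
  unfolding poisson_pi_def by (rule poisson_triple.U_universal[OF End_poisson_triple])+

end


section \<open>Minors of the Poisson structure matrix\<close>

definition poisson_matrix :: "('a::idom \<Rightarrow> 'a \<Rightarrow> 'a) \<Rightarrow> (nat \<Rightarrow> 'a) \<Rightarrow> nat \<Rightarrow> 'a mat" where
  "poisson_matrix br x n = mat n n (\<lambda>(i, j). br (x i) (x j))"

definition poisson_rank :: "('a::idom \<Rightarrow> 'a \<Rightarrow> 'a) \<Rightarrow> (nat \<Rightarrow> 'a) \<Rightarrow> nat \<Rightarrow> nat" where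
  "poisson_rank br x n = vec_space.rank n (map_mat to_fract (poisson_matrix br x n))"

definition incr_tuples :: "nat \<Rightarrow> nat \<Rightarrow> nat list set" where
  "incr_tuples n d = {is. length is = d \<and> sorted_wrt (<) is \<and> set is \<subseteq> {..<n}}"

definition minor :: "('a::idom \<Rightarrow> 'a \<Rightarrow> 'a) \<Rightarrow> (nat \<Rightarrow> 'a) \<Rightarrow> nat list \<Rightarrow> nat list \<Rightarrow> 'a" where
  "minor br x is js = det (mat (length is) (length js) (\<lambda>(s, t). br (x (is ! s)) (x (js ! t))))"

definition minors_ideal :: "('a::idom \<Rightarrow> 'a \<Rightarrow> 'a) \<Rightarrow> (nat \<Rightarrow> 'a) \<Rightarrow> nat \<Rightarrow> nat \<Rightarrow> 'a set" where
  "minors_ideal br x n d =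
     Idl\<^bsub>class_ring\<^esub> {minor br x is js | is js. is \<in> incr_tuples n d \<and> js \<in> incr_tuples n d}"

definition nonzero_tuples :: "('a::idom \<Rightarrow> 'a \<Rightarrow> 'a) \<Rightarrow> (nat \<Rightarrow> 'a) \<Rightarrow> nat \<Rightarrow> nat \<Rightarrow> nat list set" where
  "nonzero_tuples br x n d =
     {is \<in> incr_tuples n d. \<exists>js \<in> incr_tuples n d. minor br x is js \<noteq> 0}"

text \<open>Positions in a tuple are counted from \<open>0\<close>, hence the sign \<open>(-1)\<^sup>s\<^sup>+\<^sup>d\<close> in place of
  \<open>(-1)\<^sup>s\<^sup>+\<^sup>d\<^sup>+\<^sup>1\<close>.\<close>

definition U_delta :: "('k::field \<Rightarrow> 'a::idom \<Rightarrow> 'a) \<Rightarrow> ('a \<Rightarrow> 'a \<Rightarrow> 'a) \<Rightarrow> (nat \<Rightarrow> 'a) \<Rightarrow>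
    nat list \<Rightarrow> nat \<Rightarrow> nat list \<Rightarrow> ('k, 'a) free_alg set" where
  "U_delta scale br x is \<nu> js =
     U_alpha scale br (minor br x is js) \<otimes>\<^bsub>U scale br\<^esub> U_beta scale br (x \<nu>)
     \<oplus>\<^bsub>U scale br\<^esub>
     (\<Oplus>\<^bsub>U scale br\<^esub>s\<in>{..<length is}.
        U_alpha scale br
          ((- 1) ^ (s + length is) * minor br x (take s is @ drop (Suc s) is @ [\<nu>]) js)
        \<otimes>\<^bsub>U scale br\<^esub> U_beta scale br (x (is ! s)))"

definition kappa :: "('k::field \<Rightarrow> 'a::idom \<Rightarrow> 'a) \<Rightarrow> ('a \<Rightarrow> 'a \<Rightarrow> 'a) \<Rightarrow> (nat \<Rightarrow> 'a) \<Rightarrow>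
    nat \<Rightarrow> nat \<Rightarrow> ('k, 'a) free_alg set set" where
  "kappa scale br x n d = Idl\<^bsub>U scale br\<^esub>
     {U_delta scale br x is \<nu> js | is \<nu> js.
        is \<in> nonzero_tuples br x n d \<and> js \<in> nonzero_tuples br x n d \<and>
        \<nu> \<in> {..<n} - set is}"

end

theory Submission
  imports Defs
begin

text \<open>
  Call an ideal stable if all derivations of \<open>\<A>\<close> map it into itself.  The only stable ideals of a
  regular domain are \<open>0\<close> and \<open>\<A>\<close>: a proper one lies in a stable prime \<open>p\<close>, and in characteristic
  zero the derivations that preserve \<open>p\<close> have rank at most \<open>trdeg \<A>/p\<close> modulo \<open>p\<close>, whereas
  regularity at \<open>p\<close> gives derivations of \<open>\<A>\<close> of rank \<open>trdeg \<A>/p + ht p\<close> modulo \<open>p\<close>; so \<open>p = 0\<close>.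

  If \<open>\<pi>\<close> is an isomorphism, then \<open>\<kappa> = 0\<close>, as \<open>\<pi>\<close> maps the generators of \<open>\<kappa>\<close> to bordered minors, which
  vanish since the rank is \<open>d\<close>.  The ideal of minors is nonzero and mapped into itself by all
  \<open>{a,\<cdot>}\<close>, hence by \<open>P\<D>(\<A>) = \<D>(\<A>)\<close>, which contains the derivations; so it is \<open>\<A>\<close>.

  Conversely, \<open>\<kappa> = 0\<close> gives \<open>\<mu> \<delta>\<^sub>a = \<Sum>\<^sub>t {a, y\<^sub>t} E\<^sub>t\<close> in \<open>\<U>(\<A>)\<close> for all \<open>a\<close>, where \<open>\<mu>\<close> is a minor with columns
  \<open>y\<^sub>1, \<dots>, y\<^sub>d\<close> and the \<open>E\<^sub>t\<close> are combinations of the \<open>\<delta>\<^sub>i\<close>.  By Euler's identity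
  \<open>k \<mu> u \<equiv> \<Sum>\<^sub>t [u, y\<^sub>t] E\<^sub>t\<close> modulo degree \<open>k - 1\<close> for \<open>u\<close> of degree \<open>k\<close>, and as the minors generate the unit ideal,
  induction on the degree shows that \<open>\<pi>\<close> is injective.  The same identity for differential operators
  shows that they lie in \<open>P\<D>(\<A>)\<close>, once \<open>\<mu> \<tau> = \<Sum>\<^sub>t \<tau>(y\<^sub>t) D\<^sub>t\<close> with Hamiltonian \<open>D\<^sub>t\<close> for every
  derivation \<open>\<tau>\<close>.  For this it suffices that a derivation killing all \<open>y\<^sub>t\<close> vanishes, and that
  follows from the relation for \<open>\<mu> \<delta>\<^sub>a\<close> with rows and columns exchanged, if \<open>\<delta>\<^sub>a\<close> may be replaced by \<open>\<tau>(a)\<close>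
  in it.  To see this, let \<open>\<U>(\<A>)\<close> act on formal power series along the generic symplectic leaf by
  \<open>\<delta>\<^sub>a \<mapsto> {a,\<cdot>} + c(a)\<close>, where \<open>c(a)\<close> has the constant term \<open>\<tau>(a)\<close>: the operator \<open>\<tau>\<close>
  fails to be a Poisson derivation by a closed two-form, whose formal primitive corrects it.
\<close>

section \<open>Linear algebra modulo a prime ideal\<close>

text \<open>Linear algebra over the residue field of a prime p is done in \<A> itself: congruences
  modulo p replace equations, elements outside p replace nonzero scalars, and denominators are
  cleared. For p = 0 the same lemmas describe the field of fractions, so that ranks at p and at the
  generic point become comparable. Transcendence degrees enter as lengths of explicit towers of
  independent elements.

  The other obstacle is that \<kappa> = 0 is a relation between the \<delta>_a inside the enveloping
  algebra, and it is not clear in advance that it remains true for differentials; for the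
  Lie-Rinehart algebra of Kaehler differentials this is the linear part of a PBW theorem. The
  representation on jets takes its place: it is built so that \<delta>_a visibly carries \<tau>(a).
  On the field of fractions the correcting one-form may fail to exist; on formal power series every
  closed two-form is exact.\<close>

locale prime_set =
  fixes q :: "'a::comm_ring_1 set"
  assumes zero_mem: "0 \<in> q"
    and add_mem: "a \<in> q \<Longrightarrow> b \<in> q \<Longrightarrow> a + b \<in> q"
    and mult_mem: "a \<in> q \<Longrightarrow> r * a \<in> q"
    and one_notin: "1 \<notin> q"
    and prime: "a * b \<in> q \<Longrightarrow> a \<in> q \<or> b \<in> q"
begin

lemma mult_mem_right: "a \<in> q \<Longrightarrow> a * r \<in> q"
  using mult_mem[of a r] by (simp add: mult.commute)

lemma uminus_mem: "a \<in> q \<Longrightarrow> - a \<in> q"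
  using mult_mem[of a "-1"] by simp

lemma diff_mem: "a \<in> q \<Longrightarrow> b \<in> q \<Longrightarrow> a - b \<in> q"
  using add_mem[of a "- b"] uminus_mem[of b] by simp

lemma sum_mem: "(\<And>i. i \<in> I \<Longrightarrow> f i \<in> q) \<Longrightarrow> sum f I \<in> q"
  by (induction I rule: infinite_finite_induct) (auto simp: zero_mem intro: add_mem)

lemma cong_mem_iff: "a - b \<in> q \<Longrightarrow> a \<in> q \<longleftrightarrow> b \<in> q"
  using add_mem[of "a - b" b] diff_mem[of a "a - b"] by auto

text \<open>Gaussian elimination without division: an equation with a coefficient outside
  \<open>q\<close> eliminates the corresponding unknown, the other coefficients are cross-multiplied
  by this pivot, and primality keeps the solution nontrivial.\<close>

lemma homogeneous_system:
  fixes u :: "'i \<Rightarrow> 'j \<Rightarrow> 'a"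
  assumes "finite J" "finite I" "card J < card I"
  shows "\<exists>a. (\<exists>i\<in>I. a i \<notin> q) \<and> (\<forall>j\<in>J. (\<Sum>i\<in>I. a i * u i j) \<in> q)"
  using assms
proof (induction J arbitrary: I u rule: finite_induct)
  case empty
  then have "I \<noteq> {}" by auto
  then show ?case using one_notin by (intro exI[of _ "\<lambda>_. 1"]) auto
next
  case (insert j J)
  show ?case
  proof (cases "\<forall>i\<in>I. u i j \<in> q")
    case True
    from insert have "card J < card I" by simp
    from insert.IH[OF insert.prems(1) this, of u] obtain a
      where a: "\<exists>i\<in>I. a i \<notin> q" "\<forall>j\<in>J. (\<Sum>i\<in>I. a i * u i j) \<in> q" by blast
    then show ?thesis using True by (intro exI[of _ a]) (auto intro: sum_mem mult_mem)
  next
    case False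
    then obtain i0 where i0: "i0 \<in> I" "u i0 j \<notin> q" by blast
    define I' where "I' = I - {i0}"
    have I': "finite I'" "i0 \<notin> I'" "I = insert i0 I'" using insert.prems i0 by (auto simp: I'_def)
    have "card J < card I'" using insert I' by simp
    from insert.IH[OF I'(1) this, of "\<lambda>i l. u i0 j * u i l - u i j * u i0 l"] obtain a
      where a: "\<exists>i\<in>I'. a i \<notin> q" "\<And>l. l \<in> J \<Longrightarrow> (\<Sum>i\<in>I'. a i * (u i0 j * u i l - u i j * u i0 l)) \<in> q"
      by blast
    \<comment> \<open>Back substitution: all other unknowns are scaled by the pivot
      \<open>u i0 j\<close>, so the value of the unknown \<open>i0\<close> needs no
      division.\<close>
    define b where "b = (\<lambda>i. if i = i0 then - (\<Sum>i\<in>I'. a i * u i j) else u i0 j * a i)"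
    have b: "b i0 = - (\<Sum>i\<in>I'. a i * u i j)" "\<And>i. i \<in> I' \<Longrightarrow> b i = u i0 j * a i"
      using I' by (auto simp: b_def)
    have eq: "(\<Sum>i\<in>I. b i * u i l) = (\<Sum>i\<in>I'. a i * (u i0 j * u i l - u i j * u i0 l))" for l
    proof -
      have "(\<Sum>i\<in>I. b i * u i l) = b i0 * u i0 l + (\<Sum>i\<in>I'. u i0 j * a i * u i l)"
        using I' b(2) by simp
      then show ?thesis
        by (simp add: b(1) sum_distrib_left sum_subtractf algebra_simps)
    qed
    have "\<exists>i\<in>I. b i \<notin> q" using a(1) b(2) i0(2) I'(3) prime by (metis insertCI)
    moreover have "(\<Sum>i\<in>I. b i * u i l) \<in> q" if "l \<in> insert j J" for l
    proof (cases "l = j")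
      case True
      have "(\<Sum>i\<in>I'. a i * (u i0 j * u i j - u i j * u i0 j)) = 0" by (simp add: algebra_simps)
      then show ?thesis using True eq[of j] zero_mem by simp
    next
      case False
      then show ?thesis using a(2) eq that by auto
    qed
    ultimately show ?thesis by blast
  qed
qed

text \<open>A rank bound: evaluation at \<open>Y\<close> is injective modulo \<open>q\<close> on the
  module \<open>M\<close>, so independent elements of \<open>M\<close> cannot outnumber the points
  of \<open>Y\<close>. Every comparison of ranks of derivations below is an instance.\<close>

lemma independent_card_le:
  fixes D :: "'i \<Rightarrow> 'b \<Rightarrow> 'a"
  assumes Y: "finite Y"
    and D: "\<And>i. i \<in> I \<Longrightarrow> D i \<in> M" and I: "finite I"
    and M: "\<And>a. (\<And>i. i \<in> I \<Longrightarrow> D i \<in> M) \<Longrightarrow> (\<lambda>b. \<Sum>i\<in>I. a i * D i b) \<in> M"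
    and sep: "\<And>E b. E \<in> M \<Longrightarrow> (\<And>y. y \<in> Y \<Longrightarrow> E y \<in> q) \<Longrightarrow> E b \<in> q"
    and indep: "\<And>a. (\<And>b. (\<Sum>i\<in>I. a i * D i b) \<in> q) \<Longrightarrow> \<forall>i\<in>I. a i \<in> q"
  shows "card I \<le> card Y"
proof (rule ccontr)
  assume "\<not> ?thesis"
  then obtain a where a: "\<exists>i\<in>I. a i \<notin> q" "\<forall>y\<in>Y. (\<Sum>i\<in>I. a i * D i y) \<in> q"
    using homogeneous_system[OF Y I, of D] by force
  have "(\<Sum>i\<in>I. a i * D i b) \<in> q" for b
    using sep[OF M[of a]] D a(2) by blast
  then show False using indep a(1) by blast
qed

lemma diagonal_independent:
  assumes I: "finite I"
    and diag: "\<And>i. i \<in> I \<Longrightarrow> D i (y i) \<notin> q"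
    and off: "\<And>i j. i \<in> I \<Longrightarrow> j \<in> I \<Longrightarrow> i \<noteq> j \<Longrightarrow> D i (y j) \<in> q"
    and zero: "\<And>b. (\<Sum>i\<in>I. a i * D i b) \<in> q"
  shows "\<forall>i\<in>I. a i \<in> q"
proof
  fix i assume i: "i \<in> I"
  have "(\<Sum>j\<in>I. a j * D j (y i)) = a i * D i (y i) + (\<Sum>j\<in>I-{i}. a j * D j (y i))"
    using I i by (simp add: sum.remove)
  moreover have "(\<Sum>j\<in>I-{i}. a j * D j (y i)) \<in> q"
    using off i by (intro sum_mem mult_mem) auto
  ultimately have "a i * D i (y i) \<in> q"
    using zero[of "y i"] diff_mem by (metis add_diff_cancel_right')
  then show "a i \<in> q" using prime diag i by blast
qed

text \<open>For families attached to a tower, where \<open>D j\<close> kills only the earlier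
  elements: the coefficients vanish one after the other, in increasing order of the index.\<close>

lemma triangular_independent:
  assumes diag: "\<And>i. i < (m::nat) \<Longrightarrow> D i (y i) \<notin> q"
    and off: "\<And>i j. j < m \<Longrightarrow> i < j \<Longrightarrow> D j (y i) \<in> q"
    and zero: "\<And>b. (\<Sum>i<m. a i * D i b) \<in> q"
  shows "\<forall>i<m. a i \<in> q"
proof (intro allI impI)
  fix i assume "i < m"
  then show "a i \<in> q"
  proof (induction i rule: less_induct)
    case (less i)
    have "(\<Sum>j<m. a j * D j (y i)) = a i * D i (y i) + (\<Sum>j\<in>{..<m}-{i}. a j * D j (y i))"
      using less by (simp add: sum.remove)
    moreover have "a j * D j (y i) \<in> q" if "j \<in> {..<m}-{i}" for j
      using that less off[of j i] by (cases "j < i") (auto intro: mult_mem mult_mem_right)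
    then have "(\<Sum>j\<in>{..<m}-{i}. a j * D j (y i)) \<in> q" by (rule sum_mem)
    ultimately have "a i * D i (y i) \<in> q"
      using zero[of "y i"] diff_mem by (metis add_diff_cancel_right')
    then show "a i \<in> q" using prime diag less by blast
  qed
qed

text \<open>It suffices to choose the pivot set \<open>C\<close> as large as possible: an element of
  \<open>M\<close> that vanishes at all pivots but not at some \<open>x i\<close> would give one
  more pivot. \<open>card C\<close> then plays the role of the rank of \<open>M\<close> modulo
  \<open>q\<close>.\<close>

lemma echelon:
  fixes M :: "('b \<Rightarrow> 'a) set" and x :: "'i \<Rightarrow> 'b"
  assumes X: "finite X" and M: "\<And>D E a b. D \<in> M \<Longrightarrow> E \<in> M \<Longrightarrow> (\<lambda>t. a * D t + b * E t) \<in> M"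
  obtains C D \<Delta> where "C \<subseteq> X" "\<Delta> \<notin> q"
    "\<And>c. c \<in> C \<Longrightarrow> D c \<in> M" "\<And>c. c \<in> C \<Longrightarrow> D c (x c) - \<Delta> \<in> q"
    "\<And>c c'. c \<in> C \<Longrightarrow> c' \<in> C \<Longrightarrow> c \<noteq> c' \<Longrightarrow> D c (x c') \<in> q"
    "\<forall>E\<in>M. (\<forall>c\<in>C. E (x c) \<in> q) \<longrightarrow> (\<forall>i\<in>X. E (x i) \<in> q)"
proof -
  define P where "P = (\<lambda>C. C \<subseteq> X \<and> (\<exists>D \<Delta>. \<Delta> \<notin> q \<and> (\<forall>c\<in>C. D c \<in> M \<and> D c (x c) - \<Delta> \<in> q \<and>
    (\<forall>c'\<in>C. c \<noteq> c' \<longrightarrow> D c (x c') \<in> q))))"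
  have "P {}" using one_notin by (auto simp: P_def)
  moreover have "\<forall>C. P C \<longrightarrow> card C < Suc (card X)"
    using X by (auto simp: P_def card_mono less_Suc_eq_le)
  ultimately obtain C where C: "P C" "\<And>C'. P C' \<Longrightarrow> card C' \<le> card C"
    using ex_has_greatest_nat[of P "{}" card "Suc (card X)"] by blast
  then obtain D \<Delta> where CX: "C \<subseteq> X" and \<Delta>: "\<Delta> \<notin> q" and D: "\<And>c. c \<in> C \<Longrightarrow> D c \<in> M"
    and diag: "\<And>c. c \<in> C \<Longrightarrow> D c (x c) - \<Delta> \<in> q"
    and off: "\<And>c c'. c \<in> C \<Longrightarrow> c' \<in> C \<Longrightarrow> c \<noteq> c' \<Longrightarrow> D c (x c') \<in> q"
    unfolding P_def by blast
  have finC: "finite C" using CX X finite_subset by blast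
  have "E (x i) \<in> q" if E: "E \<in> M" and EC: "\<And>c. c \<in> C \<Longrightarrow> E (x c) \<in> q" and i: "i \<in> X" for E i
  proof (rule ccontr)
    assume Ei: "E (x i) \<notin> q"
    then have iC: "i \<notin> C" using EC by blast
    \<comment> \<open>The new row is scaled by the old diagonal and the old rows are cleared at
      \<open>i\<close>, so that all rows get the diagonal entry \<open>\<Delta> * E (x i)\<close>.
      The summand \<open>0 * E t\<close> brings the first case into the form under which
      \<open>M\<close> is closed.\<close>
    define D' where "D' = (\<lambda>c t. if c = i then \<Delta> * E t + 0 * E t else E (x i) * D c t + (- D c (x i)) * E t)"
    have "P (insert i C)"
      unfolding P_def
    proof (intro conjI exI[of _ D'] exI[of _ "\<Delta> * E (x i)"] ballI impI)
      show "insert i C \<subseteq> X" using CX i by blast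
      show "\<Delta> * E (x i) \<notin> q" using prime \<Delta> Ei by blast
      fix c assume c: "c \<in> insert i C"
      show "D' c \<in> M" using c D M[OF E E, of \<Delta> 0] M[OF D E, of c "E (x i)" "- D c (x i)"]
        by (cases "c = i") (simp_all add: D'_def)
      show "D' c (x c) - \<Delta> * E (x i) \<in> q"
      proof (cases "c = i")
        case True
        then show ?thesis by (simp add: D'_def zero_mem)
      next
        case False
        then have "D' c (x c) - \<Delta> * E (x i) = E (x i) * (D c (x c) - \<Delta>) - D c (x i) * E (x c)"
          by (simp add: D'_def algebra_simps)
        moreover have "E (x i) * (D c (x c) - \<Delta>) - D c (x i) * E (x c) \<in> q"
          using diff_mem[OF mult_mem[OF diag] mult_mem[OF EC]] c False by simp
        ultimately show ?thesis by simp
      qed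
      fix c' assume c': "c' \<in> insert i C" "c \<noteq> c'"
      show "D' c (x c') \<in> q"
      proof (cases "c = i")
        case True
        then show ?thesis using c' EC by (auto simp: D'_def intro!: mult_mem)
      next
        case False
        show ?thesis
        proof (cases "c' = i")
          case True
          then show ?thesis using False by (simp add: D'_def zero_mem)
        next
          case c'i: False
          then have "E (x i) * D c (x c') - D c (x i) * E (x c') \<in> q"
            using c c' False EC[of c'] off[of c c'] by (intro diff_mem mult_mem) auto
          then show ?thesis using False by (simp add: D'_def)
        qed
      qed
    qed
    then show False using C(2)[of "insert i C"] iC finC by simp
  qed
  then have "\<forall>E\<in>M. (\<forall>c\<in>C. E (x c) \<in> q) \<longrightarrow> (\<forall>i\<in>X. E (x i) \<in> q)" by blast
  then show ?thesis using that CX \<Delta> D diag off by blast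
qed

text \<open>The elimination behind Nakayama's lemma.\<close>

lemma elimination:
  fixes W :: "('i \<Rightarrow> 'a) set"
  assumes C: "finite C"
    and W: "\<And>v w a b. v \<in> W \<Longrightarrow> w \<in> W \<Longrightarrow> (\<lambda>i. a * v i + b * w i) \<in> W" and W0: "(\<lambda>_. 0) \<in> W"
    and nz: "\<And>v. \<exists>c\<in>C. v c \<notin> q \<Longrightarrow> \<exists>w\<in>W. (\<Sum>c\<in>C. w c * v c) \<notin> q"
  shows "\<exists>\<Delta> w. \<Delta> \<notin> q \<and> (\<forall>c\<in>C. w c \<in> W \<and> w c c = \<Delta> \<and> (\<forall>c'\<in>C. c' \<noteq> c \<longrightarrow> w c c' = 0))"
  using C nz
proof (induction C rule: finite_induct)
  case empty
  then show ?case using one_notin by auto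
next
  case (insert i C)
  have "\<exists>w\<in>W. (\<Sum>c\<in>C. w c * v c) \<notin> q" if v: "\<exists>c\<in>C. v c \<notin> q" for v
  proof -
    have "\<exists>c\<in>insert i C. (v(i := 0)) c \<notin> q"
      using v insert.hyps by (metis fun_upd_apply insertCI)
    from insert.prems[OF this] obtain w where w: "w \<in> W" "(\<Sum>c\<in>insert i C. w c * (v(i := 0)) c) \<notin> q"
      by blast
    have "(\<Sum>c\<in>insert i C. w c * (v(i := 0)) c) = (\<Sum>c\<in>C. w c * v c)"
      using insert.hyps by (auto intro!: sum.cong)
    then show ?thesis using w by auto
  qed
  from insert.IH[OF this] obtain \<Delta> w where \<Delta>: "\<Delta> \<notin> q" and w: "\<And>c. c \<in> C \<Longrightarrow> w c \<in> W"
    "\<And>c. c \<in> C \<Longrightarrow> w c c = \<Delta>" "\<And>c c'. c \<in> C \<Longrightarrow> c' \<in> C \<Longrightarrow> c' \<noteq> c \<Longrightarrow> w c c' = 0"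
    by blast
  \<comment> \<open>\<open>v\<close> is orthogonal to every \<open>w c\<close> with \<open>c\<close>
    in \<open>C\<close>, so a vector \<open>u\<close> of \<open>W\<close> whose pairing with
    \<open>v\<close> is outside \<open>q\<close> is independent of them. Clearing \<open>u\<close>
    on \<open>C\<close> leaves exactly this pairing as the entry at \<open>i\<close>.\<close>
  define v where "v = (\<lambda>c. if c = i then \<Delta> else - w c i)"
  have "\<exists>c\<in>insert i C. v c \<notin> q" using \<Delta> by (auto simp: v_def)
  from insert.prems[OF this] obtain u where u: "u \<in> W" "(\<Sum>c\<in>insert i C. u c * v c) \<notin> q" by blast
  define w' where "w' = (\<lambda>t. \<Delta> * u t - (\<Sum>c\<in>C. u c * w c t))"
  have comb: "(\<lambda>t. \<Sum>c\<in>C'. u c * w c t) \<in> W" if "C' \<subseteq> C" for C'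
    using finite_subset[OF that insert.hyps(1)] that
  proof (induction C' rule: finite_induct)
    case empty
    then show ?case using W0 by simp
  next
    case (insert c F)
    then show ?case using W[OF w(1)[of c] insert.IH, of "u c" 1] by simp
  qed
  have w'W: "w' \<in> W" unfolding w'_def using W[OF u(1) comb[OF order_refl], of \<Delta> "-1"] by simp
  have w'i: "w' i = (\<Sum>c\<in>insert i C. u c * v c)"
  proof -
    have "(\<Sum>c\<in>C. u c * v c) = - (\<Sum>c\<in>C. u c * w c i)"
      using insert.hyps by (auto simp: v_def sum_negf[symmetric] intro!: sum.cong)
    then show ?thesis using insert.hyps by (simp add: w'_def v_def algebra_simps)
  qed
  have w'C: "w' c = 0" if "c \<in> C" for c
  proof -
    have "(\<Sum>c'\<in>C. u c' * w c' c) = u c * w c c + (\<Sum>c'\<in>C-{c}. u c' * w c' c)"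
      using insert.hyps that by (simp add: sum.remove)
    also have "(\<Sum>c'\<in>C-{c}. u c' * w c' c) = 0"
      using w(3) that by (intro sum.neutral) (metis DiffE insertI1 mult_zero_right)
    finally show ?thesis using w(2)[OF that] by (simp add: w'_def algebra_simps)
  qed
  define z where "z = (\<lambda>c t. if c = i then \<Delta> * w' t + 0 * w' t else w' i * w c t + (- w c i) * w' t)"
  have "\<forall>c\<in>insert i C. z c \<in> W \<and> z c c = \<Delta> * w' i \<and> (\<forall>c'\<in>insert i C. c' \<noteq> c \<longrightarrow> z c c' = 0)"
  proof (intro ballI conjI impI)
    fix c assume c: "c \<in> insert i C"
    show "z c \<in> W" using c W[OF w'W w'W, of \<Delta> 0] W[OF w(1) w'W, of c "w' i" "- w c i"]
      by (cases "c = i") (simp_all add: z_def)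
    show "z c c = \<Delta> * w' i" using c w(2) w'C by (auto simp: z_def algebra_simps)
    fix c' assume "c' \<in> insert i C" "c' \<noteq> c"
    then show "z c c' = 0" using c w(3) w'C insert.hyps by (auto simp: z_def algebra_simps)
  qed
  moreover have "\<Delta> * w' i \<notin> q" using prime \<Delta> u(2) w'i by metis
  ultimately show ?case by blast
qed

end

lemma zero_prime_set: "prime_set {0 :: 'a::idom}"
  by unfold_locales auto

lemma prime_set_primeideal:
  assumes "prime_set p"
  shows "primeideal p (class_ring :: 'a::comm_ring_1 ring)"
proof -
  interpret prime_set p by (rule assms)
  have ring: "ring (class_ring :: 'a ring)" by (rule class_ring.ring_axioms)
  have cring: "cring (class_ring :: 'a ring)"
    by (rule cring.intro[OF ring], unfold_locales) (simp add: mult.commute)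
  have inv: "inv\<^bsub>add_monoid (class_ring :: 'a ring)\<^esub> a = - a" for a :: 'a
    using abelian_group.minus_equality[OF ring.is_abelian_group[OF ring], of "- a" a]
    by (simp add: a_inv_def)
  have "ideal p (class_ring :: 'a ring)"
  proof (rule idealI[OF ring])
    show "subgroup p (add_monoid (class_ring :: 'a ring))"
    proof (rule group.subgroupI[OF abelian_group.a_group[OF ring.is_abelian_group[OF ring]]])
      show "inv\<^bsub>add_monoid class_ring\<^esub> a \<in> p" if "a \<in> p" for a
        unfolding inv by (rule uminus_mem[OF that])
    qed (use zero_mem add_mem in auto)
  qed (simp_all add: mult_mem mult_mem_right)
  then show ?thesis
    by (rule primeidealI[OF _ cring]) (use one_notin prime in auto)
qed

section \<open>Extension of derivations in characteristic zero\<close>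

definition subring_set :: "'b::idom set \<Rightarrow> bool" where
  "subring_set R \<longleftrightarrow> 1 \<in> R \<and> (\<forall>a\<in>R. \<forall>b\<in>R. a - b \<in> R \<and> a * b \<in> R)"

definition adjoin :: "'b::idom set \<Rightarrow> 'b \<Rightarrow> 'b set" where
  "adjoin R y = {poly P y |P. \<forall>i. coeff P i \<in> R}"

definition transcendental_over :: "'b::idom set \<Rightarrow> 'b \<Rightarrow> bool" where
  "transcendental_over R y \<longleftrightarrow> (\<forall>P. (\<forall>i. coeff P i \<in> R) \<longrightarrow> poly P y = 0 \<longrightarrow> P = 0)"

text \<open>The values of \<open>D\<close> need not lie in \<open>R\<close>. This admits derivations
  of a subring into a larger field, which arise when a derivation is extended step by step.\<close>

definition deriv_on :: "'b::idom set \<Rightarrow> ('b \<Rightarrow> 'b) \<Rightarrow> bool" where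
  "deriv_on R D \<longleftrightarrow> (\<forall>a\<in>R. \<forall>b\<in>R. D (a + b) = D a + D b \<and> D (a * b) = a * D b + b * D a)"

context
  fixes R :: "'b::idom set"
  assumes R: "subring_set R"
begin

lemma subring_set_diff: "a \<in> R \<Longrightarrow> b \<in> R \<Longrightarrow> a - b \<in> R"
  and subring_set_mult: "a \<in> R \<Longrightarrow> b \<in> R \<Longrightarrow> a * b \<in> R"
  and subring_set_one: "1 \<in> R"
  using R by (auto simp: subring_set_def)

lemma subring_set_zero: "0 \<in> R"
  using subring_set_diff[OF subring_set_one subring_set_one] by simp

lemma subring_set_uminus: "a \<in> R \<Longrightarrow> - a \<in> R"
  using subring_set_diff[OF subring_set_zero, of a] by simp

lemma subring_set_add: "a \<in> R \<Longrightarrow> b \<in> R \<Longrightarrow> a + b \<in> R"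
  using subring_set_diff[OF _ subring_set_uminus, of a b] by simp

lemma subring_set_sum: "(\<And>i. i \<in> I \<Longrightarrow> f i \<in> R) \<Longrightarrow> sum f I \<in> R"
  by (induction I rule: infinite_finite_induct) (auto simp: subring_set_zero intro: subring_set_add)

lemma subring_set_of_nat: "of_nat m \<in> R"
  by (induction m) (auto simp: subring_set_zero subring_set_one intro: subring_set_add)

lemma coeff_mult_mem: "(\<And>i. coeff P i \<in> R) \<Longrightarrow> (\<And>i. coeff Q i \<in> R) \<Longrightarrow> coeff (P * Q) i \<in> R"
  by (auto simp: coeff_mult intro!: subring_set_sum subring_set_mult)

lemma coeff_pderiv_mem: "(\<And>i. coeff P i \<in> R) \<Longrightarrow> coeff (pderiv P) i \<in> R"
  by (simp only: coeff_pderiv) (intro subring_set_mult subring_set_of_nat)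

lemma subring_set_adjoin: "subring_set (adjoin R y)"
  unfolding subring_set_def
proof (intro conjI ballI)
  show "1 \<in> adjoin R y"
    unfolding adjoin_def using subring_set_one subring_set_zero
    by (intro CollectI exI[of _ "[:1:]"]) (auto simp: coeff_pCons split: nat.split)
  fix a b assume "a \<in> adjoin R y" "b \<in> adjoin R y"
  then obtain P Q where P: "a = poly P y" "\<And>i. coeff P i \<in> R" and Q: "b = poly Q y" "\<And>i. coeff Q i \<in> R"
    by (auto simp: adjoin_def)
  show "a - b \<in> adjoin R y"
    unfolding adjoin_def using P Q by (intro CollectI exI[of _ "P - Q"]) (auto intro: subring_set_diff)
  show "a * b \<in> adjoin R y"
    unfolding adjoin_def using P Q by (intro CollectI exI[of _ "P * Q"]) (auto intro: coeff_mult_mem)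
qed

lemma subset_adjoin: "R \<subseteq> adjoin R y"
proof
  fix a assume "a \<in> R"
  then show "a \<in> adjoin R y"
    unfolding adjoin_def using subring_set_zero
    by (intro CollectI exI[of _ "[:a:]"]) (auto simp: coeff_pCons split: nat.split)
qed

lemma mem_adjoin: "y \<in> adjoin R y"
  unfolding adjoin_def using subring_set_zero subring_set_one
  by (intro CollectI exI[of _ "[:0, 1:]"]) (auto simp: coeff_pCons split: nat.split)

context
  fixes D assumes D: "deriv_on R D"
begin

lemma deriv_on_add: "a \<in> R \<Longrightarrow> b \<in> R \<Longrightarrow> D (a + b) = D a + D b"
  and deriv_on_mult: "a \<in> R \<Longrightarrow> b \<in> R \<Longrightarrow> D (a * b) = a * D b + b * D a"
  using D by (auto simp: deriv_on_def)

lemma deriv_on_zero: "D 0 = 0"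
  using deriv_on_add[OF subring_set_zero subring_set_zero] by (metis add_cancel_left_left add_0)

lemma deriv_on_one: "D 1 = 0"
  using deriv_on_mult[OF subring_set_one subring_set_one] by (metis add_cancel_left_left mult_1)

lemma deriv_on_diff: "a \<in> R \<Longrightarrow> b \<in> R \<Longrightarrow> D (a - b) = D a - D b"
  using deriv_on_add[of "a - b" b] subring_set_diff by simp

lemma deriv_on_sum: "(\<And>i. i \<in> I \<Longrightarrow> f i \<in> R) \<Longrightarrow> D (sum f I) = (\<Sum>i\<in>I. D (f i))"
  by (induction I rule: infinite_finite_induct)
    (auto simp: deriv_on_zero deriv_on_add subring_set_sum)

lemma map_poly_deriv_add:
  "(\<And>i. coeff P i \<in> R) \<Longrightarrow> (\<And>i. coeff Q i \<in> R) \<Longrightarrow> map_poly D (P + Q) = map_poly D P + map_poly D Q"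
  by (intro poly_eqI) (simp add: coeff_map_poly deriv_on_zero deriv_on_add)

lemma map_poly_deriv_diff:
  "(\<And>i. coeff P i \<in> R) \<Longrightarrow> (\<And>i. coeff Q i \<in> R) \<Longrightarrow> map_poly D (P - Q) = map_poly D P - map_poly D Q"
  by (intro poly_eqI) (simp add: coeff_map_poly deriv_on_zero deriv_on_diff)

lemma map_poly_deriv_mult:
  "(\<And>i. coeff P i \<in> R) \<Longrightarrow> (\<And>i. coeff Q i \<in> R) \<Longrightarrow>
    map_poly D (P * Q) = P * map_poly D Q + Q * map_poly D P"
  unfolding mult.commute[of Q "map_poly D P"]
proof (rule poly_eqI)
  fix m assume PQ: "\<And>i. coeff P i \<in> R" "\<And>i. coeff Q i \<in> R"
  then have "D (coeff P i * coeff Q (m - i)) = coeff P i * D (coeff Q (m - i)) + D (coeff P i) * coeff Q (m - i)" for i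
    using deriv_on_mult[of "coeff P i" "coeff Q (m - i)"] by (simp only: mult.commute[of "D (coeff P i)"])
  then show "coeff (map_poly D (P * Q)) m = coeff (P * map_poly D Q + map_poly D P * Q) m"
    using PQ by (simp add: coeff_map_poly coeff_mult deriv_on_zero deriv_on_sum subring_set_mult sum.distrib)
qed

end

end

lemma deriv_on_fractions:
  fixes R :: "'l::field set"
  assumes R: "subring_set R" and D: "deriv_on R D"
  obtains M D' where "subring_set M" "R \<subseteq> M" "\<And>a. a \<in> M \<Longrightarrow> inverse a \<in> M" "deriv_on M D'"
    "\<And>a. a \<in> R \<Longrightarrow> D' a = D a" "M = {a / b |a b. a \<in> R \<and> b \<in> R}"
proof -
  note mult = subring_set_mult[OF R] and diff = subring_set_diff[OF R] and one = subring_set_one[OF R]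
    and add = subring_set_add[OF R] and zero = subring_set_zero[OF R]
  define M where "M = {a / b |a b. a \<in> R \<and> b \<in> R}"
  define val where "val = (\<lambda>a b. (D a * b - a * D b) / (b * b))"
  define D' where "D' = (\<lambda>w. THE v. \<exists>a\<in>R. \<exists>b\<in>R. b \<noteq> 0 \<and> w = a / b \<and> v = val a b)"
  \<comment> \<open>A fraction with denominator 0 equals \<open>0 / 1\<close>, so a nonzero
    denominator can always be chosen.\<close>
  have M: "\<exists>a\<in>R. \<exists>b\<in>R. b \<noteq> 0 \<and> w = a / b" if "w \<in> M" for w
  proof -
    from that obtain a b where "a \<in> R" "b \<in> R" "w = a / b" by (auto simp: M_def)
    then show ?thesis
    proof (cases "b = 0")
      case True
      then show ?thesis using zero one \<open>w = a / b\<close> by (intro bexI[of _ 0] bexI[of _ 1]) auto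
    qed blast
  qed
  have D': "D' (a / b) = val a b" if ab: "a \<in> R" "b \<in> R" "b \<noteq> 0" for a b
    unfolding D'_def
  proof (rule the_equality)
    show "\<exists>a'\<in>R. \<exists>b'\<in>R. b' \<noteq> 0 \<and> a / b = a' / b' \<and> val a b = val a' b'" using ab by blast
    fix v assume "\<exists>a'\<in>R. \<exists>b'\<in>R. b' \<noteq> 0 \<and> a / b = a' / b' \<and> v = val a' b'"
    then obtain a' b' where ab': "a' \<in> R" "b' \<in> R" "b' \<noteq> 0" "a / b = a' / b'" "v = val a' b'" by blast
    have eq: "a * b' = a' * b" using ab' ab by (simp add: frac_eq_eq)
    then have h: "a * D b' + b' * D a = a' * D b + b * D a'"
      using deriv_on_mult[OF R D ab(1) ab'(2)] deriv_on_mult[OF R D ab'(1) ab(2)] by simp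
    \<comment> \<open>The difference of the two quotient rules is a combination of the
      cross-multiplied equality \<open>eq\<close> and of its derivative \<open>h\<close>.\<close>
    have "(D a * b - a * D b) * (b' * b') - (D a' * b' - a' * D b') * (b * b)
        = b * b' * ((a * D b' + b' * D a) - (a' * D b + b * D a')) + (b' * D b + b * D b') * (a' * b - a * b')"
      by (simp add: algebra_simps)
    also have "\<dots> = 0" by (simp only: h eq) simp
    finally have "(D a * b - a * D b) * (b' * b') = (D a' * b' - a' * D b') * (b * b)" by simp
    then show "v = val a b" using ab ab' by (simp add: val_def frac_eq_eq)
  qed
  have fa: "a / b + a' / b' = (a * b' + a' * b) / (b * b')"
    and fs: "a / b - a' / b' = (a * b' - a' * b) / (b * b')"
    and fm: "a / b * (a' / b') = (a * a') / (b * b')" if "b \<noteq> 0" "b' \<noteq> 0" for a b a' b' :: 'l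
    using that by (simp_all add: field_simps)
  have subM: "subring_set M"
    unfolding subring_set_def
  proof (intro conjI ballI)
    show "1 \<in> M" using one by (auto simp: M_def intro!: exI[of _ 1])
    fix v w assume "v \<in> M" "w \<in> M"
    then obtain a b a' b' where *: "a \<in> R" "b \<in> R" "b \<noteq> 0" "v = a / b" "a' \<in> R" "b' \<in> R" "b' \<noteq> 0" "w = a' / b'"
      using M by metis
    have "v - w = (a * b' - a' * b) / (b * b')" "v * w = (a * a') / (b * b')"
      unfolding * by (rule fs[OF *(3,7)], rule fm[OF *(3,7)])
    moreover have "a * b' - a' * b \<in> R" "a * a' \<in> R" "b * b' \<in> R"
      using * by (simp_all add: mult diff)
    ultimately show "v - w \<in> M" "v * w \<in> M" unfolding M_def by blast+
  qed
  have "R \<subseteq> M"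
  proof
    fix a assume "a \<in> R"
    moreover have "a = a / 1" by simp
    ultimately show "a \<in> M" unfolding M_def using one by blast
  qed
  moreover have "inverse v \<in> M" if v: "v \<in> M" for v
  proof -
    obtain a b where "a \<in> R" "b \<in> R" "v = a / b" using v by (auto simp: M_def)
    moreover have "inverse (a / b) = b / a" by simp
    ultimately show ?thesis unfolding M_def by blast
  qed
  moreover have "deriv_on M D'"
    unfolding deriv_on_def
  proof (intro ballI)
    fix v w assume "v \<in> M" "w \<in> M"
    then obtain a b a' b' where *: "a \<in> R" "b \<in> R" "b \<noteq> 0" "v = a / b" "a' \<in> R" "b' \<in> R" "b' \<noteq> 0" "w = a' / b'"
      using M by metis
    have bb: "b * b' \<noteq> 0" using * by simp
    have "D' (v + w) = val (a * b' + a' * b) (b * b')"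
      unfolding *(4,8) fa[OF *(3,7)] by (rule D') (use * bb mult add in auto)
    also have "\<dots> = ((D a * b - a * D b) * (b' * b') + (D a' * b' - a' * D b') * (b * b)) / ((b * b) * (b' * b'))"
      using * by (simp add: val_def deriv_on_add[OF R D] deriv_on_mult[OF R D] mult)
        (simp add: algebra_simps)
    also have "\<dots> = val a b + val a' b'"
      using * unfolding val_def by (intro add_frac_eq[symmetric]) auto
    also have "\<dots> = D' v + D' w" using * D' by simp
    finally have 1: "D' (v + w) = D' v + D' w" .
    have "D' (v * w) = val (a * a') (b * b')"
      unfolding *(4,8) fm[OF *(3,7)] by (rule D') (use * bb mult add in auto)
    also have "\<dots> = (a * (D a' * b' - a' * D b') * (b' * (b * b)) + a' * (D a * b - a * D b) * (b * (b' * b')))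
        / ((b * (b' * b')) * (b' * (b * b)))"
    proof -
      have "val (a * a') (b * b') = ((a * (D a' * b' - a' * D b') * b + a' * (D a * b - a * D b) * b') * (b * b')) /
          ((b * b' * (b * b')) * (b * b'))"
        using * by (simp add: val_def deriv_on_mult[OF R D] mult) (simp add: algebra_simps)
      then show ?thesis by (simp add: algebra_simps)
    qed
    also have "\<dots> = a / b * val a' b' + a' / b' * val a b"
      using * unfolding val_def times_divide_times_eq by (intro add_frac_eq[symmetric]) auto
    also have "\<dots> = v * D' w + w * D' v" using * D' by simp
    finally show "D' (v + w) = D' v + D' w \<and> D' (v * w) = v * D' w + w * D' v" using 1 by blast
  qed
  moreover have "D' a = D a" if "a \<in> R" for a
    using D'[OF that one] deriv_on_one[OF R D] by (simp add: val_def)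
  ultimately show ?thesis using that[OF subM] M_def by blast
qed

text \<open>In characteristic zero, a root \<open>z\<close> of its minimal polynomial is a simple root, which
  determines the value at \<open>z\<close>; for transcendental \<open>z\<close> the condition on \<open>u\<close> is void.\<close>

lemma deriv_value_exists:
  fixes M :: "'l::field set"
  assumes M: "subring_set M" and inv: "\<And>a. a \<in> M \<Longrightarrow> inverse a \<in> M" and D: "deriv_on M D"
    and char0: "\<And>m. m > 0 \<Longrightarrow> (of_nat m :: 'l) \<noteq> 0"
  shows "\<exists>u. \<forall>P. (\<forall>i. coeff P i \<in> M) \<longrightarrow> poly P z = 0 \<longrightarrow>
    poly (map_poly D P) z + poly (pderiv P) z * u = 0"
proof (cases "transcendental_over M z")
  case True
  then have "P = 0" if "\<forall>i. coeff P i \<in> M" "poly P z = 0" for P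
    using that unfolding transcendental_over_def by blast
  then show ?thesis by fastforce
next
  case False
  define Q where "Q = (\<lambda>P. (\<forall>i. coeff P i \<in> M) \<and> poly P z = 0 \<and> P \<noteq> 0)"
  from False have "\<exists>P. Q P" by (auto simp: transcendental_over_def Q_def)
  then obtain m where m: "Q m" "\<And>P. Q P \<Longrightarrow> degree m \<le> degree P"
    using ex_has_least_nat[of Q _ degree] by blast
  have mM: "coeff m i \<in> M" for i using m by (simp add: Q_def)
  have mz: "poly m z = 0" and m0: "m \<noteq> 0" using m by (auto simp: Q_def)
  have degm: "degree m > 0"
  proof (rule ccontr)
    assume "\<not> ?thesis"
    then obtain a where "m = [:a:]" using degree_eq_zeroE by blast
    then show False using mz m0 by simp
  qed
  have "coeff (pderiv m) (degree m - 1) \<noteq> 0"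
    using degm m0 char0[OF degm] by (simp add: coeff_pderiv)
  then have pm0: "pderiv m \<noteq> 0" by force
  have "degree (pderiv m) < degree m"
    using degm by (intro degree_lessI) (auto simp: coeff_pderiv pm0 coeff_eq_0)
  \<comment> \<open>The derivative of \<open>m\<close> is nonzero in characteristic zero and of
    smaller degree, so by minimality it cannot vanish at \<open>z\<close>. This makes the equation
    for \<open>u\<close> solvable.\<close>
  then have pmz: "poly (pderiv m) z \<noteq> 0"
    using m(2)[of "pderiv m"] pm0 coeff_pderiv_mem[OF M mM] by (auto simp: Q_def)
  define u where "u = - poly (map_poly D m) z / poly (pderiv m) z"
  have um: "poly (map_poly D m) z + poly (pderiv m) z * u = 0"
    using pmz by (simp add: u_def)
  have "poly (map_poly D P) z + poly (pderiv P) z * u = 0"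
    if "\<forall>i. coeff P i \<in> M" "poly P z = 0" for P
    using that
  proof (induction "degree P" arbitrary: P rule: less_induct)
    case less
    show ?case
    proof (cases "P = 0")
      case True
      then show ?thesis by simp
    next
      case False
      then have le: "degree m \<le> degree P" using m(2)[of P] less.prems by (auto simp: Q_def)
      \<comment> \<open>One step of division by \<open>m\<close>: subtracting a multiple of
        \<open>m\<close> lowers the degree. The condition on \<open>u\<close> is additive, and it
        passes from \<open>m\<close> to its multiples because \<open>m\<close> vanishes at
        \<open>z\<close>.\<close>
      define c where "c = lead_coeff P * inverse (lead_coeff m)"
      define S where "S = monom c (degree P - degree m)"
      have S: "coeff S i \<in> M" for i
        using less.prems(1) mM inv subring_set_mult[OF M] subring_set_zero[OF M]
        by (auto simp: S_def c_def)
      have Sm: "coeff (S * m) i \<in> M" for i by (rule coeff_mult_mem[OF M S mM])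
      define P' where "P' = P - S * m"
      have c0: "c \<noteq> 0" using False m0 by (simp add: c_def)
      have degS: "degree (S * m) = degree P"
        
      proof -
        have "degree S = degree P - degree m" "S \<noteq> 0" using c0 by (simp_all add: S_def degree_monom_eq monom_eq_0_iff)
        then show ?thesis using m0 le by (simp add: degree_mult_eq)
      qed
      have lcS: "lead_coeff (S * m) = lead_coeff P"
      proof -
        have "lead_coeff S = c" using c0 by (simp add: S_def degree_monom_eq)
        then show ?thesis using m0 unfolding lead_coeff_mult by (simp add: c_def)
      qed
      have P'M: "\<forall>i. coeff P' i \<in> M" using Sm less.prems(1) by (auto simp: P'_def intro: subring_set_diff[OF M])
      have P'z: "poly P' z = 0" using mz less.prems by (simp add: P'_def)
      have "degree P > 0"
        using le degm by simp
      then have "degree P' < degree P"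
        using lcS degS unfolding P'_def
        by (intro degree_lessI) (auto simp: coeff_eq_0 le_less)
      from less.hyps[OF this P'M P'z]
      have IH: "poly (map_poly D P') z + poly (pderiv P') z * u = 0" .
      have P: "P = P' + S * m" by (simp add: P'_def)
      have "map_poly D P = map_poly D P' + (S * map_poly D m + m * map_poly D S)"
        unfolding P using P'M Sm S mM by (simp add: map_poly_deriv_add[OF M D] map_poly_deriv_mult[OF M D])
      moreover have "pderiv P = pderiv P' + (S * pderiv m + m * pderiv S)"
        by (subst P) (simp add: pderiv_add pderiv_mult)
      moreover have "poly (map_poly D P') z + (poly S z * poly (map_poly D m) z + poly m z * poly (map_poly D S) z)
          + (poly (pderiv P') z + (poly S z * poly (pderiv m) z + poly m z * poly (pderiv S) z)) * u = 0" (is ?this)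
      proof -
        have "?this \<longleftrightarrow> (poly (map_poly D P') z + poly (pderiv P') z * u)
            + poly S z * (poly (map_poly D m) z + poly (pderiv m) z * u) = 0"
          by (simp add: mz algebra_simps)
        then show ?thesis using IH um by simp
      qed
      ultimately show ?thesis by simp
    qed
  qed
  then show ?thesis by blast
qed

text \<open>The value at \<open>poly P z\<close> has to be
  \<open>poly (map_poly D P) z + poly (pderiv P) z * u\<close>; the condition on \<open>u\<close>
  says exactly that this does not depend on \<open>P\<close>.\<close>

lemma deriv_on_adjoin:
  fixes M :: "'l::field set"
  assumes M: "subring_set M" and D: "deriv_on M D"
    and u: "\<forall>P. (\<forall>i. coeff P i \<in> M) \<longrightarrow> poly P z = 0 \<longrightarrow>
      poly (map_poly D P) z + poly (pderiv P) z * u = 0"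
  obtains D' where "deriv_on (adjoin M z) D'" "\<And>a. a \<in> M \<Longrightarrow> D' a = D a" "D' z = u"
proof -
  define val where "val = (\<lambda>P. poly (map_poly D P) z + poly (pderiv P) z * u)"
  define D' where "D' = (\<lambda>w. THE v. \<exists>P. (\<forall>i. coeff P i \<in> M) \<and> w = poly P z \<and> v = val P)"
  have D': "D' (poly P z) = val P" if P: "\<And>i. coeff P i \<in> M" for P
    unfolding D'_def
  proof (rule the_equality)
    show "\<exists>P'. (\<forall>i. coeff P' i \<in> M) \<and> poly P z = poly P' z \<and> val P = val P'" using P by blast
    fix v assume "\<exists>P'. (\<forall>i. coeff P' i \<in> M) \<and> poly P z = poly P' z \<and> v = val P'"
    then obtain P' where P': "\<And>i. coeff P' i \<in> M" "poly P z = poly P' z" "v = val P'" by blast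
    have "poly (map_poly D (P' - P)) z + poly (pderiv (P' - P)) z * u = 0"
      using P P' by (intro u[rule_format]) (auto intro: subring_set_diff[OF M])
    then show "v = val P"
      using P P' by (simp add: val_def map_poly_deriv_diff[OF M D] pderiv_diff algebra_simps)
  qed
  have "deriv_on (adjoin M z) D'"
    unfolding deriv_on_def
  proof (intro ballI)
    fix a b assume "a \<in> adjoin M z" "b \<in> adjoin M z"
    then obtain P Q where P: "a = poly P z" "\<And>i. coeff P i \<in> M" and Q: "b = poly Q z" "\<And>i. coeff Q i \<in> M"
      by (auto simp: adjoin_def)
    have "D' (poly (P + Q) z) = val (P + Q)" "D' (poly (P * Q) z) = val (P * Q)"
      by (rule D'; use P Q in \<open>auto intro!: subring_set_add[OF M] coeff_mult_mem[OF M]\<close>)+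
    moreover have "D' a = val P" "D' b = val Q" using P Q D' by auto
    ultimately show "D' (a + b) = D' a + D' b \<and> D' (a * b) = a * D' b + b * D' a"
      using P Q by (simp add: val_def map_poly_deriv_add[OF M D] map_poly_deriv_mult[OF M D]
          pderiv_add pderiv_mult algebra_simps)
  qed
  moreover have "D' a = D a" if "a \<in> M" for a
    using D'[of "[:a:]"] that subring_set_zero[OF M] deriv_on_zero[OF M D]
    by (auto simp: val_def map_poly_pCons coeff_pCons split: nat.splits)
  moreover have "D' z = u"
    using D'[of "[:0, 1:]"] subring_set_zero[OF M] subring_set_one[OF M] deriv_on_zero[OF M D] deriv_on_one[OF M D]
    by (auto simp: val_def map_poly_pCons coeff_pCons pderiv_pCons split: nat.splits)
  ultimately show ?thesis using that by blast
qed

text \<open>Adjoining an element and passing to fractions alternate, because division by a minimal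
  polynomial requires inverses of leading coefficients in the base.\<close>

lemma deriv_on_extend:
  fixes M :: "'l::field set"
  assumes "subring_set M" and "\<And>a. a \<in> M \<Longrightarrow> inverse a \<in> M" and "deriv_on M D"
    and char0: "\<And>m. m > 0 \<Longrightarrow> (of_nat m :: 'l) \<noteq> 0"
  shows "\<exists>N D'. subring_set N \<and> (\<forall>a\<in>N. inverse a \<in> N) \<and> deriv_on N D' \<and> M \<subseteq> N \<and> set zs \<subseteq> N \<and>
    (\<forall>a\<in>M. D' a = D a)"
  using assms(1-3)
proof (induction zs arbitrary: M D)
  case Nil
  then show ?case by auto
next
  case (Cons z zs)
  obtain u where u: "\<forall>P. (\<forall>i. coeff P i \<in> M) \<longrightarrow> poly P z = 0 \<longrightarrow>
      poly (map_poly D P) z + poly (pderiv P) z * u = 0"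
    using deriv_value_exists[OF Cons.prems char0, of z] ..
  obtain D1 where D1: "deriv_on (adjoin M z) D1" "\<And>a. a \<in> M \<Longrightarrow> D1 a = D a"
    by (rule deriv_on_adjoin[OF Cons.prems(1,3) u]) (rule that)
  obtain M2 D2 where 2: "subring_set M2" "adjoin M z \<subseteq> M2" "\<And>a. a \<in> M2 \<Longrightarrow> inverse a \<in> M2"
    "deriv_on M2 D2" "\<And>a. a \<in> adjoin M z \<Longrightarrow> D2 a = D1 a"
    by (rule deriv_on_fractions[OF subring_set_adjoin[OF Cons.prems(1)] D1(1)]) (rule that)
  from Cons.IH[OF 2(1,3,4)] obtain N D' where N: "subring_set N" "\<forall>a\<in>N. inverse a \<in> N" "deriv_on N D'"
    "M2 \<subseteq> N" "set zs \<subseteq> N" "\<forall>a\<in>M2. D' a = D2 a" by blast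
  have "M \<subseteq> adjoin M z" "z \<in> adjoin M z"
    using subset_adjoin[OF Cons.prems(1)] mem_adjoin[OF Cons.prems(1)] by auto
  then have "M \<subseteq> N" "set (z # zs) \<subseteq> N" "\<forall>a\<in>M. D' a = D a"
    using N(4-6) 2(2,5) D1(2) by (auto simp: subset_iff)
  then show ?case using N(1-3) by blast
qed

section \<open>Derivations modulo a prime ideal and towers of transcendental elements\<close>

text \<open>These are the lifts to \<A> of the \<open>K\<close>-derivations from \<A> to its residue
  ring modulo \<open>q\<close>; for \<open>q = {0}\<close> they are the derivations of \<A>. They
  may map \<open>q\<close> outside itself: preservation of \<open>q\<close> is imposed separately
  where stability matters.\<close>

definition derivs :: "('k::field \<Rightarrow> 'a::comm_ring_1 \<Rightarrow> 'a) \<Rightarrow> 'a set \<Rightarrow> ('a \<Rightarrow> 'a) set" where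
  "derivs scale q = {D. (\<forall>a b. D (a + b) - (D a + D b) \<in> q) \<and>
     (\<forall>a b. D (a * b) - (a * D b + b * D a) \<in> q) \<and> (\<forall>c. D (scale c 1) \<in> q)}"

context prime_set
begin

lemma derivs_add_iff: "D \<in> derivs scale q \<Longrightarrow> D (a + b) \<in> q \<longleftrightarrow> D a + D b \<in> q"
  by (rule cong_mem_iff) (simp add: derivs_def)

lemma derivs_mult_iff: "D \<in> derivs scale q \<Longrightarrow> D (a * b) \<in> q \<longleftrightarrow> a * D b + b * D a \<in> q"
  by (rule cong_mem_iff) (simp add: derivs_def)

lemma derivs_add: "D \<in> derivs scale q \<Longrightarrow> D (a + b) - (D a + D b) \<in> q"
  and derivs_mult: "D \<in> derivs scale q \<Longrightarrow> D (a * b) - (a * D b + b * D a) \<in> q"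
  and derivs_scalar: "D \<in> derivs scale q \<Longrightarrow> D (scale c 1) \<in> q"
  by (simp_all add: derivs_def)

lemma derivs_zero: "D \<in> derivs scale q \<Longrightarrow> D 0 \<in> q"
  using derivs_add[of D scale 0 0] uminus_mem[of "- D 0"] by simp

lemma derivs_combination:
  assumes "\<And>i. i \<in> I \<Longrightarrow> D i \<in> derivs scale q"
  shows "(\<lambda>b. \<Sum>i\<in>I. a i * D i b) \<in> derivs scale q"
  unfolding derivs_def
proof (intro CollectI conjI allI)
  fix b c k
  have "(\<Sum>i\<in>I. a i * D i (b + c)) - ((\<Sum>i\<in>I. a i * D i b) + (\<Sum>i\<in>I. a i * D i c))
      = (\<Sum>i\<in>I. a i * (D i (b + c) - (D i b + D i c)))"
    by (simp add: sum.distrib sum_subtractf algebra_simps)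
  then show "(\<Sum>i\<in>I. a i * D i (b + c)) - ((\<Sum>i\<in>I. a i * D i b) + (\<Sum>i\<in>I. a i * D i c)) \<in> q"
    using assms by (auto intro!: sum_mem mult_mem derivs_add)
  have "(\<Sum>i\<in>I. a i * D i (b * c)) - (b * (\<Sum>i\<in>I. a i * D i c) + c * (\<Sum>i\<in>I. a i * D i b))
      = (\<Sum>i\<in>I. a i * (D i (b * c) - (b * D i c + c * D i b)))"
    by (simp add: sum.distrib sum_subtractf sum_distrib_left algebra_simps)
  then show "(\<Sum>i\<in>I. a i * D i (b * c)) - (b * (\<Sum>i\<in>I. a i * D i c) + c * (\<Sum>i\<in>I. a i * D i b)) \<in> q"
    using assms by (auto intro!: sum_mem mult_mem derivs_mult)
  have "D i (scale k 1) \<in> q" if "i \<in> I" for i using assms[OF that] by (simp add: derivs_def)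
  then show "(\<Sum>i\<in>I. a i * D i (scale k 1)) \<in> q" by (intro sum_mem mult_mem)
qed

lemma derivs_combination2:
  assumes "D \<in> derivs scale q" "E \<in> derivs scale q"
  shows "(\<lambda>t. a * D t + b * E t) \<in> derivs scale q"
  using derivs_combination[of UNIV "\<lambda>i. if i then D else E" scale "\<lambda>i. if i then a else b"] assms
  by (simp add: UNIV_bool add.commute)

end

lemma derivs_poly:
  fixes q :: "'a::idom set"
  assumes q: "prime_set q" and D: "D \<in> derivs scale q"
  shows "(\<And>i. D (coeff P i) \<in> q) \<Longrightarrow> D (poly P y) - poly (pderiv P) y * D y \<in> q"
proof (induction P)
  case 0
  then show ?case using prime_set.derivs_zero[OF q D] by simp
next
  case (pCons c P)
  interpret prime_set q by (rule q)
  have c: "D c \<in> q" and P: "D (coeff P i) \<in> q" for i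
    using pCons.prems[of 0] pCons.prems[of "Suc i"] by simp_all
  have "D (c + y * poly P y) - poly (pderiv (pCons c P)) y * D y
      = (D (c + y * poly P y) - (D c + D (y * poly P y))) + D c
      + (D (y * poly P y) - (y * D (poly P y) + poly P y * D y))
      + y * (D (poly P y) - poly (pderiv P) y * D y)"
    by (simp add: pderiv_pCons algebra_simps)
  also have "\<dots> \<in> q"
    by (intro add_mem mult_mem derivs_add[OF D] derivs_mult[OF D] c pCons.IH[OF P])
  finally show ?case by simp
qed

lemma exact_derivs_iff:
  "D \<in> derivs scale {0} \<longleftrightarrow> (\<forall>a b. D (a + b) = D a + D b) \<and>
     (\<forall>a b. D (a * b) = a * D b + b * D a) \<and> (\<forall>c. D (scale c 1) = 0)"
  by (auto simp: derivs_def)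

lemma (in comm_algebra) scale_eq_mult: "scale c a = scale c 1 * a"
  by (simp add: scale_mult_left)

inductive_set (in comm_algebra) generated_by :: "'a set \<Rightarrow> 'a set" for X where
  scalar: "scale c 1 \<in> generated_by X"
| gen: "a \<in> X \<Longrightarrow> a \<in> generated_by X"
| add: "a \<in> generated_by X \<Longrightarrow> b \<in> generated_by X \<Longrightarrow> a + b \<in> generated_by X"
| mult: "a \<in> generated_by X \<Longrightarrow> b \<in> generated_by X \<Longrightarrow> a * b \<in> generated_by X"

text \<open>What is kept of a presentation: every element is a fraction of polynomials in the
  \<open>x i\<close> with an invertible denominator. The relations are recovered later as the
  polynomials that vanish at \<open>x\<close>.\<close>

locale ess_finite_algebra = comm_algebra scale
  for scale :: "'k::field_char_0 \<Rightarrow> 'a::idom \<Rightarrow> 'a" +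
  fixes x :: "nat \<Rightarrow> 'a" and n :: nat
  assumes ess: "\<exists>s\<in>generated_by (x ` {..<n}). a * s \<in> generated_by (x ` {..<n}) \<and> s dvd 1"
begin

lemma of_nat_scale: "of_nat m = scale (of_nat m) 1"
  by (induction m) (simp_all add: scale_left_distrib)

lemma of_nat_nonzero: "m > 0 \<Longrightarrow> (of_nat m :: 'a) \<noteq> 0"
  by (simp add: of_nat_scale)

text \<open>The last case is made for derivations: the quotient rule expresses the value at
  \<open>a\<close> by those at \<open>s\<close> and \<open>a * s\<close>, so no induction hypothesis
  about the inverse \<open>t\<close> is involved.\<close>

lemma ess_induct [case_names scalar gen add mult divide]:
  assumes "\<And>c. P (scale c 1)" and "\<And>i. i < n \<Longrightarrow> P (x i)"
    and "\<And>a b. P a \<Longrightarrow> P b \<Longrightarrow> P (a + b)" and "\<And>a b. P a \<Longrightarrow> P b \<Longrightarrow> P (a * b)"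
    and "\<And>a s t. P s \<Longrightarrow> P (a * s) \<Longrightarrow> s * t = 1 \<Longrightarrow> P a"
  shows "P a"
proof -
  have gen: "P b" if "b \<in> generated_by (x ` {..<n})" for b
    using that by induction (use assms(1-4) in auto)
  obtain s where "s \<in> generated_by (x ` {..<n})" "a * s \<in> generated_by (x ` {..<n})" "s dvd 1"
    using ess by blast
  moreover from this(3) obtain t where "s * t = 1" by (metis dvdE)
  ultimately show ?thesis using gen assms(5)[of s a t] by simp
qed

lemma derivs_vanish:
  assumes q: "prime_set q" and D: "D \<in> derivs scale q" and x: "\<And>i. i < n \<Longrightarrow> D (x i) \<in> q"
  shows "D a \<in> q"
proof -
  interpret prime_set q by (rule q)
  show ?thesis
  proof (induction a rule: ess_induct)
    case (divide a s t)
    have "a * D s + s * D a \<in> q" using divide(2) unfolding derivs_mult_iff[OF D] .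
    then have "s * D a \<in> q" using diff_mem[OF _ mult_mem[OF divide(1)], of "a * D s + s * D a" a] by simp
    then have "t * (s * D a) \<in> q" by (rule mult_mem)
    moreover have "t * (s * D a) = (s * t) * D a" by (simp only: ac_simps)
    ultimately show ?case using divide(3) by simp
  next
    case (scalar c)
    show ?case by (rule derivs_scalar[OF D])
  next
    case (gen i)
    then show ?case by (rule x)
  next
    case (add a b)
    then show ?case unfolding derivs_add_iff[OF D] by (rule add_mem)
  next
    case (mult a b)
    then show ?case unfolding derivs_mult_iff[OF D] by (intro add_mem mult_mem)
  qed
qed

end

lemma to_fract_of_nat: "to_fract (of_nat m) = of_nat m"
  by (induction m) simp_all

lemma common_denominator:
  fixes f :: "'i \<Rightarrow> 'a::idom fract"
  assumes R: "subring_set R" and I: "finite I"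
    and f: "\<And>i. i \<in> I \<Longrightarrow> \<exists>a\<in>R. \<exists>b\<in>R. b \<noteq> 0 \<and> f i * to_fract b = to_fract a"
  shows "\<exists>b\<in>R. b \<noteq> 0 \<and> (\<forall>i\<in>I. \<exists>a\<in>R. f i * to_fract b = to_fract a)"
  using I f
proof (induction I rule: finite_induct)
  case empty
  then show ?case using subring_set_one[OF R] by (intro bexI[of _ 1]) auto
next
  case (insert i I)
  then obtain b where b: "b \<in> R" "b \<noteq> 0" "\<And>i. i \<in> I \<Longrightarrow> \<exists>a\<in>R. f i * to_fract b = to_fract a" by blast
  obtain a' b' where ab': "a' \<in> R" "b' \<in> R" "b' \<noteq> 0" "f i * to_fract b' = to_fract a'"
    using insert.prems by blast
  have "\<exists>a\<in>R. f j * to_fract (b * b') = to_fract a" if j: "j \<in> insert i I" for j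
  proof (cases "j = i")
    case True
    have "f i * to_fract (b * b') = to_fract (b * a')"
      using ab'(4) by (simp add: mult.left_commute)
    then show ?thesis using True subring_set_mult[OF R b(1) ab'(1)] by blast
  next
    case False
    then obtain a where a: "a \<in> R" "f j * to_fract b = to_fract a" using b j by blast
    then have "f j * to_fract (b * b') = to_fract (a * b')" by (simp add: mult.assoc[symmetric])
    then show ?thesis using subring_set_mult[OF R a(1) ab'(2)] by blast
  qed
  moreover have "b * b' \<in> R" "b * b' \<noteq> 0" using b ab' subring_set_mult[OF R] by auto
  ultimately show ?case by blast
qed

lemma poly_map_to_fract: "poly (map_poly to_fract P) (to_fract y) = to_fract (poly P y)"
  by (induction P) (simp_all add: map_poly_pCons)

lemma inj_to_fract: "inj to_fract"
  by (auto intro: injI)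

text \<open>Differentiation by \<open>y\<close> over the fractions of \<open>R\<close> extends to
  the field of fractions of \<A>, since finitely many elements remain to be adjoined. Multiplication
  by a common denominator of the values at the \<open>x i\<close> brings the values back into
  \<A>.\<close>

lemma (in ess_finite_algebra) transcendental_derivation:
  assumes R: "subring_set R" and K: "range (\<lambda>c. scale c 1) \<subseteq> R" and y: "transcendental_over R y"
  shows "\<exists>D\<in>derivs scale {0}. (\<forall>a\<in>R. D a = 0) \<and> D y \<noteq> 0"
proof -
  let ?R = "to_fract ` R"
  have R': "subring_set ?R"
    unfolding subring_set_def
  proof (intro conjI ballI)
    show "1 \<in> ?R" using subring_set_one[OF R] by (metis image_eqI to_fract_1)
    fix a b assume "a \<in> ?R" "b \<in> ?R"
    then obtain a' b' where ab: "a' \<in> R" "b' \<in> R" "a = to_fract a'" "b = to_fract b'" by blast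
    then have "a - b = to_fract (a' - b')" "a * b = to_fract (a' * b')" by simp_all
    then show "a - b \<in> ?R" "a * b \<in> ?R"
      using ab subring_set_diff[OF R] subring_set_mult[OF R] by blast+
  qed
  have "deriv_on ?R (\<lambda>_. 0)" by (simp add: deriv_on_def)
  then obtain M D0 where M: "subring_set M" "?R \<subseteq> M" "\<And>a. a \<in> M \<Longrightarrow> inverse a \<in> M"
    and D0: "deriv_on M D0" "\<And>a. a \<in> ?R \<Longrightarrow> D0 a = 0" and Mf: "M = {a / b |a b. a \<in> ?R \<and> b \<in> ?R}"
    by (rule deriv_on_fractions[OF R']) (rule that)
  have frac: "\<exists>a\<in>R. \<exists>b\<in>R. b \<noteq> 0 \<and> w * to_fract b = to_fract a" if w: "w \<in> M" for w
  proof -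
    obtain a b where ab: "a \<in> R" "b \<in> R" "w = to_fract a / to_fract b" using w unfolding Mf by blast
    show ?thesis
    proof (cases "b = 0")
      case True
      then have "w * to_fract 1 = to_fract 0" using ab by simp
      then show ?thesis
        using subring_set_zero[OF R] subring_set_one[OF R] by (metis one_neq_zero)
    next
      case False
      then have "w * to_fract b = to_fract a" using ab by simp
      then show ?thesis using ab False by blast
    qed
  qed
  have tr: "P = 0" if P: "\<forall>i. coeff P i \<in> M" and P0: "poly P (to_fract y) = 0" for P
  proof -
    have "\<exists>b\<in>R. b \<noteq> 0 \<and> (\<forall>i\<in>{..degree P}. \<exists>a\<in>R. coeff P i * to_fract b = to_fract a)"
      using P frac by (intro common_denominator[OF R]) auto
    then obtain b where b: "b \<noteq> 0" "\<And>i. i \<le> degree P \<Longrightarrow> \<exists>a\<in>R. coeff P i * to_fract b = to_fract a"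
      by auto
    define Q where "Q = Polynomial.smult (to_fract b) P"
    have Q: "\<exists>a\<in>R. coeff Q i = to_fract a" for i
    proof (cases "i \<le> degree P")
      case True
      then show ?thesis using b(2) by (simp add: Q_def mult.commute)
    next
      case False
      then have "coeff Q i = to_fract 0" by (simp add: Q_def coeff_eq_0)
      then show ?thesis using subring_set_zero[OF R] by blast
    qed
    define Q0 where "Q0 = map_poly (inv_into UNIV to_fract) Q"
    have inv0: "inv_into UNIV to_fract 0 = (0::'a)" using inv_f_f[OF inj_to_fract, of 0] by simp
    have Q0R: "coeff Q0 i \<in> R \<and> to_fract (coeff Q0 i) = coeff Q i" for i
      using Q[of i] by (auto simp: Q0_def coeff_map_poly inv0 inv_f_f[OF inj_to_fract])
    have "map_poly to_fract Q0 = Q" using Q0R by (intro poly_eqI) (simp add: coeff_map_poly)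
    then have "to_fract (poly Q0 y) = 0"
      using P0 by (metis Q_def mult_zero_right poly_map_to_fract poly_smult)
    then have "Q0 = 0" using y Q0R unfolding transcendental_over_def by simp
    then have "Q = 0" using \<open>map_poly to_fract Q0 = Q\<close> by simp
    then show "P = 0" using b(1) by (simp add: Q_def)
  qed
  \<comment> \<open>No nonzero polynomial over \<open>M\<close> vanishes at \<open>y\<close>, so the
    value there is free; it is chosen to be 1.\<close>
  have "\<forall>P. (\<forall>i. coeff P i \<in> M) \<longrightarrow> poly P (to_fract y) = 0 \<longrightarrow>
      poly (map_poly D0 P) (to_fract y) + poly (pderiv P) (to_fract y) * 1 = 0"
  proof (intro allI impI)
    fix P assume "\<forall>i. coeff P i \<in> M" "poly P (to_fract y) = 0"
    then have "P = 0" by (rule tr)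
    then show "poly (map_poly D0 P) (to_fract y) + poly (pderiv P) (to_fract y) * 1 = 0" by simp
  qed
  then obtain D1 where D1: "deriv_on (adjoin M (to_fract y)) D1" "\<And>a. a \<in> M \<Longrightarrow> D1 a = D0 a"
    "D1 (to_fract y) = 1"
    by (rule deriv_on_adjoin[OF M(1) D0(1)]) (rule that)
  obtain M2 D2 where M2: "subring_set M2" "adjoin M (to_fract y) \<subseteq> M2" "\<And>a. a \<in> M2 \<Longrightarrow> inverse a \<in> M2"
    "deriv_on M2 D2" "\<And>a. a \<in> adjoin M (to_fract y) \<Longrightarrow> D2 a = D1 a"
    by (rule deriv_on_fractions[OF subring_set_adjoin[OF M(1)] D1(1)]) (rule that)
  have char0: "(of_nat m :: 'a fract) \<noteq> 0" if "m > 0" for m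
    using of_nat_nonzero[OF that] by (simp add: to_fract_of_nat[symmetric])
  obtain N D' where N: "subring_set N" "\<forall>a\<in>N. inverse a \<in> N" "deriv_on N D'"
    "M2 \<subseteq> N" "set (map (\<lambda>i. to_fract (x i)) [0..<n]) \<subseteq> N" "\<forall>a\<in>M2. D' a = D2 a"
    using deriv_on_extend[OF M2(1,3,4) char0, of "map (\<lambda>i. to_fract (x i)) [0..<n]"] by blast
  have sub: "M \<subseteq> adjoin M (to_fract y)" "to_fract y \<in> adjoin M (to_fract y)"
    using subset_adjoin[OF M(1)] mem_adjoin[OF M(1)] by auto
  have D'R: "D' (to_fract a) = 0" and RN: "to_fract a \<in> N" if "a \<in> R" for a
  proof -
    have "to_fract a \<in> ?R" using that by blast
    then have "to_fract a \<in> M" "D0 (to_fract a) = 0" using M(2) D0(2) by auto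
    moreover from this have "to_fract a \<in> M2" using sub(1) M2(2) by blast
    ultimately show "D' (to_fract a) = 0" "to_fract a \<in> N"
      using sub(1) M2(5) D1(2) N(4,6) by (auto simp: subset_iff)
  qed
  have D'y: "D' (to_fract y) = 1"
    using sub(2) M2(2,5) D1(3) N(6) by (auto simp: subset_iff)
  have scalar: "scale c 1 \<in> R" for c using K by blast
  have inN: "to_fract a \<in> N" for a
  proof (induction a rule: ess_induct)
    case (divide a s t)
    have "s \<noteq> 0" using divide(3) by auto
    then have "to_fract a = to_fract (a * s) * inverse (to_fract s)" by simp
    then show ?case using divide N(2) subring_set_mult[OF N(1)] by metis
  qed (use RN scalar N(5) subring_set_add[OF N(1)] subring_set_mult[OF N(1)] in auto)
  have "\<exists>a\<in>UNIV. \<exists>b\<in>UNIV. b \<noteq> 0 \<and> w * to_fract b = to_fract a" for w :: "'a fract"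
  proof (cases w rule: Fract_cases)
    case (Fract a b)
    then have "w * to_fract b = to_fract a" by (simp add: Fract_conv_to_fract)
    then show ?thesis using Fract by blast
  qed
  then have "\<exists>b\<in>UNIV. b \<noteq> 0 \<and> (\<forall>i\<in>{..<n}. \<exists>a\<in>UNIV. D' (to_fract (x i)) * to_fract b = to_fract a)"
    by (intro common_denominator) (auto simp: subring_set_def)
  then obtain b where b: "b \<noteq> 0" "\<And>i. i < n \<Longrightarrow> \<exists>a. D' (to_fract (x i)) * to_fract b = to_fract a"
    by auto
  \<comment> \<open>Clearing denominators at the generators is enough: by the product and quotient
    rules all values of \<open>E\<close> are then in \<A>, since the denominators needed to write
    elements of \<A> are units.\<close>
  define E where "E = (\<lambda>a. D' (to_fract a) * to_fract b)"
  have E_add: "E (a + c) = E a + E c" and E_mult: "E (a * c) = to_fract a * E c + to_fract c * E a" for a c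
    using deriv_on_add[OF N(1,3) inN inN, of a c] deriv_on_mult[OF N(1,3) inN inN, of a c]
    by (simp_all add: E_def algebra_simps)
  have E_scalar: "E (scale k 1) = 0" for k using D'R[OF scalar] by (simp add: E_def)
  have "\<exists>e. E a = to_fract e" for a
  proof (induction a rule: ess_induct)
    case (scalar c)
    then show ?case using E_scalar by (intro exI[of _ 0]) simp
  next
    case (gen i)
    then show ?case unfolding E_def by (rule b(2))
  next
    case (add a c)
    then obtain e f where "E a = to_fract e" "E c = to_fract f" by blast
    then have "E (a + c) = to_fract (e + f)" by (simp add: E_add)
    then show ?case by blast
  next
    case (mult a c)
    then obtain e f where "E a = to_fract e" "E c = to_fract f" by blast
    then have "E (a * c) = to_fract (a * f + c * e)" by (simp add: E_mult)
    then show ?case by blast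
  next
    case (divide a s t)
    then obtain e f where ef: "E s = to_fract e" "E (a * s) = to_fract f" by blast
    have st: "to_fract t * to_fract s = 1"
      using divide(3) by (simp only: to_fract_mult[symmetric] mult.commute[of t] to_fract_1)
    have "to_fract s * E a = E (a * s) - to_fract a * E s" by (simp add: E_mult)
    also have "\<dots> = to_fract (f - a * e)" by (simp add: ef)
    finally have "to_fract t * to_fract s * E a = to_fract (t * (f - a * e))"
      by (simp only: mult.assoc to_fract_mult)
    then have "E a = to_fract (t * (f - a * e))" by (simp only: st mult_1)
    then show ?case by blast
  qed
  then obtain D where D: "\<And>a. E a = to_fract (D a)" by metis
  have "D \<in> derivs scale {0}"
    unfolding exact_derivs_iff
  proof (intro conjI allI)
    fix a c k
    have "to_fract (D (a + c)) = to_fract (D a + D c)"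
      by (simp only: D[symmetric] E_add to_fract_add)
    then show "D (a + c) = D a + D c" by (simp only: to_fract_eq_iff)
    have "to_fract (D (a * c)) = to_fract (a * D c + c * D a)"
      by (simp only: D[symmetric] E_mult to_fract_add to_fract_mult)
    then show "D (a * c) = a * D c + c * D a" by (simp only: to_fract_eq_iff)
    show "D (scale k 1) = 0" using D[of "scale k 1"] E_scalar by simp
  qed
  moreover have "D a = 0" if "a \<in> R" for a using D[of a] D'R[OF that] by (simp add: E_def)
  moreover have "D y \<noteq> 0" using D[of y] D'y b(1) by (auto simp: E_def)
  ultimately show ?thesis by blast
qed

subsection \<open>Towers\<close>

context ess_finite_algebra
begin

text \<open>An algebraically independent list together with the polynomial ring that it generates,
  built one element at a time. Lengths of towers serve as lower bounds for transcendence
  degrees.\<close>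

inductive tower :: "'a set \<Rightarrow> 'a list \<Rightarrow> bool" where
  base: "tower (range (\<lambda>c. scale c 1)) []"
| step: "tower R ys \<Longrightarrow> transcendental_over R y \<Longrightarrow> tower (adjoin R y) (ys @ [y])"

lemma subring_set_scalars: "subring_set (range (\<lambda>c. scale c 1))"
  unfolding subring_set_def
proof (intro conjI ballI)
  show "1 \<in> range (\<lambda>c. scale c (1::'a))" by (rule range_eqI[of _ _ 1]) simp
  fix a b assume "a \<in> range (\<lambda>c. scale c (1::'a))" "b \<in> range (\<lambda>c. scale c (1::'a))"
  then obtain c d where "a = scale c 1" "b = scale d 1" by blast
  then have "a - b = scale (c - d) 1" "a * b = scale (c * d) 1"
    by (simp_all add: scale_left_diff_distrib scale_mult_left)
  then show "a - b \<in> range (\<lambda>c. scale c 1)" "a * b \<in> range (\<lambda>c. scale c 1)" by blast+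
qed

lemma tower_subring: "tower R ys \<Longrightarrow> subring_set R \<and> range (\<lambda>c. scale c 1) \<subseteq> R \<and> set ys \<subseteq> R"
proof (induction rule: tower.induct)
  case base
  then show ?case using subring_set_scalars by simp
next
  case (step R ys y)
  then show ?case
    using subring_set_adjoin[of R y] subset_adjoin[of R y] mem_adjoin[of R y] by auto
qed

text \<open>Differentiating by each element over the ring generated by its predecessors gives a
  triangular family, so the generic rank of the derivations of \<A> is at least the length of the
  tower.\<close>

lemma tower_derivations:
  assumes "tower R ys"
  shows "\<exists>D. \<forall>j<length ys. D j \<in> derivs scale {0} \<and> D j (ys ! j) \<noteq> 0 \<and> (\<forall>i<j. D j (ys ! i) = 0)"
  using assms
proof (induction rule: tower.induct)
  case (step R ys y)
  note R = tower_subring[OF step(1)]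
  obtain D where D: "\<And>j. j < length ys \<Longrightarrow> D j \<in> derivs scale {0} \<and> D j (ys ! j) \<noteq> 0 \<and> (\<forall>i<j. D j (ys ! i) = 0)"
    using step.IH by blast
  obtain E where E: "E \<in> derivs scale {0}" "\<forall>a\<in>R. E a = 0" "E y \<noteq> 0"
    using transcendental_derivation[of R y] R step(2) by blast
  have "E (ys ! i) = 0" if "i < length ys" for i using E(2) R that nth_mem by blast
  then show ?case using D E by (intro exI[of _ "D(length ys := E)"]) (auto simp: nth_append less_Suc_eq)
qed auto

lemma tower_extend:
  assumes R: "tower R ys" and q: "prime_set q"
    and y: "\<And>P. (\<And>i. coeff P i \<in> R) \<Longrightarrow> poly P y \<in> q \<Longrightarrow> P = 0"
  shows "tower (adjoin R y) (ys @ [y]) \<and> adjoin R y \<inter> q \<subseteq> {0}"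
proof -
  interpret prime_set q by (rule q)
  have "transcendental_over R y" using y zero_mem by (auto simp: transcendental_over_def)
  moreover have "adjoin R y \<inter> q \<subseteq> {0}" using y by (force simp: adjoin_def)
  ultimately show ?thesis using tower.step[OF R] by blast
qed

text \<open>Differentiating a relation for \<open>y\<close> modulo \<open>p\<close> and cancelling
  \<open>D y\<close> leaves a relation of smaller degree, and in characteristic zero the derivative
  of a nonconstant polynomial is not zero. This is how derivations produce algebraic independence
  modulo \<open>p\<close>.\<close>

lemma poly_mem_prime_eq_0:
  assumes p: "prime_set p" and R: "subring_set R" "R \<inter> p \<subseteq> {0}" and D: "D \<in> derivs scale p"
    and DR: "\<And>a. a \<in> R \<Longrightarrow> D a \<in> p" and Dp: "\<And>a. a \<in> p \<Longrightarrow> D a \<in> p" and Dy: "D y \<notin> p"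
  shows "(\<And>i. coeff P i \<in> R) \<Longrightarrow> poly P y \<in> p \<Longrightarrow> P = 0"
proof (induction "degree P" arbitrary: P rule: less_induct)
  case less
  interpret prime_set p by (rule p)
  have const: "P = 0" if "degree P = 0"
  proof -
    from that obtain a where P: "P = [:a:]" using degree_eq_zeroE by blast
    then have "a \<in> R" "a \<in> p" using less.prems(1)[of 0] less.prems(2) by simp_all
    then show ?thesis using R(2) P by auto
  qed
  show ?case
  proof (cases "degree P = 0")
    case False
    have "D (poly P y) - poly (pderiv P) y * D y \<in> p"
      using less.prems DR by (intro derivs_poly[OF p D]) blast
    then have "poly (pderiv P) y * D y \<in> p"
      using cong_mem_iff Dp[OF less.prems(2)] by blast
    then have "poly (pderiv P) y \<in> p" using prime Dy by blast
    moreover have "degree (pderiv P) < degree P"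
    proof (cases "pderiv P = 0")
      case False
      then show ?thesis using \<open>degree P \<noteq> 0\<close>
        by (intro degree_lessI) (auto simp: coeff_pderiv coeff_eq_0)
    qed (use False in simp)
    ultimately have "pderiv P = 0"
      using less.hyps[of "pderiv P"] coeff_pderiv_mem[OF R(1)] less.prems(1) by blast
    then have "coeff (pderiv P) (degree P - 1) = 0" by simp
    then have "of_nat (degree P) * lead_coeff P = 0" using False by (simp add: coeff_pderiv)
    then have "lead_coeff P = 0" using of_nat_nonzero[of "degree P"] False by auto
    then show ?thesis by simp
  qed (rule const)
qed

lemma derivs_adjoin:
  assumes p: "prime_set p" and D: "D \<in> derivs scale p"
    and DR: "\<And>a. a \<in> R \<Longrightarrow> D a \<in> p" and Dy: "D y \<in> p" and a: "a \<in> adjoin R y"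
  shows "D a \<in> p"
proof -
  interpret prime_set p by (rule p)
  obtain P where P: "a = poly P y" "\<And>i. coeff P i \<in> R" using a by (auto simp: adjoin_def)
  have "D (poly P y) - poly (pderiv P) y * D y \<in> p"
    using P DR by (intro derivs_poly[OF p D]) blast
  then show ?thesis using P cong_mem_iff mult_mem[OF Dy] by blast
qed

text \<open>Since the \<open>D c\<close> preserve \<open>p\<close>, each \<open>y c\<close> is
  transcendental modulo \<open>p\<close> over the ring generated by the previous ones. The last
  clause of the conclusion drives the induction: the next derivation kills the previous
  \<open>y c\<close>, hence all of \<open>R\<close> modulo \<open>p\<close>.\<close>

lemma tower_of_derivations:
  assumes p: "prime_set p" and "distinct cs"
    and D: "\<And>c. c \<in> set cs \<Longrightarrow> D c \<in> derivs scale p" "\<And>c a. c \<in> set cs \<Longrightarrow> a \<in> p \<Longrightarrow> D c a \<in> p"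
    "\<And>c. c \<in> set cs \<Longrightarrow> D c (y c) \<notin> p"
    "\<And>c c'. c \<in> set cs \<Longrightarrow> c' \<in> set cs \<Longrightarrow> c \<noteq> c' \<Longrightarrow> D c (y c') \<in> p"
  shows "\<exists>R. tower R (map y cs) \<and> R \<inter> p \<subseteq> {0} \<and>
    (\<forall>E\<in>derivs scale p. (\<forall>c\<in>set cs. E (y c) \<in> p) \<longrightarrow> (\<forall>a\<in>R. E a \<in> p))"
  using assms(2-)
proof (induction cs rule: rev_induct)
  case Nil
  interpret prime_set p by (rule p)
  have "range (\<lambda>c. scale c 1) \<inter> p \<subseteq> {0}"
  proof
    fix a assume "a \<in> range (\<lambda>c. scale c 1) \<inter> p"
    then obtain c where c: "a = scale c 1" "a \<in> p" by blast
    show "a \<in> {0}"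
    proof (rule ccontr)
      assume "a \<notin> {0}"
      then have "c \<noteq> 0" using c by auto
      then have "scale (inverse c) 1 * a = 1" by (simp add: c scale_mult_left)
      then show False using mult_mem[OF c(2)] one_notin by metis
    qed
  qed
  moreover have "E a \<in> p" if "E \<in> derivs scale p" "a \<in> range (\<lambda>c. scale c 1)" for E a
    using that derivs_scalar by blast
  ultimately show ?case using tower.base by (intro exI[of _ "range (\<lambda>c. scale c 1)"]) simp
next
  case (snoc c cs)
  have "\<exists>R. tower R (map y cs) \<and> R \<inter> p \<subseteq> {0} \<and>
    (\<forall>E\<in>derivs scale p. (\<forall>c\<in>set cs. E (y c) \<in> p) \<longrightarrow> (\<forall>a\<in>R. E a \<in> p))"
    by (rule snoc.IH) (use snoc.prems in auto)
  then obtain R where R: "tower R (map y cs)" "R \<inter> p \<subseteq> {0}"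
    "\<And>E a. E \<in> derivs scale p \<Longrightarrow> (\<forall>c\<in>set cs. E (y c) \<in> p) \<Longrightarrow> a \<in> R \<Longrightarrow> E a \<in> p" by blast
  have "D c (y c') \<in> p" if "c' \<in> set cs" for c'
    using snoc.prems(5)[of c c'] snoc.prems(1) that by auto
  then have DcR: "D c a \<in> p" if "a \<in> R" for a
    using R(3)[of "D c" a] snoc.prems(2)[of c] that by simp
  have c: "c \<in> set (cs @ [c])" by simp
  have "P = 0" if "\<And>i. coeff P i \<in> R" "poly P (y c) \<in> p" for P
    by (rule poly_mem_prime_eq_0[OF p conjunct1[OF tower_subring[OF R(1)]] R(2) snoc.prems(2)[OF c]
        DcR snoc.prems(3)[OF c] snoc.prems(4)[OF c]]) (simp_all add: that)
  from tower_extend[OF R(1) p this]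
  have "tower (adjoin R (y c)) (map y (cs @ [c]))" "adjoin R (y c) \<inter> p \<subseteq> {0}" by simp_all
  moreover have "E a \<in> p" if "E \<in> derivs scale p" "\<forall>c\<in>set (cs @ [c]). E (y c) \<in> p" "a \<in> adjoin R (y c)" for E a
    by (rule derivs_adjoin[OF p that(1) R(3)[OF that(1)] _ that(3)]) (use that in simp_all)
  ultimately show ?case by blast
qed

text \<open>For a polynomial over \<open>R\<close> whose value at \<open>z\<close> lies in the smaller prime, the constant
  coefficient lies in the larger one, hence vanishes; then \<open>z\<close> can be cancelled.\<close>

lemma tower_of_chain:
  assumes "\<And>i. i \<le> e \<Longrightarrow> prime_set (P i)" "\<And>i. i < e \<Longrightarrow> P i \<subset> P (Suc i)"
    "tower R ys" "R \<inter> P e \<subseteq> {0}"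
  shows "\<exists>R' ys'. tower R' ys' \<and> length ys' = length ys + e"
  using assms
proof (induction e arbitrary: R ys)
  case 0
  then show ?case by auto
next
  case (Suc e)
  interpret P: prime_set "P e" using Suc.prems by simp
  interpret Q: prime_set "P (Suc e)" using Suc.prems by simp
  have sub: "P e \<subset> P (Suc e)" using Suc.prems by simp
  then obtain z where z: "z \<in> P (Suc e)" "z \<notin> P e" by blast
  have "H = 0" if "\<And>i. coeff H i \<in> R" "poly H z \<in> P e" for H
    using that
  proof (induction H)
    case (pCons a H)
    have a: "a \<in> R" and H: "coeff H i \<in> R" for i
      using pCons.prems(1)[of 0] pCons.prems(1)[of "Suc i"] by simp_all
    have "a + z * poly H z \<in> P (Suc e)" using pCons.prems(2) sub by auto
    then have "a \<in> P (Suc e)" using Q.diff_mem[OF _ Q.mult_mem_right[OF z(1)], of "a + z * poly H z" "poly H z"] by simp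
    then have "a = 0" using a Suc.prems(4) by blast
    then have "poly H z \<in> P e" using pCons.prems(2) P.prime z(2) by auto
    then show ?case using pCons.IH H \<open>a = 0\<close> by simp
  qed simp
  from tower_extend[OF Suc.prems(3) P.prime_set_axioms this]
  have "tower (adjoin R z) (ys @ [z])" "adjoin R z \<inter> P e \<subseteq> {0}" by auto
  with Suc.IH[of "adjoin R z" "ys @ [z]"] Suc.prems show ?case by simp
qed

end

section \<open>Derivations of a presented algebra\<close>

text \<open>Dual numbers: evaluating a polynomial at \<open>x + \<epsilon> v\<close> with the square
  of \<epsilon> zero gives its value and its derivative in the direction \<open>v\<close>, and the
  product rule becomes multiplicativity of the evaluation.\<close>

datatype 'a dual = Dual (re: 'a) (eps: 'a)

instantiation dual :: (comm_ring_1) comm_ring_1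
begin
definition "0 = Dual 0 0"
definition "1 = Dual 1 0"
definition "u + v = Dual (re u + re v) (eps u + eps v)"
definition "u - v = Dual (re u - re v) (eps u - eps v)"
definition "- u = Dual (- re u) (- eps u)"
definition "u * v = Dual (re u * re v) (re u * eps v + re v * eps u)"
instance
  by intro_classes
    (auto simp: zero_dual_def one_dual_def plus_dual_def minus_dual_def uminus_dual_def times_dual_def
      dual.expand algebra_simps)
end

lemma re_eps_simps [simp]:
  "re (u + v) = re u + re v" "eps (u + v) = eps u + eps v"
  "re (u * v) = re u * re v" "eps (u * v) = re u * eps v + re v * eps u"
  "re (u - v) = re u - re v" "eps (u - v) = eps u - eps v"
  by (simp_all add: plus_dual_def times_dual_def minus_dual_def)

definition mpoly_eval :: "('k::field \<Rightarrow> 'b::comm_ring_1) \<Rightarrow> (nat \<Rightarrow> 'b) \<Rightarrow> ((nat \<Rightarrow>\<^sub>0 nat) \<Rightarrow>\<^sub>0 'k) \<Rightarrow> 'b" where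
  "mpoly_eval \<kappa> y p = (\<Sum>m\<in>Poly_Mapping.keys p. \<kappa> (Poly_Mapping.lookup p m) *
     (\<Prod>i\<in>Poly_Mapping.keys m. y i ^ Poly_Mapping.lookup m i))"

context
  fixes \<kappa> :: "'k::field \<Rightarrow> 'b::comm_ring_1" and y :: "nat \<Rightarrow> 'b"
  assumes \<kappa>: "\<kappa> 0 = 0" "\<kappa> 1 = 1" "\<And>c d. \<kappa> (c + d) = \<kappa> c + \<kappa> d" "\<And>c d. \<kappa> (c * d) = \<kappa> c * \<kappa> d"
begin

private abbreviation (input) mon where
  "mon m \<equiv> (\<Prod>i\<in>Poly_Mapping.keys m. y i ^ Poly_Mapping.lookup m i)"

private lemma mon_superset:
  "finite S \<Longrightarrow> Poly_Mapping.keys m \<subseteq> S \<Longrightarrow> mon m = (\<Prod>i\<in>S. y i ^ Poly_Mapping.lookup m i)"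
  by (rule prod.mono_neutral_left) (auto simp: in_keys_iff)

private lemma mon_add: "mon (m + m') = mon m * mon m'"
proof -
  let ?S = "Poly_Mapping.keys m \<union> Poly_Mapping.keys m'"
  have "Poly_Mapping.keys (m + m') \<subseteq> ?S" by (rule keys_add)
  then have "mon (m + m') = (\<Prod>i\<in>?S. y i ^ Poly_Mapping.lookup (m + m') i)"
    by (intro mon_superset) auto
  also have "\<dots> = (\<Prod>i\<in>?S. y i ^ Poly_Mapping.lookup m i) * (\<Prod>i\<in>?S. y i ^ Poly_Mapping.lookup m' i)"
    by (simp add: lookup_add power_add prod.distrib)
  also have "\<dots> = mon m * mon m'"
    using mon_superset[of ?S m] mon_superset[of ?S m'] by simp
  finally show ?thesis .
qed

private lemma eval_superset:
  "finite S \<Longrightarrow> Poly_Mapping.keys p \<subseteq> S \<Longrightarrow>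
    mpoly_eval \<kappa> y p = (\<Sum>m\<in>S. \<kappa> (Poly_Mapping.lookup p m) * mon m)"
  unfolding mpoly_eval_def by (rule sum.mono_neutral_left) (auto simp: in_keys_iff \<kappa>)

lemma mpoly_eval_add: "mpoly_eval \<kappa> y (p + q) = mpoly_eval \<kappa> y p + mpoly_eval \<kappa> y q"
proof -
  let ?S = "Poly_Mapping.keys p \<union> Poly_Mapping.keys q"
  have "Poly_Mapping.keys (p + q) \<subseteq> ?S" by (rule keys_add)
  then have "mpoly_eval \<kappa> y (p + q) = (\<Sum>m\<in>?S. \<kappa> (Poly_Mapping.lookup (p + q) m) * mon m)"
    by (intro eval_superset) auto
  also have "\<dots> = (\<Sum>m\<in>?S. \<kappa> (Poly_Mapping.lookup p m) * mon m) + (\<Sum>m\<in>?S. \<kappa> (Poly_Mapping.lookup q m) * mon m)"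
    by (simp add: lookup_add \<kappa> distrib_right sum.distrib)
  also have "\<dots> = mpoly_eval \<kappa> y p + mpoly_eval \<kappa> y q"
    using eval_superset[of ?S p] eval_superset[of ?S q] by simp
  finally show ?thesis .
qed

lemma mpoly_eval_single: "mpoly_eval \<kappa> y (Poly_Mapping.single m c) = \<kappa> c * mon m"
  by (subst eval_superset[of "{m}"]) auto

lemma mpoly_eval_mult: "mpoly_eval \<kappa> y (p * q) = mpoly_eval \<kappa> y p * mpoly_eval \<kappa> y q"
proof (induction p rule: update_induct)
  case const
  then show ?case by (simp add: mpoly_eval_def)
next
  case (update f v b)
  have "mpoly_eval \<kappa> y (Poly_Mapping.single v b * q) = mpoly_eval \<kappa> y (Poly_Mapping.single v b) * mpoly_eval \<kappa> y q"
  proof (induction q rule: update_induct)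
    case const
    then show ?case by (simp add: mpoly_eval_def)
  next
    case (update g w c)
    then show ?case
      by (simp add: update_eq_add distrib_left mpoly_eval_add mult_single mpoly_eval_single mon_add \<kappa> algebra_simps)
  qed
  with update show ?case
    by (simp add: update_eq_add distrib_right mpoly_eval_add)
qed

lemma mpoly_eval_pconst: "mpoly_eval \<kappa> y (pconst c) = \<kappa> c"
  by (simp add: pconst_def mpoly_eval_single)

lemma mpoly_eval_pvar: "mpoly_eval \<kappa> y (pvar i) = y i"
  by (simp add: pvar_def mpoly_eval_single \<kappa>)

end

lemma mpoly_carrier_simps:
  "pconst c \<in> carrier (mpoly_ring n)" "i < n \<Longrightarrow> pvar i \<in> carrier (mpoly_ring n)"
  "p \<in> carrier (mpoly_ring n) \<Longrightarrow> q \<in> carrier (mpoly_ring n) \<Longrightarrow> p + q \<in> carrier (mpoly_ring n)"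
  "p \<in> carrier (mpoly_ring n) \<Longrightarrow> q \<in> carrier (mpoly_ring n) \<Longrightarrow> p - q \<in> carrier (mpoly_ring n)"
  "p \<in> carrier (mpoly_ring n) \<Longrightarrow> q \<in> carrier (mpoly_ring n) \<Longrightarrow> p * q \<in> carrier (mpoly_ring n)"
proof -
  show "pconst c \<in> carrier (mpoly_ring n)" by (simp add: pconst_def mpoly_ring_def)
  show "i < n \<Longrightarrow> pvar i \<in> carrier (mpoly_ring n)" by (simp add: pvar_def mpoly_ring_def)
  assume pq: "p \<in> carrier (mpoly_ring n)" "q \<in> carrier (mpoly_ring n)"
  show "p + q \<in> carrier (mpoly_ring n)"
    using pq keys_add[of p q] by (auto simp: mpoly_ring_def)
  show "p - q \<in> carrier (mpoly_ring n)"
    using pq keys_diff[of p q] by (auto simp: mpoly_ring_def)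
  show "p * q \<in> carrier (mpoly_ring n)"
  proof -
    have "Poly_Mapping.keys m \<subseteq> {..<n}" if m: "m \<in> Poly_Mapping.keys (p * q)" for m
    proof -
      obtain a b where ab: "m = a + b" "a \<in> Poly_Mapping.keys p" "b \<in> Poly_Mapping.keys q"
        using m keys_mult[of p q] by blast
      then have "Poly_Mapping.keys a \<subseteq> {..<n}" "Poly_Mapping.keys b \<subseteq> {..<n}"
        using pq by (auto simp: mpoly_ring_def)
      then show ?thesis using keys_add[of a b] ab(1) by blast
    qed
    then show ?thesis by (simp add: mpoly_ring_def)
  qed
qed

lemma mpoly_ring_induct [consumes 1, case_names pconst pvar add mult]:
  fixes p :: "(nat \<Rightarrow>\<^sub>0 nat) \<Rightarrow>\<^sub>0 'k::field"
  assumes p: "p \<in> carrier (mpoly_ring n)"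
    and const: "\<And>c. Q (pconst c)" and var: "\<And>i. i < n \<Longrightarrow> Q (pvar i)"
    and add: "\<And>a b. a \<in> carrier (mpoly_ring n) \<Longrightarrow> b \<in> carrier (mpoly_ring n) \<Longrightarrow> Q a \<Longrightarrow> Q b \<Longrightarrow> Q (a + b)"
    and mult: "\<And>a b. a \<in> carrier (mpoly_ring n) \<Longrightarrow> b \<in> carrier (mpoly_ring n) \<Longrightarrow> Q a \<Longrightarrow> Q b \<Longrightarrow> Q (a * b)"
  shows "Q p"
proof -
  let ?C = "carrier (mpoly_ring n :: ((nat \<Rightarrow>\<^sub>0 nat) \<Rightarrow>\<^sub>0 'k) ring)"
  have pow: "Poly_Mapping.single (Poly_Mapping.single i a) 1 \<in> ?C \<and> Q (Poly_Mapping.single (Poly_Mapping.single i a) 1)"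
    if i: "i < n" for i a
  proof (induction a)
    case 0
    then show ?case using const[of 1] mpoly_carrier_simps(1)[of 1] by (simp add: pconst_def)
  next
    case (Suc a)
    have "Poly_Mapping.single i (Suc a) = Poly_Mapping.single i 1 + Poly_Mapping.single i a"
      by (simp add: single_add[symmetric])
    then have "Poly_Mapping.single (Poly_Mapping.single i (Suc a)) (1::'k)
        = pvar i * Poly_Mapping.single (Poly_Mapping.single i a) 1"
      by (simp add: pvar_def mult_single)
    then show ?case
      using Suc mult[OF _ _ var[OF i]] i by (simp add: mpoly_carrier_simps)
  qed
  have mono: "Poly_Mapping.keys m \<subseteq> {..<n} \<Longrightarrow> Poly_Mapping.single m 1 \<in> ?C \<and> Q (Poly_Mapping.single m 1)" for m
  proof (induction m rule: update_induct)
    case const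
    then show ?case using assms(2)[of 1] mpoly_carrier_simps(1)[of 1] by (simp add: pconst_def)
  next
    case (update f i a)
    have keys: "Poly_Mapping.keys (Poly_Mapping.update i a f) = insert i (Poly_Mapping.keys f)"
      using update by (auto simp: keys_update)
    have "Poly_Mapping.single (Poly_Mapping.update i a f) (1::'k)
        = Poly_Mapping.single (Poly_Mapping.single i a) 1 * Poly_Mapping.single f 1"
      using update by (simp add: update_eq_add mult_single)
    moreover have "i < n" "Poly_Mapping.keys f \<subseteq> {..<n}" using update.prems unfolding keys by auto
    ultimately show ?case using pow[of i a] update.IH mult by (simp add: mpoly_carrier_simps)
  qed
  have "p \<in> ?C \<Longrightarrow> Q p" for p
  proof (induction p rule: update_induct)
    case const
    then show ?case using assms(2)[of 0] by (simp add: pconst_def)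
  next
    case (update f m c)
    have keys: "Poly_Mapping.keys (Poly_Mapping.update m c f) = insert m (Poly_Mapping.keys f)"
      using update by (auto simp: keys_update)
    then have f: "f \<in> ?C" and m: "Poly_Mapping.keys m \<subseteq> {..<n}"
      using update.prems by (auto simp: mpoly_ring_def)
    have eq: "Poly_Mapping.update m c f = pconst c * Poly_Mapping.single m 1 + f"
      using update by (simp add: update_eq_add pconst_def mult_single)
    note s = mono[OF m, THEN conjunct1] mono[OF m, THEN conjunct2]
    show ?case
      unfolding eq
      by (rule add[OF mpoly_carrier_simps(5)[OF mpoly_carrier_simps(1) s(1)] f
          mult[OF mpoly_carrier_simps(1) s(1) const s(2)] update.IH[OF f]])
  qed
  with p show ?thesis by blast
qed

section \<open>Gradients of relations and the Jacobian description of derivations\<close>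

context ess_finite_algebra
begin

definition dual_eval :: "(nat \<Rightarrow> 'a) \<Rightarrow> ((nat \<Rightarrow>\<^sub>0 nat) \<Rightarrow>\<^sub>0 'k) \<Rightarrow> 'a dual" where
  "dual_eval v = mpoly_eval (\<lambda>c. Dual (scale c 1) 0) (\<lambda>i. Dual (x i) (v i))"

definition value_at :: "((nat \<Rightarrow>\<^sub>0 nat) \<Rightarrow>\<^sub>0 'k) \<Rightarrow> 'a" where
  "value_at p = re (dual_eval (\<lambda>_. 0) p)"

text \<open>The partial derivative of \<open>p\<close> by the variable number \<open>i\<close>,
  evaluated at \<open>x\<close>.\<close>

definition grad :: "((nat \<Rightarrow>\<^sub>0 nat) \<Rightarrow>\<^sub>0 'k) \<Rightarrow> nat \<Rightarrow> 'a" where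
  "grad p i = eps (dual_eval (\<lambda>j. if j = i then 1 else 0) p)"

lemma dual_eval_simps:
  "dual_eval v (p + q) = dual_eval v p + dual_eval v q"
  "dual_eval v (p * q) = dual_eval v p * dual_eval v q"
  "dual_eval v (pconst c) = Dual (scale c 1) 0"
  "dual_eval v (pvar i) = Dual (x i) (v i)"
proof -
  have \<kappa>: "Dual (scale 0 1) 0 = (0 :: 'a dual)" "Dual (scale 1 1) 0 = (1 :: 'a dual)"
    "Dual (scale (c + d) 1) 0 = Dual (scale c 1) 0 + (Dual (scale d 1) 0 :: 'a dual)"
    "Dual (scale (c * d) 1) 0 = Dual (scale c 1) 0 * (Dual (scale d 1) 0 :: 'a dual)" for c d
    by (simp_all add: zero_dual_def one_dual_def plus_dual_def times_dual_def scale_left_distrib scale_mult_left)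
  show "dual_eval v (p + q) = dual_eval v p + dual_eval v q"
    "dual_eval v (p * q) = dual_eval v p * dual_eval v q"
    "dual_eval v (pconst c) = Dual (scale c 1) 0"
    "dual_eval v (pvar i) = Dual (x i) (v i)"
    unfolding dual_eval_def
    by (rule mpoly_eval_add[OF \<kappa>], rule mpoly_eval_mult[OF \<kappa>], rule mpoly_eval_pconst[OF \<kappa>],
        rule mpoly_eval_pvar[OF \<kappa>])
qed

lemma dual_eval_diff: "dual_eval v (p - q) = dual_eval v p - dual_eval v q"
  using dual_eval_simps(1)[of v "p - q" q] by (simp add: algebra_simps)

lemma value_at_simps:
  "value_at (p + q) = value_at p + value_at q" "value_at (p - q) = value_at p - value_at q"
  "value_at (p * q) = value_at p * value_at q"
  "value_at (pconst c) = scale c 1" "value_at (pvar i) = x i"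
  by (simp_all add: value_at_def dual_eval_simps dual_eval_diff)

lemma re_dual_eval: "p \<in> carrier (mpoly_ring n) \<Longrightarrow> re (dual_eval v p) = value_at p"
  by (induction p rule: mpoly_ring_induct) (simp_all add: dual_eval_simps value_at_simps)

lemma eps_dual_eval: "p \<in> carrier (mpoly_ring n) \<Longrightarrow> eps (dual_eval v p) = (\<Sum>i<n. v i * grad p i)"
proof (induction p rule: mpoly_ring_induct)
  case (pvar j)
  have "(\<Sum>i<n. v i * grad (pvar j) i) = (\<Sum>i<n. if i = j then v i else 0)"
    by (intro sum.cong) (simp_all add: grad_def dual_eval_simps)
  then show ?case using pvar by (simp add: dual_eval_simps)
next
  case (mult p q)
  have "grad (p * q) i = value_at p * grad q i + value_at q * grad p i" for i
    using mult by (simp add: grad_def dual_eval_simps re_dual_eval)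
  then show ?case
    using mult by (simp add: dual_eval_simps re_dual_eval distrib_left sum.distrib sum_distrib_left mult.left_commute)
next
  case (add p q)
  have "grad (p + q) i = grad p i + grad q i" for i by (simp add: grad_def dual_eval_simps)
  then show ?case using add by (simp add: dual_eval_simps distrib_left sum.distrib)
qed (simp add: dual_eval_simps grad_def)

lemma derivs_value_at:
  assumes D: "D \<in> derivs scale {0}" and p: "p \<in> carrier (mpoly_ring n)"
  shows "D (value_at p) = eps (dual_eval (\<lambda>i. D (x i)) p)"
  using p by (induction p rule: mpoly_ring_induct)
    (use D in \<open>simp_all add: dual_eval_simps value_at_simps exact_derivs_iff re_dual_eval\<close>)

lemma value_at_surj:
  "\<exists>p\<in>carrier (mpoly_ring n). \<exists>s\<in>carrier (mpoly_ring n). \<exists>t. a * value_at s = value_at p \<and> value_at s * t = 1"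
proof -
  have gen: "\<exists>p\<in>carrier (mpoly_ring n). b = value_at p" if "b \<in> generated_by (x ` {..<n})" for b
    using that
  proof induction
    case (scalar c)
    then show ?case by (intro bexI[of _ "pconst c"]) (simp_all add: value_at_simps mpoly_carrier_simps)
  next
    case (gen a)
    then obtain i where "i < n" "a = x i" by blast
    then show ?case by (intro bexI[of _ "pvar i"]) (simp_all add: value_at_simps mpoly_carrier_simps)
  next
    case (add a b)
    then obtain p q where "p \<in> carrier (mpoly_ring n)" "q \<in> carrier (mpoly_ring n)" "a = value_at p" "b = value_at q"
      by blast
    then show ?case by (intro bexI[of _ "p + q"]) (simp_all add: value_at_simps mpoly_carrier_simps)
  next
    case (mult a b)
    then obtain p q where "p \<in> carrier (mpoly_ring n)" "q \<in> carrier (mpoly_ring n)" "a = value_at p" "b = value_at q"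
      by blast
    then show ?case by (intro bexI[of _ "p * q"]) (simp_all add: value_at_simps mpoly_carrier_simps)
  qed
  obtain s where "s \<in> generated_by (x ` {..<n})" "a * s \<in> generated_by (x ` {..<n})" "s dvd 1"
    using ess by blast
  with gen[of s] gen[of "a * s"] show ?thesis by (metis dvdE)
qed

text \<open>Orthogonality to the gradients of all relations makes the derivative in the direction
  \<open>v\<close> well defined modulo \<open>q\<close> on polynomials in the \<open>x i\<close>,
  and the quotient rule extends it to \<A>.\<close>

lemma derivs_of_vector:
  assumes q: "prime_set q"
    and v: "\<And>p. p \<in> carrier (mpoly_ring n) \<Longrightarrow> value_at p = 0 \<Longrightarrow> (\<Sum>i<n. v i * grad p i) \<in> q"
  shows "\<exists>D\<in>derivs scale q. \<forall>i<n. D (x i) - v i \<in> q"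
proof -
  interpret prime_set q by (rule q)
  let ?C = "carrier (mpoly_ring n)"
  define \<delta> where "\<delta> = (\<lambda>p. eps (dual_eval v p))"
  obtain P S T where rep: "\<And>a. P a \<in> ?C" "\<And>a. S a \<in> ?C" "\<And>a. a * value_at (S a) = value_at (P a)"
    "\<And>a. value_at (S a) * T a = 1"
    using value_at_surj by metis
  \<comment> \<open>The quotient rule for \<open>a\<close> written with numerator
    \<open>value_at (P a)\<close> and denominator \<open>value_at (S a)\<close>, where
    \<open>T a\<close> is the inverse of the denominator.\<close>
  define D where "D = (\<lambda>a. T a * (\<delta> (P a) - a * \<delta> (S a)))"
  have cancel: "b \<in> q" if "s * b \<in> q" "s * t = 1" for s b t
  proof -
    have "t * (s * b) = (s * t) * b" by (simp only: ac_simps)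
    also have "\<dots> = b" using that(2) by simp
    finally show ?thesis using mult_mem[OF that(1), of t] by (simp only:)
  qed
  have val: "value_at (p * r) = value_at p * value_at r" "value_at (p + r) = value_at p + value_at r" for p r
    by (simp_all add: value_at_simps)
  have \<delta>: "\<delta> (p * r) = value_at p * \<delta> r + value_at r * \<delta> p" "\<delta> (p + r) = \<delta> p + \<delta> r"
    if "p \<in> ?C" "r \<in> ?C" for p r
    using that by (simp_all add: \<delta>_def dual_eval_simps re_dual_eval)
  \<comment> \<open>Independence of the fraction: two ways of writing \<open>a\<close> give the
    relation \<open>p * S a - P a * s\<close>, to which the condition on \<open>v\<close>
    applies.\<close>
  have key: "value_at s * D a + a * \<delta> s - \<delta> p \<in> q"
    if ps: "p \<in> ?C" "s \<in> ?C" "a * value_at s = value_at p" for p s a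
  proof (rule cancel[OF _ rep(4)[of a]])
    have C: "p * S a - P a * s \<in> ?C" using ps rep by (intro mpoly_carrier_simps)
    have "value_at (p * S a - P a * s) = 0"
      by (simp add: value_at_simps ps(3)[symmetric] rep(3)[symmetric])
    from v[OF C this] have "\<delta> (p * S a - P a * s) \<in> q"
      by (simp add: \<delta>_def eps_dual_eval[OF C])
    also have "\<delta> (p * S a - P a * s) = \<delta> (p * S a) - \<delta> (P a * s)"
      by (simp add: \<delta>_def dual_eval_diff)
    also have "\<dots> = - (value_at s * (\<delta> (P a) - a * \<delta> (S a)) + value_at (S a) * (a * \<delta> s - \<delta> p))"
      using ps rep by (simp add: \<delta> ps(3)[symmetric] rep(3)[symmetric] algebra_simps)
    finally have 1: "value_at s * (\<delta> (P a) - a * \<delta> (S a)) + value_at (S a) * (a * \<delta> s - \<delta> p) \<in> q"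
      using uminus_mem by (metis add.inverse_inverse)
    have "value_at (S a) * (value_at s * D a + a * \<delta> s - \<delta> p)
        = value_at s * ((value_at (S a) * T a) * (\<delta> (P a) - a * \<delta> (S a))) + value_at (S a) * (a * \<delta> s - \<delta> p)"
      by (simp add: D_def algebra_simps)
    with 1 show "value_at (S a) * (value_at s * D a + a * \<delta> s - \<delta> p) \<in> q" by (simp only: rep(4) mult_1)
  qed
  have unit: "value_at (S a) * value_at (S b) * (T a * T b) = 1" for a b
  proof -
    have "value_at (S a) * value_at (S b) * (T a * T b) = (value_at (S a) * T a) * (value_at (S b) * T b)"
      by (simp only: ac_simps)
    then show ?thesis by (simp only: rep(4) mult_1)
  qed
  have "D \<in> derivs scale q"
    unfolding derivs_def
  proof (intro CollectI conjI allI)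
    fix a b c
    let ?s = "value_at (S a)" and ?s' = "value_at (S b)"
    have ka: "?s * D a + a * \<delta> (S a) - \<delta> (P a) \<in> q" and kb: "?s' * D b + b * \<delta> (S b) - \<delta> (P b) \<in> q"
      using key rep by blast+
    have "value_at (S a * S b) * D (a + b) + (a + b) * \<delta> (S a * S b) - \<delta> (P a * S b + P b * S a) \<in> q"
      using rep by (intro key mpoly_carrier_simps) (simp_all add: val rep(3)[symmetric] algebra_simps)
    then have "(value_at (S a * S b) * D (a + b) + (a + b) * \<delta> (S a * S b) - \<delta> (P a * S b + P b * S a))
        - (?s' * (?s * D a + a * \<delta> (S a) - \<delta> (P a)) + ?s * (?s' * D b + b * \<delta> (S b) - \<delta> (P b))) \<in> q"
      by (rule diff_mem) (intro add_mem mult_mem ka kb)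
    also have "\<delta> (P a * S b + P b * S a) = a * ?s * \<delta> (S b) + ?s' * \<delta> (P a) + (b * ?s' * \<delta> (S a) + ?s * \<delta> (P b))"
      using rep by (simp add: \<delta> mpoly_carrier_simps rep(3)[symmetric])
    finally have "?s * ?s' * (D (a + b) - (D a + D b)) \<in> q"
      using rep(1,2) by (simp add: \<delta> val algebra_simps)
    then show "D (a + b) - (D a + D b) \<in> q" using unit by (rule cancel)
    have "value_at (S a * S b) * D (a * b) + (a * b) * \<delta> (S a * S b) - \<delta> (P a * P b) \<in> q"
      using rep by (intro key mpoly_carrier_simps) (simp_all add: val rep(3)[symmetric] algebra_simps)
    then have "(value_at (S a * S b) * D (a * b) + (a * b) * \<delta> (S a * S b) - \<delta> (P a * P b))
        - (b * ?s' * (?s * D a + a * \<delta> (S a) - \<delta> (P a)) + a * ?s * (?s' * D b + b * \<delta> (S b) - \<delta> (P b))) \<in> q"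
      by (rule diff_mem) (intro add_mem mult_mem ka kb)
    also have "\<delta> (P a * P b) = a * ?s * \<delta> (P b) + b * ?s' * \<delta> (P a)"
      using rep by (simp add: \<delta> rep(3)[symmetric])
    finally have "?s * ?s' * (D (a * b) - (a * D b + b * D a)) \<in> q"
      using rep(1,2) by (simp add: \<delta> val algebra_simps)
    then show "D (a * b) - (a * D b + b * D a) \<in> q" using unit by (rule cancel)
    have "value_at (pconst 1) * D (scale c 1) + scale c 1 * \<delta> (pconst 1) - \<delta> (pconst c) \<in> q"
      by (intro key mpoly_carrier_simps) (simp add: value_at_simps)
    then show "D (scale c 1) \<in> q" by (simp add: \<delta>_def dual_eval_simps value_at_simps)
  qed
  moreover have "D (x i) - v i \<in> q" if "i < n" for i
  proof -
    have "value_at (pconst 1) * D (x i) + x i * \<delta> (pconst 1) - \<delta> (pvar i) \<in> q"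
      using that by (intro key mpoly_carrier_simps) (simp_all add: value_at_simps)
    then show ?thesis by (simp add: \<delta>_def dual_eval_simps value_at_simps)
  qed
  ultimately show ?thesis by blast
qed

end

section \<open>A regular domain has no stable ideal\<close>

text \<open>Zorn's lemma gives a maximal proper stable ideal. In characteristic zero radicals of
  stable ideals are stable, so it is radical; then its quotient by any single element is stable too,
  and maximality makes it prime.\<close>

lemma (in ess_finite_algebra) stable_prime_of_stable_ideal:
  assumes J: "0 \<in> J" "\<And>a b. a \<in> J \<Longrightarrow> b \<in> J \<Longrightarrow> a + b \<in> J" "\<And>r a. a \<in> J \<Longrightarrow> r * a \<in> J" "1 \<notin> J"
    and stable: "\<And>D a. D \<in> derivs scale {0} \<Longrightarrow> a \<in> J \<Longrightarrow> D a \<in> J"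
  shows "\<exists>p. J \<subseteq> p \<and> prime_set p \<and> (\<forall>D\<in>derivs scale {0}. \<forall>a\<in>p. D a \<in> p)"
proof -
  define good where "good = (\<lambda>I. (0::'a) \<in> I \<and> (\<forall>a\<in>I. \<forall>b\<in>I. a + b \<in> I) \<and> (\<forall>a\<in>I. \<forall>r. r * a \<in> I) \<and>
    (\<forall>a\<in>I. \<forall>D\<in>derivs scale {0}. D a \<in> I))"
  define \<S> where "\<S> = {I. good I \<and> J \<subseteq> I \<and> 1 \<notin> I}"
  have JS: "J \<in> \<S>"
    unfolding \<S>_def good_def by (intro CollectI conjI ballI allI) (simp_all add: J stable)
  have "\<exists>p\<in>\<S>. \<forall>X\<in>\<S>. p \<subseteq> X \<longrightarrow> X = p"
  proof (rule subset_Zorn_nonempty)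
    show "\<S> \<noteq> {}" using JS by blast
    fix \<C> assume C: "\<C> \<noteq> {}" "subset.chain \<S> \<C>"
    have CS: "\<C> \<subseteq> \<S>" using C(2) unfolding subset_chain_def by blast
    have dir: "\<exists>Z\<in>\<C>. X \<subseteq> Z \<and> Y \<subseteq> Z" if "X \<in> \<C>" "Y \<in> \<C>" for X Y
    proof -
      have "X \<subseteq> Y \<or> Y \<subseteq> X" using C(2) that unfolding subset_chain_def by blast
      then show ?thesis using that by blast
    qed
    have "good (\<Union>\<C>)"
      unfolding good_def
    proof (intro conjI ballI allI)
      obtain X where "X \<in> \<C>" using C(1) by blast
      then show "0 \<in> \<Union>\<C>" using CS unfolding \<S>_def good_def by blast
      fix a assume "a \<in> \<Union>\<C>"
      then obtain X where X: "X \<in> \<C>" "a \<in> X" by blast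
      then have gX: "good X" using CS unfolding \<S>_def by blast
      show "r * a \<in> \<Union>\<C>" for r using gX X unfolding good_def by blast
      show "D a \<in> \<Union>\<C>" if "D \<in> derivs scale {0}" for D using gX X that unfolding good_def by blast
      fix b assume "b \<in> \<Union>\<C>"
      then obtain Y where Y: "Y \<in> \<C>" "b \<in> Y" by blast
      obtain Z where Z: "Z \<in> \<C>" "X \<subseteq> Z" "Y \<subseteq> Z" using dir X Y by blast
      then have "good Z" using CS unfolding \<S>_def by blast
      moreover have "a \<in> Z" "b \<in> Z" using X Y Z by auto
      ultimately show "a + b \<in> \<Union>\<C>" using Z(1) unfolding good_def by blast
    qed
    moreover obtain X where "X \<in> \<C>" using C(1) by blast
    then have "J \<subseteq> \<Union>\<C>" using CS unfolding \<S>_def by blast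
    moreover have "1 \<notin> \<Union>\<C>" using CS unfolding \<S>_def by blast
    ultimately show "\<Union>\<C> \<in> \<S>" unfolding \<S>_def by blast
  qed
  then obtain p where p: "p \<in> \<S>" "\<And>X. X \<in> \<S> \<Longrightarrow> p \<subseteq> X \<Longrightarrow> X = p" by blast
  have zero: "0 \<in> p" and add: "\<And>a b. a \<in> p \<Longrightarrow> b \<in> p \<Longrightarrow> a + b \<in> p" and mult: "\<And>r a. a \<in> p \<Longrightarrow> r * a \<in> p"
    and D: "\<And>D a. D \<in> derivs scale {0} \<Longrightarrow> a \<in> p \<Longrightarrow> D a \<in> p" and Jp: "J \<subseteq> p" and one: "1 \<notin> p"
    using p(1) unfolding \<S>_def good_def by blast+
  have minus: "a - b \<in> p" if "a \<in> p" "b \<in> p" for a b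
    using add[OF that(1) mult[OF that(2), of "-1"]] by simp
  have nat_cancel: "b \<in> p" if "of_nat m * b \<in> p" "m > 0" for m :: nat and b
  proof -
    have "scale (inverse (of_nat m)) 1 * (of_nat m * b) = scale (inverse (of_nat m)) (scale (of_nat m) 1 * b)"
      unfolding of_nat_scale[of m] by (simp add: scale_mult_left)
    also have "\<dots> = b" using that(2) by (simp add: scale_mult_left)
    finally have "scale (inverse (of_nat m)) 1 * (of_nat m * b) = b" .
    then show ?thesis using mult[OF that(1), of "scale (inverse (of_nat m)) 1"] by (simp only:)
  qed
  have Dpow: "E (f ^ m) = of_nat m * (f ^ (m - 1) * E f)" if E: "E \<in> derivs scale {0}" for E f m
  proof (induction m)
    case 0
    have "E (scale 1 1) = 0" using E by (simp only: exact_derivs_iff)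
    then show ?case by simp
  next
    case (Suc m)
    have "E (f * f ^ m) = f * E (f ^ m) + f ^ m * E f" using E by (simp only: exact_derivs_iff)
    then show ?case using Suc by (cases m) (simp_all add: algebra_simps)
  qed
  \<comment> \<open>Applying \<open>E\<close> to a member and multiplying by \<open>E f\<close>
    trades one factor \<open>f\<close> for two factors \<open>E f\<close>, up to a nonzero integer
    and a multiple of the member itself. At \<open>j = m\<close> only a power of \<open>E f\<close>
    is left.\<close>
  have pow_stable: "f ^ (m - j) * E f ^ (2 * j) \<in> p"
    if E: "E \<in> derivs scale {0}" and f: "f ^ m \<in> p" and "j \<le> m" for E f m j
    using \<open>j \<le> m\<close>
  proof (induction j)
    case 0
    then show ?case using f by simp
  next
    case (Suc j)
    define k l where "k = m - Suc j" and "l = 2 * j"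
    have mk: "m - j = Suc k" using Suc.prems by (simp add: k_def)
    have IH: "f ^ Suc k * E f ^ l \<in> p" using Suc mk by (simp add: l_def)
    have "E (f ^ Suc k * E f ^ l) = f ^ Suc k * E (E f ^ l) + E f ^ l * E (f ^ Suc k)"
      using E by (simp only: exact_derivs_iff)
    also have "\<dots> = f ^ Suc k * (of_nat l * (E f ^ (l - 1) * E (E f))) + E f ^ l * (of_nat (Suc k) * (f ^ k * E f))"
      by (simp only: Dpow[OF E]) simp
    finally have "E f * E (f ^ Suc k * E f ^ l)
        = E f * (f ^ Suc k * (of_nat l * (E f ^ (l - 1) * E (E f)))) + of_nat (Suc k) * (f ^ k * (E f ^ Suc (Suc l)))"
      by (simp add: algebra_simps)
    moreover have "E f * (f ^ Suc k * (of_nat l * (E f ^ (l - 1) * E (E f)))) = of_nat l * E (E f) * (f ^ Suc k * E f ^ l)"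
      by (cases l) (simp_all add: algebra_simps)
    moreover have "E f * E (f ^ Suc k * E f ^ l) \<in> p" using mult[OF D[OF E IH]] .
    ultimately have "E f * E (f ^ Suc k * E f ^ l) - of_nat l * E (E f) * (f ^ Suc k * E f ^ l) \<in> p"
      "E f * E (f ^ Suc k * E f ^ l) - of_nat l * E (E f) * (f ^ Suc k * E f ^ l)
        = of_nat (Suc k) * (f ^ k * (E f ^ Suc (Suc l)))"
      using minus[OF _ mult[OF IH]] by (blast, simp only: add_diff_cancel_left')
    then have "of_nat (Suc k) * (f ^ k * (E f ^ Suc (Suc l))) \<in> p" by (simp only:)
    then have "f ^ k * (E f ^ Suc (Suc l)) \<in> p" by (rule nat_cancel) simp
    then show ?case by (simp add: k_def l_def)
  qed
  have radical: "f \<in> p" if f: "f ^ m \<in> p" for f m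
  proof -
    define X where "X = {g. \<exists>m. g ^ m \<in> p}"
    have pow_mono: "g ^ (m + k) \<in> p" if "g ^ m \<in> p" for g m k
      using mult[OF that, of "g ^ k"] by (simp add: power_add mult.commute)
    have "X \<in> \<S>"
      unfolding \<S>_def good_def
    proof (intro CollectI conjI ballI allI)
      show "0 \<in> X" using zero unfolding X_def by (intro CollectI exI[of _ 1]) simp
      fix a assume "a \<in> X"
      then obtain k where a: "a ^ k \<in> p" by (auto simp: X_def)
      show "r * a \<in> X" for r
        unfolding X_def using mult[OF a, of "r ^ k"] by (auto simp: power_mult_distrib)
      show "E a \<in> X" if "E \<in> derivs scale {0}" for E
        unfolding X_def using pow_stable[OF that a, of k] by auto
      fix b assume "b \<in> X"
      then obtain l where b: "b ^ l \<in> p" by (auto simp: X_def)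
      have sum_mem: "sum h I \<in> p" if "\<And>i. i \<in> I \<Longrightarrow> h i \<in> p" for h and I :: "nat set"
        using that by (induction I rule: infinite_finite_induct) (auto intro: zero add)
      have "(a + b) ^ (k + l) \<in> p"
        unfolding binomial_ring
      proof (rule sum_mem)
        fix i assume "i \<in> {..k + l}"
        show "of_nat (k + l choose i) * a ^ i * b ^ (k + l - i) \<in> p"
        proof (cases "k \<le> i")
          case True
          then have "a ^ i \<in> p" using pow_mono[OF a, of "i - k"] by simp
          then have "of_nat (k + l choose i) * b ^ (k + l - i) * a ^ i \<in> p" by (rule mult)
          then show ?thesis by (simp add: ac_simps)
        next
          case False
          then have "b ^ (k + l - i) \<in> p" using pow_mono[OF b, of "k - i"] by (simp add: add.commute)
          then show ?thesis by (rule mult)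
        qed
      qed
      then show "a + b \<in> X" by (auto simp: X_def)
    next
      have "p \<subseteq> X" unfolding X_def by (intro subsetI CollectI exI[of _ 1]) simp
      then show "J \<subseteq> X" using Jp by blast
      show "1 \<notin> X" using one by (simp add: X_def)
    qed
    moreover have "p \<subseteq> X" unfolding X_def by (intro subsetI CollectI exI[of _ 1]) simp
    ultimately have "X = p" by (rule p(2))
    then show ?thesis using f by (auto simp: X_def)
  qed
  have "prime_set p"
  proof
    fix a b assume ab: "a * b \<in> p"
    show "a \<in> p \<or> b \<in> p"
    proof (rule ccontr)
      assume "\<not> (a \<in> p \<or> b \<in> p)"
      then have a: "a \<notin> p" and b: "b \<notin> p" by auto
      \<comment> \<open>The ideal quotient of \<open>p\<close> by \<open>a\<close>. It is stable
        because \<open>(a * E c) ^ 2\<close> lies in \<open>p\<close> and \<open>p\<close> is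
        radical.\<close>
      define X where "X = {c. a * c \<in> p}"
      have "X \<in> \<S>"
        unfolding \<S>_def good_def
      proof (intro CollectI conjI ballI allI)
        show "0 \<in> X" using zero by (simp add: X_def)
        fix c assume "c \<in> X"
        then have c: "a * c \<in> p" by (simp add: X_def)
        show "r * c \<in> X" for r using mult[OF c, of r] by (simp add: X_def mult.left_commute)
        show "c + e \<in> X" if "e \<in> X" for e using add[OF c, of "a * e"] that by (simp add: X_def distrib_left)
        show "E c \<in> X" if E: "E \<in> derivs scale {0}" for E
        proof -
          have "E (a * c) = a * E c + c * E a" using E by (simp only: exact_derivs_iff)
          then have "(a * E c) ^ 2 = a * E c * E (a * c) - (E c * E a) * (a * c)"
            by (simp add: power2_eq_square algebra_simps)
          also have "\<dots> \<in> p" by (rule minus[OF mult[OF D[OF E c]] mult[OF c]])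
          finally show ?thesis unfolding X_def using radical by blast
        qed
      next
        have "p \<subseteq> X" using mult by (auto simp: X_def)
        then show "J \<subseteq> X" using Jp by blast
        show "1 \<notin> X" using a by (simp add: X_def)
      qed
      moreover have "p \<subseteq> X" using mult by (auto simp: X_def)
      ultimately have "X = p" by (rule p(2))
      then show False using ab b by (auto simp: X_def)
    qed
  qed (use zero add mult one in auto)
  then show ?thesis using Jp D by blast
qed

subsection \<open>The local ring\<close>

lemma local_ring_carrier:
  "w \<in> carrier (local_ring_at p) \<longleftrightarrow> (\<exists>a b. b \<notin> p \<and> w = Fract a b)"
  by (auto simp: local_ring_at_def)

lemma local_ring_simps:
  "v \<otimes>\<^bsub>local_ring_at p\<^esub> w = v * w" "v \<oplus>\<^bsub>local_ring_at p\<^esub> w = v + w"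
  "\<one>\<^bsub>local_ring_at p\<^esub> = 1" "\<zero>\<^bsub>local_ring_at p\<^esub> = 0"
  by (simp_all add: local_ring_at_def)

context
  fixes p :: "'a::idom set"
  assumes p: "prime_set p" and cring: "cring (local_ring_at p)"
begin

interpretation p: prime_set p by (rule p)
interpretation R: cring "local_ring_at p" by (rule cring)

lemma to_fract_local: "to_fract a \<in> carrier (local_ring_at p)"
  unfolding local_ring_carrier using p.one_notin by (metis to_fract_def)

lemma inverse_local: "b \<notin> p \<Longrightarrow> inverse (to_fract b) \<in> carrier (local_ring_at p)"
  unfolding local_ring_carrier by (metis divide_inverse Fract_conv_to_fract to_fract_1 mult_1)

lemma nonzero_outside: "b \<notin> p \<Longrightarrow> to_fract b \<noteq> 0"
  using p.zero_mem by auto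

lemma prime_of_local_prime:
  assumes Q: "primeideal Q (local_ring_at p)"
  shows "prime_set {a. to_fract a \<in> Q}" "{a. to_fract a \<in> Q} \<subseteq> p"
    "\<And>w. w \<in> carrier (local_ring_at p) \<Longrightarrow> \<exists>a b. b \<notin> p \<and> to_fract a = w * to_fract b \<and> (w \<in> Q \<longleftrightarrow> to_fract a \<in> Q)"
proof -
  interpret Q: primeideal Q "local_ring_at p" by (rule Q)
  have one: "1 \<notin> Q"
    using Q.one_imp_carrier Q.I_notcarr by (auto simp: local_ring_simps)
  show "prime_set {a. to_fract a \<in> Q}"
  proof
    show "0 \<in> {a. to_fract a \<in> Q}"
      using additive_subgroup.zero_closed[OF Q.additive_subgroup_axioms] by (simp add: local_ring_simps)
    show "a + b \<in> {a. to_fract a \<in> Q}" if "a \<in> {a. to_fract a \<in> Q}" "b \<in> {a. to_fract a \<in> Q}" for a b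
      using additive_subgroup.a_closed[OF Q.additive_subgroup_axioms, of "to_fract a" "to_fract b"] that
      by (simp add: local_ring_simps)
    show "r * a \<in> {a. to_fract a \<in> Q}" if "a \<in> {a. to_fract a \<in> Q}" for r a
      using Q.I_l_closed[of "to_fract a" "to_fract r"] that to_fract_local by (simp add: local_ring_simps)
    show "1 \<notin> {a. to_fract a \<in> Q}" using one by simp
    show "a \<in> {a. to_fract a \<in> Q} \<or> b \<in> {a. to_fract a \<in> Q}" if "a * b \<in> {a. to_fract a \<in> Q}" for a b
      using Q.I_prime[OF to_fract_local to_fract_local, of a b] that by (simp add: local_ring_simps)
  qed
  show "{a. to_fract a \<in> Q} \<subseteq> p"
  proof
    fix a assume a: "a \<in> {a. to_fract a \<in> Q}"
    show "a \<in> p"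
    proof (rule ccontr)
      assume "a \<notin> p"
      then have "inverse (to_fract a) * to_fract a \<in> Q"
        using Q.I_l_closed[of "to_fract a" "inverse (to_fract a)"] a inverse_local by (simp add: local_ring_simps)
      then show False using one nonzero_outside[OF \<open>a \<notin> p\<close>] by simp
    qed
  qed
  fix w assume "w \<in> carrier (local_ring_at p)"
  then obtain a b where b: "b \<notin> p" and w: "w = Fract a b" by (auto simp: local_ring_carrier)
  have b0: "to_fract b \<noteq> 0" by (rule nonzero_outside[OF b])
  have a: "to_fract a = w * to_fract b" "w = inverse (to_fract b) * to_fract a"
    using b0 by (simp_all add: w Fract_conv_to_fract field_simps)
  have "to_fract a \<in> Q" if "w \<in> Q"
    using Q.I_r_closed[OF that to_fract_local, of b] a(1) by (simp add: local_ring_simps)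
  moreover have "w \<in> Q" if "to_fract a \<in> Q"
    using Q.I_l_closed[OF that inverse_local[OF b]] a(2) by (simp add: local_ring_simps)
  ultimately show "\<exists>a b. b \<notin> p \<and> to_fract a = w * to_fract b \<and> (w \<in> Q \<longleftrightarrow> to_fract a \<in> Q)"
    using b a(1) by blast
qed

text \<open>Primes of the local ring are determined by their contractions to \<A>, so a strict chain
  stays strict after contraction.\<close>

lemma chain_of_krull_dim:
  assumes e: "krull_dim (local_ring_at p) = enat e" and M: "primeideal M (local_ring_at p)"
  obtains P where "\<And>i. i \<le> e \<Longrightarrow> prime_set (P i)" "\<And>i. i < e \<Longrightarrow> P i \<subset> P (Suc i)" "P e \<subseteq> p"
proof -
  define S where "S = {k. \<exists>P :: nat \<Rightarrow> 'a fract set.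
      (\<forall>i\<le>k. primeideal (P i) (local_ring_at p)) \<and> (\<forall>i<k. P i \<subset> P (Suc i))}"
  \<comment> \<open>The prime \<open>M\<close> is a chain of length 0, so the supremum is taken over
    a nonempty set and, being finite, is attained.\<close>
  have "0 \<in> S" unfolding S_def using M by (intro CollectI exI[of _ "\<lambda>_. M"]) auto
  moreover have SUP: "Sup (enat ` S) = enat e" using e by (simp add: krull_dim_def S_def)
  ultimately have fin: "finite (enat ` S)"
    by (auto simp: Sup_enat_def split: if_splits)
  then have "Max (enat ` S) = enat e" using SUP \<open>0 \<in> S\<close> by (auto simp: Sup_enat_def split: if_splits)
  moreover have "Max (enat ` S) \<in> enat ` S" using fin \<open>0 \<in> S\<close> by (intro Max_in) auto
  ultimately have "e \<in> S" by auto
  then obtain Q :: "nat \<Rightarrow> 'a fract set" where Q: "\<And>i. i \<le> e \<Longrightarrow> primeideal (Q i) (local_ring_at p)"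
    "\<And>i. i < e \<Longrightarrow> Q i \<subset> Q (Suc i)" by (auto simp: S_def)
  define P where "P = (\<lambda>i. {a. to_fract a \<in> Q i})"
  have "P i \<subset> P (Suc i)" if i: "i < e" for i
  proof -
    obtain w where w: "w \<in> Q (Suc i)" "w \<notin> Q i" using Q(2)[OF i] by blast
    have "w \<in> carrier (local_ring_at p)"
      using w(1) Q(1)[of "Suc i"] i additive_subgroup.a_subset ideal.axioms(1) primeideal.axioms(1)
      by (metis Suc_leI subsetD)
    moreover have Qi: "primeideal (Q i) (local_ring_at p)" "primeideal (Q (Suc i)) (local_ring_at p)"
      using Q(1)[of i] Q(1)[of "Suc i"] i by auto
    ultimately obtain a b where ab: "b \<notin> p" "to_fract a = w * to_fract b" "to_fract a \<notin> Q i"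
      using prime_of_local_prime(3)[OF Qi(1)] w(2) by blast
    have "to_fract a \<in> Q (Suc i)"
      using ideal.I_r_closed[OF primeideal.axioms(1)[OF Qi(2)] w(1) to_fract_local, of b] ab(2)
      by (simp add: local_ring_simps)
    then show ?thesis using ab(3) Q(2)[OF i] by (auto simp: P_def)
  qed
  moreover have "prime_set (P i)" if "i \<le> e" for i
    unfolding P_def by (rule prime_of_local_prime(1)[OF Q(1)[OF that]])
  moreover have "P e \<subseteq> p" unfolding P_def by (rule prime_of_local_prime(2)[OF Q(1)]) simp
  ultimately show ?thesis using that by blast
qed

lemma local_idealI:
  assumes "N \<subseteq> carrier (local_ring_at p)" "0 \<in> N" "\<And>v w. v \<in> N \<Longrightarrow> w \<in> N \<Longrightarrow> v + w \<in> N"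
    and mult: "\<And>v w. v \<in> carrier (local_ring_at p) \<Longrightarrow> w \<in> N \<Longrightarrow> v * w \<in> N"
  shows "ideal N (local_ring_at p)"
proof (rule idealI[OF R.ring_axioms])
  have "inv\<^bsub>add_monoid (local_ring_at p)\<^esub> w \<in> N" if w: "w \<in> N" for w
  proof -
    have "\<ominus>\<^bsub>local_ring_at p\<^esub> w = (\<ominus>\<^bsub>local_ring_at p\<^esub> \<one>\<^bsub>local_ring_at p\<^esub>) \<otimes>\<^bsub>local_ring_at p\<^esub> w"
      using assms(1) w by (subst R.l_minus) auto
    also have "\<dots> \<in> N" using mult[OF _ w] by (simp add: local_ring_simps(1))
    finally show ?thesis by (simp add: a_inv_def)
  qed
  then show "subgroup N (add_monoid (local_ring_at p))"
    using assms by (intro group.subgroupI[OF R.a_group]) (auto simp: local_ring_simps)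
  show "v \<otimes>\<^bsub>local_ring_at p\<^esub> w \<in> N" "w \<otimes>\<^bsub>local_ring_at p\<^esub> v \<in> N"
    if "w \<in> N" "v \<in> carrier (local_ring_at p)" for v w
    using mult[OF that(2,1)] by (simp_all add: local_ring_simps mult.commute[of w v])
qed

lemma local_fractions_add:
  "b \<notin> p \<Longrightarrow> d \<notin> p \<Longrightarrow> Fract a b + Fract c d = Fract (a * d + c * b) (b * d) \<and> b * d \<notin> p"
proof -
  assume "b \<notin> p" "d \<notin> p"
  moreover from this have "b \<noteq> 0" "d \<noteq> 0" using p.zero_mem by auto
  ultimately show ?thesis using p.prime by (auto simp: mult.commute[of b c])
qed

lemma local_fractions_mult:
  "b \<notin> p \<Longrightarrow> d \<notin> p \<Longrightarrow> Fract a b * Fract c d = Fract (a * c) (b * d) \<and> b * d \<notin> p"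
  using p.prime by auto

lemma ideal_of_fractions:
  assumes X: "0 \<in> X" "\<And>a b. a \<in> X \<Longrightarrow> b \<in> X \<Longrightarrow> a + b \<in> X" "\<And>r a. a \<in> X \<Longrightarrow> r * a \<in> X"
  shows "ideal {Fract a b |a b. a \<in> X \<and> b \<notin> p} (local_ring_at p)"
proof (rule local_idealI)
  show "{Fract a b |a b. a \<in> X \<and> b \<notin> p} \<subseteq> carrier (local_ring_at p)"
    unfolding local_ring_at_def by auto
  have "0 = Fract 0 (1::'a)" by (simp add: Zero_fract_def)
  then show "0 \<in> {Fract a b |a b. a \<in> X \<and> b \<notin> p}" using X(1) p.one_notin by blast
  show "v + w \<in> {Fract a b |a b. a \<in> X \<and> b \<notin> p}"
    if vw: "v \<in> {Fract a b |a b. a \<in> X \<and> b \<notin> p}" "w \<in> {Fract a b |a b. a \<in> X \<and> b \<notin> p}" for v w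
  proof -
    obtain a b c d where *: "v = Fract a b" "a \<in> X" "b \<notin> p" "w = Fract c d" "c \<in> X" "d \<notin> p"
      using vw by blast
    moreover have "a * d + c * b \<in> X" using X(2)[OF X(3)[OF *(2), of d] X(3)[OF *(5), of b]] by (simp add: mult.commute)
    ultimately show ?thesis using local_fractions_add[OF *(3,6)] by blast
  qed
  show "v * w \<in> {Fract a b |a b. a \<in> X \<and> b \<notin> p}"
    if vw: "v \<in> carrier (local_ring_at p)" "w \<in> {Fract a b |a b. a \<in> X \<and> b \<notin> p}" for v w
  proof -
    obtain a b c d where *: "v = Fract a b" "b \<notin> p" "w = Fract c d" "c \<in> X" "d \<notin> p"
      using vw unfolding local_ring_carrier by blast
    then show ?thesis using local_fractions_mult[OF *(2,5)] X(3)[OF *(4), of a] by blast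
  qed
qed

lemma maximal_local:
  assumes M: "maximalideal M (local_ring_at p)"
  shows "M = {Fract a b |a b. a \<in> p \<and> b \<notin> p}" (is "M = ?N")
proof -
  interpret M: maximalideal M "local_ring_at p" by (rule M)
  have Mprime: "primeideal M (local_ring_at p)"
    by (rule R.maximalideal_prime[OF M])
  have sub: "M \<subseteq> ?N"
  proof
    fix w assume "w \<in> M"
    moreover from this have w: "w \<in> carrier (local_ring_at p)"
      using additive_subgroup.a_subset[OF M.additive_subgroup_axioms] by blast
    ultimately obtain a b where ab: "b \<notin> p" "to_fract a = w * to_fract b" "to_fract a \<in> M"
      using prime_of_local_prime(3)[OF Mprime w] by blast
    then have "a \<in> p" using prime_of_local_prime(2)[OF Mprime] by blast
    moreover have "w = Fract a b" using ab nonzero_outside[OF ab(1)] by (simp add: Fract_conv_to_fract)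
    ultimately show "w \<in> ?N" using ab(1) by blast
  qed
  have N: "ideal ?N (local_ring_at p)"
    by (rule ideal_of_fractions) (auto intro: p.zero_mem p.add_mem p.mult_mem)
  have "1 \<notin> ?N"
  proof
    assume "1 \<in> ?N"
    then obtain a b where ab: "1 = Fract a b" "a \<in> p" "b \<notin> p" by blast
    then have "to_fract a = to_fract b"
      using nonzero_outside[OF ab(3)] by (simp add: Fract_conv_to_fract field_simps)
    then show False using ab by simp
  qed
  moreover have "1 \<in> carrier (local_ring_at p)" using R.one_closed by (simp add: local_ring_simps)
  ultimately have "?N \<noteq> carrier (local_ring_at p)" by blast
  moreover have "?N \<subseteq> carrier (local_ring_at p)" unfolding local_ring_at_def by auto
  ultimately show ?thesis using M.I_maximal[OF N sub] by blast
qed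

end

text \<open>\<open>Y\<close> consists of numerators of the generators of the maximal ideal.\<close>

lemma generators_detect_stability:
  assumes p: "prime_set p" and cring: "cring (local_ring_at p)"
    and M: "maximalideal M (local_ring_at p)" and G: "G \<subseteq> carrier (local_ring_at p)" "finite G"
    and MG: "M = Idl\<^bsub>local_ring_at p\<^esub> G"
  obtains Y where "finite Y" "card Y \<le> card G" "Y \<subseteq> p"
    "\<forall>D\<in>derivs scale p. (\<forall>y\<in>Y. D y \<in> p) \<longrightarrow> (\<forall>a\<in>p. D a \<in> p)"
proof -
  interpret p: prime_set p by (rule p)
  interpret R: cring "local_ring_at p" by (rule cring)
  have "G \<subseteq> M" unfolding MG by (rule R.genideal_self[OF G(1)])
  then have "\<forall>g\<in>G. \<exists>a b. g = Fract a b \<and> a \<in> p \<and> b \<notin> p"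
    unfolding maximal_local[OF p cring M] by blast
  then obtain num den where nd: "\<And>g. g \<in> G \<Longrightarrow> g = Fract (num g) (den g) \<and> num g \<in> p \<and> den g \<notin> p"
    by metis
  have "D a \<in> p" if D: "D \<in> derivs scale p" and Y: "\<And>y. y \<in> num ` G \<Longrightarrow> D y \<in> p" and a: "a \<in> p" for D a
  proof -
    \<comment> \<open>On \<open>p\<close> itself \<open>D\<close> is linear over \<A> modulo
      \<open>p\<close>, so these elements form an ideal. Its extension to the local ring contains
      the generators, hence the whole maximal ideal.\<close>
    let ?X = "{a \<in> p. D a \<in> p}"
    have X: "ideal {Fract a b |a b. a \<in> ?X \<and> b \<notin> p} (local_ring_at p)"
    proof (rule ideal_of_fractions[OF p cring])
      show "0 \<in> ?X" using p.zero_mem p.derivs_zero[OF D] by simp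
      show "a + b \<in> ?X" if "a \<in> ?X" "b \<in> ?X" for a b
        using that p.derivs_add_iff[OF D, of a b] by (simp add: p.add_mem)
      show "r * a \<in> ?X" if "a \<in> ?X" for r a
        using that p.derivs_mult_iff[OF D, of r a] by (simp add: p.add_mem p.mult_mem p.mult_mem_right)
    qed
    moreover have "G \<subseteq> {Fract a b |a b. a \<in> ?X \<and> b \<notin> p}"
    proof
      fix g assume "g \<in> G"
      then have "num g \<in> ?X" "den g \<notin> p" "g = Fract (num g) (den g)" using nd[of g] Y by auto
      then show "g \<in> {Fract a b |a b. a \<in> ?X \<and> b \<notin> p}" by blast
    qed
    ultimately have sub: "M \<subseteq> {Fract a b |a b. a \<in> ?X \<and> b \<notin> p}"
      unfolding MG by (rule R.genideal_minimal)
    have "Fract a 1 \<in> M" unfolding maximal_local[OF p cring M] using a p.one_notin by blast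
    then obtain c d where cd: "Fract a 1 = Fract c d" "c \<in> p" "D c \<in> p" "d \<notin> p" using sub by blast
    from cd(4) have "d \<noteq> 0" using p.zero_mem by auto
    then have "a * d = c" using cd(1) by (simp add: eq_fract)
    then have "a * D d + d * D a \<in> p" using cd(3) p.derivs_mult_iff[OF D, of a d] by simp
    then have "d * D a \<in> p" using p.diff_mem[OF _ p.mult_mem_right[OF a, of "D d"]] by fastforce
    then show ?thesis using p.prime cd(4) by blast
  qed
  then have "\<forall>D\<in>derivs scale p. (\<forall>y\<in>num ` G. D y \<in> p) \<longrightarrow> (\<forall>a\<in>p. D a \<in> p)" by blast
  then show ?thesis using that[of "num ` G"] nd G(2) card_image_le[OF G(2), of num] by blast
qed

section \<open>Comparison of ranks at a stable prime\<close>

context ess_finite_algebra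
begin

text \<open>The gradients of the relations span the coordinates outside \<open>T\<close> modulo \<open>p\<close>.\<close>

lemma derivs_determined:
  assumes p: "prime_set p" and T: "T \<subseteq> {..<n}"
    and det: "\<And>E i. E \<in> derivs scale p \<Longrightarrow> (\<And>c. c \<in> T \<Longrightarrow> E (x c) \<in> p) \<Longrightarrow> i < n \<Longrightarrow> E (x i) \<in> p"
  obtains \<Delta> b where "\<Delta> \<notin> p"
    "\<And>D i. D \<in> derivs scale {0} \<Longrightarrow> i < n \<Longrightarrow> i \<notin> T \<Longrightarrow> \<Delta> * D (x i) = (\<Sum>k\<in>T. b i k * D (x k))"
proof -
  interpret prime_set p by (rule p)
  \<comment> \<open>All linear relations that hold exactly between the values \<open>D (x i)\<close>
    of derivations of \<A>. The gradients of the relations of \<A> are among them.\<close>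
  define W where "W = {w :: nat \<Rightarrow> 'a. \<forall>D\<in>derivs scale {0}. (\<Sum>i<n. w i * D (x i)) = 0}"
  let ?C = "{..<n} - T"
  have grad: "grad P \<in> W" if P: "P \<in> carrier (mpoly_ring n)" "value_at P = 0" for P
  proof -
    have "(\<Sum>i<n. grad P i * D (x i)) = 0" if D: "D \<in> derivs scale {0}" for D
    proof -
      have "(\<Sum>i<n. D (x i) * grad P i) = D (value_at P)"
        using derivs_value_at[OF D P(1)] eps_dual_eval[OF P(1)] by simp
      also have "\<dots> = 0" using D P(2) prime_set.derivs_zero[OF zero_prime_set D] by simp
      finally show ?thesis by (simp add: mult.commute)
    qed
    then show ?thesis unfolding W_def by blast
  qed
  have "\<exists>\<Delta> w. \<Delta> \<notin> p \<and> (\<forall>c\<in>?C. w c \<in> W \<and> w c c = \<Delta> \<and> (\<forall>c'\<in>?C. c' \<noteq> c \<longrightarrow> w c c' = 0))"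
  proof (rule elimination)
    show "finite ?C" by simp
    show "(\<lambda>_. 0) \<in> W" by (simp add: W_def)
    show "(\<lambda>i. a * v i + b * w i) \<in> W" if "v \<in> W" "w \<in> W" for v w a b
      using that by (simp add: W_def distrib_right sum.distrib mult.assoc sum_distrib_left[symmetric])
    fix v assume "\<exists>c\<in>?C. v c \<notin> p"
    then obtain c where c: "c \<in> ?C" "v c \<notin> p" by blast
    show "\<exists>w\<in>W. (\<Sum>c\<in>?C. w c * v c) \<notin> p"
    proof (rule ccontr)
      assume "\<not> ?thesis"
      then have W: "(\<Sum>c\<in>?C. w c * v c) \<in> p" if "w \<in> W" for w using that by blast
      \<comment> \<open>A vector orthogonal to \<open>W\<close> modulo \<open>p\<close>, extended by
        zero on \<open>T\<close>, comes from a derivation modulo \<open>p\<close> that vanishes at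
        the coordinates in \<open>T\<close>. By \<open>det\<close> it vanishes at \<open>c\<close>
        too, against the choice of \<open>c\<close>.\<close>
      define v' where "v' = (\<lambda>i. if i \<in> ?C then v i else 0)"
      have "\<exists>D\<in>derivs scale p. \<forall>i<n. D (x i) - v' i \<in> p"
      proof (rule derivs_of_vector[OF p])
        fix P assume P: "P \<in> carrier (mpoly_ring n)" "value_at P = 0"
        have "(\<Sum>i<n. v' i * grad P i) = (\<Sum>i\<in>?C. v' i * grad P i)"
          by (rule sum.mono_neutral_right) (auto simp: v'_def)
        also have "\<dots> = (\<Sum>i\<in>?C. grad P i * v i)"
          by (rule sum.cong) (simp_all add: v'_def mult.commute)
        finally show "(\<Sum>i<n. v' i * grad P i) \<in> p" using W[OF grad[OF P]] by simp
      qed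
      then obtain D where D: "D \<in> derivs scale p" and Dx: "\<And>i. i < n \<Longrightarrow> D (x i) - v' i \<in> p" by blast
      have "D (x k) \<in> p" if "k \<in> T" for k
        using Dx[of k] that T by (auto simp: v'_def)
      from det[OF D this] have "D (x c) \<in> p" using c(1) by simp
      then have "v' c \<in> p" using cong_mem_iff[OF Dx[of c]] c(1) by simp
      then show False using c by (simp add: v'_def)
    qed
  qed
  then obtain \<Delta> w where \<Delta>: "\<Delta> \<notin> p" and w: "\<And>c. c \<in> ?C \<Longrightarrow> w c \<in> W" "\<And>c. c \<in> ?C \<Longrightarrow> w c c = \<Delta>"
    "\<And>c c'. c \<in> ?C \<Longrightarrow> c' \<in> ?C \<Longrightarrow> c' \<noteq> c \<Longrightarrow> w c c' = 0" by blast
  show ?thesis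
  proof (rule that[OF \<Delta>, of "\<lambda>i k. - w i k"])
    fix D i assume D: "D \<in> derivs scale {0}" and i: "i < n" "i \<notin> T"
    then have iC: "i \<in> ?C" by simp
    have "0 = (\<Sum>j<n. w i j * D (x j))" using w(1)[OF iC] D by (simp add: W_def)
    also have "\<dots> = (\<Sum>j\<in>?C. w i j * D (x j)) + (\<Sum>j\<in>T. w i j * D (x j))"
      using T by (intro sum.subset_diff) auto
    also have "(\<Sum>j\<in>?C. w i j * D (x j)) = (\<Sum>j\<in>{i}. w i j * D (x j))"
      using iC w(3)[OF iC] by (intro sum.mono_neutral_right) auto
    also have "\<dots> = \<Delta> * D (x i)" using w(2)[OF iC] by simp
    finally show "\<Delta> * D (x i) = (\<Sum>k\<in>T. - w i k * D (x k))"
      by (simp add: sum_negf eq_neg_iff_add_eq_0)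
  qed
qed

lemma divided_derivation:
  assumes D: "D \<in> derivs scale {0}" and d: "d \<noteq> 0" and x: "\<And>i. i < n \<Longrightarrow> d dvd c * D (x i)"
  obtains E where "E \<in> derivs scale {0}" "\<And>a. c * D a = d * E a"
proof -
  have add: "D (a + b) = D a + D b" and mult: "D (a * b) = a * D b + b * D a" and sc: "D (scale k 1) = 0" for a b k
    using D by (simp_all add: exact_derivs_iff)
  have "d dvd c * D a" for a
  proof (induction a rule: ess_induct)
    case (divide a s t)
    have "d dvd t * (c * D (a * s) - a * (c * D s))"
      by (rule dvd_mult, rule dvd_diff, rule divide(2), rule dvd_mult, rule divide(1))
    also have "t * (c * D (a * s) - a * (c * D s)) = (s * t) * (c * D a)"
      by (simp add: mult algebra_simps)
    finally show ?case by (simp add: divide(3))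
  next
    case (mult a b)
    have "d dvd a * (c * D b) + b * (c * D a)" by (rule dvd_add, rule dvd_mult, rule mult(2), rule dvd_mult, rule mult(1))
    then show ?case by (simp add: \<open>\<And>a b. D (a * b) = a * D b + b * D a\<close> algebra_simps)
  qed (use x in \<open>simp_all add: add sc distrib_left\<close>)
  then obtain E where E: "\<And>a. c * D a = d * E a" unfolding dvd_def by metis
  have "E \<in> derivs scale {0}"
    unfolding exact_derivs_iff
  proof (intro conjI allI)
    fix a b k
    have "d * E (a + b) = d * (E a + E b)" by (simp only: E[symmetric] add distrib_left)
    then show "E (a + b) = E a + E b" by (simp only: mult_left_cancel[OF d])
    have "d * E (a * b) = a * (d * E b) + b * (d * E a)"
      by (simp only: E[symmetric] mult) (simp add: algebra_simps)
    also have "\<dots> = d * (a * E b + b * E a)" by (simp add: algebra_simps)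
    finally show "E (a * b) = a * E b + b * E a" by (simp only: mult_left_cancel[OF d])
    have "d * E (scale k 1) = 0" by (simp only: E[symmetric] sc mult_zero_right)
    then show "E (scale k 1) = 0" using d by simp
  qed
  with E show ?thesis using that by blast
qed

text \<open>Let \<open>s\<close> be the rank modulo \<open>p\<close> of the derivations that
  preserve \<open>p\<close> and \<open>e\<close> the dimension of the local ring. All derivations
  modulo \<open>p\<close> have rank at most \<open>s + e\<close>, as regularity gives
  \<open>e\<close> conditions that detect preservation of \<open>p\<close>; those of \<A> have
  generic rank at least \<open>s + e\<close>, by a tower that climbs through a chain of primes.
  Equality yields derivations of \<A> that are still independent modulo \<open>p\<close>. By
  stability they preserve \<open>p\<close>, so \<open>s + e \<le> s\<close>.\<close>

theorem regular_no_stable_ideal: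
  assumes reg: "regular_domain TYPE('a)"
    and J: "0 \<in> J" "\<And>a b. a \<in> J \<Longrightarrow> b \<in> J \<Longrightarrow> a + b \<in> J" "\<And>r a. a \<in> J \<Longrightarrow> r * a \<in> J"
    and stable: "\<And>D a. D \<in> derivs scale {0} \<Longrightarrow> a \<in> J \<Longrightarrow> D a \<in> J"
    and nz: "a0 \<in> J" "a0 \<noteq> 0"
  shows "1 \<in> J"
proof (rule ccontr)
  assume "1 \<notin> J"
  have "\<exists>p. J \<subseteq> p \<and> prime_set p \<and> (\<forall>D\<in>derivs scale {0}. \<forall>a\<in>p. D a \<in> p)"
    by (rule stable_prime_of_stable_ideal[of J]) (simp_all add: J stable \<open>1 \<notin> J\<close>)
  then obtain p where Jp: "J \<subseteq> p" and p: "prime_set p"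
    and pD: "\<And>D a. D \<in> derivs scale {0} \<Longrightarrow> a \<in> p \<Longrightarrow> D a \<in> p" by blast
  interpret p: prime_set p by (rule p)
  interpret Z: prime_set "{0 :: 'a}" by (rule zero_prime_set)
  have "regular_local_ring (local_ring_at p)"
    using reg prime_set_primeideal[OF p] by (simp add: regular_domain_def)
  then obtain M G where cring: "cring (local_ring_at p)" and M: "maximalideal M (local_ring_at p)"
    and G: "G \<subseteq> carrier (local_ring_at p)" "finite G" "enat (card G) = krull_dim (local_ring_at p)"
    and MG: "M = Idl\<^bsub>local_ring_at p\<^esub> G"
    unfolding regular_local_ring_def by blast
  interpret R: cring "local_ring_at p" by (rule cring)
  define e where "e = card G"
  obtain P where P: "\<And>i. i \<le> e \<Longrightarrow> prime_set (P i)" "\<And>i. i < e \<Longrightarrow> P i \<subset> P (Suc i)" "P e \<subseteq> p"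
    using chain_of_krull_dim[OF p cring G(3)[symmetric] R.maximalideal_prime[OF M]] unfolding e_def by blast
  obtain Y where Y: "finite Y" "card Y \<le> e" "Y \<subseteq> p"
    "\<forall>D\<in>derivs scale p. (\<forall>y\<in>Y. D y \<in> p) \<longrightarrow> (\<forall>a\<in>p. D a \<in> p)"
    by (rule generators_detect_stability[OF p cring M G(1,2) MG]) (rule that, simp_all add: e_def)
  define M0 where "M0 = {D \<in> derivs scale p. \<forall>a\<in>p. D a \<in> p}"
  have M0_comb: "(\<lambda>b. \<Sum>i\<in>I. a i * D i b) \<in> M0" if "\<And>i. i \<in> I \<Longrightarrow> D i \<in> M0" for I :: "nat set" and a D
  proof -
    have "(\<lambda>b. \<Sum>i\<in>I. a i * D i b) \<in> derivs scale p"
      using that by (intro p.derivs_combination) (auto simp: M0_def)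
    moreover have "(\<Sum>i\<in>I. a i * D i b) \<in> p" if "b \<in> p" for b
      using that \<open>\<And>i. i \<in> I \<Longrightarrow> D i \<in> M0\<close> by (intro p.sum_mem p.mult_mem) (auto simp: M0_def)
    ultimately show ?thesis by (simp add: M0_def)
  qed
  have M0_comb2: "(\<lambda>t. a * D t + b * E t) \<in> M0" if "D \<in> M0" "E \<in> M0" for D E a b
    using that p.derivs_combination2[of D scale E a b] unfolding M0_def
    by (auto intro!: p.add_mem p.mult_mem)
  obtain Cp Dp \<Delta>p where Cp: "Cp \<subseteq> {..<n}" "\<Delta>p \<notin> p" and Dp: "\<And>c. c \<in> Cp \<Longrightarrow> Dp c \<in> M0"
    "\<And>c. c \<in> Cp \<Longrightarrow> Dp c (x c) - \<Delta>p \<in> p" "\<And>c c'. c \<in> Cp \<Longrightarrow> c' \<in> Cp \<Longrightarrow> c \<noteq> c' \<Longrightarrow> Dp c (x c') \<in> p"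
    and Cp_det: "\<forall>E\<in>M0. (\<forall>c\<in>Cp. E (x c) \<in> p) \<longrightarrow> (\<forall>i\<in>{..<n}. E (x i) \<in> p)"
    by (rule p.echelon[of "{..<n}" M0 x, OF _ M0_comb2]) (simp, assumption, assumption, rule that)
  have finCp: "finite Cp" using Cp(1) finite_subset by blast
  have Cp_zero: "E a \<in> p" if "E \<in> M0" "\<And>c. c \<in> Cp \<Longrightarrow> E (x c) \<in> p" for E a
  proof (rule derivs_vanish[OF p, of E])
    show "E \<in> derivs scale p" using that(1) by (simp add: M0_def)
    have "\<forall>i\<in>{..<n}. E (x i) \<in> p" using Cp_det that by simp
    then show "E (x i) \<in> p" if "i < n" for i using that by simp
  qed
  define s where "s = card Cp"
  have Dpdiag: "Dp c (x c) \<notin> p" if "c \<in> Cp" for c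
    using p.cong_mem_iff[OF Dp(2)[OF that]] Cp(2) by blast
  have "\<exists>R. tower R (map x (sorted_list_of_set Cp)) \<and> R \<inter> p \<subseteq> {0} \<and>
    (\<forall>E\<in>derivs scale p. (\<forall>c\<in>set (sorted_list_of_set Cp). E (x c) \<in> p) \<longrightarrow> (\<forall>a\<in>R. E a \<in> p))"
    by (rule tower_of_derivations[OF p, where D = Dp])
      (use Dp Dpdiag finCp in \<open>simp_all add: M0_def\<close>)
  then obtain R where R: "tower R (map x (sorted_list_of_set Cp))" "R \<inter> p \<subseteq> {0}" by blast
  have "R \<inter> P e \<subseteq> {0}" using R(2) P(3) by blast
  from tower_of_chain[OF P(1,2) R(1) this] obtain R' ys where R': "tower R' ys" "length ys = s + e"
    by (auto simp: s_def finCp)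
  obtain F where "\<forall>j<length ys. F j \<in> derivs scale {0} \<and> F j (ys ! j) \<noteq> 0 \<and> (\<forall>i<j. F j (ys ! i) = 0)"
    using tower_derivations[OF R'(1)] by (rule exE)
  then have F: "\<And>j. j < s + e \<Longrightarrow> F j \<in> derivs scale {0}" "\<And>j. j < s + e \<Longrightarrow> F j (ys ! j) \<noteq> 0"
    "\<And>i j. j < s + e \<Longrightarrow> i < j \<Longrightarrow> F j (ys ! i) = 0"
    unfolding R'(2) by simp_all
  obtain T E \<Delta>T where T: "T \<subseteq> {..<n}" "\<Delta>T \<notin> p" and E: "\<And>c. c \<in> T \<Longrightarrow> E c \<in> derivs scale p"
    "\<And>c. c \<in> T \<Longrightarrow> E c (x c) - \<Delta>T \<in> p" "\<And>c c'. c \<in> T \<Longrightarrow> c' \<in> T \<Longrightarrow> c \<noteq> c' \<Longrightarrow> E c (x c') \<in> p"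
    and T_det: "\<forall>E\<in>derivs scale p. (\<forall>c\<in>T. E (x c) \<in> p) \<longrightarrow> (\<forall>i\<in>{..<n}. E (x i) \<in> p)"
    by (rule p.echelon[of "{..<n}" "derivs scale p" x, OF _ p.derivs_combination2]) (simp, assumption, assumption, rule that)
  have finT: "finite T" using T(1) finite_subset by blast
  have Ediag: "E c (x c) \<notin> p" if "c \<in> T" for c
    using p.cong_mem_iff[OF E(2)[OF that]] T(2) by blast
  \<comment> \<open>A derivation modulo \<open>p\<close> that maps \<open>Y\<close> into
    \<open>p\<close> preserves \<open>p\<close>, so it lies in \<open>M0\<close> and is determined
    by its values at the coordinates in \<open>Cp\<close>.\<close>
  have "card T \<le> card (x ` Cp \<union> Y)"
  proof (rule p.independent_card_le[where D = E and M = "derivs scale p"])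
    show "finite (x ` Cp \<union> Y)" using finCp Y(1) by simp
    show "E i \<in> derivs scale p" if "i \<in> T" for i using E(1) that .
    show "(\<lambda>b. \<Sum>i\<in>T. a i * E i b) \<in> derivs scale p" for a
      by (rule p.derivs_combination[OF E(1)])
    show "H b \<in> p" if "H \<in> derivs scale p" "\<And>y. y \<in> x ` Cp \<union> Y \<Longrightarrow> H y \<in> p" for H b
    proof (rule Cp_zero[of H])
      show "H \<in> M0" using Y(4) that unfolding M0_def by blast
    qed (use that in auto)
    show "\<forall>i\<in>T. a i \<in> p" if "\<And>b. (\<Sum>i\<in>T. a i * E i b) \<in> p" for a
      by (rule p.diagonal_independent[where D = E and y = x, OF finT Ediag E(3) that])
  qed (rule finT)
  also have "\<dots> \<le> s + e"
    using card_Un_le[of "x ` Cp" Y] card_image_le[OF finCp, of x] Y(2) by (simp add: s_def)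
  finally have Tse: "card T \<le> s + e" .
  obtain \<Delta> b where \<Delta>: "\<Delta> \<notin> p" and b: "\<And>D i. D \<in> derivs scale {0} \<Longrightarrow> i < n \<Longrightarrow> i \<notin> T \<Longrightarrow>
      \<Delta> * D (x i) = (\<Sum>k\<in>T. b i k * D (x k))"
    by (rule derivs_determined[OF p T(1)]) (use T_det in blast, rule that)
  have \<Delta>0: "\<Delta> \<noteq> 0" using \<Delta> p.zero_mem by auto
  have T_zero: "D a = 0" if D: "D \<in> derivs scale {0}" and T0: "\<And>k. k \<in> T \<Longrightarrow> D (x k) = 0" for D a
  proof -
    have "D (x i) \<in> {0}" if "i < n" for i
      using b[OF D that] T0 \<Delta>0 by (cases "i \<in> T") auto
    then show ?thesis using derivs_vanish[OF zero_prime_set D] by blast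
  qed
  obtain C H \<Delta>' where C: "C \<subseteq> T" "\<Delta>' \<notin> {0}" and H: "\<And>c. c \<in> C \<Longrightarrow> H c \<in> derivs scale {0}"
    "\<And>c. c \<in> C \<Longrightarrow> H c (x c) - \<Delta>' \<in> {0}" "\<And>c c'. c \<in> C \<Longrightarrow> c' \<in> C \<Longrightarrow> c \<noteq> c' \<Longrightarrow> H c (x c') \<in> {0}"
    and C_det: "\<forall>E\<in>derivs scale {0}. (\<forall>c\<in>C. E (x c) \<in> {0}) \<longrightarrow> (\<forall>i\<in>T. E (x i) \<in> {0})"
    by (rule Z.echelon[of T "derivs scale {0}" x, OF finT Z.derivs_combination2]) (assumption, assumption, rule that)
  have finC: "finite C" using C(1) finT finite_subset by blast
  \<comment> \<open>\<open>card C\<close> is the generic rank of the derivations of \<A>; the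
    triangular family of the tower bounds it from below.\<close>
  have "card {..<s + e} \<le> card (x ` C)"
  proof (rule Z.independent_card_le[where D = F and M = "derivs scale {0}"])
    show "finite (x ` C)" "finite {..<s + e}" using finC by simp_all
    show "F i \<in> derivs scale {0}" if "i \<in> {..<s + e}" for i using F(1) that by simp
    show "(\<lambda>b. \<Sum>i\<in>{..<s + e}. a i * F i b) \<in> derivs scale {0}" for a
      by (rule Z.derivs_combination) (use F(1) in simp)
    show "K b \<in> {0}" if "K \<in> derivs scale {0}" "\<And>y. y \<in> x ` C \<Longrightarrow> K y \<in> {0}" for K b
    proof -
      have "\<forall>c\<in>C. K (x c) \<in> {0}" using that(2) by simp
      then have "\<forall>k\<in>T. K (x k) \<in> {0}" using C_det that(1) by simp
      then show ?thesis using T_zero[OF that(1)] by simp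
    qed
    show "\<forall>i\<in>{..<s + e}. a i \<in> {0}" if "\<And>b. (\<Sum>i\<in>{..<s + e}. a i * F i b) \<in> {0}" for a
    proof -
      have "\<forall>i<s + e. a i \<in> {0}"
        by (rule Z.triangular_independent[where D = F and y = "\<lambda>i. ys ! i", OF _ _ that])
          (simp_all add: F)
      then show ?thesis by simp
    qed
  qed
  then have "s + e \<le> card C" using card_image_le[OF finC, of x] by simp
  then have CT: "C = T" and T_eq: "card T = s + e"
    using Tse C(1) card_seteq[OF finT C(1)] card_mono[OF finT C(1)] by auto
  \<comment> \<open>The diagonal entry \<open>\<Delta>'\<close> of the \<open>H k\<close> may lie in
    \<open>p\<close>. It divides their values on \<open>T\<close>, and the other coordinates are
    determined by these up to the factor \<Delta>, so \<open>\<Delta> * H k\<close> can be divided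
    by it. The quotients have the diagonal entry \<Delta>, which is outside
    \<open>p\<close>.\<close>
  have "\<exists>K. \<forall>k\<in>T. K k \<in> derivs scale {0} \<and> (\<forall>a. \<Delta> * H k a = \<Delta>' * K k a)"
  proof (intro bchoice ballI)
    fix k assume k: "k \<in> T"
    have Hk: "H k \<in> derivs scale {0}" using H(1) k CT by simp
    have div: "\<Delta>' dvd H k (x j)" if "j \<in> T" for j
      using H(2)[of k] H(3)[of k j] k that CT by (cases "j = k") auto
    have "\<Delta>' dvd \<Delta> * H k (x i)" if "i < n" for i
    proof (cases "i \<in> T")
      case True
      then show ?thesis using div by simp
    next
      case False
      then have "\<Delta> * H k (x i) = (\<Sum>j\<in>T. b i j * H k (x j))" using b[OF Hk that] by simp
      then show ?thesis using div by (auto intro!: dvd_sum)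
    qed
    then show "\<exists>K. K \<in> derivs scale {0} \<and> (\<forall>a. \<Delta> * H k a = \<Delta>' * K a)"
      using divided_derivation[OF Hk, of \<Delta>' \<Delta>] C(2) by blast
  qed
  then obtain K where K: "\<And>k. k \<in> T \<Longrightarrow> K k \<in> derivs scale {0}"
    and KH: "\<And>k a. k \<in> T \<Longrightarrow> \<Delta> * H k a = \<Delta>' * K k a" by blast
  have K_diag: "K k (x k) = \<Delta>" if "k \<in> T" for k
    using KH[OF that, of "x k"] H(2)[of k] that CT C(2) by auto
  have K_off: "K k (x j) = 0" if "k \<in> T" "j \<in> T" "k \<noteq> j" for k j
    using KH[OF that(1), of "x j"] H(3)[of k j] that CT C(2) by auto
  have KM0: "K k \<in> M0" if "k \<in> T" for k
  proof -
    have "K k \<in> derivs scale p" using K[OF that] p.zero_mem by (simp add: exact_derivs_iff derivs_def)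
    then show ?thesis using pD[OF K[OF that]] by (simp add: M0_def)
  qed
  have "card T \<le> card (x ` Cp)"
  proof (rule p.independent_card_le[where D = K and M = M0])
    show "finite (x ` Cp)" using finCp by simp
    show "H b \<in> p" if "H \<in> M0" "\<And>y. y \<in> x ` Cp \<Longrightarrow> H y \<in> p" for H b
      by (rule Cp_zero[of H]) (use that in auto)
    show "\<forall>i\<in>T. a i \<in> p" if "\<And>b. (\<Sum>i\<in>T. a i * K i b) \<in> p" for a
      by (rule p.diagonal_independent[where D = K and y = x, OF finT _ _ that])
        (simp_all add: \<Delta> K_diag K_off p.zero_mem)
  qed (use finT KM0 M0_comb in auto)
  then have "s + e \<le> s" using T_eq card_image_le[OF finCp, of x] by (simp add: s_def)
  \<comment> \<open>Now \<open>e = 0\<close>: the maximal ideal of the local ring has no generators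
    and is zero, although it contains the nonzero element \<open>a0\<close>.\<close>
  then have "G = {}" using G(2) by (simp add: e_def)
  have "ideal {0} (local_ring_at p)" using R.zeroideal by (simp add: local_ring_simps)
  then have "M \<subseteq> {0}" unfolding MG \<open>G = {}\<close> by (rule R.genideal_minimal) simp
  moreover have "Fract a0 1 \<in> M"
    unfolding maximal_local[OF p cring M] using nz(1) Jp p.one_notin by blast
  ultimately have "Fract a0 1 = 0" by blast
  then show False using nz(2) by (simp add: Zero_fract_def eq_fract)
qed

end

section \<open>Rank and minors of the Poisson matrix\<close>

text \<open>Coefficients are indexed by positions in the list, so a repeated column counts as
  dependent. The definition makes sense over any commutative ring, which allows passage between \<A>
  and its fractions by clearing denominators.\<close>

definition columns_independent :: "nat \<Rightarrow> (nat \<Rightarrow> nat \<Rightarrow> 'b::comm_ring_1) \<Rightarrow> nat list \<Rightarrow> bool" where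
  "columns_independent n A ks \<longleftrightarrow>
     (\<forall>a. (\<forall>i<n. (\<Sum>t<length ks. A i (ks ! t) * a t) = 0) \<longrightarrow> (\<forall>t<length ks. a t = 0))"

context vec_space
begin

lemma mat_vec_eq_0_iff:
  assumes "B \<in> carrier_mat n m" "v \<in> carrier_vec m"
  shows "B *\<^sub>v v = 0\<^sub>v n \<longleftrightarrow> (\<forall>i<n. (\<Sum>t<m. B $$ (i, t) * v $ t) = 0)"
proof -
  have "(B *\<^sub>v v) $ i = (\<Sum>t<m. B $$ (i, t) * v $ t)" if "i < n" for i
    using assms that by (auto simp: scalar_prod_def atLeast0LessThan intro!: sum.cong)
  then show ?thesis using assms by (auto simp: vec_eq_iff)
qed

lemma independent_columns_le_rank:
  assumes A: "A \<in> carrier_mat n nc" and ks: "set ks \<subseteq> {..<nc}"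
    and indep: "columns_independent n (\<lambda>i j. A $$ (i, j)) ks"
  shows "length ks \<le> rank A"
proof -
  let ?m = "length ks"
  define B where "B = mat n ?m (\<lambda>(i, t). A $$ (i, ks ! t))"
  have B: "B \<in> carrier_mat n ?m" by (simp add: B_def)
  have colB: "cols B ! t = col A (ks ! t)" if "t < ?m" for t
    using that A ks by (auto simp: B_def nth_mem subset_iff)
  have dist: "distinct (cols B)"
    unfolding distinct_conv_nth
  proof (intro allI impI)
    fix s t assume st: "s < length (cols B)" "t < length (cols B)" "s \<noteq> t"
    then have sm: "s < ?m" "t < ?m" using B by auto
    show "cols B ! s \<noteq> cols B ! t"
    proof
      assume eq: "cols B ! s = cols B ! t"
      define a where "a = (\<lambda>u. if u = s then (1::'a) else if u = t then - 1 else 0)"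
      have "(\<Sum>u<?m. A $$ (i, ks ! u) * a u) = 0" if i: "i < n" for i
      proof -
        have "(\<Sum>u<?m. A $$ (i, ks ! u) * a u) = (\<Sum>u\<in>{s, t}. A $$ (i, ks ! u) * a u)"
          using sm by (intro sum.mono_neutral_right) (auto simp: a_def)
        also have "\<dots> = A $$ (i, ks ! s) - A $$ (i, ks ! t)" using st(3) by (simp add: a_def)
        also have "\<dots> = (cols B ! s) $ i - (cols B ! t) $ i"
          using colB sm A ks i by (auto simp: nth_mem subset_iff)
        finally show ?thesis using eq by simp
      qed
      then have "a s = 0" using indep sm(1) unfolding columns_independent_def by blast
      then show False by (simp add: a_def)
    qed
  qed
  have "set (cols B) \<subseteq> set (cols A)"
  proof
    fix w assume "w \<in> set (cols B)"
    then obtain t where "t < length (cols B)" "w = cols B ! t" by (metis in_set_conv_nth)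
    then have t: "t < ?m" "w = col A (ks ! t)" using colB B by auto
    then have "ks ! t < nc" using ks nth_mem by blast
    then have "cols A ! (ks ! t) = w" "ks ! t < length (cols A)" using A t by auto
    then show "w \<in> set (cols A)" by (metis nth_mem)
  qed
  moreover have "lin_indpt (set (cols B))"
  proof
    assume "lin_dep (set (cols B))"
    from lin_depE[OF B this dist] obtain v where v: "v \<in> carrier_vec ?m" "v \<noteq> 0\<^sub>v ?m" "B *\<^sub>v v = 0\<^sub>v n" .
    then have "\<forall>i<n. (\<Sum>t<?m. A $$ (i, ks ! t) * v $ t) = 0"
      using mat_vec_eq_0_iff[OF B v(1)] by (simp add: B_def)
    then have "\<forall>t<?m. v $ t = 0" using indep unfolding columns_independent_def by blast
    then show False using v(1,2) by (auto simp: vec_eq_iff)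
  qed
  ultimately have "card (set (cols B)) \<le> rank A" using rank_ge_card_indpt[OF A] by blast
  then show ?thesis using distinct_card[OF dist] B by simp
qed

lemma independent_columns_eq_rank:
  assumes A: "A \<in> carrier_mat n nc"
  obtains ks where "length ks = rank A" "set ks \<subseteq> {..<nc}" "columns_independent n (\<lambda>i j. A $$ (i, j)) ks"
proof -
  have "lin_indpt {}" by (simp add: lin_dep_def)
  then obtain S where S: "maximal S (\<lambda>T. T \<subseteq> set (cols A) \<and> lin_indpt T)"
    using maximal_exists_superset[of "set (cols A)" "\<lambda>T. T \<subseteq> set (cols A) \<and> lin_indpt T" "{}"] by auto
  then have SA: "S \<subseteq> set (cols A)" and indep: "lin_indpt S" by (auto simp: maximal_def)
  have rank: "rank A = card S" by (rule rank_card_indpt[OF A S])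
  have finS: "finite S" using SA finite_subset by blast
  have "\<forall>w\<in>S. \<exists>k<nc. w = col A k"
    using SA A by (metis carrier_matD(2) cols_length cols_nth in_set_conv_nth subsetD)
  then obtain g where g: "\<And>w. w \<in> S \<Longrightarrow> g w < nc \<and> w = col A (g w)" by metis
  obtain ws where ws: "set ws = S" "distinct ws" using finite_distinct_list[OF finS] by blast
  define ks where "ks = map g ws"
  have len: "length ks = length ws" "length ws = card S" using ws(1) distinct_card[OF ws(2)] by (simp_all add: ks_def)
  define B where "B = mat n (length ks) (\<lambda>(i, t). A $$ (i, ks ! t))"
  have B: "B \<in> carrier_mat n (length ks)" by (simp add: B_def)
  have "cols B = ws"
  proof (rule nth_equalityI)
    show "length (cols B) = length ws" using B len by simp
    fix t assume "t < length (cols B)"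
    then have t: "t < length ws" using B len by simp
    then have gt: "g (ws ! t) < nc" "ws ! t = col A (g (ws ! t))" using g ws nth_mem by blast+
    have "col B t = col A (g (ws ! t))" using t gt(1) A len by (auto simp: B_def ks_def)
    then show "cols B ! t = ws ! t" using t B len gt by simp
  qed
  then have dist: "distinct (cols B)" and set: "set (cols B) = S" using ws by auto
  have "columns_independent n (\<lambda>i j. A $$ (i, j)) ks"
    unfolding columns_independent_def
  proof (rule allI, rule impI)
    fix a assume a: "\<forall>i<n. (\<Sum>t<length ks. A $$ (i, ks ! t) * a t) = 0"
    let ?v = "vec (length ks) a"
    have v: "?v \<in> carrier_vec (length ks)" by simp
    have "B *\<^sub>v ?v = 0\<^sub>v n" unfolding mat_vec_eq_0_iff[OF B v] using a by (simp add: B_def)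
    then have "?v = 0\<^sub>v (length ks)" using lin_depI[OF B v _ _ dist] indep set by blast
    then show "\<forall>t<length ks. a t = 0" by (metis index_vec index_zero_vec(1))
  qed
  moreover have "set ks \<subseteq> {..<nc}" using g ws by (auto simp: ks_def)
  ultimately show ?thesis using that len rank by simp
qed

end

lemma to_fract_sum: "to_fract (sum f I) = (\<Sum>i\<in>I. to_fract (f i))"
  by (induction I rule: infinite_finite_induct) simp_all

lemma columns_independent_to_fract:
  "columns_independent n (\<lambda>i j. to_fract (A i j)) ks \<longleftrightarrow> columns_independent n (A :: nat \<Rightarrow> nat \<Rightarrow> 'a::idom) ks"
proof
  assume L: "columns_independent n (\<lambda>i j. to_fract (A i j)) ks"
  show "columns_independent n A ks"
    unfolding columns_independent_def
  proof (rule allI, rule impI)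
    fix a assume a: "\<forall>i<n. (\<Sum>t<length ks. A i (ks ! t) * a t) = 0"
    have "(\<Sum>t<length ks. to_fract (A i (ks ! t)) * to_fract (a t)) = 0" if "i < n" for i
    proof -
      have "(\<Sum>t<length ks. to_fract (A i (ks ! t)) * to_fract (a t)) = to_fract (\<Sum>t<length ks. A i (ks ! t) * a t)"
        by (simp add: to_fract_sum)
      then show ?thesis using a that by simp
    qed
    then have "\<forall>t<length ks. to_fract (a t) = 0"
      using spec[OF L[unfolded columns_independent_def], of "\<lambda>t. to_fract (a t)"] by blast
    then show "\<forall>t<length ks. a t = 0" by simp
  qed
next
  assume R: "columns_independent n A ks"
  show "columns_independent n (\<lambda>i j. to_fract (A i j)) ks"
    unfolding columns_independent_def
  proof (rule allI, rule impI)
    fix a assume a: "\<forall>i<n. (\<Sum>t<length ks. to_fract (A i (ks ! t)) * a t) = 0"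
    have "\<exists>c\<in>UNIV. \<exists>b\<in>UNIV. b \<noteq> 0 \<and> w * to_fract b = to_fract c" for w :: "'a fract"
    proof (cases w rule: Fract_cases)
      case (Fract c b)
      then have "w * to_fract b = to_fract c" by (simp add: Fract_conv_to_fract)
      then show ?thesis using Fract by blast
    qed
    then have "\<exists>b\<in>UNIV. b \<noteq> 0 \<and> (\<forall>t\<in>{..<length ks}. \<exists>c\<in>UNIV. a t * to_fract b = to_fract c)"
      by (intro common_denominator) (auto simp: subring_set_def)
    then obtain b where b: "b \<noteq> 0" "\<forall>t\<in>{..<length ks}. \<exists>c. a t * to_fract b = to_fract c" by auto
    obtain c where "\<forall>t\<in>{..<length ks}. a t * to_fract b = to_fract (c t)"
      using bchoice[OF b(2)] by (rule exE)
    then have c: "a t * to_fract b = to_fract (c t)" if "t < length ks" for t using that by simp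
    have "(\<Sum>t<length ks. A i (ks ! t) * c t) = 0" if "i < n" for i
    proof -
      have "to_fract (\<Sum>t<length ks. A i (ks ! t) * c t) = (\<Sum>t<length ks. to_fract (A i (ks ! t)) * (a t * to_fract b))"
        by (simp add: to_fract_sum c)
      also have "\<dots> = (\<Sum>t<length ks. to_fract (A i (ks ! t)) * a t) * to_fract b"
        by (simp add: sum_distrib_right mult.assoc)
      also have "\<dots> = 0" using a that by simp
      finally show ?thesis by (simp only: to_fract_eq_0_iff)
    qed
    then have "\<forall>t<length ks. c t = 0" using spec[OF R[unfolded columns_independent_def], of c] by blast
    then have "a t * to_fract b = 0" if "t < length ks" for t using c[OF that] that by simp
    then show "\<forall>t<length ks. a t = 0" using b(1) by simp
  qed
qed

section \<open>Cofactors and bordered minors\<close>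

definition poisson_minor_matrix :: "('a::idom \<Rightarrow> 'a \<Rightarrow> 'a) \<Rightarrow> (nat \<Rightarrow> 'a) \<Rightarrow> nat list \<Rightarrow> nat list \<Rightarrow> 'a mat" where
  "poisson_minor_matrix br x is js = mat (length is) (length js) (\<lambda>(s, t). br (x (is ! s)) (x (js ! t)))"

definition minor_cofactor where
  "minor_cofactor br x is js s t = cofactor (poisson_minor_matrix br x is js) s t"

lemma minor_cofactor_row:
  assumes len: "length is = d" "length js = d" and s: "s < d" "s' < d"
  shows "(\<Sum>t<d. br (x (is ! s)) (x (js ! t)) * minor_cofactor br x is js s' t)
    = (if s = s' then minor br x is js else 0)"
proof -
  let ?M = "poisson_minor_matrix br x is js"
  have M: "?M \<in> carrier_mat d d" by (simp add: poisson_minor_matrix_def len)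
  have "(\<Sum>t<d. br (x (is ! s)) (x (js ! t)) * minor_cofactor br x is js s' t) = (?M * adj_mat ?M) $$ (s, s')"
    using s len by (simp add: times_mat_def scalar_prod_def adj_mat_def minor_cofactor_def
      poisson_minor_matrix_def atLeast0LessThan)
  also have "\<dots> = (if s = s' then minor br x is js else 0)"
    unfolding adj_mat(2)[OF M] using s by (simp add: minor_def poisson_minor_matrix_def)
  finally show ?thesis .
qed

lemma minor_cofactor_column:
  assumes len: "length is = d" "length js = d" and t: "t < d" "t' < d"
  shows "(\<Sum>s<d. minor_cofactor br x is js s t * br (x (is ! s)) (x (js ! t')))
    = (if t = t' then minor br x is js else 0)"
proof -
  let ?M = "poisson_minor_matrix br x is js"
  have M: "?M \<in> carrier_mat d d" by (simp add: poisson_minor_matrix_def len)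
  have "(\<Sum>s<d. minor_cofactor br x is js s t * br (x (is ! s)) (x (js ! t'))) = (adj_mat ?M * ?M) $$ (t, t')"
    using t len by (simp add: times_mat_def scalar_prod_def adj_mat_def minor_cofactor_def
      poisson_minor_matrix_def atLeast0LessThan)
  also have "\<dots> = (if t = t' then minor br x is js else 0)"
    unfolding adj_mat(3)[OF M] using t by (simp add: minor_def poisson_minor_matrix_def)
  finally show ?thesis .
qed

text \<open>The minor bordered by the row \<open>\<nu>\<close> and the column of the values \<open>br (x i) a\<close>, expanded along the
  new column.\<close>

definition bordered :: "('a::idom \<Rightarrow> 'a \<Rightarrow> 'a) \<Rightarrow> (nat \<Rightarrow> 'a) \<Rightarrow> nat list \<Rightarrow> nat list \<Rightarrow> nat \<Rightarrow> 'a \<Rightarrow> 'a" where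
  "bordered br x is js \<nu> a = minor br x is js * br (x \<nu>) a -
     (\<Sum>s<length is. (\<Sum>t<length js. br (x \<nu>) (x (js ! t)) * minor_cofactor br x is js s t) * br (x (is ! s)) a)"

lemma bordered_column:
  assumes len: "length is = d" "length js = d" and t: "t < d"
  shows "bordered br x is js \<nu> (x (js ! t)) = 0"
proof -
  have "(\<Sum>s<d. (\<Sum>u<d. br (x \<nu>) (x (js ! u)) * minor_cofactor br x is js s u) * br (x (is ! s)) (x (js ! t)))
      = (\<Sum>s<d. \<Sum>u<d. br (x \<nu>) (x (js ! u)) * (minor_cofactor br x is js s u * br (x (is ! s)) (x (js ! t))))"
    by (simp add: sum_distrib_right mult.assoc)
  also have "\<dots> = (\<Sum>u<d. br (x \<nu>) (x (js ! u)) * (\<Sum>s<d. minor_cofactor br x is js s u * br (x (is ! s)) (x (js ! t))))"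
    by (subst sum.swap) (simp add: sum_distrib_left)
  also have "\<dots> = (\<Sum>u<d. br (x \<nu>) (x (js ! u)) * (if u = t then minor br x is js else 0))"
    using t by (intro sum.cong refl) (simp add: minor_cofactor_column[OF len])
  also have "\<dots> = (\<Sum>u<d. if u = t then br (x \<nu>) (x (js ! u)) * minor br x is js else 0)"
    by (rule sum.cong) auto
  also have "\<dots> = br (x \<nu>) (x (js ! t)) * minor br x is js" using t by simp
  finally show ?thesis by (simp add: bordered_def len mult.commute)
qed

text \<open>Combining row \<nu> with the rows \<open>is\<close> into bordered minors kills the
  columns \<open>js\<close> and leaves a nonzero multiple of the last coefficient. The other
  coefficients then vanish because the minor itself is nonzero.\<close>

lemma bordered_independent:
  assumes len: "length is = d" "length js = d" and mu: "minor br x is js \<noteq> 0"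
    and rows: "set is \<subseteq> I" "\<nu> \<in> I" and b: "bordered br x is js \<nu> (x k) \<noteq> 0"
    and zero: "\<And>i. i \<in> I \<Longrightarrow> (\<Sum>t<Suc d. br (x i) (x ((js @ [k]) ! t)) * a t) = 0"
    and t: "t < Suc d"
  shows "a t = 0"
proof -
  have row: "(\<Sum>t<d. br (x i) (x (js ! t)) * a t) + br (x i) (x k) * a d = 0" if "i \<in> I" for i
    using zero[OF that] len by (simp add: nth_append)
  let ?c = "\<lambda>s. \<Sum>u<d. br (x \<nu>) (x (js ! u)) * minor_cofactor br x is js s u"
  let ?E = "bordered br x is js \<nu>"
  have E: "?E b = minor br x is js * br (x \<nu>) b - (\<Sum>s<d. ?c s * br (x (is ! s)) b)" for b
    by (simp add: bordered_def len)
  have "(\<Sum>t<d. ?E (x (js ! t)) * a t) + ?E (x k) * a d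
      = minor br x is js * ((\<Sum>t<d. br (x \<nu>) (x (js ! t)) * a t) + br (x \<nu>) (x k) * a d)
        - (\<Sum>s<d. ?c s * ((\<Sum>t<d. br (x (is ! s)) (x (js ! t)) * a t) + br (x (is ! s)) (x k) * a d))"
  proof -
    have "(\<Sum>t<d. (\<Sum>s<d. ?c s * br (x (is ! s)) (x (js ! t))) * a t)
        = (\<Sum>s<d. ?c s * (\<Sum>t<d. br (x (is ! s)) (x (js ! t)) * a t))"
      by (subst sum_distrib_right, subst sum.swap) (simp add: sum_distrib_left mult.assoc)
    then show ?thesis
      by (simp add: E left_diff_distrib sum_subtractf sum_distrib_left sum_distrib_right distrib_left
          sum.distrib mult.assoc)
  qed
  also have "(\<Sum>s<d. ?c s * ((\<Sum>t<d. br (x (is ! s)) (x (js ! t)) * a t) + br (x (is ! s)) (x k) * a d)) = 0"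
    using row rows(1) len by (intro sum.neutral ballI) (simp add: nth_mem subset_iff)
  also have "minor br x is js * ((\<Sum>t<d. br (x \<nu>) (x (js ! t)) * a t) + br (x \<nu>) (x k) * a d) = 0"
    using row[OF rows(2)] by simp
  also have "(\<Sum>t<d. ?E (x (js ! t)) * a t) = 0"
    by (intro sum.neutral ballI) (simp add: bordered_column[OF len])
  finally have ad: "a d = 0" using b by simp
  have row0: "(\<Sum>t<d. br (x (is ! s)) (x (js ! t)) * a t) = 0" if "s < d" for s
    using row[of "is ! s"] ad rows(1) that len by (simp add: nth_mem subset_iff)
  have "minor br x is js * a u = 0" if u: "u < d" for u
  proof -
    have "0 = (\<Sum>s<d. minor_cofactor br x is js s u * (\<Sum>t<d. br (x (is ! s)) (x (js ! t)) * a t))"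
      using row0 by simp
    also have "\<dots> = (\<Sum>t<d. (\<Sum>s<d. minor_cofactor br x is js s u * br (x (is ! s)) (x (js ! t))) * a t)"
      by (simp only: sum_distrib_left sum_distrib_right, subst sum.swap) (simp add: mult.assoc)
    also have "\<dots> = (\<Sum>t<d. if u = t then minor br x is js * a t else 0)"
      using u by (intro sum.cong refl) (simp add: minor_cofactor_column[OF len])
    also have "\<dots> = minor br x is js * a u" using u by simp
    finally show ?thesis by simp
  qed
  then show ?thesis using ad t mu by (cases "t = d") auto
qed

lemma minor_nonzero_iff:
  assumes len: "length is = d" "length js = d"
  shows "minor br x is js \<noteq> 0 \<longleftrightarrow>
    (\<forall>a. (\<forall>s<d. (\<Sum>t<d. br (x (is ! s)) (x (js ! t)) * a t) = 0) \<longrightarrow> (\<forall>t<d. a t = 0))"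
proof -
  let ?M = "poisson_minor_matrix br x is js"
  have M: "?M \<in> carrier_mat d d" by (simp add: poisson_minor_matrix_def len)
  have eq: "?M *\<^sub>v v = 0\<^sub>v d \<longleftrightarrow> (\<forall>s<d. (\<Sum>t<d. br (x (is ! s)) (x (js ! t)) * v $ t) = 0)"
    if "v \<in> carrier_vec d" for v
  proof -
    have "(?M *\<^sub>v v) $ s = (\<Sum>t<d. br (x (is ! s)) (x (js ! t)) * v $ t)" if "s < d" for s
      using that \<open>v \<in> carrier_vec d\<close> len
      by (auto simp: scalar_prod_def atLeast0LessThan poisson_minor_matrix_def intro!: sum.cong)
    then show ?thesis using M that by (auto simp: vec_eq_iff)
  qed
  have "minor br x is js = 0 \<longleftrightarrow> (\<exists>v. v \<in> carrier_vec d \<and> v \<noteq> 0\<^sub>v d \<and> ?M *\<^sub>v v = 0\<^sub>v d)"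
    using det_0_iff_vec_prod_zero[OF M] by (simp add: minor_def poisson_minor_matrix_def)
  also have "\<dots> \<longleftrightarrow> (\<exists>a. (\<exists>t<d. a t \<noteq> 0) \<and> (\<forall>s<d. (\<Sum>t<d. br (x (is ! s)) (x (js ! t)) * a t) = 0))"
  proof
    assume "\<exists>v. v \<in> carrier_vec d \<and> v \<noteq> 0\<^sub>v d \<and> ?M *\<^sub>v v = 0\<^sub>v d"
    then obtain v where v: "v \<in> carrier_vec d" "v \<noteq> 0\<^sub>v d" "?M *\<^sub>v v = 0\<^sub>v d" by blast
    have "\<exists>t<d. v $ t \<noteq> 0" using v(1,2) by (auto simp: vec_eq_iff)
    then show "\<exists>a. (\<exists>t<d. a t \<noteq> 0) \<and> (\<forall>s<d. (\<Sum>t<d. br (x (is ! s)) (x (js ! t)) * a t) = 0)"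
      using v(3) unfolding eq[OF v(1)] by blast
  next
    assume "\<exists>a. (\<exists>t<d. a t \<noteq> 0) \<and> (\<forall>s<d. (\<Sum>t<d. br (x (is ! s)) (x (js ! t)) * a t) = 0)"
    then obtain a where a: "\<exists>t<d. a t \<noteq> 0" "\<forall>s<d. (\<Sum>t<d. br (x (is ! s)) (x (js ! t)) * a t) = 0" by blast
    have "vec d a \<in> carrier_vec d" "vec d a \<noteq> 0\<^sub>v d" using a(1) by (auto simp: vec_eq_iff)
    moreover have "?M *\<^sub>v vec d a = 0\<^sub>v d" using a(2) by (subst eq) simp_all
    ultimately show "\<exists>v. v \<in> carrier_vec d \<and> v \<noteq> 0\<^sub>v d \<and> ?M *\<^sub>v v = 0\<^sub>v d" by blast
  qed
  finally show ?thesis by blast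
qed

lemma poisson_rank_iff:
  fixes br :: "'a::idom \<Rightarrow> 'a \<Rightarrow> 'a"
  shows "set ks \<subseteq> {..<n} \<Longrightarrow> columns_independent n (\<lambda>i j. br (x i) (x j)) ks \<Longrightarrow> length ks \<le> poisson_rank br x n"
    "\<exists>ks. length ks = poisson_rank br x n \<and> set ks \<subseteq> {..<n} \<and> columns_independent n (\<lambda>i j. br (x i) (x j)) ks"
proof -
  let ?A = "map_mat to_fract (poisson_matrix br x n)"
  have A: "?A \<in> carrier_mat n n" by (simp add: poisson_matrix_def)
  have entry: "?A $$ (i, j) = to_fract (br (x i) (x j))" if "i < n" "j < n" for i j
    using that by (simp add: poisson_matrix_def)
  have ind: "columns_independent n (\<lambda>i j. ?A $$ (i, j)) ks \<longleftrightarrow> columns_independent n (\<lambda>i j. br (x i) (x j)) ks"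
    if "set ks \<subseteq> {..<n}" for ks
  proof -
    have "?A $$ (i, ks ! t) = to_fract (br (x i) (x (ks ! t)))" if "i < n" "t < length ks" for i t
      using \<open>set ks \<subseteq> {..<n}\<close> that by (intro entry) (auto simp: subset_iff)
    then have "columns_independent n (\<lambda>i j. ?A $$ (i, j)) ks
        \<longleftrightarrow> columns_independent n (\<lambda>i j. to_fract (br (x i) (x j))) ks"
      by (simp add: columns_independent_def)
    also have "\<dots> \<longleftrightarrow> columns_independent n (\<lambda>i j. br (x i) (x j)) ks"
      by (rule columns_independent_to_fract)
    finally show ?thesis .
  qed
  show "length ks \<le> poisson_rank br x n"
    if "set ks \<subseteq> {..<n}" "columns_independent n (\<lambda>i j. br (x i) (x j)) ks"
    unfolding poisson_rank_def
    using vec_space.independent_columns_le_rank[OF A that(1)] ind[OF that(1)] that(2) by simp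
  obtain ks where ks: "length ks = vec_space.rank n ?A" "set ks \<subseteq> {..<n}"
    "columns_independent n (\<lambda>i j. ?A $$ (i, j)) ks"
    by (rule vec_space.independent_columns_eq_rank[OF A])
  show "\<exists>ks. length ks = poisson_rank br x n \<and> set ks \<subseteq> {..<n} \<and> columns_independent n (\<lambda>i j. br (x i) (x j)) ks"
    unfolding poisson_rank_def using ks(1,2) ks(3)[unfolded ind[OF ks(2)]] by (intro exI[of _ ks] conjI)
qed

locale ess_poisson = poisson_algebra scale br + ess_finite_algebra scale x n
  for scale :: "'k::field_char_0 \<Rightarrow> 'a::idom \<Rightarrow> 'a" and br :: "'a \<Rightarrow> 'a \<Rightarrow> 'a"
    and x :: "nat \<Rightarrow> 'a" and n :: nat
begin

lemma br_mult_left: "br (a * b) c = a * br b c + b * br a c"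
  using br_leibniz[of c a b] by (simp add: br_anti[of c] algebra_simps)

lemma br_one: "br a 1 = 0"
  using br_leibniz[of a 1 1] by (simp only: mult_1 mult_1_right add_cancel_right_right)

lemma br_scalar: "br a (scale c 1) = 0"
  by (simp add: br_simps br_one)

lemma br_right_deriv: "br a \<in> derivs scale {0}"
  by (auto simp: exact_derivs_iff br_simps br_leibniz br_one)

lemma br_left_deriv: "(\<lambda>a. br a b) \<in> derivs scale {0}"
proof -
  have "br (scale c 1) b = 0" for c using br_anti[of "scale c 1" b] br_scalar[of b c] by simp
  then show ?thesis by (auto simp: exact_derivs_iff br_simps br_mult_left)
qed

lemma exact_deriv_zero:
  "D \<in> derivs scale {0} \<Longrightarrow> (\<And>i. i < n \<Longrightarrow> D (x i) = 0) \<Longrightarrow> D a = 0"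
  using derivs_vanish[OF zero_prime_set, of D a] by simp

lemma exact_derivs_sum:
  "(\<And>i. i \<in> I \<Longrightarrow> D i \<in> derivs scale {0}) \<Longrightarrow> (\<lambda>b. \<Sum>i\<in>I. a i * D i b) \<in> derivs scale {0}"
  by (rule prime_set.derivs_combination[OF zero_prime_set])

lemma exact_derivs_comb2:
  "D \<in> derivs scale {0} \<Longrightarrow> E \<in> derivs scale {0} \<Longrightarrow> (\<lambda>t. a * D t + b * E t) \<in> derivs scale {0}"
  by (rule prime_set.derivs_combination2[OF zero_prime_set])

text \<open>The \<open>g k\<close> are coefficients of the differential of \<open>a\<close> in terms
  of the differentials of the \<open>x k\<close>; it matters that they do not depend on
  \<open>y\<close>.\<close>

lemma br_combination: "\<exists>g. \<forall>y. br a y = (\<Sum>k<n. g k * br (x k) y)"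
proof (induction a rule: ess_induct)
  case (scalar c)
  have "br (scale c 1) y = 0" for y using br_anti[of "scale c 1" y] br_scalar[of y c] by simp
  then show ?case by (intro exI[of _ "\<lambda>_. 0"]) simp
next
  case (gen i)
  have "br (x i) y = (\<Sum>k<n. (if k = i then 1 else 0) * br (x k) y)" for y
  proof -
    have "(\<Sum>k<n. (if k = i then 1 else 0) * br (x k) y) = (\<Sum>k<n. if k = i then br (x k) y else 0)"
      by (rule sum.cong) auto
    then show ?thesis using gen by simp
  qed
  then show ?case by (intro exI allI)
next
  case (add a b)
  then obtain g h where "\<And>y. br a y = (\<Sum>k<n. g k * br (x k) y)" "\<And>y. br b y = (\<Sum>k<n. h k * br (x k) y)"
    by blast
  then have "br (a + b) y = (\<Sum>k<n. (g k + h k) * br (x k) y)" for y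
    by (simp add: br_simps distrib_right sum.distrib)
  then show ?case by (intro exI allI)
next
  case (mult a b)
  then obtain g h where "\<And>y. br a y = (\<Sum>k<n. g k * br (x k) y)" "\<And>y. br b y = (\<Sum>k<n. h k * br (x k) y)"
    by blast
  then have "br (a * b) y = (\<Sum>k<n. (a * h k + b * g k) * br (x k) y)" for y
    by (simp add: br_mult_left distrib_right sum.distrib sum_distrib_left mult.assoc)
  then show ?case by (intro exI allI)
next
  case (divide a s t)
  then obtain g h where gh: "\<And>y. br s y = (\<Sum>k<n. g k * br (x k) y)" "\<And>y. br (a * s) y = (\<Sum>k<n. h k * br (x k) y)"
    by blast
  have "br a y = (\<Sum>k<n. (t * (h k - a * g k)) * br (x k) y)" for y
  proof -
    have "br a y = (s * t) * br a y" by (simp add: divide(3))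
    also have "\<dots> = t * (br (a * s) y - a * br s y)" by (simp add: br_mult_left algebra_simps)
    also have "\<dots> = (\<Sum>k<n. (t * (h k - a * g k)) * br (x k) y)"
      unfolding gh by (simp add: sum_distrib_left sum_subtractf[symmetric] algebra_simps)
    finally show ?thesis .
  qed
  then show ?case by (intro exI allI)
qed

subsection \<open>Nonzero minors\<close>

lemma bordered_deriv: "bordered br x is js \<nu> \<in> derivs scale {0}"
proof -
  have "(\<lambda>a. minor br x is js * br (x \<nu>) a + (- 1) *
     (\<Sum>s<length is. (\<Sum>t<length js. br (x \<nu>) (x (js ! t)) * minor_cofactor br x is js s t) * br (x (is ! s)) a))
     \<in> derivs scale {0}"
    by (intro exact_derivs_comb2 exact_derivs_sum br_right_deriv)
  then show ?thesis by (simp add: bordered_def[abs_def])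
qed

text \<open>A nonzero value at some \<open>x k\<close> would give more independent columns than the
  rank allows. As a function of \<open>a\<close> the bordered minor is a derivation, so the
  coordinates suffice.\<close>

lemma bordered_zero:
  assumes len: "length is = poisson_rank br x n" "length js = poisson_rank br x n"
    and set: "set is \<subseteq> {..<n}" "set js \<subseteq> {..<n}" and mu: "minor br x is js \<noteq> 0" and \<nu>: "\<nu> < n"
  shows "bordered br x is js \<nu> a = 0"
proof (rule exact_deriv_zero[OF bordered_deriv])
  fix k assume k: "k < n"
  show "bordered br x is js \<nu> (x k) = 0"
  proof (rule ccontr)
    assume b: "bordered br x is js \<nu> (x k) \<noteq> 0"
    have "columns_independent n (\<lambda>i j. br (x i) (x j)) (js @ [k])"
      unfolding columns_independent_def
    proof (intro allI impI)
      fix a t assume a: "\<forall>i<n. (\<Sum>t<length (js @ [k]). br (x i) (x ((js @ [k]) ! t)) * a t) = 0"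
        and t: "t < length (js @ [k])"
      show "a t = 0"
        by (rule bordered_independent[OF len mu _ _ b, where I = "{..<n}"])
          (use set \<nu> a t len in auto)
    qed
    from poisson_rank_iff(1)[OF _ this] show False using set k len by simp
  qed
qed

text \<open>The growth step for minors. If all bordered minors vanished, every row would be a
  combination of the rows \<open>is\<close> up to the factor \<open>minor br x is js\<close>, and
  more than \<open>m\<close> columns could not be independent.\<close>

lemma exists_bordered_nonzero:
  assumes len: "length is = m" "length js = m" and mu: "minor br x is js \<noteq> 0"
    and m: "m < poisson_rank br x n"
  shows "\<exists>\<nu><n. \<exists>k<n. bordered br x is js \<nu> (x k) \<noteq> 0"
proof (rule ccontr)
  assume "\<not> ?thesis"
  then have zero: "bordered br x is js \<nu> (x k) = 0" if "\<nu> < n" "k < n" for \<nu> k using that by blast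
  obtain ks where ks: "length ks = poisson_rank br x n" "set ks \<subseteq> {..<n}"
    "columns_independent n (\<lambda>i j. br (x i) (x j)) ks"
    using poisson_rank_iff(2)[of br x n] by blast
  interpret Z: prime_set "{0::'a}" by (rule zero_prime_set)
  define u where "u = (\<lambda>r s. br (x (is ! s)) (x (ks ! r)))"
  \<comment> \<open>One equation for each of the \<open>m\<close> rows in \<open>is\<close>, and
    more than \<open>m\<close> unknowns. Multiplied by the minor, the solution satisfies the
    equations of all rows.\<close>
  have "\<exists>a. (\<exists>r\<in>{..<length ks}. a r \<notin> {0}) \<and> (\<forall>s\<in>{..<m}. (\<Sum>r<length ks. a r * u r s) \<in> {0})"
    by (rule Z.homogeneous_system) (use ks(1) m in auto)
  then obtain a r where r: "r < length ks" "a r \<noteq> 0" and a: "\<And>s. s < m \<Longrightarrow> (\<Sum>r<length ks. a r * u r s) = 0"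
    by auto
  have "(\<Sum>r<length ks. br (x i) (x (ks ! r)) * (minor br x is js * a r)) = 0" if i: "i < n" for i
  proof -
    let ?c = "\<lambda>s. \<Sum>t<length js. br (x i) (x (js ! t)) * minor_cofactor br x is js s t"
    have "br (x i) (x (ks ! r)) * (minor br x is js * a r) = (\<Sum>s<m. ?c s * (a r * u r s))"
      if "r < length ks" for r
    proof -
      have "ks ! r < n" using that ks(2) nth_mem by blast
      then have "minor br x is js * br (x i) (x (ks ! r)) = (\<Sum>s<m. ?c s * u r s)"
        using zero[OF i, of "ks ! r"] len by (simp add: bordered_def u_def)
      then have "a r * (minor br x is js * br (x i) (x (ks ! r))) = a r * (\<Sum>s<m. ?c s * u r s)" by simp
      then show ?thesis by (simp add: sum_distrib_left ac_simps)
    qed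
    then have "(\<Sum>r<length ks. br (x i) (x (ks ! r)) * (minor br x is js * a r))
        = (\<Sum>r<length ks. \<Sum>s<m. ?c s * (a r * u r s))"
      by (intro sum.cong) simp_all
    also have "\<dots> = (\<Sum>s<m. ?c s * (\<Sum>r<length ks. a r * u r s))"
      by (subst sum.swap) (simp add: sum_distrib_left)
    also have "\<dots> = 0" using a by simp
    finally show ?thesis .
  qed
  then have "\<forall>t<length ks. minor br x is js * a t = 0"
    using spec[OF ks(3)[unfolded columns_independent_def], of "\<lambda>r. minor br x is js * a r"] by blast
  then show False using r mu by simp
qed

lemma exists_minor_nonzero_lists:
  "m \<le> poisson_rank br x n \<Longrightarrow> \<exists>is js. length is = m \<and> length js = m \<and> set is \<subseteq> {..<n} \<and> set js \<subseteq> {..<n} \<and>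
    minor br x is js \<noteq> 0"
proof (induction m)
  case 0
  have "minor br x [] [] = 1" by (simp add: minor_def det_def)
  then show ?case by (intro exI[of _ "[]"]) simp
next
  case (Suc m)
  then obtain "is" js where *: "length is = m" "length js = m" "set is \<subseteq> {..<n}" "set js \<subseteq> {..<n}"
    "minor br x is js \<noteq> 0" by auto
  then obtain \<nu> k where b: "\<nu> < n" "k < n" "bordered br x is js \<nu> (x k) \<noteq> 0"
    using exists_bordered_nonzero[of "is" m js] Suc.prems by auto
  have "minor br x (is @ [\<nu>]) (js @ [k]) \<noteq> 0"
  proof (subst minor_nonzero_iff[where d = "Suc m"])
    show "\<forall>a. (\<forall>s<Suc m. (\<Sum>t<Suc m. br (x ((is @ [\<nu>]) ! s)) (x ((js @ [k]) ! t)) * a t) = 0) \<longrightarrow> (\<forall>t<Suc m. a t = 0)"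
    proof (intro allI impI)
      fix a t
      assume a: "\<forall>s<Suc m. (\<Sum>t<Suc m. br (x ((is @ [\<nu>]) ! s)) (x ((js @ [k]) ! t)) * a t) = 0" and t: "t < Suc m"
      show "a t = 0"
      proof (rule bordered_independent[OF *(1,2,5) _ _ b(3), where I = "set (is @ [\<nu>])"])
        fix i assume "i \<in> set (is @ [\<nu>])"
        then obtain s where "s < length (is @ [\<nu>])" "i = (is @ [\<nu>]) ! s" by (metis in_set_conv_nth)
        then show "(\<Sum>t<Suc m. br (x i) (x ((js @ [k]) ! t)) * a t) = 0" using a *(1) by simp
      qed (use t in auto)
    qed
  qed (use * in simp_all)
  then show ?case using * b by (intro exI[of _ "is @ [\<nu>]"] exI[of _ "js @ [k]"]) simp
qed

end

lemma minor_permute_rows: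
  assumes p: "p permutes {..<length is}" and len: "length js = length is"
  shows "minor br x (permute_list p is) js = signof p * minor br x is js"
proof -
  let ?M = "poisson_minor_matrix br x is js" and ?d = "length is"
  have M: "?M \<in> carrier_mat ?d ?d" by (simp add: poisson_minor_matrix_def len)
  have eq: "mat ?d ?d (\<lambda>(i, j). ?M $$ (p i, j)) = poisson_minor_matrix br x (permute_list p is) js"
  proof (rule eq_matI)
    fix i j assume "i < dim_row (poisson_minor_matrix br x (permute_list p is) js)"
      "j < dim_col (poisson_minor_matrix br x (permute_list p is) js)"
    then have ij: "i < ?d" "j < ?d" by (simp_all add: poisson_minor_matrix_def len)
    then have "p i < ?d" using permutes_in_image[OF p, of i] by simp
    then show "mat ?d ?d (\<lambda>(i, j). ?M $$ (p i, j)) $$ (i, j) = poisson_minor_matrix br x (permute_list p is) js $$ (i, j)"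
      using ij len by (simp add: poisson_minor_matrix_def permute_list_nth[OF p])
  qed (simp_all add: poisson_minor_matrix_def len)
  have "minor br x (permute_list p is) js = det (mat ?d ?d (\<lambda>(i, j). ?M $$ (p i, j)))"
    unfolding eq by (simp add: minor_def poisson_minor_matrix_def)
  also have "\<dots> = signof p * det ?M"
    by (rule det_permute_rows[OF M]) (use p in \<open>simp add: atLeast0LessThan\<close>)
  also have "det ?M = minor br x is js" by (simp add: minor_def poisson_minor_matrix_def)
  finally show ?thesis .
qed

context ess_poisson
begin

text \<open>The bracket is alternating, so exchanging the two lists transposes the matrix and
  changes the sign of every entry. Arguments about rows thereby carry over to columns.\<close>

lemma minor_swap:
  assumes "length js = length is"
  shows "minor br x js is = (- 1) ^ length is * minor br x is js"
proof -
  let ?M = "poisson_minor_matrix br x is js" and ?d = "length is"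
  have M: "?M \<in> carrier_mat ?d ?d" by (simp add: poisson_minor_matrix_def assms)
  have eq: "poisson_minor_matrix br x js is = (- 1) \<cdot>\<^sub>m transpose_mat ?M"
  proof (rule eq_matI)
    fix i j assume "i < dim_row ((- 1) \<cdot>\<^sub>m transpose_mat ?M)" "j < dim_col ((- 1) \<cdot>\<^sub>m transpose_mat ?M)"
    then show "poisson_minor_matrix br x js is $$ (i, j) = ((- 1) \<cdot>\<^sub>m transpose_mat ?M) $$ (i, j)"
      using assms by (simp add: poisson_minor_matrix_def br_anti[of "x (js ! i)"])
  qed (simp_all add: poisson_minor_matrix_def assms)
  have "minor br x js is = det (poisson_minor_matrix br x js is)"
    by (simp add: minor_def poisson_minor_matrix_def)
  also have "\<dots> = (- 1) ^ ?d * det (transpose_mat ?M)"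
    unfolding eq by (simp add: poisson_minor_matrix_def)
  also have "\<dots> = (- 1) ^ ?d * minor br x is js"
    unfolding det_transpose[OF M] by (simp add: minor_def poisson_minor_matrix_def)
  finally show ?thesis .
qed

text \<open>A repeated index makes two rows equal, and sorting distinct indices changes at most the
  sign. Columns are treated as the rows of the exchanged minor.\<close>

lemma minor_sorted:
  assumes len: "length is = d" "length js = d" and set: "set is \<subseteq> {..<n}" "set js \<subseteq> {..<n}"
  obtains "minor br x is js = 0"
  | is' js' e where "is' \<in> incr_tuples n d" "js' \<in> incr_tuples n d" "minor br x is js = e * minor br x is' js'"
proof -
  have rows: "\<exists>is' e. is' \<in> incr_tuples n d \<and> minor br x is js = e * minor br x is' js"
    if nz: "minor br x is js \<noteq> 0" and len: "length is = d" "length js = d" and set: "set is \<subseteq> {..<n}" for "is" js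
  proof -
    have dist: "distinct is"
    proof (rule ccontr)
      assume "\<not> distinct is"
      then obtain s t where st: "s < d" "t < d" "s \<noteq> t" "is ! s = is ! t" using len(1) by (auto simp: distinct_conv_nth)
      have M: "poisson_minor_matrix br x is js \<in> carrier_mat d d" by (simp add: poisson_minor_matrix_def len)
      have "det (poisson_minor_matrix br x is js) = 0"
        by (rule det_identical_rows[OF M st(3,1,2)])
          (use st len in \<open>auto simp: poisson_minor_matrix_def vec_eq_iff\<close>)
      then show False using nz by (simp add: minor_def poisson_minor_matrix_def)
    qed
    have "mset is = mset (sort is)" by simp
    then obtain p where p: "p permutes {..<length (sort is)}" "permute_list p (sort is) = is"
      by (rule mset_eq_permutation)
    have "minor br x is js = signof p * minor br x (sort is) js"
      using minor_permute_rows[OF p(1), of js br x] p(2) len by simp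
    moreover have "sort is \<in> incr_tuples n d"
      using dist len set by (simp add: incr_tuples_def strict_sorted_iff)
    ultimately show ?thesis by blast
  qed
  show ?thesis
  proof (cases "minor br x is js = 0")
    case False
    from rows[OF this len set(1)] obtain is' e where 1: "is' \<in> incr_tuples n d" "minor br x is js = e * minor br x is' js"
      by blast
    have len': "length is' = d" using 1(1) by (simp add: incr_tuples_def)
    have "minor br x js is' \<noteq> 0" using 1(2) False minor_swap[of js is'] len len' by auto
    from rows[OF this len(2) len' set(2)] obtain js' f where 2: "js' \<in> incr_tuples n d"
      "minor br x js is' = f * minor br x js' is'" by blast
    have len'': "length js' = d" using 2(1) by (simp add: incr_tuples_def)
    have "minor br x is' js = (- 1) ^ d * minor br x js is'" using minor_swap[of is' js] len len' by simp
    also have "\<dots> = (- 1) ^ d * (f * ((- 1) ^ d * minor br x is' js'))"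
      using 2(2) minor_swap[of js' is'] len' len'' by simp
    finally have "minor br x is js = (e * ((- 1) ^ d * (f * (- 1) ^ d))) * minor br x is' js'"
      using 1(2) by (simp add: mult.assoc)
    then show ?thesis using that(2) 1(1) 2(1) by blast
  qed (rule that(1))
qed

lemma exists_minor_nonzero:
  assumes "d = poisson_rank br x n"
  shows "\<exists>is\<in>incr_tuples n d. \<exists>js\<in>incr_tuples n d. minor br x is js \<noteq> 0"
proof -
  obtain "is" js where *: "length is = d" "length js = d" "set is \<subseteq> {..<n}" "set js \<subseteq> {..<n}"
    "minor br x is js \<noteq> 0"
    using exists_minor_nonzero_lists[of d] assms by auto
  from *(1-4) show ?thesis by (rule minor_sorted) (use *(5) in auto)
qed

end

section \<open>The ideal of minors\<close>

text \<open>Jacobi's formula: by Leibniz' rule the determinant is differentiated one row at a time,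
  and Laplace expansion along the differentiated row gives the cofactors.\<close>

lemma det_derivation:
  fixes A :: "'a::idom mat"
  assumes A: "A \<in> carrier_mat d d" and D: "\<And>a b. D (a + b) = D a + D b" "\<And>a b. D (a * b) = a * D b + b * D a"
  shows "D (det A) = (\<Sum>s<d. \<Sum>t<d. D (A $$ (s, t)) * cofactor A s t)"
proof -
  have D0: "D 0 = 0" using D(1)[of 0 0] by (metis add_cancel_left_left add_0)
  have D1: "D 1 = 0" using D(2)[of 1 1] by (metis add_cancel_left_left mult_1)
  have Dsum: "D (sum f I) = (\<Sum>i\<in>I. D (f i))" for f :: "'b \<Rightarrow> 'a" and I
    by (induction I rule: infinite_finite_induct) (simp_all add: D0 D(1))
  have Dm1: "D (- 1) = 0" using D(1)[of 1 "- 1"] D0 D1 by simp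
  have Dsign: "D (signof p) = 0" for p :: "nat \<Rightarrow> nat" by (simp add: sign_def D1 Dm1)
  have Dprod: "D (prod f I) = (\<Sum>s\<in>I. D (f s) * prod f (I - {s}))" if "finite I" for f :: "nat \<Rightarrow> 'a" and I
    using that
  proof (induction I rule: finite_induct)
    case empty
    then show ?case by (simp add: D1)
  next
    case (insert i I)
    have "D (prod f (insert i I)) = f i * (\<Sum>s\<in>I. D (f s) * prod f (I - {s})) + prod f I * D (f i)"
      using insert by (simp add: D(2))
    also have "f i * (\<Sum>s\<in>I. D (f s) * prod f (I - {s})) = (\<Sum>s\<in>I. D (f s) * prod f (insert i I - {s}))"
      unfolding sum_distrib_left
    proof (rule sum.cong)
      fix s assume s: "s \<in> I"
      then have "insert i I - {s} = insert i (I - {s})" using insert.hyps by auto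
      then show "f i * (D (f s) * prod f (I - {s})) = D (f s) * prod f (insert i I - {s})"
        using insert.hyps by simp
    qed simp
    also have "prod f I * D (f i) = D (f i) * prod f (insert i I - {i})" using insert.hyps by (simp add: mult.commute)
    finally show ?case using insert.hyps by (simp add: add.commute)
  qed
  let ?P = "{p. p permutes {0..<d}}"
  \<comment> \<open>The matrix \<open>A\<close> with its row \<open>s\<close>
    differentiated.\<close>
  define B where "B = (\<lambda>s. mat d d (\<lambda>(i, j). if i = s then D (A $$ (i, j)) else A $$ (i, j)))"
  have B: "B s \<in> carrier_mat d d" for s by (simp add: B_def)
  have detB: "det (B s) = (\<Sum>t<d. D (A $$ (s, t)) * cofactor A s t)" if s: "s < d" for s
  proof -
    have "mat_delete (B s) s t = mat_delete A s t" if "t < d" for t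
      using A s that by (intro eq_matI) (auto simp: mat_delete_def B_def)
    then have "cofactor (B s) s t = cofactor A s t" if "t < d" for t using that by (simp add: cofactor_def)
    then show ?thesis
      unfolding laplace_expansion_row[OF B s] using s by (intro sum.cong) (simp_all add: B_def)
  qed
  have "D (det A) = (\<Sum>p\<in>?P. signof p * D (\<Prod>i = 0..<d. A $$ (i, p i)))"
    unfolding det_def'[OF A] Dsum by (simp add: D(2) Dsign)
  also have "\<dots> = (\<Sum>p\<in>?P. \<Sum>s<d. signof p * (\<Prod>i = 0..<d. B s $$ (i, p i)))"
  proof (rule sum.cong)
    fix p assume p: "p \<in> ?P"
    have pd: "p i < d" if "i < d" for i using p that permutes_in_image[of p "{0..<d}" i] by simp
    have "D (\<Prod>i = 0..<d. A $$ (i, p i)) = (\<Sum>s = 0..<d. D (A $$ (s, p s)) * (\<Prod>i\<in>{0..<d} - {s}. A $$ (i, p i)))"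
      by (rule Dprod) simp
    also have "\<dots> = (\<Sum>s<d. \<Prod>i = 0..<d. B s $$ (i, p i))"
      unfolding atLeast0LessThan
    proof (rule sum.cong)
      fix s assume s: "s \<in> {..<d}"
      then have "(\<Prod>i<d. B s $$ (i, p i)) = B s $$ (s, p s) * (\<Prod>i\<in>{..<d} - {s}. B s $$ (i, p i))"
        by (simp add: prod.remove)
      also have "(\<Prod>i\<in>{..<d} - {s}. B s $$ (i, p i)) = (\<Prod>i\<in>{..<d} - {s}. A $$ (i, p i))"
        by (rule prod.cong) (auto simp: B_def pd)
      also have "B s $$ (s, p s) = D (A $$ (s, p s))" using s pd by (simp add: B_def)
      finally show "D (A $$ (s, p s)) * (\<Prod>i\<in>{..<d} - {s}. A $$ (i, p i)) = (\<Prod>i<d. B s $$ (i, p i))" by simp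
    qed simp
    finally show "signof p * D (\<Prod>i = 0..<d. A $$ (i, p i)) = (\<Sum>s<d. signof p * (\<Prod>i = 0..<d. B s $$ (i, p i)))"
      by (simp add: sum_distrib_left)
  qed simp
  also have "\<dots> = (\<Sum>s<d. det (B s))"
    by (subst sum.swap) (simp add: det_def'[OF B])
  also have "\<dots> = (\<Sum>s<d. \<Sum>t<d. D (A $$ (s, t)) * cofactor A s t)"
    by (rule sum.cong) (simp_all add: detB)
  finally show ?thesis .
qed

context ess_poisson
begin

lemma minor_replace_row:
  assumes len: "length is = d" "length js = d" and s: "s < d"
  shows "(\<Sum>t<d. br (x k) (x (js ! t)) * minor_cofactor br x is js s t) = minor br x (is[s := k]) js"
proof -
  let ?M = "poisson_minor_matrix br x is js" and ?N = "poisson_minor_matrix br x (is[s := k]) js"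
  have N: "?N \<in> carrier_mat d d" by (simp add: poisson_minor_matrix_def len)
  have "mat_delete ?N s t = mat_delete ?M s t" if "t < d" for t
    using s that len by (intro eq_matI) (auto simp: mat_delete_def poisson_minor_matrix_def)
  then have "cofactor ?N s t = minor_cofactor br x is js s t" if "t < d" for t
    using that by (simp add: cofactor_def minor_cofactor_def)
  then have "det ?N = (\<Sum>t<d. br (x k) (x (js ! t)) * minor_cofactor br x is js s t)"
    unfolding laplace_expansion_row[OF N s]
    using s len by (intro sum.cong) (simp_all add: poisson_minor_matrix_def)
  then show ?thesis by (simp add: minor_def poisson_minor_matrix_def)
qed

lemma minor_replace_column:
  assumes len: "length is = d" "length js = d" and t: "t < d"
  shows "(\<Sum>s<d. br (x (is ! s)) (x k) * minor_cofactor br x is js s t) = minor br x is (js[t := k])"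
proof -
  let ?M = "poisson_minor_matrix br x is js" and ?N = "poisson_minor_matrix br x is (js[t := k])"
  have N: "?N \<in> carrier_mat d d" by (simp add: poisson_minor_matrix_def len)
  have "mat_delete ?N s t = mat_delete ?M s t" if "s < d" for s
    using t that len by (intro eq_matI) (auto simp: mat_delete_def poisson_minor_matrix_def)
  then have "cofactor ?N s t = minor_cofactor br x is js s t" if "s < d" for s
    using that by (simp add: cofactor_def minor_cofactor_def)
  then have "det ?N = (\<Sum>s<d. br (x (is ! s)) (x k) * minor_cofactor br x is js s t)"
    unfolding laplace_expansion_column[OF N t]
    using t len by (intro sum.cong) (simp_all add: poisson_minor_matrix_def)
  then show ?thesis by (simp add: minor_def poisson_minor_matrix_def)
qed

lemma minors_ideal_ideal: "ideal (minors_ideal br x n d) class_ring"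
  unfolding minors_ideal_def by (rule ring.genideal_ideal[OF class_ring.ring_axioms]) simp

lemma minors_ideal_closed:
  "0 \<in> minors_ideal br x n d" "a \<in> minors_ideal br x n d \<Longrightarrow> b \<in> minors_ideal br x n d \<Longrightarrow> a + b \<in> minors_ideal br x n d"
  "a \<in> minors_ideal br x n d \<Longrightarrow> r * a \<in> minors_ideal br x n d"
proof -
  interpret ideal "minors_ideal br x n d" class_ring by (rule minors_ideal_ideal)
  show "0 \<in> minors_ideal br x n d"
    using additive_subgroup.zero_closed[OF additive_subgroup_axioms] by simp
  show "a + b \<in> minors_ideal br x n d" if "a \<in> minors_ideal br x n d" "b \<in> minors_ideal br x n d"
    using additive_subgroup.a_closed[OF additive_subgroup_axioms that] by simp
  show "r * a \<in> minors_ideal br x n d" if "a \<in> minors_ideal br x n d"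
    using I_l_closed[OF that, of r] by simp
qed

lemma minors_ideal_sum: "(\<And>i. i \<in> I \<Longrightarrow> f i \<in> minors_ideal br x n d) \<Longrightarrow> sum f I \<in> minors_ideal br x n d"
  by (induction I rule: infinite_finite_induct) (auto simp: minors_ideal_closed)

lemma minor_mem_minors_ideal:
  assumes "length is = d" "length js = d" "set is \<subseteq> {..<n}" "set js \<subseteq> {..<n}"
  shows "minor br x is js \<in> minors_ideal br x n d"
  using assms
proof (rule minor_sorted)
  fix is' js' e
  assume *: "is' \<in> incr_tuples n d" "js' \<in> incr_tuples n d" "minor br x is js = e * minor br x is' js'"
  have "minor br x is' js' \<in> minors_ideal br x n d"
    unfolding minors_ideal_def
    using ring.genideal_self[OF class_ring.ring_axioms, of "{minor br x is js |is js. is \<in> incr_tuples n d \<and> js \<in> incr_tuples n d}"] *(1,2)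
    by auto
  then show ?thesis unfolding *(3) by (rule minors_ideal_closed)
qed (simp add: minors_ideal_closed)

lemma minors_ideal_subset:
  assumes "0 \<in> J" "\<And>a b. a \<in> J \<Longrightarrow> b \<in> J \<Longrightarrow> a + b \<in> J" "\<And>r a. a \<in> J \<Longrightarrow> r * a \<in> J"
    and min: "\<And>is js. is \<in> incr_tuples n d \<Longrightarrow> js \<in> incr_tuples n d \<Longrightarrow> minor br x is js \<in> J"
  shows "minors_ideal br x n d \<subseteq> J"
proof -
  have ring: "ring (class_ring :: 'a ring)" by (rule class_ring.ring_axioms)
  have inv: "inv\<^bsub>add_monoid (class_ring :: 'a ring)\<^esub> a = - a" for a :: 'a
    using abelian_group.minus_equality[OF ring.is_abelian_group[OF ring], of "- a" a]
    by (simp add: a_inv_def)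
  have "ideal J class_ring"
  proof (rule idealI[OF ring])
    show "subgroup J (add_monoid (class_ring :: 'a ring))"
    proof (rule group.subgroupI[OF abelian_group.a_group[OF ring.is_abelian_group[OF ring]]])
      show "inv\<^bsub>add_monoid class_ring\<^esub> a \<in> J" if "a \<in> J" for a
        unfolding inv using assms(3)[OF that, of "-1"] by simp
    qed (use assms in auto)
    show "a \<otimes>\<^bsub>class_ring\<^esub> b \<in> J" if "a \<in> J" "b \<in> carrier class_ring" for a b
      using assms(3)[OF that(1), of b] by (simp add: mult.commute)
  qed (simp_all add: assms)
  then show ?thesis
    unfolding minors_ideal_def by (rule ring.genideal_minimal[OF ring]) (use min in blast)
qed

text \<open>By the Jacobi identity \<open>br b\<close> acts on an entry by replacing its row index
  or its column index by a combination of indices. With Jacobi's formula the derivative of a minor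
  becomes a combination of minors with one row or one column exchanged.\<close>

lemma minors_ideal_stable:
  assumes "a \<in> minors_ideal br x n d"
  shows "br b a \<in> minors_ideal br x n d"
proof -
  let ?J = "minors_ideal br x n d"
  have "?J \<subseteq> {a \<in> ?J. br b a \<in> ?J}"
  proof (rule minors_ideal_subset)
    fix "is" js assume ij: "is \<in> incr_tuples n d" "js \<in> incr_tuples n d"
    then have len: "length is = d" "length js = d" and set: "set is \<subseteq> {..<n}" "set js \<subseteq> {..<n}"
      by (auto simp: incr_tuples_def)
    have mem: "minor br x is js \<in> ?J" by (rule minor_mem_minors_ideal[OF len set])
    obtain g where g: "\<And>i y. br (br b (x i)) y = (\<Sum>k<n. g i k * br (x k) y)"
      using br_combination[of "br b (x i)" for i] by metis
    have entry: "br b (br (x i) (x j)) = (\<Sum>k<n. g i k * br (x k) (x j)) + (\<Sum>k<n. g j k * br (x i) (x k))" for i j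
    proof -
      have "br b (br (x i) (x j)) = br (br b (x i)) (x j) + br (x i) (br b (x j))"
        using br_jacobi[of b "x i" "x j"] br_anti[of "x j" b] br_anti[of "br b (x i)" "x j"]
        by (simp add: br_minus add_eq_0_iff algebra_simps)
      also have "br (x i) (br b (x j)) = - br (br b (x j)) (x i)" by (rule br_anti)
      also have "\<dots> = (\<Sum>k<n. g j k * br (x i) (x k))"
        unfolding g sum_negf[symmetric] by (rule sum.cong) (simp_all add: br_anti[of "x i"])
      finally show ?thesis by (simp add: g)
    qed
    have "br b (minor br x is js) = br b (det (poisson_minor_matrix br x is js))"
      by (simp add: minor_def poisson_minor_matrix_def)
    also have "\<dots> = (\<Sum>s<d. \<Sum>t<d. br b (poisson_minor_matrix br x is js $$ (s, t)) * minor_cofactor br x is js s t)"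
      unfolding minor_cofactor_def
      by (rule det_derivation) (simp_all add: poisson_minor_matrix_def len br_simps br_leibniz mult.commute add.commute)
    also have "\<dots> = (\<Sum>s<d. \<Sum>t<d. br b (br (x (is ! s)) (x (js ! t))) * minor_cofactor br x is js s t)"
      by (intro sum.cong refl) (simp add: poisson_minor_matrix_def len)
    also have "\<dots> = (\<Sum>s<d. \<Sum>k<n. g (is ! s) k * (\<Sum>t<d. br (x k) (x (js ! t)) * minor_cofactor br x is js s t))
        + (\<Sum>t<d. \<Sum>k<n. g (js ! t) k * (\<Sum>s<d. br (x (is ! s)) (x k) * minor_cofactor br x is js s t))"
    proof -
      have "(\<Sum>s<d. \<Sum>t<d. (\<Sum>k<n. g (is ! s) k * br (x k) (x (js ! t))) * minor_cofactor br x is js s t)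
          = (\<Sum>s<d. \<Sum>k<n. g (is ! s) k * (\<Sum>t<d. br (x k) (x (js ! t)) * minor_cofactor br x is js s t))"
        unfolding sum_distrib_left sum_distrib_right mult.assoc by (rule sum.cong[OF refl], rule sum.swap)
      moreover have "(\<Sum>s<d. \<Sum>t<d. (\<Sum>k<n. g (js ! t) k * br (x (is ! s)) (x k)) * minor_cofactor br x is js s t)
          = (\<Sum>t<d. \<Sum>k<n. g (js ! t) k * (\<Sum>s<d. br (x (is ! s)) (x k) * minor_cofactor br x is js s t))"
        unfolding sum_distrib_left sum_distrib_right mult.assoc
        by (subst sum.swap, rule sum.cong[OF refl], rule sum.swap)
      ultimately show ?thesis by (simp add: entry distrib_right sum.distrib)
    qed
    also have "\<dots> \<in> ?J"
    proof (rule minors_ideal_closed(2))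
      show "(\<Sum>s<d. \<Sum>k<n. g (is ! s) k * (\<Sum>t<d. br (x k) (x (js ! t)) * minor_cofactor br x is js s t)) \<in> ?J"
      proof (rule minors_ideal_sum, rule minors_ideal_sum, rule minors_ideal_closed(3))
        fix s k assume s: "s \<in> {..<d}" and k: "k \<in> {..<n}"
        have "(\<Sum>t<d. br (x k) (x (js ! t)) * minor_cofactor br x is js s t) = minor br x (is[s := k]) js"
          using s by (intro minor_replace_row[OF len]) simp
        also have "\<dots> \<in> ?J"
          using set_update_subset_insert[of "is" s k] set k len by (intro minor_mem_minors_ideal) auto
        finally show "(\<Sum>t<d. br (x k) (x (js ! t)) * minor_cofactor br x is js s t) \<in> ?J" .
      qed
      show "(\<Sum>t<d. \<Sum>k<n. g (js ! t) k * (\<Sum>s<d. br (x (is ! s)) (x k) * minor_cofactor br x is js s t)) \<in> ?J"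
      proof (rule minors_ideal_sum, rule minors_ideal_sum, rule minors_ideal_closed(3))
        fix t k assume t: "t \<in> {..<d}" and k: "k \<in> {..<n}"
        have "(\<Sum>s<d. br (x (is ! s)) (x k) * minor_cofactor br x is js s t) = minor br x is (js[t := k])"
          using t by (intro minor_replace_column[OF len]) simp
        also have "\<dots> \<in> ?J"
          using set_update_subset_insert[of js t k] set k len by (intro minor_mem_minors_ideal) auto
        finally show "(\<Sum>s<d. br (x (is ! s)) (x k) * minor_cofactor br x is js s t) \<in> ?J" .
      qed
    qed
    finally show "minor br x is js \<in> {a \<in> ?J. br b a \<in> ?J}" using mem by blast
  next
    have "br b 0 = 0" using br_simps(1)[of b 0 0] by (metis add_cancel_left_left add_0)
    then show "0 \<in> {a \<in> ?J. br b a \<in> ?J}" using minors_ideal_closed(1) by simp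
  next
    fix r a assume a: "a \<in> {a \<in> ?J. br b a \<in> ?J}"
    have "br b (r * a) = br b r * a + r * br b a" by (rule br_leibniz)
    then show "r * a \<in> {a \<in> ?J. br b a \<in> ?J}" using a by (simp add: minors_ideal_closed)
  qed (simp add: minors_ideal_closed br_simps)
  then show ?thesis using assms by blast
qed

end

section \<open>Injectivity of the canonical homomorphism\<close>

context ess_poisson
begin

text \<open>Equality in the enveloping algebra, read on representatives, so that calculations can
  take place in the free algebra.\<close>

definition ueq :: "('k, 'a) free_alg \<Rightarrow> ('k, 'a) free_alg \<Rightarrow> bool" (infix "\<approx>" 50) where
  "u \<approx> v \<longleftrightarrow> u - v \<in> U_ideal scale br"

abbreviation mul :: "'a \<Rightarrow> ('k, 'a) free_alg" where "mul a \<equiv> fgen (Mul a)"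
abbreviation ham :: "'a \<Rightarrow> ('k, 'a) free_alg" where "ham a \<equiv> fgen (Ham a)"

lemma U_ideal_closed:
  "0 \<in> U_ideal scale br"
  "u \<in> U_ideal scale br \<Longrightarrow> v \<in> U_ideal scale br \<Longrightarrow> u + v \<in> U_ideal scale br"
  "u \<in> U_ideal scale br \<Longrightarrow> w * u \<in> U_ideal scale br"
  "u \<in> U_ideal scale br \<Longrightarrow> u * w \<in> U_ideal scale br"
  "u \<in> U_ideal scale br \<Longrightarrow> - u \<in> U_ideal scale br"
  "u \<in> U_ideal scale br \<Longrightarrow> v \<in> U_ideal scale br \<Longrightarrow> u - v \<in> U_ideal scale br"
proof -
  interpret I: ideal "U_ideal scale br" class_ring by (rule U_ideal_ideal)
  show "0 \<in> U_ideal scale br"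
    using additive_subgroup.zero_closed[OF I.additive_subgroup_axioms] by simp
  show add: "u + v \<in> U_ideal scale br" if "u \<in> U_ideal scale br" "v \<in> U_ideal scale br" for u v
    using additive_subgroup.a_closed[OF I.additive_subgroup_axioms that] by simp
  show left: "w * u \<in> U_ideal scale br" if "u \<in> U_ideal scale br" for u w
    using I.I_l_closed[OF that, of w] by simp
  show "u * w \<in> U_ideal scale br" if "u \<in> U_ideal scale br"
    using I.I_r_closed[OF that, of w] by simp
  show minus: "- u \<in> U_ideal scale br" if "u \<in> U_ideal scale br" for u
    using left[OF that, of "- 1"] by simp
  show "u - v \<in> U_ideal scale br" if "u \<in> U_ideal scale br" "v \<in> U_ideal scale br"
    using add[OF that(1) minus[OF that(2)]] by simp
qed

lemma U_ideal_commutator: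
  "u \<in> U_ideal scale br \<Longrightarrow> u * w - w * u \<in> U_ideal scale br"
  "u \<in> U_ideal scale br \<Longrightarrow> w * u - u * w \<in> U_ideal scale br"
  by (rule U_ideal_closed(6); erule U_ideal_closed(3,4))+

lemma U_relation_mem: "u \<in> U_relations scale br \<Longrightarrow> u \<in> U_ideal scale br"
  unfolding U_ideal_def using ring.genideal_self[OF free_alg_ring, of "U_relations scale br"] by auto

lemma ueq_relations:
  "mul 1 \<approx> 1" "mul (a + b) \<approx> mul a + mul b" "mul (scale c a) \<approx> fconst c * mul a"
  "mul (a * b) \<approx> mul a * mul b" "ham (a + b) \<approx> ham a + ham b" "ham (scale c a) \<approx> fconst c * ham a"
  "ham (br a b) \<approx> ham a * ham b - ham b * ham a" "ham a * mul b - mul b * ham a \<approx> mul (br a b)"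
  "ham (a * b) \<approx> mul a * ham b + mul b * ham a"
  unfolding ueq_def by (rule U_relation_mem, unfold U_relations_def, blast)+

lemma ueq_refl [simp]: "u \<approx> u"
  by (simp add: ueq_def U_ideal_closed)

lemma ueq_sym: "u \<approx> v \<Longrightarrow> v \<approx> u"
  unfolding ueq_def using U_ideal_closed(5)[of "u - v"] by simp

lemma ueq_trans [trans]: "u \<approx> v \<Longrightarrow> v \<approx> w \<Longrightarrow> u \<approx> w"
  unfolding ueq_def using U_ideal_closed(2)[of "u - v" "v - w"] by simp

lemma ueq_add: "u \<approx> v \<Longrightarrow> u' \<approx> v' \<Longrightarrow> u + u' \<approx> v + v'"
  unfolding ueq_def using U_ideal_closed(2)[of "u - v" "u' - v'"] by (simp add: algebra_simps)

lemma ueq_diff: "u \<approx> v \<Longrightarrow> u' \<approx> v' \<Longrightarrow> u - u' \<approx> v - v'"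
  unfolding ueq_def using U_ideal_closed(6)[of "u - v" "u' - v'"] by (simp add: algebra_simps)

lemma ueq_mult: "u \<approx> v \<Longrightarrow> u' \<approx> v' \<Longrightarrow> u * u' \<approx> v * v'"
proof -
  assume "u \<approx> v" "u' \<approx> v'"
  then have "(u - v) * u' + v * (u' - v') \<in> U_ideal scale br"
    unfolding ueq_def by (intro U_ideal_closed(2) U_ideal_closed(3,4))
  then show ?thesis unfolding ueq_def by (simp add: algebra_simps)
qed

lemma ueq_sum: "(\<And>i. i \<in> I \<Longrightarrow> f i \<approx> g i) \<Longrightarrow> sum f I \<approx> sum g I"
  by (induction I rule: infinite_finite_induct) (auto intro: ueq_add)

lemma ueq_zero_iff: "u \<approx> 0 \<longleftrightarrow> u \<in> U_ideal scale br"
  by (simp add: ueq_def)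

lemma ueq_mem: "u \<approx> v \<Longrightarrow> v \<in> U_ideal scale br \<Longrightarrow> u \<in> U_ideal scale br"
  using ueq_trans[of u v 0] by (simp add: ueq_zero_iff)

lemma mul_zero: "mul 0 \<approx> 0"
  using U_ideal_closed(5)[OF ueq_relations(2)[of 0 0, unfolded ueq_def]] by (simp add: ueq_def)

lemma mul_sum: "mul (sum f I) \<approx> (\<Sum>i\<in>I. mul (f i))"
proof (induction I rule: infinite_finite_induct)
  case (insert i I)
  have "mul (sum f (insert i I)) \<approx> mul (f i) + mul (sum f I)" using insert by (simp add: ueq_relations(2))
  also have "\<dots> \<approx> (\<Sum>i\<in>insert i I. mul (f i))" using insert by (simp add: ueq_add)
  finally show ?case .
qed (simp_all add: mul_zero)

lemma mul_commute: "mul a * mul b \<approx> mul b * mul a"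
  using ueq_trans[OF ueq_sym[OF ueq_relations(4)[of a b]]] ueq_relations(4)[of b a] by (simp add: mult.commute)

lemma ham_one: "ham 1 \<approx> 0"
proof -
  have "ham (1 * 1) \<approx> mul 1 * ham 1 + mul 1 * ham 1" by (rule ueq_relations(9))
  also have "\<dots> \<approx> 1 * ham 1 + 1 * ham 1" by (intro ueq_add ueq_mult ueq_relations(1) ueq_refl)
  finally have "- (ham 1 - (ham 1 + ham 1)) \<in> U_ideal scale br"
    unfolding ueq_def by (intro U_ideal_closed(5)) simp
  then show ?thesis by (simp add: ueq_def)
qed

lemma fconst_mul: "fconst c \<approx> mul (scale c 1)"
proof -
  have "fconst c = fconst c * 1" by simp
  also have "\<dots> \<approx> fconst c * mul 1" by (intro ueq_mult ueq_refl ueq_sym[OF ueq_relations(1)])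
  also have "\<dots> \<approx> mul (scale c 1)" by (rule ueq_sym[OF ueq_relations(3)])
  finally show ?thesis .
qed

text \<open>\<open>filtered 0\<close> is the ideal, and \<open>filtered (Suc k)\<close> describes the elements of degree at most \<open>k\<close>
  in the generators \<open>Ham a\<close>, up to the ideal.\<close>

inductive filtered :: "nat \<Rightarrow> ('k, 'a) free_alg \<Rightarrow> bool" where
  ideal: "u \<in> U_ideal scale br \<Longrightarrow> filtered 0 u"
| mul: "filtered (Suc 0) (mul a)"
| ham: "filtered (Suc (Suc 0)) (ham a)"
| add: "filtered k u \<Longrightarrow> filtered k v \<Longrightarrow> filtered k (u + v)"
| mult: "filtered (Suc i) u \<Longrightarrow> filtered (Suc j) v \<Longrightarrow> filtered (Suc (i + j)) (u * v)"
| weaken: "filtered k u \<Longrightarrow> filtered (Suc k) u"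

lemma filtered_0: "filtered 0 u \<longleftrightarrow> u \<in> U_ideal scale br"
proof
  have "k = 0 \<longrightarrow> u \<in> U_ideal scale br" if "filtered k u" for k u
    using that by induction (auto simp: U_ideal_closed)
  then show "filtered 0 u \<Longrightarrow> u \<in> U_ideal scale br" by blast
qed (rule filtered.ideal)

lemma filtered_mono: "filtered k u \<Longrightarrow> k \<le> l \<Longrightarrow> filtered l u"
  by (induction l) (auto simp: le_Suc_eq intro: filtered.weaken)

lemma filtered_ideal: "u \<in> U_ideal scale br \<Longrightarrow> filtered k u"
  using filtered_mono[OF filtered.ideal] by simp

lemma filtered_cong: "u \<approx> v \<Longrightarrow> filtered k v \<Longrightarrow> filtered k u"
  using filtered.add[of k "u - v" v] filtered_ideal[of "u - v" k] by (simp add: ueq_def)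

lemma filtered_mult_left: "filtered i u \<Longrightarrow> filtered (Suc j) v \<Longrightarrow> filtered (i + j) (u * v)"
  by (cases i) (auto simp: filtered_0 U_ideal_closed intro: filtered_ideal filtered.mult)

lemma filtered_mult_right: "filtered (Suc i) u \<Longrightarrow> filtered j v \<Longrightarrow> filtered (i + j) (u * v)"
  by (cases j) (auto simp: filtered_0 U_ideal_closed intro: filtered_ideal filtered.mult)

lemma filtered_fconst: "filtered (Suc 0) (fconst c)"
  by (rule filtered_cong[OF fconst_mul filtered.mul])

lemma fconst_simps: "fconst (c + d) = fconst c + fconst d" "fconst (c * d) = fconst c * fconst d"
  "fconst 1 = 1" "fconst (- 1) = - 1" "fconst 0 = 0"
  by (simp_all add: fconst_def single_add mult_single single_uminus)

lemma filtered_uminus: "filtered k u \<Longrightarrow> filtered k (- u)"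
  using filtered_mult_right[OF filtered_fconst, of k u "- 1"] by (simp add: fconst_simps)

lemma filtered_diff: "filtered k u \<Longrightarrow> filtered k v \<Longrightarrow> filtered k (u - v)"
  using filtered.add[of k u "- v"] filtered_uminus[of k v] by simp

lemma filtered_sum: "(\<And>i. i \<in> I \<Longrightarrow> filtered k (f i)) \<Longrightarrow> filtered k (sum f I)"
  by (induction I rule: infinite_finite_induct) (auto simp: U_ideal_closed intro: filtered_ideal filtered.add)

lemma of_nat_fconst: "of_nat m = fconst (of_nat m)"
  by (induction m) (simp_all add: fconst_simps)

lemma filtered_of_nat: "filtered k u \<Longrightarrow> filtered k (of_nat m * u)"
  using filtered_mult_right[OF filtered_fconst, of k u "of_nat m"] by (simp add: of_nat_fconst[symmetric])

lemma filtered_exhaust: "\<exists>k. filtered k u"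
proof (induction u rule: update_induct)
  case const
  then show ?case using filtered_ideal[OF U_ideal_closed(1)] by blast
next
  case (update f w c)
  have word: "\<exists>k. filtered (Suc k) (Poly_Mapping.single (Word gs) 1)" for gs
  proof (induction gs)
    case Nil
    have "Poly_Mapping.single (Word []) 1 = (fconst 1 :: ('k, 'a) free_alg)"
      by (simp add: fconst_def zero_free_monoid_def)
    then show ?case using filtered_fconst[of 1] by metis
  next
    case (Cons g gs)
    then obtain k where k: "filtered (Suc k) (Poly_Mapping.single (Word gs) 1)" by blast
    have g: "\<exists>j. filtered (Suc j) (fgen g)"
      by (cases g) (use filtered.mul filtered.ham in blast)+
    have "Poly_Mapping.single (Word (g # gs)) (1::'k) = fgen g * Poly_Mapping.single (Word gs) 1"
      by (simp add: fgen_def mult_single plus_free_monoid_def)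
    then show ?case using g k filtered.mult by metis
  qed
  obtain k where k: "filtered (Suc k) (Poly_Mapping.single (Word (letters w)) 1)" using word by blast
  have "Poly_Mapping.single w c = fconst c * Poly_Mapping.single (Word (letters w)) 1"
    by (simp add: fconst_def mult_single)
  then have "filtered (Suc k) (Poly_Mapping.single w c)"
    using filtered.mult[OF filtered_fconst k] by simp
  moreover obtain l where "filtered l f" using update by blast
  ultimately have "filtered (Suc k + l) (Poly_Mapping.single w c + f)"
    by (intro filtered.add) (auto elim: filtered_mono)
  then show ?case using update by (auto simp: update_eq_add)
qed

lemma filtered_commutator_mul: "filtered l v \<Longrightarrow> filtered (l - 1) (mul a * v - v * mul a)"
proof (induction rule: filtered.induct)
  case (ideal u)
  then show ?case by (simp add: filtered_0 U_ideal_commutator)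
next
  case (mul b)
  then show ?case using mul_commute[of a b] by (simp add: filtered_0 ueq_def)
next
  case (ham b)
  have "mul a * ham b - ham b * mul a = - (ham b * mul a - mul a * ham b)" by simp
  then show ?case
    using filtered_uminus[OF filtered_cong[OF ueq_relations(8)[of b a] filtered.mul]] by simp
next
  case (add k u v)
  have "mul a * (u + v) - (u + v) * mul a = (mul a * u - u * mul a) + (mul a * v - v * mul a)"
    by (simp add: algebra_simps)
  then show ?case using filtered.add[OF add.IH] by simp
next
  case (mult i u j v)
  have eq: "mul a * (u * v) - (u * v) * mul a = (mul a * u - u * mul a) * v + u * (mul a * v - v * mul a)"
    by (simp add: algebra_simps)
  have "filtered (i + j) ((mul a * u - u * mul a) * v)"
    using filtered_mult_left[of i _ j v] mult by simp
  moreover have "filtered (i + j) (u * (mul a * v - v * mul a))"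
    using filtered_mult_right[of i u j] mult by simp
  ultimately show ?case unfolding eq using filtered.add by simp
next
  case (weaken k u)
  then show ?case using filtered_mono[of "k - 1" _ k] by simp
qed

lemma filtered_commutator_ham: "filtered l v \<Longrightarrow> filtered l (ham a * v - v * ham a)"
proof (induction rule: filtered.induct)
  case (ideal u)
  then show ?case by (simp add: filtered_0 U_ideal_commutator)
next
  case (mul b)
  show ?case by (rule filtered_cong[OF ueq_relations(8) filtered.mul])
next
  case (ham b)
  show ?case by (rule filtered_cong[OF ueq_sym[OF ueq_relations(7)] filtered.ham])
next
  case (add k u v)
  have "ham a * (u + v) - (u + v) * ham a = (ham a * u - u * ham a) + (ham a * v - v * ham a)"
    by (simp add: algebra_simps)
  then show ?case using filtered.add[OF add.IH] by simp
next
  case (mult i u j v)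
  have eq: "ham a * (u * v) - (u * v) * ham a = (ham a * u - u * ham a) * v + u * (ham a * v - v * ham a)"
    by (simp add: algebra_simps)
  show ?case unfolding eq by (intro filtered.add filtered.mult mult)
qed (auto intro: filtered.weaken)

text \<open>Commutators lower the degree by one, so the associated graded algebra is commutative.
  Indices are degrees plus one: the degree \<open>(k - 1) + (l - 1) - 1\<close> has the index
  \<open>k + l - 2\<close>.\<close>

lemma filtered_commutator: "filtered k u \<Longrightarrow> filtered l v \<Longrightarrow> filtered (k + l - 2) (u * v - v * u)"
proof (induction arbitrary: l v rule: filtered.induct)
  case (ideal u)
  then show ?case by (intro filtered_ideal U_ideal_commutator)
next
  case (mul a)
  have "Suc 0 + l - 2 = l - 1" by simp
  then show ?case using filtered_commutator_mul[OF mul, of a] by (simp only:)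
next
  case (ham a)
  have "Suc (Suc 0) + l - 2 = l" by simp
  then show ?case using filtered_commutator_ham[OF ham, of a] by (simp only:)
next
  case (add k u u')
  have "(u + u') * v - v * (u + u') = (u * v - v * u) + (u' * v - v * u')"
    by (simp add: algebra_simps)
  then show ?case using filtered.add[OF add.IH[OF add.prems]] by simp
next
  case (mult i u j u')
  have eq: "(u * u') * v - v * (u * u') = u * (u' * v - v * u') + (u * v - v * u) * u'"
    by (simp add: algebra_simps)
  show ?case
  proof (cases l)
    case 0
    then show ?thesis using mult.prems unfolding filtered_0[symmetric] by (intro filtered_ideal U_ideal_commutator) (simp add: filtered_0)
  next
    case (Suc m)
    have "filtered (i + (j + m)) (u * (u' * v - v * u'))"
      using filtered_mult_right[OF mult.hyps(1), of "j + m"] mult.IH(2)[OF mult.prems] Suc by simp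
    moreover have "filtered ((i + m) + j) ((u * v - v * u) * u')"
      using filtered_mult_left[OF _ mult.hyps(2), of "i + m"] mult.IH(1)[OF mult.prems] Suc by simp
    ultimately show ?thesis
      unfolding eq using filtered.add[of "i + j + m"] Suc by (simp add: ac_simps)
  qed
next
  case (weaken k u)
  then show ?case using filtered_mono[of "k + l - 2" _ "Suc k + l - 2"] by simp
qed

text \<open>Euler's identity: on symbols of degree \<open>k\<close>, the operator \<open>\<Sum>\<^sub>t [\<cdot>, y\<^sub>t] E\<^sub>t\<close> is multiplication
  by \<open>k\<mu>\<close>.\<close>

lemma filtered_euler:
  assumes E: "\<And>t. t < d \<Longrightarrow> filtered 2 (E t)"
    and ham: "\<And>a. mul \<mu> * ham a \<approx> (\<Sum>t<d. mul (br a (y t)) * E t)"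
  shows "filtered k u \<Longrightarrow>
    filtered (k - 1) (of_nat (k - 1) * (mul \<mu> * u) - (\<Sum>t<d. (u * mul (y t) - mul (y t) * u) * E t))"
proof (induction rule: filtered.induct)
  case (ideal u)
  have "(\<Sum>t<d. (u * mul (y t) - mul (y t) * u) * E t) \<in> U_ideal scale br"
    unfolding filtered_0[symmetric] using ideal
    by (intro filtered_sum) (simp add: filtered_0 U_ideal_commutator U_ideal_closed)
  then show ?case using U_ideal_closed(5) by (auto simp: filtered_0)
next
  case (mul a)
  have "(\<Sum>t<d. (mul a * mul (y t) - mul (y t) * mul a) * E t) \<approx> (\<Sum>t<d. 0 * E t)"
    using mul_commute[of a] by (intro ueq_sum ueq_mult ueq_refl) (simp add: ueq_def)
  then show ?case using U_ideal_closed(5) by (auto simp: filtered_0 ueq_def)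
next
  case (ham a)
  have "(\<Sum>t<d. (ham a * mul (y t) - mul (y t) * ham a) * E t) \<approx> (\<Sum>t<d. mul (br a (y t)) * E t)"
    by (intro ueq_sum ueq_mult ueq_refl ueq_relations(8))
  also have "\<dots> \<approx> mul \<mu> * ham a" by (rule ueq_sym[OF assms(2)])
  finally have "mul \<mu> * ham a - (\<Sum>t<d. (ham a * mul (y t) - mul (y t) * ham a) * E t) \<in> U_ideal scale br"
    using ueq_sym by (auto simp: ueq_def)
  then show ?case by (simp add: filtered_ideal)
next
  case (add k u v)
  have "of_nat (k - 1) * (mul \<mu> * (u + v)) - (\<Sum>t<d. ((u + v) * mul (y t) - mul (y t) * (u + v)) * E t)
      = (of_nat (k - 1) * (mul \<mu> * u) - (\<Sum>t<d. (u * mul (y t) - mul (y t) * u) * E t))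
      + (of_nat (k - 1) * (mul \<mu> * v) - (\<Sum>t<d. (v * mul (y t) - mul (y t) * v) * E t))"
    by (simp add: distrib_left distrib_right left_diff_distrib sum.distrib sum_subtractf)
  then show ?case using filtered.add[OF add.IH] by simp
next
  case (mult i u j v)
  let ?c = "\<lambda>w t. w * mul (y t) - mul (y t) * w"
  let ?B = "of_nat j * (mul \<mu> * v) - (\<Sum>t<d. ?c v t * E t)"
  let ?A = "of_nat i * (mul \<mu> * u) - (\<Sum>t<d. ?c u t * E t)"
  have nat: "of_nat m * w = w * of_nat m" for m and w :: "('k, 'a) free_alg"
    unfolding of_nat_fconst by (rule fconst_central)
  \<comment> \<open>Commutation with \<open>y t\<close> obeys the product rule. Moving
    \<open>E t\<close> past \<open>v\<close> then costs the product of two commutators, which has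
    lower degree.\<close>
  have summand: "?c (u * v) t * E t = u * (?c v t * E t) + (?c u t * E t) * v - ?c u t * (E t * v - v * E t)" for t
    by (simp add: algebra_simps)
  have main: "of_nat (i + j) * (mul \<mu> * (u * v)) = u * (of_nat j * (mul \<mu> * v))
      - of_nat j * ((u * mul \<mu> - mul \<mu> * u) * v) + (of_nat i * (mul \<mu> * u)) * v"
  proof -
    have "u * (of_nat j * (mul \<mu> * v)) = of_nat j * (u * (mul \<mu> * v))"
      by (simp only: mult.assoc[symmetric] nat[of j u])
    then show ?thesis by (simp add: algebra_simps)
  qed
  have eq: "of_nat (i + j) * (mul \<mu> * (u * v)) - (\<Sum>t<d. ?c (u * v) t * E t)
      = u * ?B - of_nat j * ((u * mul \<mu> - mul \<mu> * u) * v) + ?A * v + (\<Sum>t<d. ?c u t * (E t * v - v * E t))"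
    unfolding main summand
    by (simp add: sum.distrib sum_subtractf right_diff_distrib left_diff_distrib sum_distrib_left sum_distrib_right)
  have A: "filtered i ?A" and B: "filtered j ?B" using mult.IH by simp_all
  have c: "filtered i (?c u t)" "filtered i (u * mul \<mu> - mul \<mu> * u)" for t
    using filtered_commutator[OF mult.hyps(1) filtered.mul] by simp_all
  have "filtered (i + j) (u * ?B)" by (rule filtered_mult_right[OF mult.hyps(1) B])
  moreover have "filtered (i + j) (of_nat j * ((u * mul \<mu> - mul \<mu> * u) * v))"
    by (intro filtered_of_nat filtered_mult_left[OF c(2) mult.hyps(2)])
  moreover have "filtered (i + j) (?A * v)" by (rule filtered_mult_left[OF A mult.hyps(2)])
  moreover have "filtered (i + j) (\<Sum>t<d. ?c u t * (E t * v - v * E t))"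
  proof (rule filtered_sum)
    fix t assume "t \<in> {..<d}"
    then have "filtered (Suc j) (E t * v - v * E t)"
      using filtered_commutator[OF E mult.hyps(2), of t] by simp
    then show "filtered (i + j) (?c u t * (E t * v - v * E t))" by (rule filtered_mult_left[OF c(1)])
  qed
  ultimately have "filtered (i + j) (of_nat (i + j) * (mul \<mu> * (u * v)) - (\<Sum>t<d. ?c (u * v) t * E t))"
    unfolding eq by (intro filtered.add filtered_diff)
  then show ?case by simp
next
  case (weaken k u)
  show ?case
  proof (cases k)
    case 0
    then show ?thesis using weaken by simp
  next
    case (Suc j)
    \<comment> \<open>Raising the index by one raises the integer factor by one; the surplus
      \<open>mul \<mu> * u\<close> still has the degree allowed.\<close>
    have eq: "of_nat (Suc j) * (mul \<mu> * u) - (\<Sum>t<d. (u * mul (y t) - mul (y t) * u) * E t)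
        = (of_nat j * (mul \<mu> * u) - (\<Sum>t<d. (u * mul (y t) - mul (y t) * u) * E t)) + mul \<mu> * u"
      by (simp add: algebra_simps)
    have "filtered (Suc j) (of_nat j * (mul \<mu> * u) - (\<Sum>t<d. (u * mul (y t) - mul (y t) * u) * E t))"
      using weaken.IH Suc filtered.weaken by simp
    moreover have "filtered (Suc j) (mul \<mu> * u)"
      using filtered_mult_right[OF filtered.mul, of "Suc j" u \<mu>] weaken.hyps Suc by simp
    ultimately have "filtered (Suc j) (of_nat (Suc j) * (mul \<mu> * u) - (\<Sum>t<d. (u * mul (y t) - mul (y t) * u) * E t))"
      unfolding eq by (rule filtered.add)
    then show ?thesis using Suc by simp
  qed
qed


section \<open>Representatives of the generators of \<open>kappa\<close>\<close>

abbreviation proj :: "('k, 'a) free_alg \<Rightarrow> ('k, 'a) free_alg set" where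
  "proj u \<equiv> U_ideal scale br +>\<^bsub>class_ring\<^esub> u"

lemma proj_add: "proj u \<oplus>\<^bsub>U scale br\<^esub> proj v = proj (u + v)"
  and proj_mult: "proj u \<otimes>\<^bsub>U scale br\<^esub> proj v = proj (u * v)"
  and proj_zero: "\<zero>\<^bsub>U scale br\<^esub> = proj 0"
  and proj_mem: "proj u \<in> carrier (U scale br)"
proof -
  interpret Q: ring_hom_ring class_ring "U scale br"
      "\<lambda>p :: ('k, 'a) free_alg. U_ideal scale br +>\<^bsub>class_ring\<^esub> p"
    by (rule U_proj_hom_ring)
  show "proj u \<oplus>\<^bsub>U scale br\<^esub> proj v = proj (u + v)" using Q.hom_add[of u v] by simp
  show "proj u \<otimes>\<^bsub>U scale br\<^esub> proj v = proj (u * v)" using Q.hom_mult[of u v] by simp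
  show "\<zero>\<^bsub>U scale br\<^esub> = proj 0" using Q.hom_zero by simp
  show "proj u \<in> carrier (U scale br)" by (simp add: U_proj_surj)
qed

lemma proj_sum:
  assumes "finite I"
  shows "(\<Oplus>\<^bsub>U scale br\<^esub>i\<in>I. proj (f i)) = proj (\<Sum>i\<in>I. f i)"
  using assms
proof (induction I)
  case empty
  interpret ring "U scale br" by (rule U_ring)
  show ?case by (simp add: proj_zero)
next
  case (insert i I)
  interpret ring "U scale br" by (rule U_ring)
  have "(\<Oplus>\<^bsub>U scale br\<^esub>i\<in>insert i I. proj (f i)) = proj (f i) \<oplus>\<^bsub>U scale br\<^esub> (\<Oplus>\<^bsub>U scale br\<^esub>i\<in>I. proj (f i))"
    by (rule finsum_insert[OF insert(1,2)]) (auto simp: proj_mem)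
  then show ?case using insert by (simp add: proj_add)
qed

lemma proj_eq_iff: "proj u = proj v \<longleftrightarrow> u \<approx> v"
proof -
  have mem: "w \<in> proj u \<longleftrightarrow> w \<approx> u" for u w
  proof
    assume "w \<in> proj u"
    then obtain i where "i \<in> U_ideal scale br" "w = i + u" by (auto simp: a_r_coset_def r_coset_def)
    then show "w \<approx> u" by (simp add: ueq_def)
  next
    assume "w \<approx> u"
    then have "w - u \<in> U_ideal scale br" by (simp add: ueq_def)
    moreover have "w = (w - u) + u" by simp
    ultimately show "w \<in> proj u" unfolding a_r_coset_def r_coset_def
      by (simp, intro bexI[of _ "w - u"]) simp_all
  qed
  show ?thesis
  proof
    assume "proj u = proj v"
    then have "u \<in> proj v" using mem[of u u] by simp
    then show "u \<approx> v" by (simp add: mem)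
  next
    assume "u \<approx> v"
    then show "proj u = proj v" using ueq_trans[of _ u v] ueq_trans[OF _ ueq_sym, of _ v u] mem by blast
  qed
qed

lemma proj_cases:
  assumes "y \<in> carrier (U scale br)" obtains u where "y = proj u"
  using assms that by (auto simp: U_proj_surj)

text \<open>Deleting the appended last row leaves the same rows as deleting row \<open>s\<close>
  from the original, so Laplace expansion along it yields the old cofactors. The last row has the
  index \<open>d - 1\<close>, which accounts for the minus sign.\<close>

lemma minor_move_row:
  assumes len: "length is = d" "length js = d" and s: "s < d"
  shows "(- 1) ^ (s + d) * minor br x (take s is @ drop (Suc s) is @ [\<nu>]) js
    = - (\<Sum>t<d. br (x \<nu>) (x (js ! t)) * minor_cofactor br x is js s t)"
proof -
  let ?js = "take s is @ drop (Suc s) is @ [\<nu>]"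
  let ?M = "poisson_minor_matrix br x is js" and ?N = "poisson_minor_matrix br x ?js js"
  obtain e where e: "d = Suc e" using s by (cases d) auto
  have len': "length ?js = d" using len s by simp
  have N: "?N \<in> carrier_mat d d" unfolding poisson_minor_matrix_def len' len by simp
  have last: "?js ! e = \<nu>" using len s e by (simp add: nth_append)
  have nth: "?js ! i = is ! (if i < s then i else Suc i)" if "i < e" for i
    using len s e that by (auto simp: nth_append)
  have dims: "dim_row ?N = Suc e" "dim_col ?N = Suc e" "dim_row ?M = Suc e" "dim_col ?M = Suc e"
    using carrier_matD[OF N] e len by (auto simp: poisson_minor_matrix_def)
  have del: "mat_delete ?N e t = mat_delete ?M s t" if t: "t < d" for t
  proof (rule eq_matI)
    fix i j assume "i < dim_row (mat_delete ?M s t)" "j < dim_col (mat_delete ?M s t)"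
    then have ij: "i < e" "j < e" using dims by (auto simp: mat_delete_def)
    let ?j = "if j < t then j else Suc j" and ?i = "if i < s then i else Suc i"
    have "mat_delete ?N e t $$ (i, j) = ?N $$ (i, ?j)"
      using ij t by (simp add: mat_delete_def dims)
    also have "\<dots> = br (x (is ! ?i)) (x (js ! ?j))"
      using ij e by (subst poisson_minor_matrix_def) (simp add: len' len nth del: append_assoc)
    also have "\<dots> = mat_delete ?M s t $$ (i, j)"
      using ij e by (simp add: mat_delete_def poisson_minor_matrix_def len)
    finally show "mat_delete ?N e t $$ (i, j) = mat_delete ?M s t $$ (i, j)" .
  qed (simp_all add: dims mat_delete_def)
  have cof: "(- 1) ^ (s + d) * cofactor ?N e t = - minor_cofactor br x is js s t" if "t < d" for t
    using del[OF that] e by (simp add: minor_cofactor_def cofactor_def power_add mult.assoc[symmetric])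
  have "minor br x ?js js = (\<Sum>t<d. ?N $$ (e, t) * cofactor ?N e t)"
    using laplace_expansion_row[OF N, of e] e by (simp add: minor_def poisson_minor_matrix_def)
  also have "\<dots> = (\<Sum>t<d. br (x \<nu>) (x (js ! t)) * cofactor ?N e t)"
    using e len len' last by (intro sum.cong refl) (simp add: poisson_minor_matrix_def del: append_assoc)
  finally have "(- 1) ^ (s + d) * minor br x ?js js
      = (\<Sum>t<d. br (x \<nu>) (x (js ! t)) * ((- 1) ^ (s + d) * cofactor ?N e t))"
    by (simp only: sum_distrib_left mult.left_commute)
  also have "\<dots> = (\<Sum>t<d. - (br (x \<nu>) (x (js ! t)) * minor_cofactor br x is js s t))"
    by (rule sum.cong) (simp_all only: cof lessThan_iff mult_minus_right)
  finally show ?thesis by (simp only: sum_negf)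
qed

definition delta_repr :: "nat list \<Rightarrow> nat \<Rightarrow> nat list \<Rightarrow> ('k, 'a) free_alg" where
  "delta_repr is \<nu> js = mul (minor br x is js) * ham (x \<nu>) +
     (\<Sum>s<length is. mul (- (\<Sum>t<length js. br (x \<nu>) (x (js ! t)) * minor_cofactor br x is js s t)) * ham (x (is ! s)))"

lemma U_delta_eq:
  assumes "length is = length js"
  shows "U_delta scale br x is \<nu> js = proj (delta_repr is \<nu> js)"
proof -
  have eq: "(\<Oplus>\<^bsub>U scale br\<^esub>s\<in>{..<length is}. U_alpha scale br
          ((- 1) ^ (s + length is) * minor br x (take s is @ drop (Suc s) is @ [\<nu>]) js)
        \<otimes>\<^bsub>U scale br\<^esub> U_beta scale br (x (is ! s)))
    = (\<Oplus>\<^bsub>U scale br\<^esub>s\<in>{..<length is}. proj (mul (- (\<Sum>t<length js. br (x \<nu>) (x (js ! t)) * minor_cofactor br x is js s t)) * ham (x (is ! s))))"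
  proof -
    interpret ring "U scale br" by (rule U_ring)
    show ?thesis
    proof (rule finsum_cong')
      fix s assume "s \<in> {..<length is}"
      then have s: "s < length js" using assms by simp
      show "U_alpha scale br
          ((- 1) ^ (s + length is) * minor br x (take s is @ drop (Suc s) is @ [\<nu>]) js)
        \<otimes>\<^bsub>U scale br\<^esub> U_beta scale br (x (is ! s))
        = proj (mul (- (\<Sum>t<length js. br (x \<nu>) (x (js ! t)) * minor_cofactor br x is js s t)) * ham (x (is ! s)))"
        unfolding assms minor_move_row[OF assms refl s]
        by (simp only: U_alpha_def U_beta_def proj_mult)
    qed (auto simp: proj_mem)
  qed
  show ?thesis
    unfolding U_delta_def eq delta_repr_def
    by (simp only: proj_sum finite_lessThan) (simp add: U_alpha_def U_beta_def proj_mult proj_add)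
qed


text \<open>The elements \<open>E\<^sub>t\<close>. The cofactors are chosen so that the operator of
  \<open>ham_row is js t\<close> sends \<open>x (js ! t)\<close> to the minor and the other
  \<open>x (js ! u)\<close> to 0.\<close>

definition ham_row :: "nat list \<Rightarrow> nat list \<Rightarrow> nat \<Rightarrow> ('k, 'a) free_alg" where
  "ham_row is js t = (\<Sum>s<length is. mul (minor_cofactor br x is js s t) * ham (x (is ! s)))"

lemma filtered_ham_row: "filtered 2 (ham_row is js t)"
  unfolding ham_row_def using filtered.mult[OF filtered.mul filtered.ham]
  by (intro filtered_sum) (simp add: numeral_2_eq_2)

lemma delta_repr_eq:
  "delta_repr is \<nu> js \<approx> mul (minor br x is js) * ham (x \<nu>) -
     (\<Sum>t<length js. mul (br (x \<nu>) (x (js ! t))) * ham_row is js t)"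
proof -
  have neg: "mul (- a) \<approx> - mul a" for a
  proof -
    have "mul (- a) + mul a \<approx> mul 0" using ueq_sym[OF ueq_relations(2)[of "- a" a]] by simp
    also have "\<dots> \<approx> 0" by (rule mul_zero)
    finally show ?thesis by (simp add: ueq_def)
  qed
  have "(\<Sum>s<length is. mul (- (\<Sum>t<length js. br (x \<nu>) (x (js ! t)) * minor_cofactor br x is js s t)) * ham (x (is ! s)))
    \<approx> (\<Sum>s<length is. - (\<Sum>t<length js. mul (br (x \<nu>) (x (js ! t))) * mul (minor_cofactor br x is js s t)) * ham (x (is ! s)))"
  proof (intro ueq_sum ueq_mult ueq_refl)
    fix s
    let ?f = "\<lambda>t. br (x \<nu>) (x (js ! t)) * minor_cofactor br x is js s t"
    have "mul (\<Sum>t<length js. ?f t) \<approx> (\<Sum>t<length js. mul (?f t))" by (rule mul_sum)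
    also have "\<dots> \<approx> (\<Sum>t<length js. mul (br (x \<nu>) (x (js ! t))) * mul (minor_cofactor br x is js s t))"
      by (intro ueq_sum ueq_relations(4))
    finally have "- mul (\<Sum>t<length js. ?f t) \<approx> - (\<Sum>t<length js. mul (br (x \<nu>) (x (js ! t))) * mul (minor_cofactor br x is js s t))"
      using ueq_diff[OF ueq_refl[of 0]] by simp
    with neg show "mul (- (\<Sum>t<length js. ?f t))
        \<approx> - (\<Sum>t<length js. mul (br (x \<nu>) (x (js ! t))) * mul (minor_cofactor br x is js s t))"
      by (rule ueq_trans)
  qed
  also have "\<dots> = - (\<Sum>t<length js. mul (br (x \<nu>) (x (js ! t))) * ham_row is js t)"
    unfolding ham_row_def
    by (simp add: sum_negf sum_distrib_left sum_distrib_right mult.assoc) (rule sum.swap)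
  finally have "mul (minor br x is js) * ham (x \<nu>) +
      (\<Sum>s<length is. mul (- (\<Sum>t<length js. br (x \<nu>) (x (js ! t)) * minor_cofactor br x is js s t)) * ham (x (is ! s)))
    \<approx> mul (minor br x is js) * ham (x \<nu>) + - (\<Sum>t<length js. mul (br (x \<nu>) (x (js ! t))) * ham_row is js t)"
    by (intro ueq_add ueq_refl)
  then show ?thesis unfolding delta_repr_def by simp
qed

text \<open>The generators of \<open>kappa\<close> have \<nu> outside \<open>is\<close>. In the
  remaining case the determinant has two equal rows, and the cofactor identities make it vanish in
  the enveloping algebra.\<close>

lemma delta_repr_row:
  assumes len: "length is = length js" and r: "r < length is"
  shows "delta_repr is (is ! r) js \<approx> 0"
proof -
  let ?\<mu> = "minor br x is js"
  have "(\<Sum>s<length is. mul (- (\<Sum>t<length js. br (x (is ! r)) (x (js ! t)) * minor_cofactor br x is js s t)) * ham (x (is ! s)))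
    \<approx> (\<Sum>s<length is. if s = r then - (mul ?\<mu> * ham (x (is ! s))) else 0)"
  proof (rule ueq_sum)
    fix s assume "s \<in> {..<length is}"
    then have eq: "(\<Sum>t<length js. br (x (is ! r)) (x (js ! t)) * minor_cofactor br x is js s t) = (if r = s then ?\<mu> else 0)"
      using minor_cofactor_row[OF len refl, of r s br x] r len by simp
    have neg: "mul (- ?\<mu>) \<approx> - mul ?\<mu>"
    proof -
      have "mul (- ?\<mu>) + mul ?\<mu> \<approx> mul 0" using ueq_sym[OF ueq_relations(2)[of "- ?\<mu>" ?\<mu>]] by simp
      also have "\<dots> \<approx> 0" by (rule mul_zero)
      finally show ?thesis by (simp add: ueq_def)
    qed
    show "mul (- (\<Sum>t<length js. br (x (is ! r)) (x (js ! t)) * minor_cofactor br x is js s t)) * ham (x (is ! s))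
       \<approx> (if s = r then - (mul ?\<mu> * ham (x (is ! s))) else 0)"
      unfolding eq using ueq_mult[OF mul_zero ueq_refl[of "ham (x (is ! s))"]]
        ueq_mult[OF neg ueq_refl[of "ham (x (is ! s))"]] by (cases "s = r") simp_all
  qed
  also have "\<dots> = - (mul ?\<mu> * ham (x (is ! r)))" using r by simp
  finally have "delta_repr is (is ! r) js \<approx> mul ?\<mu> * ham (x (is ! r)) + - (mul ?\<mu> * ham (x (is ! r)))"
    unfolding delta_repr_def by (intro ueq_add ueq_refl)
  then show ?thesis by simp
qed

lemma kappa_zero_delta:
  assumes kappa: "kappa scale br x n d = {\<zero>\<^bsub>U scale br\<^esub>}"
    and "is": "is \<in> incr_tuples n d" and js: "js \<in> incr_tuples n d" and mu: "minor br x is js \<noteq> 0" and \<nu>: "\<nu> < n"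
  shows "delta_repr is \<nu> js \<approx> 0"
proof (cases "\<nu> \<in> set is")
  case True
  then obtain r where "r < length is" "\<nu> = is ! r" by (metis in_set_conv_nth)
  then show ?thesis using delta_repr_row[of "is" js r] "is" js by (simp add: incr_tuples_def)
next
  case False
  have len: "length is = length js" using "is" js by (simp add: incr_tuples_def)
  have "minor br x js is \<noteq> 0" using mu minor_swap[of js "is"] len by simp
  then have nz: "is \<in> nonzero_tuples br x n d" "js \<in> nonzero_tuples br x n d"
    using "is" js mu by (auto simp: nonzero_tuples_def)
  have "U_delta scale br x is \<nu> js \<in> kappa scale br x n d"
  proof -
    let ?S = "{U_delta scale br x is \<nu> js | is \<nu> js.
        is \<in> nonzero_tuples br x n d \<and> js \<in> nonzero_tuples br x n d \<and> \<nu> \<in> {..<n} - set is}"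
    have "?S \<subseteq> carrier (U scale br)"
    proof
      fix y assume "y \<in> ?S"
      then obtain is' js' \<nu>' where y: "y = U_delta scale br x is' \<nu>' js'"
        "is' \<in> nonzero_tuples br x n d" "js' \<in> nonzero_tuples br x n d" by blast
      then have "length is' = length js'" by (simp add: nonzero_tuples_def incr_tuples_def)
      then show "y \<in> carrier (U scale br)" unfolding y(1) by (simp only: U_delta_eq proj_mem)
    qed
    from ring.genideal_self[OF U_ring this] have "?S \<subseteq> kappa scale br x n d" unfolding kappa_def .
    moreover have "U_delta scale br x is \<nu> js \<in> ?S" using nz False \<nu> by blast
    ultimately show ?thesis by (rule subsetD)
  qed
  then have "proj (delta_repr is \<nu> js) = proj 0" unfolding kappa U_delta_eq[OF len] by (simp add: proj_zero)
  then show ?thesis by (simp only: proj_eq_iff)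
qed

text \<open>The difference of the two sides is a derivation in \<open>a\<close> with values in the
  enveloping algebra as a left module over \<A>, and at the \<open>x i\<close> it is a generator
  that \<open>kappa\<close> forces to vanish.\<close>

lemma kappa_zero_ham:
  assumes kappa: "kappa scale br x n d = {\<zero>\<^bsub>U scale br\<^esub>}"
    and "is": "is \<in> incr_tuples n d" and js: "js \<in> incr_tuples n d" and mu: "minor br x is js \<noteq> 0"
  shows "mul (minor br x is js) * ham a \<approx> (\<Sum>t<d. mul (br a (x (js ! t))) * ham_row is js t)"
proof -
  let ?\<mu> = "minor br x is js" and ?y = "\<lambda>t. x (js ! t)" and ?E = "ham_row is js"
  have len: "length js = d" using js by (simp add: incr_tuples_def)
  define Q where "Q = (\<lambda>a. mul ?\<mu> * ham a - (\<Sum>t<d. mul (br a (?y t)) * ?E t))"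
  have Q_add: "Q (a + b) \<approx> Q a + Q b" for a b
  proof -
    have "Q (a + b) \<approx> mul ?\<mu> * (ham a + ham b) - (\<Sum>t<d. (mul (br a (?y t)) + mul (br b (?y t))) * ?E t)"
      unfolding Q_def br_simps by (intro ueq_diff ueq_mult ueq_sum ueq_refl ueq_relations)
    also have "\<dots> = Q a + Q b" by (simp add: Q_def algebra_simps sum.distrib)
    finally show ?thesis .
  qed
  have Q_mult: "Q (a * b) \<approx> mul a * Q b + mul b * Q a" for a b
  proof -
    have "mul ?\<mu> * ham (a * b) \<approx> mul ?\<mu> * (mul a * ham b + mul b * ham a)"
      by (intro ueq_mult ueq_refl ueq_relations)
    also have "\<dots> = (mul ?\<mu> * mul a) * ham b + (mul ?\<mu> * mul b) * ham a" by (simp add: algebra_simps)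
    also have "\<dots> \<approx> (mul a * mul ?\<mu>) * ham b + (mul b * mul ?\<mu>) * ham a"
      by (intro ueq_add ueq_mult ueq_refl mul_commute)
    finally have 1: "mul ?\<mu> * ham (a * b) \<approx> (mul a * mul ?\<mu>) * ham b + (mul b * mul ?\<mu>) * ham a" .
    have 2: "mul (br (a * b) (?y t)) \<approx> mul a * mul (br b (?y t)) + mul b * mul (br a (?y t))" for t
    proof -
      have "mul (br (a * b) (?y t)) \<approx> mul (a * br b (?y t)) + mul (b * br a (?y t))"
        unfolding br_mult_left by (rule ueq_relations)
      also have "\<dots> \<approx> mul a * mul (br b (?y t)) + mul b * mul (br a (?y t))"
        by (intro ueq_add ueq_relations)
      finally show ?thesis .
    qed
    have "Q (a * b) \<approx> (mul a * mul ?\<mu>) * ham b + (mul b * mul ?\<mu>) * ham a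
        - (\<Sum>t<d. (mul a * mul (br b (?y t)) + mul b * mul (br a (?y t))) * ?E t)"
      unfolding Q_def by (intro ueq_diff ueq_sum ueq_mult 1 2 ueq_refl)
    also have "\<dots> = mul a * Q b + mul b * Q a"
      by (simp add: Q_def algebra_simps sum.distrib sum_distrib_left)
    finally show ?thesis .
  qed
  have "Q a \<approx> 0"
  proof (induction a rule: ess_induct)
    case (scalar c)
    have "ham (scale c 1) \<approx> fconst c * ham 1" by (rule ueq_relations)
    also have "\<dots> \<approx> fconst c * 0" by (intro ueq_mult ueq_refl ham_one)
    finally have h: "ham (scale c 1) \<approx> 0" by simp
    have b: "br (scale c 1) z = 0" for z using br_anti[of "scale c 1" z] br_scalar[of z c] by simp
    have "Q (scale c 1) \<approx> mul ?\<mu> * 0 - (\<Sum>t<d. 0 * ?E t)"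
      unfolding Q_def b by (intro ueq_diff ueq_mult ueq_sum ueq_refl h mul_zero)
    then show ?case by simp
  next
    case (gen i)
    then show ?case
      using ueq_trans[OF ueq_sym[OF delta_repr_eq] kappa_zero_delta[OF kappa "is" js mu gen]]
      by (simp add: Q_def len)
  next
    case (add a b)
    then show ?case using ueq_trans[OF Q_add ueq_add[OF add]] by simp
  next
    case (mult a b)
    then show ?case using ueq_trans[OF Q_mult ueq_add[OF ueq_mult[OF ueq_refl mult(2)] ueq_mult[OF ueq_refl mult(1)]]] by simp
  next
    case (divide a s t)
    have "mul s * Q a \<approx> Q (a * s) - mul a * Q s"
      using ueq_diff[OF ueq_sym[OF Q_mult[of a s]] ueq_refl[of "mul a * Q s"]] by simp
    also have "\<dots> \<approx> 0 - mul a * 0" by (intro ueq_diff ueq_mult ueq_refl divide)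
    finally have "mul t * (mul s * Q a) \<approx> mul t * 0" by (intro ueq_mult ueq_refl) simp
    then have z: "mul t * mul s * Q a \<approx> 0" by (simp add: mult.assoc)
    have "1 * Q a \<approx> mul (t * s) * Q a"
      using divide(3) ueq_relations(1) by (intro ueq_mult ueq_refl) (simp add: mult.commute ueq_sym)
    also have "\<dots> \<approx> mul t * mul s * Q a" by (intro ueq_mult ueq_refl ueq_relations)
    finally show ?case using z ueq_trans by simp
  qed
  then show ?thesis unfolding Q_def by (simp add: ueq_def)
qed


section \<open>The kernel and the image of the canonical homomorphism\<close>

definition ev :: "('k, 'a) free_alg \<Rightarrow> 'a \<Rightarrow> 'a" where
  "ev u = free_eval (End_ring scale) scale (\<lambda>a b. a * b) br u"

lemma poisson_pi_proj: "poisson_pi scale br (proj u) = ev u"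
  unfolding poisson_pi_def ev_def by (rule poisson_triple.U_lift_proj[OF End_poisson_triple])

lemma ev_simps:
  "ev (u + v) b = ev u b + ev v b" "ev (u * v) b = ev u (ev v b)" "ev (u - v) b = ev u b - ev v b"
  "ev (mul a) b = a * b" "ev (ham a) b = br a b" "ev (fconst c) b = scale c b" "ev 0 b = 0" "ev 1 b = b"
proof -
  interpret E: poisson_triple scale br "End_ring scale" scale "\<lambda>a b. a * b" br by (rule End_poisson_triple)
  show add: "ev (u + v) b = ev u b + ev v b" for u v
    unfolding ev_def E.free_eval_add by (simp add: End_ring_simps)
  show "ev (u * v) b = ev u (ev v b)"
    unfolding ev_def E.free_eval_mult by (simp add: End_ring_simps)
  show "ev (u - v) b = ev u b - ev v b"
    using add[of "u - v" v] by (simp add: eq_diff_eq)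
  show "ev (mul a) b = a * b" "ev (ham a) b = br a b" "ev (fconst c) b = scale c b"
    unfolding ev_def E.free_eval_gen by simp_all
  show "ev 0 b = 0" "ev 1 b = b"
    unfolding ev_def E.free_eval_zero E.free_eval_one by (simp_all add: End_ring_simps)
qed

lemma ev_sum: "ev (sum f I) b = (\<Sum>i\<in>I. ev (f i) b)"
  by (induction I rule: infinite_finite_induct) (simp_all add: ev_simps)

lemma ev_ideal: "u \<in> U_ideal scale br \<Longrightarrow> ev u b = 0"
  unfolding ev_def using poisson_triple.free_eval_ideal[OF End_poisson_triple, of u]
  by (simp add: End_ring_simps)

lemma filtered_one_mul:
  assumes "filtered (Suc 0) u"
  shows "\<exists>a. u \<approx> mul a"
proof -
  have "k \<le> Suc 0 \<longrightarrow> (\<exists>a. u \<approx> mul a)" if "filtered k u" for k u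
    using that
  proof (induction rule: filtered.induct)
    case (ideal u)
    then have "u \<approx> mul 0" using ueq_trans[OF _ ueq_sym[OF mul_zero]] by (simp add: ueq_zero_iff)
    then show ?case by (intro impI exI)
  next
    case (mul a)
    show ?case by (intro impI exI[of _ a] ueq_refl)
  next
    case (ham a)
    then show ?case by simp
  next
    case (add k u v)
    show ?case
    proof
      assume "k \<le> Suc 0"
      then obtain a b where "u \<approx> mul a" "v \<approx> mul b" using add by blast
      then have "u + v \<approx> mul (a + b)" by (rule ueq_trans[OF ueq_add ueq_sym[OF ueq_relations(2)]])
      then show "\<exists>a. u + v \<approx> mul a" by (rule exI)
    qed
  next
    case (mult i u j v)
    show ?case
    proof
      assume "Suc (i + j) \<le> Suc 0"
      then have "Suc i \<le> Suc 0" "Suc j \<le> Suc 0" by simp_all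
      then obtain a b where "u \<approx> mul a" "v \<approx> mul b" using mult.IH by blast
      then have "u * v \<approx> mul (a * b)" by (rule ueq_trans[OF ueq_mult ueq_sym[OF ueq_relations(4)]])
      then show "\<exists>a. u * v \<approx> mul a" by (rule exI)
    qed
  next
    case (weaken k u)
    then show ?case by simp
  qed
  then show ?thesis using assms by simp
qed

text \<open>The kernel is a two-sided ideal, so it contains the commutators of \<open>u\<close> with
  \<A>; these have smaller degree and vanish by induction. Euler's identity then gives
  \<open>k \<mu> u\<close> a smaller degree too, and it vanishes by induction again. In degree 0 the
  element is read off by applying the operator to 1.\<close>

lemma ev_injective:
  assumes kappa: "kappa scale br x n d = {\<zero>\<^bsub>U scale br\<^esub>}" and min: "minors_ideal br x n d = UNIV"
  shows "filtered k u \<Longrightarrow> (\<And>b. ev u b = 0) \<Longrightarrow> u \<in> U_ideal scale br"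
proof (induction k arbitrary: u)
  case 0
  then show ?case by (simp add: filtered_0)
next
  case (Suc k)
  show ?case
  proof (cases k)
    case 0
    then obtain a where a: "u \<approx> mul a" using filtered_one_mul Suc.prems(1) by blast
    have "ev (mul a) 1 = 0"
      using ev_ideal[OF a[unfolded ueq_def], of 1] Suc.prems(2)[of 1] by (simp add: ev_simps)
    then have "a = 0" by (simp add: ev_simps)
    then show ?thesis using a ueq_mem[of u "mul 0"] mul_zero by (simp add: ueq_zero_iff)
  next
    case (Suc j)
    note u = Suc.prems(1)
    have comm: "u * mul a - mul a * u \<in> U_ideal scale br" for a
    proof (rule Suc.IH)
      show "filtered k (u * mul a - mul a * u)"
        using filtered_commutator[OF Suc.prems(1) filtered.mul, of a] by simp
      show "ev (u * mul a - mul a * u) b = 0" for b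
        using Suc.prems(2) by (simp add: ev_simps)
    qed
    \<comment> \<open>An ideal of \<A>; once it contains the minors it contains 1, and
      \<open>u\<close> vanishes.\<close>
    let ?J = "{a. mul a * u \<in> U_ideal scale br}"
    have "minors_ideal br x n d \<subseteq> ?J"
    proof (rule minors_ideal_subset)
      show "0 \<in> ?J" using ueq_mem[OF ueq_mult[OF mul_zero ueq_refl[of u]]] by (simp add: U_ideal_closed)
      show "a + b \<in> ?J" if "a \<in> ?J" "b \<in> ?J" for a b
        using ueq_mem[OF ueq_mult[OF ueq_relations(2)[of a b] ueq_refl[of u]]] that
        by (simp add: distrib_right U_ideal_closed)
      show "r * a \<in> ?J" if "a \<in> ?J" for r a
        using ueq_mem[OF ueq_mult[OF ueq_relations(4)[of r a] ueq_refl[of u]]] that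
        by (simp add: mult.assoc U_ideal_closed)
      fix "is" js assume t: "is \<in> incr_tuples n d" "js \<in> incr_tuples n d"
      let ?\<mu> = "minor br x is js"
      show "?\<mu> \<in> ?J"
      proof (cases "?\<mu> = 0")
        case True
        then show ?thesis using ueq_mem[OF ueq_mult[OF mul_zero ueq_refl[of u]]] by (simp add: U_ideal_closed)
      next
        case False
        let ?S = "\<Sum>t<d. (u * mul (x (js ! t)) - mul (x (js ! t)) * u) * ham_row is js t"
        have S: "?S \<in> U_ideal scale br"
          unfolding filtered_0[symmetric]
          by (intro filtered_sum) (simp add: filtered_0 U_ideal_closed comm)
        have "of_nat k * (mul ?\<mu> * u) - ?S \<in> U_ideal scale br"
        proof (rule Suc.IH)
          show "filtered k (of_nat k * (mul ?\<mu> * u) - ?S)"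
            using filtered_euler[of d "ham_row is js" ?\<mu> "\<lambda>t. x (js ! t)", OF filtered_ham_row kappa_zero_ham[OF kappa t False] Suc.prems(1)]
            by simp
          show "ev (of_nat k * (mul ?\<mu> * u) - ?S) b = 0" for b
            using Suc.prems(2) ev_ideal[OF S] by (simp add: ev_simps of_nat_fconst)
        qed
        from U_ideal_closed(2)[OF this S] have "of_nat k * (mul ?\<mu> * u) \<in> U_ideal scale br" by simp
        then have "fconst (inverse (of_nat k)) * (of_nat k * (mul ?\<mu> * u)) \<in> U_ideal scale br"
          by (rule U_ideal_closed(3))
        moreover have "fconst (inverse (of_nat k)) * (of_nat k * (mul ?\<mu> * u)) = mul ?\<mu> * u"
          using Suc by (simp add: of_nat_fconst mult.assoc[symmetric] fconst_simps(2)[symmetric] fconst_simps(3) del: of_nat_Suc)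
        ultimately show ?thesis by simp
      qed
    qed
    then have "mul 1 * u \<in> U_ideal scale br" unfolding min by blast
    moreover have "u \<approx> mul 1 * u" using ueq_mult[OF ueq_sym[OF ueq_relations(1)] ueq_refl[of u]] by simp
    ultimately show ?thesis using ueq_mem by blast
  qed
qed

lemma poisson_pi_injective:
  assumes "kappa scale br x n d = {\<zero>\<^bsub>U scale br\<^esub>}" "minors_ideal br x n d = UNIV"
  shows "inj_on (poisson_pi scale br) (carrier (U scale br))"
proof (rule inj_onI)
  fix y z assume y: "y \<in> carrier (U scale br)" and z: "z \<in> carrier (U scale br)"
    and eq: "poisson_pi scale br y = poisson_pi scale br z"
  obtain u v where uv: "y = proj u" "z = proj v" using proj_cases[OF y] proj_cases[OF z] by metis
  have "ev (u - v) b = 0" for b using eq unfolding uv poisson_pi_proj by (simp add: ev_simps)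
  moreover obtain k where "filtered k (u - v)" using filtered_exhaust by blast
  ultimately have "u - v \<in> U_ideal scale br" using ev_injective[OF assms] by blast
  then show "y = z" unfolding uv proj_eq_iff ueq_def .
qed

section \<open>Differential operators\<close>

abbreviation PD :: "('a \<Rightarrow> 'a) set" where
  "PD \<equiv> generate_ring (End_ring scale) (range (\<lambda>a b. a * b) \<union> range br)"

lemma PD_carrier: "f \<in> PD \<Longrightarrow> f \<in> carrier (End_ring scale)"
proof -
  interpret E: poisson_triple scale br "End_ring scale" scale "\<lambda>a b. a * b" br by (rule End_poisson_triple)
  have "range (\<lambda>a b. a * b) \<union> range br \<subseteq> carrier (End_ring scale)"
    using E.alpha_simps(1) E.beta_closed by blast
  then show "f \<in> PD \<Longrightarrow> f \<in> carrier (End_ring scale)" using ring.generate_ring_in_carrier[OF End_ring_ring] by blast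
qed

lemma PD_mult: "(\<lambda>b. a * b) \<in> PD" and PD_br: "br a \<in> PD"
  by (rule generate_ring.incl, simp)+

lemma PD_comp: "f \<in> PD \<Longrightarrow> g \<in> PD \<Longrightarrow> (\<lambda>b. f (g b)) \<in> PD"
  using generate_ring.eng_mult[of f "End_ring scale" _ g] by (simp add: End_ring_simps comp_def)

lemma PD_add: "f \<in> PD \<Longrightarrow> g \<in> PD \<Longrightarrow> (\<lambda>b. f b + g b) \<in> PD"
  using generate_ring.eng_add[of f "End_ring scale" _ g] by (simp add: End_ring_simps)

lemma PD_left_mult: "f \<in> PD \<Longrightarrow> (\<lambda>b. a * f b) \<in> PD"
  by (rule PD_comp[OF PD_mult])

lemma PD_zero: "(\<lambda>_. 0) \<in> PD"
  using PD_mult[of 0] by simp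

lemma PD_sum: "(\<And>i. i \<in> I \<Longrightarrow> f i \<in> PD) \<Longrightarrow> (\<lambda>b. \<Sum>i\<in>I. f i b) \<in> PD"
  by (induction I rule: infinite_finite_induct) (auto simp: PD_zero PD_add)

lemma ev_mem_PD: "ev u \<in> PD"
proof -
  obtain k where "filtered k u" using filtered_exhaust by blast
  then show ?thesis
  proof (induction rule: filtered.induct)
    case (ideal u)
    then have "ev u = (\<lambda>_. 0)" by (simp add: ev_ideal fun_eq_iff)
    then show ?case by (simp add: PD_zero)
  next
    case (mul a)
    have "ev (mul a) = (\<lambda>b. a * b)" by (simp add: ev_simps fun_eq_iff)
    then show ?case by (simp add: PD_mult)
  next
    case (ham a)
    have "ev (ham a) = br a" by (simp add: ev_simps fun_eq_iff)
    then show ?case by (simp add: PD_br)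
  next
    case (add k u v)
    have "ev (u + v) = (\<lambda>b. ev u b + ev v b)" by (simp add: ev_simps fun_eq_iff)
    then show ?case using PD_add add by simp
  next
    case (mult i u j v)
    have "ev (u * v) = (\<lambda>b. ev u (ev v b))" by (simp add: ev_simps fun_eq_iff)
    then show ?case using PD_comp mult by simp
  qed
qed

lemma PD_induct [consumes 1, case_names mult br add comp]:
  assumes "f \<in> PD" and "\<And>a. P (\<lambda>b. a * b)" and "\<And>a. P (br a)"
    and "\<And>f g. f \<in> PD \<Longrightarrow> g \<in> PD \<Longrightarrow> P f \<Longrightarrow> P g \<Longrightarrow> P (\<lambda>b. f b + g b)"
    and "\<And>f g. f \<in> PD \<Longrightarrow> g \<in> PD \<Longrightarrow> P f \<Longrightarrow> P g \<Longrightarrow> P (\<lambda>b. f (g b))"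
  shows "P f"
  using assms(1)
proof (induction rule: generate_ring.induct)
  case one
  have "\<one>\<^bsub>End_ring scale\<^esub> = (\<lambda>b. 1 * b)" by (simp add: End_ring_simps fun_eq_iff)
  then show ?case using assms(2)[of 1] by (simp only:)
next
  case (incl h)
  then show ?case using assms(2,3) by blast
next
  case (a_inv h)
  have "(\<lambda>_. 0) \<in> carrier (End_ring scale)" by (simp add: End_ring_carrier)
  then have "\<ominus>\<^bsub>End_ring scale\<^esub> h = (\<lambda>b. (- 1) * h b)"
    using End_ring_minus[of "\<lambda>_. 0" h] PD_carrier[OF a_inv(1)] ring.ring_simprules(15)[OF End_ring_ring]
    by (simp add: a_minus_def End_ring_simps)
  then show ?case using assms(5)[OF PD_mult a_inv(1) assms(2) a_inv(2), of "- 1"] by (simp only:)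
next
  case (eng_add f g)
  then show ?case using assms(4)[of f g] by (simp add: End_ring_simps)
next
  case (eng_mult f g)
  then show ?case using assms(5)[of f g] by (simp add: End_ring_simps comp_def)
qed

lemma PD_eq_range_ev: "PD = range ev"
proof
  show "range ev \<subseteq> PD" using ev_mem_PD by blast
  show "PD \<subseteq> range ev"
  proof
    fix f assume "f \<in> PD"
    then show "f \<in> range ev"
    proof (induction rule: PD_induct)
      case (mult a)
      show ?case by (rule range_eqI[of _ _ "mul a"]) (simp add: ev_simps fun_eq_iff)
    next
      case (br a)
      show ?case by (rule range_eqI[of _ _ "ham a"]) (simp add: ev_simps fun_eq_iff)
    next
      case (add f g)
      then obtain u v where uv: "f = ev u" "g = ev v" by blast
      show ?case by (rule range_eqI[of _ _ "u + v"]) (simp add: ev_simps fun_eq_iff uv)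
    next
      case (comp f g)
      then obtain u v where uv: "f = ev u" "g = ev v" by blast
      show ?case by (rule range_eqI[of _ _ "u * v"]) (simp add: ev_simps fun_eq_iff uv)
    qed
  qed
qed

lemma poisson_pi_image: "poisson_pi scale br ` carrier (U scale br) = PD"
  unfolding U_proj_surj PD_eq_range_ev by (simp add: image_image poisson_pi_proj)

end

text \<open>The shift of the order by one makes the zero operator the bottom of the filtration.\<close>

primrec dop :: "('k::field \<Rightarrow> 'a::comm_ring_1 \<Rightarrow> 'a) \<Rightarrow> nat \<Rightarrow> ('a \<Rightarrow> 'a) set" where
  "dop scale 0 = {\<lambda>_. 0}"
| "dop scale (Suc k) =
     {f \<in> carrier (End_ring scale). \<forall>a. (\<lambda>b. f (a * b) - a * f b) \<in> dop scale k}"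

declare dop.simps(2) [simp del]

lemma dop_Suc: "dop scale (Suc k) = diff_ops_upto scale k"
proof (induction k)
  case (Suc k)
  have "dop scale (Suc (Suc k)) = {f \<in> carrier (End_ring scale). \<forall>a. (\<lambda>b. f (a * b) - a * f b) \<in> dop scale (Suc k)}"
    by (rule dop.simps(2))
  also have "\<dots> = diff_ops_upto scale (Suc k)" unfolding Suc by (rule diff_ops_upto.simps(2)[symmetric])
  finally show ?case .
qed (simp add: dop.simps(2))

section \<open>Differential operators filtered by order\<close>

context ess_poisson
begin

lemma dop_linear:
  assumes "P \<in> dop scale k"
  shows "P (a + b) = P a + P b" "P (scale c a) = scale c (P a)" "P 0 = 0" "P (- a) = - P a" "P (a - b) = P a - P b"
proof -
  have add: "P (a + b) = P a + P b" for a b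
    using assms by (cases k) (auto simp: End_ring_carrier dop.simps(2))
  then show "P (a + b) = P a + P b" .
  show "P (scale c a) = scale c (P a)" using assms by (cases k) (auto simp: End_ring_carrier dop.simps(2))
  show zero: "P 0 = 0" using add[of 0 0] by (metis add_cancel_left_left add_0)
  have minus: "P (- a) = - P a" for a using add[of "- a" a] zero by (simp add: eq_neg_iff_add_eq_0)
  then show "P (- a) = - P a" .
  show "P (a - b) = P a - P b" using add[of a "- b"] minus by simp
qed

lemma dop_carrier: "P \<in> dop scale k \<Longrightarrow> P \<in> carrier (End_ring scale)"
  by (simp add: End_ring_carrier dop_linear)

lemma dop_SucI:
  "P \<in> carrier (End_ring scale) \<Longrightarrow> (\<And>a. (\<lambda>b. P (a * b) - a * P b) \<in> dop scale k) \<Longrightarrow> P \<in> dop scale (Suc k)"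
  by (simp add: dop.simps(2))

lemma dop_commutator: "P \<in> dop scale k \<Longrightarrow> (\<lambda>b. P (a * b) - a * P b) \<in> dop scale (k - 1)"
  by (cases k) (auto simp: dop.simps(2))

lemma dop_zero: "(\<lambda>_. 0) \<in> dop scale k"
  by (induction k) (auto simp: End_ring_carrier dop.simps(2))

lemma dop_Suc_mono: "P \<in> dop scale k \<Longrightarrow> P \<in> dop scale (Suc k)"
proof (induction k arbitrary: P)
  case 0
  then show ?case using dop_zero[of "Suc 0"] by simp
next
  case (Suc k)
  show ?case
  proof (rule dop_SucI[OF dop_carrier[OF Suc.prems]])
    fix a
    show "(\<lambda>b. P (a * b) - a * P b) \<in> dop scale (Suc k)"
      using Suc.IH[OF dop_commutator[OF Suc.prems, of a, simplified]] .
  qed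
qed

lemma dop_mono: "P \<in> dop scale k \<Longrightarrow> k \<le> l \<Longrightarrow> P \<in> dop scale l"
  by (induction l) (auto simp: le_Suc_eq dop_Suc_mono)

lemma dop_add: "P \<in> dop scale k \<Longrightarrow> Q \<in> dop scale k \<Longrightarrow> (\<lambda>b. P b + Q b) \<in> dop scale k"
proof (induction k arbitrary: P Q)
  case (Suc k)
  show ?case
  proof (rule dop_SucI)
    show "(\<lambda>b. P b + Q b) \<in> carrier (End_ring scale)"
      by (simp add: End_ring_carrier dop_linear[OF Suc.prems(1)] dop_linear[OF Suc.prems(2)] scale_right_distrib algebra_simps)
    fix a
    have "(\<lambda>b. (P (a * b) - a * P b) + (Q (a * b) - a * Q b)) \<in> dop scale k"
      using Suc.IH dop_commutator[OF Suc.prems(1), of a] dop_commutator[OF Suc.prems(2), of a] by simp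
    then show "(\<lambda>b. P (a * b) + Q (a * b) - a * (P b + Q b)) \<in> dop scale k"
      by (simp add: algebra_simps)
  qed
qed simp

lemma dop_left_mult: "P \<in> dop scale k \<Longrightarrow> (\<lambda>b. c * P b) \<in> dop scale k"
proof (induction k arbitrary: P)
  case (Suc k)
  show ?case
  proof (rule dop_SucI)
    show "(\<lambda>b. c * P b) \<in> carrier (End_ring scale)"
      by (simp add: End_ring_carrier dop_linear[OF Suc.prems] scale_mult_right distrib_left)
    fix a
    have "(\<lambda>b. c * (P (a * b) - a * P b)) \<in> dop scale k"
      using Suc.IH dop_commutator[OF Suc.prems, of a] by simp
    then show "(\<lambda>b. c * P (a * b) - a * (c * P b)) \<in> dop scale k"
      by (simp add: right_diff_distrib mult.left_commute)
  qed
qed simp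

lemma dop_diff: "P \<in> dop scale k \<Longrightarrow> Q \<in> dop scale k \<Longrightarrow> (\<lambda>b. P b - Q b) \<in> dop scale k"
  using dop_add[of P k "\<lambda>b. (- 1) * Q b"] dop_left_mult[of Q k "- 1"] by simp

lemma dop_sum: "(\<And>i. i \<in> I \<Longrightarrow> P i \<in> dop scale k) \<Longrightarrow> (\<lambda>b. \<Sum>i\<in>I. P i b) \<in> dop scale k"
  by (induction I rule: infinite_finite_induct) (auto simp: dop_zero dop_add)

text \<open>The rule \<open>[P Q, a] = P [Q, a] + [P, a] Q\<close> reduces the sum of the orders. As
  indices are orders plus one, additivity of orders gives the index
  \<open>i + j - 1\<close>.\<close>

lemma dop_comp: "P \<in> dop scale i \<Longrightarrow> Q \<in> dop scale j \<Longrightarrow> (\<lambda>b. P (Q b)) \<in> dop scale (i + j - 1)"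
proof (induction "i + j" arbitrary: i j P Q rule: less_induct)
  case less
  show ?case
  proof (cases "i = 0 \<or> j = 0")
    case True
    then have "(\<lambda>b. P (Q b)) = (\<lambda>_. 0)" using less.prems dop_linear(3)[OF less.prems(1)] by auto
    then show ?thesis using dop_zero by simp
  next
    case False
    then obtain i' j' where ij: "i = Suc i'" "j = Suc j'" using not0_implies_Suc by blast
    note P = dop_linear[OF less.prems(1)] and Q = dop_linear[OF less.prems(2)]
    have "(\<lambda>b. P (Q b)) \<in> dop scale (Suc (i' + j'))"
    proof (rule dop_SucI)
      show "(\<lambda>b. P (Q b)) \<in> carrier (End_ring scale)" by (simp add: End_ring_carrier P Q)
      fix a
      have c: "(\<lambda>b. P (a * b) - a * P b) \<in> dop scale i'" "(\<lambda>b. Q (a * b) - a * Q b) \<in> dop scale j'"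
        using dop_commutator[OF less.prems(1), of a] dop_commutator[OF less.prems(2), of a] ij by simp_all
      have "(\<lambda>b. P (Q (a * b) - a * Q b)) \<in> dop scale (i' + j')"
        using less.hyps[OF _ less.prems(1) c(2)] ij by simp
      moreover have "(\<lambda>b. P (a * Q b) - a * P (Q b)) \<in> dop scale (i' + j')"
        using less.hyps[OF _ c(1) less.prems(2)] ij by simp
      ultimately have "(\<lambda>b. P (Q (a * b) - a * Q b) + (P (a * Q b) - a * P (Q b))) \<in> dop scale (i' + j')"
        by (rule dop_add)
      then show "(\<lambda>b. P (Q (a * b)) - a * P (Q b)) \<in> dop scale (i' + j')" by (simp add: P)
    qed
    then show ?thesis using ij by simp
  qed
qed

lemma dop_mult: "(\<lambda>b. c * b) \<in> dop scale (Suc 0)"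
  by (simp add: dop.simps(2) End_ring_carrier scale_mult_right distrib_left mult.left_commute)

lemma dop_one_eq: "P \<in> dop scale (Suc 0) \<Longrightarrow> P b = b * P 1"
proof -
  assume "P \<in> dop scale (Suc 0)"
  then have "(\<lambda>x. P (b * x) - b * P x) = (\<lambda>_. 0)" by (simp add: dop.simps(2))
  from fun_cong[OF this, of 1] show ?thesis by simp
qed

lemma deriv_dop:
  assumes D: "D \<in> derivs scale {0}"
  shows "D \<in> dop scale 2"
proof -
  have D': "D (a + b) = D a + D b" "D (a * b) = a * D b + b * D a" "D (scale c 1) = 0" for a b c
    using D by (auto simp: exact_derivs_iff)
  have "D (scale c b) = scale c (D b)" for c b
    unfolding scale_eq_mult[of c b] scale_eq_mult[of c "D b"] D'(2) D'(3) by simp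
  then have "D \<in> carrier (End_ring scale)" by (simp add: End_ring_carrier D'(1))
  moreover have "(\<lambda>b. D (a * b) - a * D b) = (\<lambda>b. D a * b)" for a
    by (simp add: D' fun_eq_iff)
  ultimately have "D \<in> dop scale (Suc (Suc 0))" using dop_mult by (auto intro!: dop_SucI[of D])
  then show ?thesis by (simp only: numeral_2_eq_2)
qed

lemma dop_two_derivs:
  assumes P: "P \<in> dop scale 2"
  shows "(\<lambda>a. P a - a * P 1) \<in> derivs scale {0}"
proof -
  note L = dop_linear[OF P]
  have "P (a * b) - a * P b = b * (P a - a * P 1)" for a b
    using dop_one_eq[OF dop_commutator[OF P, of a, simplified], of b] by simp
  then have "P (a * b) = a * P b + b * (P a - a * P 1)" for a b by (simp add: diff_eq_eq)
  then have "P (a * b) - a * b * P 1 = a * (P b - b * P 1) + b * (P a - a * P 1)" for a b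
    by (simp add: algebra_simps)
  moreover have "P (scale c 1) - scale c 1 * P 1 = 0" for c
    unfolding L(2) by (simp add: scale_mult_left)
  ultimately show ?thesis
    by (auto simp: exact_derivs_iff L algebra_simps)
qed

text \<open>The symbol of an operator of order \<open>k\<close> is a polynomial on the derivations; its behaviour under
  \<open>[\<cdot>, a]\<close> and Euler's identity follow from their expansion \<open>\<mu>\<tau> = \<Sum>\<^sub>t \<tau>(y\<^sub>t) D\<^sub>t\<close>.\<close>

lemma dop_symbol:
  assumes exp: "\<And>\<tau> a. \<tau> \<in> derivs scale {0} \<Longrightarrow> \<mu> * \<tau> a = (\<Sum>t<d. \<tau> (y t) * D t a)"
  shows "P \<in> dop scale (Suc (Suc k)) \<Longrightarrow>
    (\<lambda>b. \<mu> * (P (a * b) - a * P b) - (\<Sum>t<d. D t a * (P (y t * b) - y t * P b))) \<in> dop scale k"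
proof (induction k arbitrary: P)
  case 0
  then have P: "P \<in> dop scale 2" by (simp only: numeral_2_eq_2)
  \<comment> \<open>In order one the commutator with \<open>c\<close> is multiplication by the value
    at \<open>c\<close> of the derivation \<open>P - P 1\<close>, to which the expansion of
    derivations applies.\<close>
  have "P (c * b) - c * P b = b * (P c - c * P 1)" for c b
    using dop_one_eq[OF dop_commutator[OF P, of c, simplified], of b] by simp
  moreover have "\<mu> * (b * q a) - (\<Sum>t<d. D t a * (b * q (y t))) = b * (\<mu> * q a - (\<Sum>t<d. q (y t) * D t a))" for b q
    by (simp add: right_diff_distrib sum_distrib_left ac_simps)
  ultimately have "\<mu> * (P (a * b) - a * P b) - (\<Sum>t<d. D t a * (P (y t * b) - y t * P b))
      = b * (\<mu> * (P a - a * P 1) - (\<Sum>t<d. (P (y t) - y t * P 1) * D t a))" for b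
    by simp
  then show ?case using exp[OF dop_two_derivs[OF P]] by simp
next
  case (Suc k)
  let ?S = "\<lambda>P b. \<mu> * (P (a * b) - a * P b) - (\<Sum>t<d. D t a * (P (y t * b) - y t * P b))"
  note L = dop_linear[OF Suc.prems]
  show ?case
  proof (rule dop_SucI)
    have c: "(\<lambda>b. P (c * b) - c * P b) \<in> dop scale (Suc (Suc k))" for c
      using dop_commutator[OF Suc.prems, of c] by simp
    have "?S P \<in> dop scale (Suc (Suc k))"
      by (rule dop_diff[OF dop_left_mult[OF c] dop_sum[OF dop_left_mult[OF c]]])
    then show "?S P \<in> carrier (End_ring scale)" by (rule dop_carrier)
    fix c
    \<comment> \<open>Forming \<open>?S\<close> is compatible with taking commutators with
      \<open>c\<close>, so the induction hypothesis for \<open>[P, c]\<close> applies.\<close>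
    have "?S (\<lambda>b. P (c * b) - c * P b) \<in> dop scale k"
      by (rule Suc.IH) (use dop_commutator[OF Suc.prems, of c] in simp)
    moreover have "?S (\<lambda>b. P (c * b) - c * P b) = (\<lambda>b. ?S P (c * b) - c * ?S P b)"
      by (rule ext) (simp add: algebra_simps sum_distrib_left sum_subtractf)
    ultimately show "(\<lambda>b. ?S P (c * b) - c * ?S P b) \<in> dop scale k" by simp
  qed
qed

text \<open>The commutator of this expression with \<open>a\<close> is the same expression for
  \<open>[P, a]\<close>, plus the expression of \<open>dop_symbol\<close>, which supplies the
  increase of \<open>k\<close> by one, minus second commutators of \<open>P\<close>. All three have
  lower order.\<close>

lemma dop_euler:
  assumes exp: "\<And>\<tau> a. \<tau> \<in> derivs scale {0} \<Longrightarrow> \<mu> * \<tau> a = (\<Sum>t<d. \<tau> (y t) * D t a)"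
    and D: "\<And>t. t < d \<Longrightarrow> D t \<in> derivs scale {0}"
  shows "P \<in> dop scale (Suc k) \<Longrightarrow>
    (\<lambda>b. of_nat k * (\<mu> * P b) - (\<Sum>t<d. P (y t * D t b) - y t * P (D t b))) \<in> dop scale k"
proof (induction k arbitrary: P)
  case 0
  have "P (y t * D t b) - y t * P (D t b) = 0" for t b
    using dop_one_eq[OF 0, of "y t * D t b"] dop_one_eq[OF 0, of "D t b"] by simp
  then show ?case by simp
next
  case (Suc k)
  let ?R = "\<lambda>k P b. of_nat k * (\<mu> * P b) - (\<Sum>t<d. P (y t * D t b) - y t * P (D t b))"
  let ?S = "\<lambda>a b. \<mu> * (P (a * b) - a * P b) - (\<Sum>t<d. D t a * (P (y t * b) - y t * P b))"
  let ?C = "\<lambda>P c b. P (c * b) - c * P b"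
  note L = dop_linear[OF Suc.prems]
  have c: "?C P c \<in> dop scale (Suc k)" for c using dop_commutator[OF Suc.prems, of c] by simp
  show ?case
  proof (rule dop_SucI)
    have CD: "(\<lambda>b. ?C P (y t) (D t b)) \<in> dop scale (Suc (Suc k))" if "t \<in> {..<d}" for t
      using dop_comp[OF c[of "y t"] deriv_dop[OF D], of t] that by simp
    have "?R (Suc k) P \<in> dop scale (Suc (Suc k))"
      by (rule dop_diff[OF dop_left_mult[OF dop_left_mult[OF Suc.prems]] dop_sum[OF CD]])
    then show "?R (Suc k) P \<in> carrier (End_ring scale)" by (rule dop_carrier)
    fix a
    have 1: "?R k (?C P a) \<in> dop scale k" by (rule Suc.IH[OF c])
    have 2: "?S a \<in> dop scale k" by (rule dop_symbol[OF exp Suc.prems])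
    have 3: "(\<lambda>b. \<Sum>t<d. ?C (?C P (y t)) (D t a) b) \<in> dop scale k"
      using dop_commutator[OF c] by (intro dop_sum) simp
    have "(\<lambda>b. (?R k (?C P a) b + ?S a b) - (\<Sum>t<d. ?C (?C P (y t)) (D t a) b)) \<in> dop scale k"
      by (rule dop_diff[OF dop_add[OF 1 2] 3])
    moreover have "(?R k (?C P a) b + ?S a b) - (\<Sum>t<d. ?C (?C P (y t)) (D t a) b)
        = ?R (Suc k) P (a * b) - a * ?R (Suc k) P b" for b
    proof -
      have D': "D t (a * b) = a * D t b + b * D t a" if "t \<in> {..<d}" for t
        using D[of t] that by (auto simp: exact_derivs_iff)
      have "P (y t * D t (a * b)) - y t * P (D t (a * b)) - a * (P (y t * D t b) - y t * P (D t b))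
          = ?C P a (y t * D t b) - y t * ?C P a (D t b) + D t a * (P (y t * b) - y t * P b)
            + ?C (?C P (y t)) (D t a) b" if "t \<in> {..<d}" for t
        unfolding D'[OF that] by (simp add: L distrib_left ac_simps) (simp add: algebra_simps)
      then have "(\<Sum>t<d. P (y t * D t (a * b)) - y t * P (D t (a * b)) - a * (P (y t * D t b) - y t * P (D t b)))
        = (\<Sum>t<d. ?C P a (y t * D t b) - y t * ?C P a (D t b) + D t a * (P (y t * b) - y t * P b)
            + ?C (?C P (y t)) (D t a) b)"
        by (rule sum.cong[OF refl])
      then have "(\<Sum>t<d. P (y t * D t (a * b)) - y t * P (D t (a * b))) - a * (\<Sum>t<d. P (y t * D t b) - y t * P (D t b))
        = (\<Sum>t<d. ?C P a (y t * D t b) - y t * ?C P a (D t b)) + (\<Sum>t<d. D t a * (P (y t * b) - y t * P b))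
            + (\<Sum>t<d. ?C (?C P (y t)) (D t a) b)"
        by (simp only: sum_subtractf[symmetric] sum.distrib[symmetric] sum_distrib_left)
      moreover have "(of_nat k * (\<mu> * (p - a * q)) - z1 + (\<mu> * (p - a * q) - z2)) - z3
          = of_nat (Suc k) * (\<mu> * p) - X - a * (of_nat (Suc k) * (\<mu> * q) - Y)"
        if "X - a * Y = z1 + z2 + z3" for p q X Y z1 z2 z3
      proof -
        have "X = z1 + z2 + z3 + a * Y" using that by (simp add: diff_eq_eq)
        then show ?thesis by (simp add: algebra_simps)
      qed
      ultimately show ?thesis by blast
    qed
    ultimately show "(\<lambda>b. ?R (Suc k) P (a * b) - a * ?R (Suc k) P b) \<in> dop scale k" by simp
  qed
qed

lemma PD_subset_dop: "f \<in> PD \<Longrightarrow> \<exists>k. f \<in> dop scale k"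
proof (induction rule: PD_induct)
  case (mult a)
  show ?case using dop_mult by blast
next
  case (br a)
  show ?case using deriv_dop[OF br_right_deriv] by blast
next
  case (add f g)
  then obtain k l where "f \<in> dop scale k" "g \<in> dop scale l" by blast
  then have "f \<in> dop scale (k + l)" "g \<in> dop scale (k + l)" by (auto intro: dop_mono)
  then show ?case using dop_add by blast
next
  case (comp f g)
  then obtain k l where "f \<in> dop scale k" "g \<in> dop scale l" by blast
  then show ?case using dop_comp by blast
qed

text \<open>The induction parallels that for injectivity: the commutators
  \<open>[P, y\<^sub>t]\<close> are in \<open>PD\<close>, so by Euler's identity
  \<open>k \<mu> P\<close> is in \<open>PD\<close> up to an operator of lower order, and the factors
  that carry \<open>P\<close> into \<open>PD\<close> form an ideal containing all minors.\<close>

lemma dop_subset_PD: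
  assumes exp: "\<And>is js \<tau> a. is \<in> incr_tuples n d \<Longrightarrow> js \<in> incr_tuples n d \<Longrightarrow> minor br x is js \<noteq> 0 \<Longrightarrow>
      \<tau> \<in> derivs scale {0} \<Longrightarrow> minor br x is js * \<tau> a =
        (\<Sum>t<d. \<tau> (x (js ! t)) * (\<Sum>s<d. minor_cofactor br x is js s t * br (x (is ! s)) a))"
    and min: "minors_ideal br x n d = UNIV"
  shows "P \<in> dop scale k \<Longrightarrow> P \<in> PD"
proof (induction k arbitrary: P)
  case 0
  then show ?case using PD_zero by simp
next
  case (Suc k)
  show ?case
  proof (cases k)
    case 0
    then have "P b = P 1 * b" for b using dop_one_eq[of P b] Suc.prems by (simp add: mult.commute)
    then have "P = (\<lambda>b. P 1 * b)" by (rule ext)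
    then show ?thesis using PD_mult[of "P 1"] by simp
  next
    case (Suc j)
    let ?J = "{a. (\<lambda>b. a * P b) \<in> PD}"
    have "minors_ideal br x n d \<subseteq> ?J"
    proof (rule minors_ideal_subset)
      show "0 \<in> ?J" using PD_zero by simp
      show "a + b \<in> ?J" if "a \<in> ?J" "b \<in> ?J" for a b
        using PD_add[of "\<lambda>z. a * P z" "\<lambda>z. b * P z"] that by (simp add: distrib_right)
      show "r * a \<in> ?J" if "a \<in> ?J" for r a
        using PD_left_mult[of "\<lambda>z. a * P z" r] that by (simp add: mult.assoc)
      fix "is" js assume t: "is \<in> incr_tuples n d" "js \<in> incr_tuples n d"
      let ?\<mu> = "minor br x is js" and ?y = "\<lambda>t. x (js ! t)"
      let ?D = "\<lambda>t a. \<Sum>s<d. minor_cofactor br x is js s t * br (x (is ! s)) a"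
      show "?\<mu> \<in> ?J"
      proof (cases "?\<mu> = 0")
        case True
        then show ?thesis using PD_zero by simp
      next
        case False
        have D: "?D t \<in> derivs scale {0}" for t by (intro exact_derivs_sum br_right_deriv)
        have D_PD: "?D t \<in> PD" for t by (intro PD_sum PD_left_mult PD_br)
        have c: "(\<lambda>b. P (?y t * b) - ?y t * P b) \<in> PD" for t
          by (rule Suc.IH) (use dop_commutator[OF Suc.prems, of "?y t"] in simp)
        have S: "(\<lambda>b. \<Sum>t<d. P (?y t * ?D t b) - ?y t * P (?D t b)) \<in> PD"
          by (intro PD_sum PD_comp[OF c D_PD])
        have "(\<lambda>b. of_nat k * (?\<mu> * P b) - (\<Sum>t<d. P (?y t * ?D t b) - ?y t * P (?D t b))) \<in> dop scale k"
          by (rule dop_euler[OF exp[OF t False] D Suc.prems])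
        from PD_add[OF Suc.IH[OF this] S] have "(\<lambda>b. of_nat k * (?\<mu> * P b)) \<in> PD" by simp
        from PD_left_mult[OF this, of "scale (inverse (of_nat k)) 1"]
        have "(\<lambda>b. (scale (inverse (of_nat k)) 1 * of_nat k) * (?\<mu> * P b)) \<in> PD" by (simp add: mult.assoc)
        moreover have "scale (inverse (of_nat k)) 1 * of_nat k = (1::'a)"
          using Suc by (simp add: of_nat_scale[of "Suc j"] scale_mult_left del: of_nat_Suc)
        ultimately show ?thesis by simp
      qed
    qed
    then show ?thesis unfolding min by (auto dest: subsetD[of UNIV _ 1])
  qed
qed

lemma poisson_diff_ops_eq:
  assumes exp: "\<And>is js \<tau> a. is \<in> incr_tuples n d \<Longrightarrow> js \<in> incr_tuples n d \<Longrightarrow> minor br x is js \<noteq> 0 \<Longrightarrow>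
      \<tau> \<in> derivs scale {0} \<Longrightarrow> minor br x is js * \<tau> a =
        (\<Sum>t<d. \<tau> (x (js ! t)) * (\<Sum>s<d. minor_cofactor br x is js s t * br (x (is ! s)) a))"
    and min: "minors_ideal br x n d = UNIV"
  shows "poisson_diff_ops scale br = diff_ops scale"
proof -
  have "PD = (\<Union>k. diff_ops_upto scale k)"
  proof
    show "PD \<subseteq> (\<Union>k. diff_ops_upto scale k)"
    proof
      fix f assume "f \<in> PD"
      then obtain k where "f \<in> dop scale k" using PD_subset_dop by blast
      then have "f \<in> dop scale (Suc k)" by (rule dop_Suc_mono)
      then show "f \<in> (\<Union>k. diff_ops_upto scale k)" unfolding dop_Suc by blast
    qed
    show "(\<Union>k. diff_ops_upto scale k) \<subseteq> PD"
      unfolding dop_Suc[symmetric] using dop_subset_PD[OF exp min] by blast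
  qed
  then show ?thesis by (simp add: poisson_diff_ops_def diff_ops_def)
qed


section \<open>Consequences of the isomorphism for \<open>kappa\<close> and the minors\<close>

lemma ev_delta_repr:
  assumes "length is = length js"
  shows "ev (delta_repr is \<nu> js) a = bordered br x is js \<nu> a"
  unfolding delta_repr_def bordered_def
  by (simp add: ev_simps ev_sum sum_negf)

text \<open>At size equal to the rank the rows \<open>is\<close> span all rows over the field of
  fractions. A relation between the columns \<open>js\<close> on these rows therefore holds on all
  rows, including some on which these columns are independent. In particular principal minors of
  such tuples are nonzero.\<close>

lemma minor_of_nonzero_tuples:
  assumes d: "d = poisson_rank br x n"
    and "is": "is \<in> nonzero_tuples br x n d" and js: "js \<in> nonzero_tuples br x n d"
  shows "minor br x is js \<noteq> 0"
proof -
  from "is" obtain js' where t: "is \<in> incr_tuples n d" "js' \<in> incr_tuples n d" "minor br x is js' \<noteq> 0"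
    by (auto simp: nonzero_tuples_def)
  from js obtain is' where t': "js \<in> incr_tuples n d" "is' \<in> incr_tuples n d" "minor br x js is' \<noteq> 0"
    by (auto simp: nonzero_tuples_def)
  have len: "length is = d" "length js' = d" "length js = d" "length is' = d"
    and set: "set is \<subseteq> {..<n}" "set js' \<subseteq> {..<n}" "set is' \<subseteq> {..<n}"
    using t t' by (simp_all add: incr_tuples_def)
  have nz: "minor br x is' js \<noteq> 0" using t'(3) minor_swap[of is' js] len by simp
  have "\<forall>t<d. a t = 0" if a: "\<forall>s<d. (\<Sum>t<d. br (x (is ! s)) (x (js ! t)) * a t) = 0" for a
  proof -
    have row: "(\<Sum>t<d. br (x \<nu>) (x (js ! t)) * a t) = 0" if \<nu>: "\<nu> < n" for \<nu>
    proof -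
      let ?\<mu> = "minor br x is js'" and ?c = "\<lambda>s. \<Sum>t<d. br (x \<nu>) (x (js' ! t)) * minor_cofactor br x is js' s t"
      have b: "?\<mu> * br (x \<nu>) c = (\<Sum>s<d. ?c s * br (x (is ! s)) c)" for c
        using bordered_zero[OF _ _ set(1,2) t(3) \<nu>, of c] len d by (simp add: bordered_def)
      have "?\<mu> * (\<Sum>t<d. br (x \<nu>) (x (js ! t)) * a t) = (\<Sum>t<d. (?\<mu> * br (x \<nu>) (x (js ! t))) * a t)"
        by (simp add: sum_distrib_left mult.assoc)
      also have "\<dots> = (\<Sum>s<d. ?c s * (\<Sum>t<d. br (x (is ! s)) (x (js ! t)) * a t))"
      proof -
        have "(\<Sum>t<d. (\<Sum>s<d. c s * m s t) * a t) = (\<Sum>s<d. c s * (\<Sum>t<d. m s t * a t))" for c and m :: "nat \<Rightarrow> nat \<Rightarrow> 'a"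
          unfolding sum_distrib_left sum_distrib_right mult.assoc by (rule sum.swap)
        then show ?thesis unfolding b .
      qed
      also have "\<dots> = 0" using a by simp
      finally show ?thesis using t(3) by simp
    qed
    have "(\<Sum>t<d. br (x (is' ! s)) (x (js ! t)) * a t) = 0" if "s < d" for s
      using row[of "is' ! s"] set(3) len(4) that nth_mem by blast
    then show ?thesis using minor_nonzero_iff[OF len(4,3), of br x] nz by blast
  qed
  then show ?thesis using minor_nonzero_iff[OF len(1,3), of br x] by blast
qed

lemma kappa_zero:
  assumes d: "d = poisson_rank br x n" and inj: "inj_on (poisson_pi scale br) (carrier (U scale br))"
  shows "kappa scale br x n d = {\<zero>\<^bsub>U scale br\<^esub>}"
proof -
  let ?S = "{U_delta scale br x is \<nu> js | is \<nu> js.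
        is \<in> nonzero_tuples br x n d \<and> js \<in> nonzero_tuples br x n d \<and> \<nu> \<in> {..<n} - set is}"
  interpret U: ring "U scale br" by (rule U_ring)
  have S: "?S \<subseteq> {\<zero>\<^bsub>U scale br\<^esub>}"
  proof
    fix y assume "y \<in> ?S"
    then obtain "is" js \<nu> where y: "y = U_delta scale br x is \<nu> js"
      "is \<in> nonzero_tuples br x n d" "js \<in> nonzero_tuples br x n d" and \<nu>: "\<nu> < n" by blast
    then have t: "is \<in> incr_tuples n d" "js \<in> incr_tuples n d" by (auto simp: nonzero_tuples_def)
    then have len: "length is = d" "length js = d" "length is = length js" and
      set: "set is \<subseteq> {..<n}" "set js \<subseteq> {..<n}" by (simp_all add: incr_tuples_def)
    have "ev (delta_repr is \<nu> js) a = 0" for a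
      using bordered_zero[OF _ _ set minor_of_nonzero_tuples[OF d y(2,3)] \<nu>] len d by (simp add: ev_delta_repr)
    then have "poisson_pi scale br (proj (delta_repr is \<nu> js)) = poisson_pi scale br (proj 0)"
      unfolding poisson_pi_proj by (simp add: ev_simps fun_eq_iff)
    then have "proj (delta_repr is \<nu> js) = proj 0"
      by (rule inj_onD[OF inj _ proj_mem proj_mem])
    then show "y \<in> {\<zero>\<^bsub>U scale br\<^esub>}" using len by (simp add: y(1) U_delta_eq proj_zero)
  qed
  have "kappa scale br x n d \<subseteq> {\<zero>\<^bsub>U scale br\<^esub>}"
    unfolding kappa_def by (rule U.genideal_minimal[OF U.zeroideal S])
  moreover have "\<zero>\<^bsub>U scale br\<^esub> \<in> kappa scale br x n d"
  proof -
    have "?S \<subseteq> carrier (U scale br)" using S by (rule subset_trans) simp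
    then show ?thesis unfolding kappa_def
      using additive_subgroup.zero_closed[OF ideal.axioms(1)[OF U.genideal_ideal]] by blast
  qed
  ultimately show ?thesis by blast
qed

lemma minors_ideal_full:
  assumes d: "d = poisson_rank br x n" and reg: "regular_domain TYPE('a)"
    and PD: "\<And>D. D \<in> derivs scale {0} \<Longrightarrow> D \<in> PD"
  shows "minors_ideal br x n d = UNIV"
proof -
  let ?J = "minors_ideal br x n d"
  obtain "is" js where t: "is \<in> incr_tuples n d" "js \<in> incr_tuples n d" "minor br x is js \<noteq> 0"
    using exists_minor_nonzero[OF d] by blast
  have mem: "minor br x is js \<in> ?J" using t by (intro minor_mem_minors_ideal) (auto simp: incr_tuples_def)
  have stable: "\<forall>a\<in>?J. f a \<in> ?J" if "f \<in> PD" for f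
    using that
  proof (induction rule: PD_induct)
    case (mult a)
    then show ?case by (simp add: minors_ideal_closed)
  next
    case (br a)
    show ?case using minors_ideal_stable d by blast
  next
    case (add f g)
    then show ?case by (simp add: minors_ideal_closed)
  qed simp
  have "1 \<in> ?J"
    using regular_no_stable_ideal[OF reg, of ?J "minor br x is js"] minors_ideal_closed stable[OF PD] mem t(3) by blast
  then show ?thesis using minors_ideal_closed(3)[of 1 d] by auto
qed

end

section \<open>Jets\<close>

text \<open>A formal power series in commuting variables \<open>z\<^sub>0, z\<^sub>1, \<dots>\<close> is given by its iterated derivatives
  at the origin, that is, by a function on words that is invariant under permutation of letters.
  With this encoding Leibniz' rule is the definition of the product.\<close>

typedef 'l jet = "{b :: nat list \<Rightarrow> 'l. \<forall>u t s v. b (u @ t # s # v) = b (u @ s # t # v)}"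
  morphisms cf Abs_jet
  by (rule exI[of _ "\<lambda>_. undefined"]) simp

lemma cf_swap: "cf b (u @ t # s # v) = cf b (u @ s # t # v)"
  using cf[of b] by blast

lemma jet_eqI: "(\<And>w. cf b w = cf c w) \<Longrightarrow> b = c"
  by (metis cf_inject ext)

text \<open>The partial derivative by the variable number \<open>t\<close>.\<close>

definition shift :: "nat \<Rightarrow> 'l jet \<Rightarrow> 'l jet" where
  "shift t b = Abs_jet (\<lambda>w. cf b (t # w))"

lemma cf_shift: "cf (shift t b) w = cf b (t # w)"
proof -
  have "cf b (t # u @ r # s # v) = cf b (t # u @ s # r # v)" for u r s v
    using cf_swap[of b "t # u" r s v] by simp
  then show ?thesis unfolding shift_def by (subst Abs_jet_inverse) auto
qed

lemma shift_commute: "shift s (shift t b) = shift t (shift s b)"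
  by (rule jet_eqI) (simp add: cf_shift cf_swap[of b "[]", simplified])

primrec shuffle :: "nat list \<Rightarrow> (nat list \<Rightarrow> 'l) \<Rightarrow> (nat list \<Rightarrow> 'l) \<Rightarrow> 'l::comm_ring_1" where
  "shuffle [] b c = b [] * c []"
| "shuffle (t # w) b c = shuffle w (\<lambda>v. b (t # v)) c + shuffle w b (\<lambda>v. c (t # v))"

lemma shuffle_swap: "shuffle (u @ t # s # v) (cf b) (cf c) = shuffle (u @ s # t # v) (cf b) (cf c)"
proof (induction u arbitrary: b c)
  case Nil
  have "(\<lambda>w. cf b (t # s # w)) = (\<lambda>w. cf b (s # t # w))" for b :: "'a jet"
    using cf_swap[of b "[]" t s] by auto
  then show ?case by (simp add: algebra_simps)
next
  case (Cons r u)
  have "(\<lambda>w. cf b (r # w)) = cf (shift r b)" for b :: "'a jet" by (simp add: cf_shift fun_eq_iff)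
  then show ?case by (simp add: Cons)
qed

instantiation jet :: (comm_ring_1) comm_ring_1
begin

definition "0 = Abs_jet (\<lambda>_. 0)"
definition "1 = Abs_jet (\<lambda>w. if w = [] then 1 else 0)"
definition "b + c = Abs_jet (\<lambda>w. cf b w + cf c w)"
definition "b - c = Abs_jet (\<lambda>w. cf b w - cf c w)"
definition "- b = Abs_jet (\<lambda>w. - cf b w)"
definition "b * c = Abs_jet (\<lambda>w. shuffle w (cf b) (cf c))"

lemma cf_simps:
  "cf 0 w = 0" "cf 1 w = (if w = [] then 1 else 0)" "cf (b + c) w = cf b w + cf c w"
  "cf (b - c) w = cf b w - cf c w" "cf (- b) w = - cf b w"
  by (simp_all add: zero_jet_def one_jet_def plus_jet_def minus_jet_def uminus_jet_def Abs_jet_inverse cf_swap)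

lemma cf_mult: "cf (b * c) w = shuffle w (cf b) (cf c)"
  unfolding times_jet_def by (subst Abs_jet_inverse) (simp_all add: shuffle_swap)

lemma cf_mult_simps:
  "cf (b * c) [] = cf b [] * cf c []" "cf (b * c) (t # w) = cf (shift t b * c) w + cf (b * shift t c) w"
  by (simp_all add: cf_mult cf_shift[abs_def])

lemma shift_add: "shift t (b + c) = shift t b + shift t c"
  by (rule jet_eqI) (simp add: cf_shift cf_simps)

lemma cf_distrib: "cf ((b + c) * d) w = cf (b * d) w + cf (c * d) w"
  by (induction w arbitrary: b c d) (simp_all add: cf_mult_simps cf_simps shift_add algebra_simps)

lemma cf_commute: "cf (b * c) w = cf (c * b) w"
  by (induction w arbitrary: b c) (simp_all add: cf_mult_simps algebra_simps)

lemma shift_mult: "shift t (b * c) = shift t b * c + b * shift t c"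
  by (rule jet_eqI) (simp add: cf_shift cf_mult_simps cf_simps)

lemma cf_distrib_right: "cf (b * (c + d)) w = cf (b * c) w + cf (b * d) w"
  by (simp add: cf_commute[of b] cf_distrib)

lemma cf_assoc: "cf (b * c * d) w = cf (b * (c * d)) w"
  by (induction w arbitrary: b c d)
    (simp_all add: cf_mult_simps shift_mult cf_distrib cf_distrib_right algebra_simps)

lemma cf_one: "cf (1 * b) w = cf b w"
proof (induction w arbitrary: b)
  case (Cons t w)
  have "shift t 1 = (0 :: 'a jet)" by (rule jet_eqI) (simp add: cf_shift cf_simps)
  moreover have "cf (0 * c) w = 0" for c :: "'a jet"
  proof -
    have "(0 :: 'a jet) + 0 = 0" by (rule jet_eqI) (simp add: cf_simps)
    then show ?thesis using cf_distrib[of 0 0 c w] by simp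
  qed
  ultimately show ?case using Cons by (simp add: cf_mult_simps cf_shift)
qed (simp add: cf_mult_simps cf_simps)

instance
proof
  fix a b c :: "'a jet"
  show "a * b * c = a * (b * c)" by (rule jet_eqI) (rule cf_assoc)
  show "a * b = b * a" by (rule jet_eqI) (rule cf_commute)
  show "1 * a = a" by (rule jet_eqI) (rule cf_one)
  show "(a + b) * c = a * c + b * c" by (rule jet_eqI) (simp add: cf_simps cf_distrib)
  have "cf (0 :: 'a jet) [] \<noteq> cf 1 []" by (simp add: cf_simps)
  then show "(0 :: 'a jet) \<noteq> 1" by metis
qed (rule jet_eqI, simp add: cf_simps)+

end

lemma shift_simps: "shift t (b + c) = shift t b + shift t c" "shift t (b - c) = shift t b - shift t c"
  "shift t 0 = 0" "shift t (b * c) = shift t b * c + b * shift t c" "shift t 1 = 0"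
  by (rule jet_eqI, simp add: cf_shift cf_simps cf_mult_simps)+

lemma shift_sum: "shift t (sum f I) = (\<Sum>i\<in>I. shift t (f i))"
  by (induction I rule: infinite_finite_induct) (simp_all add: shift_simps)

lemma cf_sum: "cf (sum f I) w = (\<Sum>i\<in>I. cf (f i) w)"
  by (induction I rule: infinite_finite_induct) (simp_all add: cf_simps)

text \<open>\<open>D\<close> acts on the coefficients and treats the variables as constants. Hence
  it commutes with \<open>shift\<close>, and a derivation \<open>D\<close> induces a derivation of
  the jets.\<close>

definition map_jet :: "('l \<Rightarrow> 'l) \<Rightarrow> 'l jet \<Rightarrow> 'l jet" where
  "map_jet D b = Abs_jet (\<lambda>w. D (cf b w))"

lemma cf_map_jet: "cf (map_jet D b) w = D (cf b w)"
  unfolding map_jet_def by (subst Abs_jet_inverse) (simp_all add: cf_swap)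

lemma shift_map_jet: "shift t (map_jet D b) = map_jet D (shift t b)"
  by (rule jet_eqI) (simp add: cf_shift cf_map_jet)

lemma map_jet_add: "(\<And>a b. D (a + b) = D a + D b) \<Longrightarrow> map_jet D (b + c) = map_jet D b + map_jet D c"
  by (rule jet_eqI) (simp add: cf_simps cf_map_jet)

lemma map_jet_mult:
  assumes D: "\<And>a b. D (a + b) = D a + D b" "\<And>a b. D (a * b) = a * D b + b * D a"
  shows "map_jet D (b * c) = b * map_jet D c + c * map_jet D b"
proof (rule jet_eqI)
  fix w
  show "cf (map_jet D (b * c)) w = cf (b * map_jet D c + c * map_jet D b) w"
  proof (induction w arbitrary: b c)
    case (Cons t w)
    have "cf (map_jet D (b * c)) (t # w) = cf (map_jet D (shift t b * c)) w + cf (map_jet D (b * shift t c)) w"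
      by (simp add: cf_map_jet cf_mult_simps D(1))
    then show ?case by (simp add: Cons cf_simps cf_mult_simps shift_map_jet)
  qed (simp add: cf_map_jet cf_mult_simps cf_simps D)
qed

definition coord :: "nat \<Rightarrow> 'l::comm_ring_1 jet" where
  "coord t = Abs_jet (\<lambda>w. if w = [t] then 1 else 0)"

lemma cf_coord: "cf (coord t) w = (if w = [t] then 1 else 0)"
  unfolding coord_def by (subst Abs_jet_inverse) (auto simp: append_eq_Cons_conv)

lemma shift_coord: "shift u (coord t) = (if u = t then 1 else 0)"
  by (rule jet_eqI) (auto simp: cf_shift cf_coord cf_simps)

text \<open>The coefficient at \<open>w\<close> has degree \<open>length w\<close>, and each letter
  of \<open>w\<close> that hits a coordinate contributes one copy of it.\<close>

lemma euler_jet: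
  assumes "\<And>t. t \<ge> d \<Longrightarrow> shift t b = 0"
  shows "cf (\<Sum>v<d. coord v * shift v b) w = of_nat (length w) * cf b w"
  using assms
proof (induction w arbitrary: b)
  case Nil
  then show ?case by (simp add: cf_sum cf_mult_simps cf_coord)
next
  case (Cons t w)
  have zero: "shift u (shift t b) = 0" if "u \<ge> d" for u
    using Cons.prems[OF that] by (simp add: shift_commute[of u t] shift_simps)
  have "shift t (\<Sum>v<d. coord v * shift v b) = (\<Sum>v<d. (if t = v then shift v b else 0)) + (\<Sum>v<d. coord v * shift v (shift t b))"
    by (simp add: shift_sum shift_simps shift_coord sum.distrib shift_commute[of t] if_distrib[of "\<lambda>c. c * _"] cong: if_cong)
  also have "(\<Sum>v<d. (if t = v then shift v b else 0)) = shift t b"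
    using Cons.prems[of t] by (cases "t < d") simp_all
  finally have "cf (\<Sum>v<d. coord v * shift v b) (t # w) = cf (shift t b) w + cf (\<Sum>v<d. coord v * shift v (shift t b)) w"
    by (simp add: cf_shift[symmetric] cf_simps)
  then show ?case by (simp add: Cons.IH[OF zero] cf_shift algebra_simps)
qed

text \<open>The Poincare lemma for two-forms; the primitive is given by the usual homotopy, which divides
  terms of degree \<open>k\<close> by \<open>k + 1\<close>.\<close>

lemma jet_poincare:
  fixes k :: "nat \<Rightarrow> nat \<Rightarrow> 'l::field jet"
  assumes char: "\<And>m. of_nat (Suc m) \<noteq> (0 :: 'l)" and anti: "\<And>t u. k t u = - k u t"
    and closed: "\<And>i u t. shift i (k u t) + shift u (k t i) + shift t (k i u) = 0"
    and support: "\<And>u t v. v \<ge> d \<Longrightarrow> shift v (k u t) = 0"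
  obtains l where "\<And>t u. u < d \<Longrightarrow> t < d \<Longrightarrow> shift u (l t) - shift t (l u) = k u t" "\<And>t. cf (l t) [] = 0"
proof
  \<comment> \<open>The contraction of the two-form with Euler's field. Coefficients of degree
    \<open>m - 1\<close> become terms of degree \<open>m\<close>; the derivative of the contraction
    multiplies them by \<open>m + 1\<close>, where \<open>m - 1\<close> comes from Euler's identity
    and 2 from differentiating the coordinates.\<close>
  define S where "S = (\<lambda>t. \<Sum>v<d. coord v * k v t)"
  define l where "l = (\<lambda>t. Abs_jet (\<lambda>w. cf (S t) w / of_nat (Suc (length w))))"
  have l: "cf (l t) w = cf (S t) w / of_nat (Suc (length w))" for t w
    unfolding l_def by (subst Abs_jet_inverse) (simp_all add: cf_swap)
  have dS: "shift u (S t) = k u t + (\<Sum>v<d. coord v * shift u (k v t))" if "u < d" for u t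
    using that by (simp add: S_def shift_sum shift_simps shift_coord sum.distrib if_distrib[of "\<lambda>c. c * _"] cong: if_cong)
  show "cf (l t) [] = 0" for t by (simp add: l S_def cf_sum cf_mult_simps cf_coord)
  show "shift u (l t) - shift t (l u) = k u t" if "u < d" "t < d" for t u
  proof (rule jet_eqI)
    fix w
    have "shift u (k v t) - shift t (k v u) = shift v (k u t)" for v
    proof -
      have neg: "shift t (k v u) = - shift t (k u v)" "shift v (k u t) = - shift v (k t u)"
        using anti[of v u] anti[of u t] shift_simps(2)[of t 0 "k u v"] shift_simps(2)[of v 0 "k t u"] shift_simps(3)
        by simp_all
      have "shift u (k v t) + shift v (k t u) + shift t (k u v) = 0" by (rule closed)
      then show ?thesis unfolding neg by (simp add: eq_neg_iff_add_eq_0 add.commute add.left_commute)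
    qed
    then have "(\<Sum>v<d. coord v * shift u (k v t)) - (\<Sum>v<d. coord v * shift t (k v u)) = (\<Sum>v<d. coord v * shift v (k u t))"
      by (simp add: sum_subtractf[symmetric] right_diff_distrib[symmetric])
    moreover have "shift u (S t) - shift t (S u)
        = k u t - k t u + ((\<Sum>v<d. coord v * shift u (k v t)) - (\<Sum>v<d. coord v * shift t (k v u)))"
      using that by (simp add: dS)
    ultimately have "shift u (S t) - shift t (S u) = k u t + k u t + (\<Sum>v<d. coord v * shift v (k u t))"
      using anti[of t u] by simp
    then have "cf (shift u (S t) - shift t (S u)) w = of_nat (Suc (Suc (length w))) * cf (k u t) w"
      using euler_jet[of d "k u t" w, OF support] by (simp only: cf_simps) (simp add: algebra_simps)
    then show "cf (shift u (l t) - shift t (l u)) w = cf (k u t) w"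
      by (simp add: cf_simps cf_shift l diff_divide_distrib[symmetric] char del: of_nat_Suc)
  qed
qed

section \<open>The generic symplectic leaf\<close>

lemma deriv_on_UNIV: "deriv_on UNIV D \<longleftrightarrow> (\<forall>a b. D (a + b) = D a + D b) \<and> (\<forall>a b. D (a * b) = a * D b + b * D a)"
  by (auto simp: deriv_on_def)

lemma deriv_on_UNIV_eq_0:
  assumes D: "deriv_on UNIV (D :: 'a::idom fract \<Rightarrow> _)" and zero: "\<And>a. D (to_fract a) = 0"
  shows "D f = 0"
proof -
  obtain a b where f: "f = Fract a b" "b \<noteq> 0" by (cases f)
  then have "f * to_fract b = to_fract a" by (simp add: to_fract_def eq_fract)
  then have "D (f * to_fract b) = 0" by (simp add: zero)
  then have "to_fract b * D f = 0" using D zero[of b] by (simp add: deriv_on_UNIV)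
  then show ?thesis using f(2) by simp
qed

lemma deriv_on_UNIV_zero: "deriv_on UNIV D \<Longrightarrow> D 0 = 0" "deriv_on UNIV D \<Longrightarrow> D 1 = 0"
  and deriv_on_UNIV_sum: "deriv_on UNIV D \<Longrightarrow> D (sum f I) = (\<Sum>i\<in>I. D (f i))"
proof -
  have U: "subring_set UNIV" by (simp add: subring_set_def)
  show "deriv_on UNIV D \<Longrightarrow> D 0 = 0" "deriv_on UNIV D \<Longrightarrow> D 1 = 0"
    by (rule deriv_on_zero[OF U] deriv_on_one[OF U], assumption)+
  show "deriv_on UNIV D \<Longrightarrow> D (sum f I) = (\<Sum>i\<in>I. D (f i))" by (rule deriv_on_sum[OF U]) auto
qed

lemma deriv_on_UNIV_combination:
  "(\<And>i. i \<in> I \<Longrightarrow> deriv_on UNIV (D i)) \<Longrightarrow> deriv_on UNIV (\<lambda>b. \<Sum>i\<in>I. a i * D i b)"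
  by (simp add: deriv_on_UNIV sum.distrib sum_distrib_left algebra_simps)

lemma deriv_on_UNIV_commutator:
  "deriv_on UNIV D \<Longrightarrow> deriv_on UNIV E \<Longrightarrow> deriv_on UNIV (\<lambda>b. D (E b) - E (D b))"
  by (simp add: deriv_on_UNIV algebra_simps)

lemma fract_deriv_exists:
  fixes scale :: "'k::field \<Rightarrow> 'a::idom \<Rightarrow> 'a"
  assumes "D \<in> derivs scale {0}"
  shows "\<exists>D'. deriv_on UNIV D' \<and> (\<forall>a. D' (to_fract a) = to_fract (D a))"
proof -
  let ?R = "range (to_fract :: 'a \<Rightarrow> _)"
  let ?D = "\<lambda>f. to_fract (D (inv_into UNIV to_fract f))"
  have inv: "inv_into UNIV to_fract (to_fract a) = a" for a :: 'a by (rule inv_f_f[OF inj_to_fract])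
  have R: "subring_set ?R"
    unfolding subring_set_def
    by (auto simp: image_iff intro: exI[of _ 1] simp del: to_fract_add to_fract_diff to_fract_mult
      simp: to_fract_add[symmetric] to_fract_diff[symmetric] to_fract_mult[symmetric])
  have D: "deriv_on ?R ?D"
    using assms by (auto simp: deriv_on_def exact_derivs_iff inv
      simp del: to_fract_add to_fract_mult simp: to_fract_add[symmetric] to_fract_mult[symmetric])
  obtain M D' where "subring_set M" "deriv_on M D'" "\<And>a. a \<in> ?R \<Longrightarrow> D' a = ?D a"
    "M = {a / b |a b. a \<in> ?R \<and> b \<in> ?R}"
    by (rule deriv_on_fractions[OF R D]) blast
  moreover have "M = UNIV"
  proof -
    have "f \<in> M" for f
    proof -
      obtain a b where "f = Fract a b" by (cases f)
      then have "f = to_fract a / to_fract b" by (simp add: Fract_conv_to_fract)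
      then show ?thesis unfolding \<open>M = _\<close> by blast
    qed
    then show ?thesis by blast
  qed
  ultimately show ?thesis by (auto simp: inv)
qed

definition fract_deriv :: "('a::idom \<Rightarrow> 'a) \<Rightarrow> 'a fract \<Rightarrow> 'a fract" where
  "fract_deriv D = (SOME D'. deriv_on UNIV D' \<and> (\<forall>a. D' (to_fract a) = to_fract (D a)))"

lemma fract_deriv:
  assumes "D \<in> derivs scale {0}"
  shows "deriv_on UNIV (fract_deriv D)" "fract_deriv D (to_fract a) = to_fract (D a)"
  using someI_ex[OF fract_deriv_exists[OF assms]] unfolding fract_deriv_def[symmetric] by blast+

text \<open>A nonzero principal minor of maximal size makes the \<open>x (js ! t)\<close>
  coordinates along the symplectic leaf through the generic point. Rows and columns agree so that
  the matrix of brackets is alternating.\<close>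

locale poisson_leaf = ess_poisson scale br x n
  for scale :: "'k::field_char_0 \<Rightarrow> 'a::idom \<Rightarrow> 'a" and br x n +
  fixes d :: nat and js :: "nat list"
  assumes d: "d = poisson_rank br x n" and len: "length js = d" and js: "set js \<subseteq> {..<n}"
    and nonzero: "minor br x js js \<noteq> 0"
begin

abbreviation y :: "nat \<Rightarrow> 'a" where "y t \<equiv> x (js ! t)"

text \<open>The inverse of the matrix of brackets of the \<open>y u\<close>; up to sign, the
  symplectic form of the leaf in these coordinates.\<close>

definition sig :: "nat \<Rightarrow> nat \<Rightarrow> 'a fract" where
  "sig u t = to_fract (minor_cofactor br x js js t u) / to_fract (minor br x js js)"

text \<open>The partial derivative along the leaf by the coordinate \<open>y u\<close>. It is set to
  0 for \<open>u \<ge> d\<close>, so that these fields commute for all indices and words may contain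
  any letters.\<close>

definition X :: "nat \<Rightarrow> 'a fract \<Rightarrow> 'a fract" where
  "X u f = (if u < d then \<Sum>t<d. sig u t * fract_deriv (br (y t)) f else 0)"

lemma sig_inverse:
  assumes "u < d" "t < d"
  shows "(\<Sum>w<d. sig u w * to_fract (br (y w) (y t))) = (if u = t then 1 else 0)"
    "(\<Sum>w<d. to_fract (br (y u) (y w)) * sig w t) = (if u = t then 1 else 0)"
proof -
  let ?\<mu> = "minor br x js js"
  have nz: "to_fract ?\<mu> \<noteq> 0" using nonzero by simp
  have "to_fract (\<Sum>w<d. minor_cofactor br x js js w u * br (y w) (y t)) = to_fract (if u = t then ?\<mu> else 0)"
    by (simp only: minor_cofactor_column[OF len len assms])
  then have "(\<Sum>w<d. sig u w * to_fract (br (y w) (y t))) * to_fract ?\<mu> = (if u = t then to_fract ?\<mu> else 0)"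
    using nz by (simp add: to_fract_sum sig_def sum_distrib_right split: if_splits)
  then show "(\<Sum>w<d. sig u w * to_fract (br (y w) (y t))) = (if u = t then 1 else 0)"
    using nz by (simp split: if_splits)
  have "to_fract (\<Sum>w<d. br (y u) (y w) * minor_cofactor br x js js t w) = to_fract (if u = t then ?\<mu> else 0)"
    by (simp only: minor_cofactor_row[OF len len assms])
  then have "(\<Sum>w<d. to_fract (br (y u) (y w)) * sig w t) * to_fract ?\<mu> = (if u = t then to_fract ?\<mu> else 0)"
    using nz by (simp add: to_fract_sum sig_def sum_distrib_right split: if_splits)
  then show "(\<Sum>w<d. to_fract (br (y u) (y w)) * sig w t) = (if u = t then 1 else 0)"
    using nz by (simp split: if_splits)
qed

lemma sum_delta_left: "u < (d::nat) \<Longrightarrow> (\<Sum>t<d. (if u = t then 1 else 0) * f t) = (f u :: 'b::comm_ring_1)"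
  and sum_delta_right: "u < (d::nat) \<Longrightarrow> (\<Sum>t<d. f t * (if t = u then 1 else 0)) = (f u :: 'b::comm_ring_1)"
  by (simp_all add: if_distrib[of "\<lambda>c. c * _"] if_distrib[of "\<lambda>c. _ * c"] cong: if_cong)

lemma sig_anti:
  assumes ut: "u < d" "t < d"
  shows "sig t u = - sig u t"
proof -
  let ?p = "\<lambda>v w. to_fract (br (y v) (y w))"
  have p: "?p v w = - ?p w v" for v w using br_anti[of "y v" "y w"] by simp
  have "- sig u t = (\<Sum>w<d. (if t = w then 1 else 0) * - sig u w)" by (simp only: sum_delta_left[OF ut(2)])
  also have "\<dots> = (\<Sum>w<d. (\<Sum>v<d. sig t v * ?p v w) * - sig u w)"
    using ut by (intro sum.cong refl) (simp add: sig_inverse(1))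
  also have "\<dots> = (\<Sum>v<d. sig t v * (\<Sum>w<d. sig u w * ?p w v))"
    unfolding sum_distrib_left sum_distrib_right
    by (subst sum.swap) (intro sum.cong refl, subst p, simp add: ac_simps)
  also have "\<dots> = (\<Sum>v<d. sig t v * (if v = u then 1 else 0))"
    using ut by (intro sum.cong refl) (auto simp add: sig_inverse(1))
  also have "\<dots> = sig t u" using ut by (simp add: sum_delta_right)
  finally show ?thesis by simp
qed

lemma X_deriv: "deriv_on UNIV (X u)"
proof (cases "u < d")
  case True
  have "deriv_on UNIV (\<lambda>f. \<Sum>t<d. sig u t * fract_deriv (br (y t)) f)"
    by (intro deriv_on_UNIV_combination fract_deriv(1)[OF br_right_deriv])
  then show ?thesis using True by (simp add: X_def[abs_def])
qed (simp add: X_def[abs_def] deriv_on_UNIV)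

lemma X_to_fract: "u < d \<Longrightarrow> X u (to_fract a) = (\<Sum>t<d. sig u t * to_fract (br (y t) a))"
  by (simp add: X_def fract_deriv(2)[OF br_right_deriv])

lemma X_y: "u < d \<Longrightarrow> t < d \<Longrightarrow> X u (to_fract (y t)) = (if u = t then 1 else 0)"
  by (simp add: X_to_fract sig_inverse)

lemma X_scalar: "X u (to_fract (scale c 1)) = 0"
  by (cases "u < d") (simp_all add: X_to_fract br_scalar, simp add: X_def)

text \<open>Divided by the minor, this is the vanishing of the bordered minors: Hamiltonian fields
  are combinations of the \<open>X v\<close>. Both sides are derivations in \<open>a\<close>, so the
  generators suffice.\<close>

lemma br_X: "to_fract (br a b) = (\<Sum>v<d. to_fract (br a (y v)) * X v (to_fract b))"
proof -
  let ?\<mu> = "minor br x js js" and ?g = "minor_cofactor br x js js"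
  let ?D = "\<lambda>a. ?\<mu> * br a b + (- 1) * (\<Sum>v<d. (\<Sum>t<d. ?g t v * br (y t) b) * br a (y v))"
  have "?D \<in> derivs scale {0}"
    by (intro exact_derivs_comb2 exact_derivs_sum br_left_deriv)
  moreover have "?D (x \<nu>) = 0" if "\<nu> < n" for \<nu>
  proof -
    have "(\<Sum>v<d. (\<Sum>t<d. ?g t v * br (y t) b) * br (x \<nu>) (y v)) = (\<Sum>s<d. (\<Sum>t<d. br (x \<nu>) (y t) * ?g s t) * br (y s) b)"
      unfolding sum_distrib_right by (subst sum.swap) (simp add: ac_simps)
    then show ?thesis
      using bordered_zero[of js js \<nu> b] len d js nonzero that by (simp add: bordered_def)
  qed
  ultimately have "?D a = 0" by (rule exact_deriv_zero)
  then have "?\<mu> * br a b = (\<Sum>v<d. (\<Sum>t<d. ?g t v * br (y t) b) * br a (y v))" by simp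
  then have "to_fract (?\<mu> * br a b) = to_fract (\<Sum>v<d. (\<Sum>t<d. ?g t v * br (y t) b) * br a (y v))" by simp
  then have "to_fract ?\<mu> * to_fract (br a b)
      = (\<Sum>v<d. (\<Sum>t<d. to_fract (?g t v) * to_fract (br (y t) b)) * to_fract (br a (y v)))"
    by (simp add: to_fract_sum)
  also have "\<dots> = to_fract ?\<mu> * (\<Sum>v<d. to_fract (br a (y v)) * X v (to_fract b))"
    using nonzero by (simp add: X_to_fract sig_def sum_distrib_left sum_distrib_right ac_simps)
  finally show ?thesis using nonzero by simp
qed

lemma br_sig: "to_fract (br a b) = - (\<Sum>u<d. \<Sum>t<d. sig u t * to_fract (br (y u) a) * to_fract (br (y t) b))"
proof -
  have "to_fract (br a (y u)) = - to_fract (br (y u) a)" for u using br_anti[of a "y u"] by simp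
  then show ?thesis
    by (subst br_X) (simp add: X_to_fract sum_negf sum_distrib_left ac_simps)
qed

text \<open>By the Jacobi identity the commutator is a combination of Hamiltonian fields, hence of
  the \<open>X v\<close>, with its values at the \<open>y v\<close> as coefficients. These are zero
  because \<open>X u\<close> and \<open>X t\<close> have constant values at the coordinates.\<close>

lemma X_commute: "X u (X t f) = X t (X u f)"
proof (cases "u < d \<and> t < d")
  case False
  then have "X u = (\<lambda>_. 0) \<or> X t = (\<lambda>_. 0)" by (auto simp: X_def[abs_def])
  then show ?thesis using deriv_on_UNIV_zero(1)[OF X_deriv] by auto
next
  case True
  then have ut: "u < d" "t < d" by simp_all
  let ?Z = "\<lambda>f. X u (X t f) - X t (X u f)"
  have Z: "deriv_on UNIV ?Z" by (intro deriv_on_UNIV_commutator X_deriv)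
  define h where "h = (\<lambda>e. X u (sig t e) - X t (sig u e))"
  have brbr: "br a (br b c) - br b (br a c) = br (br a b) c" for a b c
    using br_jacobi[of a b c] br_anti[of "br a b" c] br_anti[of a c] br_minus[of b "br a c"]
    by (simp add: add_eq_0_iff algebra_simps)
  have XX: "X v (X w (to_fract a)) = (\<Sum>e<d. X v (sig w e) * to_fract (br (y e) a))
      + (\<Sum>e<d. \<Sum>f<d. sig w e * sig v f * to_fract (br (y f) (br (y e) a)))" if "v < d" "w < d" for v w a
    using X_deriv[of v] that
    by (simp add: X_to_fract deriv_on_UNIV_sum[OF X_deriv]) 
       (simp add: deriv_on_UNIV X_to_fract sum.distrib sum_distrib_left ac_simps)
  have Za: "?Z (to_fract a) = (\<Sum>e<d. h e * to_fract (br (y e) a))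
      + (\<Sum>e<d. \<Sum>f<d. sig t e * sig u f * to_fract (br (br (y f) (y e)) a))" for a
  proof -
    have "(\<Sum>e<d. \<Sum>f<d. sig u e * sig t f * to_fract (br (y f) (br (y e) a)))
        = (\<Sum>e<d. \<Sum>f<d. sig t e * sig u f * to_fract (br (y e) (br (y f) a)))"
      by (subst sum.swap) (simp add: ac_simps)
    then show ?thesis
      unfolding XX[OF ut] XX[OF ut(2,1)] h_def brbr[symmetric]
      by (simp add: left_diff_distrib right_diff_distrib sum_subtractf)
  qed
  have "?Z (to_fract a) = (\<Sum>v<d. ?Z (to_fract (y v)) * X v (to_fract a))" for a
  proof -
    have 1: "(\<Sum>e<d. h e * (\<Sum>v<d. p e v * c v)) = (\<Sum>v<d. (\<Sum>e<d. h e * p e v) * c v)" for p c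
      unfolding sum_distrib_left sum_distrib_right mult.assoc by (rule sum.swap)
    have 2: "(\<Sum>e<d. \<Sum>f<d. g e f * (\<Sum>v<d. p e f v * c v)) = (\<Sum>v<d. (\<Sum>e<d. \<Sum>f<d. g e f * p e f v) * c v)"
      for g and p :: "nat \<Rightarrow> nat \<Rightarrow> nat \<Rightarrow> 'a fract" and c
    proof -
      have "(\<Sum>e<d. \<Sum>f<d. g e f * (\<Sum>v<d. p e f v * c v)) = (\<Sum>e<d. \<Sum>v<d. (\<Sum>f<d. g e f * p e f v) * c v)"
        unfolding sum_distrib_left sum_distrib_right mult.assoc by (rule sum.cong[OF refl], rule sum.swap)
      also have "\<dots> = (\<Sum>v<d. (\<Sum>e<d. \<Sum>f<d. g e f * p e f v) * c v)"
        unfolding sum_distrib_right by (rule sum.swap)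
      finally show ?thesis .
    qed
    show ?thesis
      unfolding Za br_X[of _ a] 1 2 by (simp only: distrib_right sum.distrib)
  qed
  moreover have "?Z (to_fract (y v)) = 0" if "v < d" for v
    using deriv_on_UNIV_zero[OF X_deriv] ut that by (simp add: X_y)
  ultimately have "?Z (to_fract a) = 0" for a by simp
  from deriv_on_UNIV_eq_0[OF Z this] show ?thesis by simp
qed


text \<open>The derivative of an inverse matrix is minus the inverse times the derivative times the
  inverse; the sign is absorbed by the alternation of \<open>sig\<close>.\<close>

lemma X_sig:
  assumes i: "i < d" and ut: "u < d" "t < d"
  shows "X i (sig u t) = (\<Sum>e<d. \<Sum>v<d. \<Sum>w<d. sig i e * sig u v * sig t w * to_fract (br (y e) (br (y v) (y w))))"
proof -
  let ?p = "\<lambda>v w. to_fract (br (y v) (y w))"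
  have D: "X i (a * b) = a * X i b + b * X i a" for a b using X_deriv[of i] by (simp add: deriv_on_UNIV)
  have row: "(\<Sum>v<d. X i (sig u v) * ?p v w) = - (\<Sum>v<d. sig u v * X i (?p v w))" if w: "w < d" for w
  proof -
    have "X i (\<Sum>v<d. sig u v * ?p v w) = 0"
      unfolding sig_inverse(1)[OF ut(1) w] using deriv_on_UNIV_zero[OF X_deriv] by simp
    then have "(\<Sum>v<d. sig u v * X i (?p v w)) + (\<Sum>v<d. ?p v w * X i (sig u v)) = 0"
      unfolding deriv_on_UNIV_sum[OF X_deriv] by (simp add: D sum.distrib)
    then show ?thesis by (simp add: eq_neg_iff_add_eq_0 add.commute mult.commute)
  qed
  have "X i (sig u t) = (\<Sum>v<d. X i (sig u v) * (if v = t then 1 else 0))"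
    using ut by (simp add: sum_delta_right)
  also have "\<dots> = (\<Sum>v<d. X i (sig u v) * (\<Sum>w<d. ?p v w * sig w t))"
    by (rule sum.cong[OF refl]) (simp only: sig_inverse(2)[OF _ ut(2)] lessThan_iff)
  also have "\<dots> = (\<Sum>w<d. (\<Sum>v<d. X i (sig u v) * ?p v w) * sig w t)"
    unfolding sum_distrib_left sum_distrib_right mult.assoc by (rule sum.swap)
  also have "\<dots> = (\<Sum>w<d. (\<Sum>v<d. sig u v * X i (?p v w)) * sig t w)"
    by (rule sum.cong[OF refl]) (simp add: row sig_anti[OF ut(2)])
  also have "\<dots> = (\<Sum>w<d. \<Sum>v<d. \<Sum>e<d. sig i e * sig u v * sig t w * to_fract (br (y e) (br (y v) (y w))))"
    unfolding X_to_fract[OF i] sum_distrib_left sum_distrib_right by (simp add: ac_simps)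
  also have "\<dots> = (\<Sum>w<d. \<Sum>e<d. \<Sum>v<d. sig i e * sig u v * sig t w * to_fract (br (y e) (br (y v) (y w))))"
    by (rule sum.cong[OF refl], rule sum.swap)
  also have "\<dots> = (\<Sum>e<d. \<Sum>w<d. \<Sum>v<d. sig i e * sig u v * sig t w * to_fract (br (y e) (br (y v) (y w))))"
    by (rule sum.swap)
  also have "\<dots> = (\<Sum>e<d. \<Sum>v<d. \<Sum>w<d. sig i e * sig u v * sig t w * to_fract (br (y e) (br (y v) (y w))))"
    by (rule sum.cong[OF refl], rule sum.swap)
  finally show ?thesis .
qed

text \<open>This is the Jacobi identity, read for the two-form inverse to the bracket.\<close>

lemma sig_closed:
  assumes iut: "i < d" "u < d" "t < d"
  shows "X i (sig u t) + X u (sig t i) + X t (sig i u) = 0"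
proof -
  define G where "G = (\<lambda>e v w. sig i e * sig u v * sig t w)"
  define J where "J = (\<lambda>e v w. to_fract (br (y e) (br (y v) (y w))))"
  have jac: "J e v w + J v w e + J w e v = 0" for e v w
    unfolding J_def to_fract_add[symmetric] br_jacobi by simp
  have 1: "X i (sig u t) = (\<Sum>e<d. \<Sum>v<d. \<Sum>w<d. G e v w * J e v w)"
    unfolding X_sig[OF iut] G_def J_def ..
  have 2: "X u (sig t i) = (\<Sum>e<d. \<Sum>v<d. \<Sum>w<d. G e v w * J v w e)"
  proof -
    have "X u (sig t i) = (\<Sum>v<d. \<Sum>w<d. \<Sum>e<d. G e v w * J v w e)"
      unfolding X_sig[OF iut(2,3,1)] G_def J_def by (simp add: ac_simps)
    also have "\<dots> = (\<Sum>v<d. \<Sum>e<d. \<Sum>w<d. G e v w * J v w e)" by (rule sum.cong[OF refl], rule sum.swap)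
    also have "\<dots> = (\<Sum>e<d. \<Sum>v<d. \<Sum>w<d. G e v w * J v w e)" by (rule sum.swap)
    finally show ?thesis .
  qed
  have 3: "X t (sig i u) = (\<Sum>e<d. \<Sum>v<d. \<Sum>w<d. G e v w * J w e v)"
  proof -
    have "X t (sig i u) = (\<Sum>w<d. \<Sum>e<d. \<Sum>v<d. G e v w * J w e v)"
      unfolding X_sig[OF iut(3,1,2)] G_def J_def by (simp add: ac_simps)
    also have "\<dots> = (\<Sum>e<d. \<Sum>w<d. \<Sum>v<d. G e v w * J w e v)" by (rule sum.swap)
    also have "\<dots> = (\<Sum>e<d. \<Sum>v<d. \<Sum>w<d. G e v w * J w e v)" by (rule sum.cong[OF refl], rule sum.swap)
    finally show ?thesis .
  qed
  have "G e v w * J e v w + G e v w * J v w e + G e v w * J w e v = 0" for e v w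
    by (simp only: distrib_left[symmetric] jac mult_zero_right)
  then show ?thesis unfolding 1 2 3 by (simp only: sum.distrib[symmetric] sum.neutral_const)
qed

subsection \<open>Taylor expansion along the leaf\<close>

text \<open>Expansion along the flows of the commuting fields: the iterated derivatives at the
  origin are the iterated derivatives along the leaf. It is a ring homomorphism that turns
  \<open>X t\<close> into \<open>shift t\<close>.\<close>

definition taylor :: "'a fract \<Rightarrow> 'a fract jet" where
  "taylor f = Abs_jet (\<lambda>w. fold X w f)"

lemma cf_taylor: "cf (taylor f) w = fold X w f"
  unfolding taylor_def by (subst Abs_jet_inverse) (simp_all add: X_commute)

lemma shift_taylor: "shift t (taylor f) = taylor (X t f)"
  by (rule jet_eqI) (simp add: cf_shift cf_taylor)

lemma taylor_add: "taylor (f + g) = taylor f + taylor g"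
proof -
  have "cf (taylor (f + g)) w = cf (taylor f + taylor g) w" for w
    using X_deriv by (induction w arbitrary: f g) (simp_all add: cf_simps cf_taylor deriv_on_UNIV)
  then show ?thesis by (rule jet_eqI)
qed

lemma taylor_mult: "taylor (f * g) = taylor f * taylor g"
proof -
  have "cf (taylor (f * g)) w = cf (taylor f * taylor g) w" for w
  proof (induction w arbitrary: f g)
    case (Cons t w)
    have "X t (f * g) = X t f * g + f * X t g" using X_deriv[of t] by (simp add: deriv_on_UNIV)
    then have "cf (taylor (f * g)) (t # w) = cf (taylor (X t f * g)) w + cf (taylor (f * X t g)) w"
      by (simp add: cf_shift[symmetric] shift_taylor taylor_add cf_simps)
    then show ?case by (simp add: Cons cf_mult_simps shift_taylor)
  qed (simp add: cf_taylor cf_mult_simps)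
  then show ?thesis by (rule jet_eqI)
qed

lemma taylor_zero: "taylor 0 = 0"
  using taylor_add[of 0 0] by (metis add_cancel_left_left add_0)

lemma taylor_one: "taylor 1 = 1"
proof -
  have "fold X w 0 = 0" for w by (induction w) (simp_all add: deriv_on_UNIV_zero(1)[OF X_deriv])
  then have "cf (taylor 1) w = cf 1 w" for w
    by (cases w) (simp_all add: cf_taylor cf_simps deriv_on_UNIV_zero(2)[OF X_deriv])
  then show ?thesis by (rule jet_eqI)
qed

lemma taylor_uminus: "taylor (- f) = - taylor f"
  using taylor_add[of f "- f"] by (simp add: taylor_zero add_eq_0_iff)

lemma taylor_sum: "taylor (sum f I) = (\<Sum>i\<in>I. taylor (f i))"
  by (induction I rule: infinite_finite_induct) (simp_all add: taylor_zero taylor_add)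

end

subsection \<open>A representation of the enveloping algebra on jets\<close>

locale poisson_leaf_deriv = poisson_leaf scale br x n d js
  for scale :: "'k::field_char_0 \<Rightarrow> 'a::idom \<Rightarrow> 'a" and br x n d js +
  fixes \<tau> :: "'a \<Rightarrow> 'a"
  assumes tau: "\<tau> \<in> derivs scale {0}"
begin

definition alpha :: "'a \<Rightarrow> 'a fract jet" where "alpha a = taylor (to_fract a)"

abbreviation jtau :: "'a fract jet \<Rightarrow> 'a fract jet" where "jtau \<equiv> map_jet (fract_deriv \<tau>)"

lemma alpha_simps: "alpha (a + b) = alpha a + alpha b" "alpha (a - b) = alpha a - alpha b"
  "alpha (a * b) = alpha a * alpha b" "alpha (- a) = - alpha a" "alpha 0 = 0" "alpha 1 = 1"
  using taylor_add[of "to_fract a" "- to_fract b"]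
  by (simp_all add: alpha_def taylor_add taylor_mult taylor_uminus taylor_zero taylor_one)

lemma shift_alpha_scalar: "shift t (alpha (scale c 1)) = 0"
  by (simp add: alpha_def shift_taylor X_scalar taylor_zero)

lemma jtau_simps: "jtau (b + c) = jtau b + jtau c" "jtau (b * c) = b * jtau c + c * jtau b"
proof -
  have "deriv_on UNIV (fract_deriv \<tau>)" by (rule fract_deriv(1)[OF tau])
  then have D: "fract_deriv \<tau> (a + b) = fract_deriv \<tau> a + fract_deriv \<tau> b"
    "fract_deriv \<tau> (a * b) = a * fract_deriv \<tau> b + b * fract_deriv \<tau> a" for a b
    by (simp_all add: deriv_on_UNIV)
  show "jtau (b + c) = jtau b + jtau c" by (rule map_jet_add) (rule D)
  show "jtau (b * c) = b * jtau c + c * jtau b" by (rule map_jet_mult) (rule D)+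
qed

lemma jtau_zero: "jtau 0 = 0"
  using jtau_simps(1)[of 0 0] by (metis add_cancel_left_left add_0)

lemma jtau_uminus: "jtau (- b) = - jtau b"
  using jtau_simps(1)[of b "- b"] by (simp add: jtau_zero add_eq_0_iff)

lemma jtau_sum: "jtau (sum f I) = (\<Sum>i\<in>I. jtau (f i))"
  by (induction I rule: infinite_finite_induct) (simp_all add: jtau_zero jtau_simps)

text \<open>The coefficients \<open>jtau (taylor (sig u t))\<close> form a closed two-form because
  \<open>sig\<close> is closed and \<open>jtau\<close> commutes with \<open>shift\<close>. The
  normalization at the origin keeps the constant term of \<open>cocycle a\<close> equal to the
  fraction of \<open>\<tau> a\<close>.\<close>

lemma primitive_exists:
  "\<exists>l. (\<forall>t u. u < d \<longrightarrow> t < d \<longrightarrow> shift u (l t) - shift t (l u) = jtau (taylor (sig u t))) \<and> (\<forall>t. cf (l t) [] = 0)"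
proof -
  \<comment> \<open>Extension by zero beyond the coordinates, so that alternation and closedness
    hold for all indices.\<close>
  define k where "k = (\<lambda>u t. if u < d \<and> t < d then jtau (taylor (sig u t)) else 0)"
  have shift_k: "shift i (k u t) = (if u < d \<and> t < d then jtau (taylor (X i (sig u t))) else 0)" for i u t
    by (simp add: k_def shift_map_jet shift_taylor shift_simps)
  have X0: "X i f = 0" if "\<not> i < d" for i f using that by (simp add: X_def)
  have c1: "of_nat (Suc m) \<noteq> (0 :: 'a fract)" for m
    using of_nat_nonzero[of "Suc m"] by (simp only: to_fract_of_nat[symmetric] to_fract_eq_0_iff zero_less_Suc) simp
  have c2: "k t u = - k u t" for t u
    using sig_anti[of u t] by (auto simp: k_def taylor_uminus jtau_uminus)
  have c3: "shift i (k u t) + shift u (k t i) + shift t (k i u) = 0" for i u t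
  proof (cases "i < d \<and> u < d \<and> t < d")
    case True
    then have "shift i (k u t) + shift u (k t i) + shift t (k i u)
        = jtau (taylor (X i (sig u t) + X u (sig t i) + X t (sig i u)))"
      by (simp add: shift_k taylor_add jtau_simps)
    then show ?thesis using sig_closed[of i u t] True by (simp add: taylor_zero jtau_zero)
  next
    case False
    then show ?thesis by (auto simp: shift_k X0 taylor_zero jtau_zero)
  qed
  have c4: "shift v (k u t) = 0" if "v \<ge> d" for u t v
    using that by (simp add: shift_k X0 taylor_zero jtau_zero)
  show ?thesis
  proof (rule jet_poincare[OF c1 c2 c3 c4])
    fix l assume "\<And>t u. u < d \<Longrightarrow> t < d \<Longrightarrow> shift u (l t) - shift t (l u) = k u t" "\<And>t. cf (l t) [] = 0"
    then show ?thesis unfolding k_def by (intro exI[of _ l]) simp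
  qed
qed

definition primitive :: "nat \<Rightarrow> 'a fract jet" where
  "primitive = (SOME l. (\<forall>t u. u < d \<longrightarrow> t < d \<longrightarrow> shift u (l t) - shift t (l u) = jtau (taylor (sig u t))) \<and> (\<forall>t. cf (l t) [] = 0))"

lemma primitive: "u < d \<Longrightarrow> t < d \<Longrightarrow> shift u (primitive t) - shift t (primitive u) = jtau (taylor (sig u t))"
  "cf (primitive t) [] = 0"
  using someI_ex[OF primitive_exists] unfolding primitive_def[symmetric] by blast+

text \<open>The Hamiltonian field of \<open>a\<close> along the leaf, acting on jets;
  \<open>alpha\<close> intertwines it with \<open>br a\<close>.\<close>

definition hvf :: "'a \<Rightarrow> 'a fract jet \<Rightarrow> 'a fract jet" where
  "hvf a b = (\<Sum>u<d. alpha (br a (y u)) * shift u b)"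

text \<open>\<open>jtau (alpha a)\<close> has the right constant term but violates the rule
  \<open>cocycle_br\<close> by the two-form with coefficients
  \<open>jtau (taylor (sig u t))\<close>. The second term adds the primitive of this form, evaluated
  on the Hamiltonian field of \<open>a\<close>.\<close>

definition cocycle :: "'a \<Rightarrow> 'a fract jet" where
  "cocycle a = jtau (alpha a) - (\<Sum>t<d. primitive t * alpha (br (y t) a))"

lemma hvf_simps: "hvf a (f + g) = hvf a f + hvf a g" "hvf a (f * g) = hvf a f * g + f * hvf a g"
  "hvf (a + b) f = hvf a f + hvf b f" "hvf (a * b) f = alpha a * hvf b f + alpha b * hvf a f"
  "hvf a 1 = 0" "hvf a 0 = 0" "hvf a (f - g) = hvf a f - hvf a g"
  by (simp_all add: hvf_def shift_simps br_simps br_mult_left alpha_simps sum.distrib sum_distrib_left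
      sum_distrib_right sum_subtractf algebra_simps)

lemma hvf_sum: "hvf a (sum f I) = (\<Sum>i\<in>I. hvf a (f i))"
  by (induction I rule: infinite_finite_induct) (simp_all add: hvf_simps)

lemma hvf_alpha: "hvf a (alpha b) = alpha (br a b)"
  unfolding hvf_def alpha_def shift_taylor br_X[of a b] taylor_sum taylor_mult ..

lemma hvf_scalar: "hvf a (alpha (scale c 1) * f) = alpha (scale c 1) * hvf a f"
  by (simp add: hvf_simps hvf_alpha br_scalar alpha_simps)

lemma hvf_scalar_left: "hvf (scale c a) f = alpha (scale c 1) * hvf a f"
proof -
  have "br (scale c 1) z = 0" for z using br_anti[of "scale c 1" z] br_scalar[of z c] by simp
  then have "hvf (scale c 1) f = 0" by (simp add: hvf_def alpha_simps)
  then show ?thesis unfolding scale_eq_mult[of c a] hvf_simps(4) by simp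
qed

lemma br_br_left: "br (br a b) z = br a (br b z) - br b (br a z)"
  using br_jacobi[of a b z] br_anti[of "br a b" z] br_anti[of a z] br_minus[of b "br a z"]
  by (simp add: add_eq_0_iff algebra_simps)

lemma hvf_br: "hvf (br a b) f = hvf a (hvf b f) - hvf b (hvf a f)"
proof -
  have HH: "hvf a (hvf b f) = (\<Sum>v<d. alpha (br a (br b (y v))) * shift v f)
      + (\<Sum>v<d. \<Sum>u<d. alpha (br b (y v)) * alpha (br a (y u)) * shift u (shift v f))" for a b
  proof -
    have "hvf a (hvf b f) = (\<Sum>v<d. alpha (br a (br b (y v))) * shift v f + alpha (br b (y v)) * hvf a (shift v f))"
      unfolding hvf_def[of b] hvf_sum by (simp add: hvf_simps hvf_alpha)
    then show ?thesis by (simp add: hvf_def sum.distrib sum_distrib_left mult.assoc)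
  qed
  have "(\<Sum>v<d. \<Sum>u<d. alpha (br a (y v)) * alpha (br b (y u)) * shift u (shift v f))
      = (\<Sum>v<d. \<Sum>u<d. alpha (br b (y v)) * alpha (br a (y u)) * shift u (shift v f))"
    by (subst sum.swap) (simp add: mult.commute shift_commute)
  then show ?thesis
    unfolding HH by (simp add: hvf_def br_br_left alpha_simps left_diff_distrib sum_subtractf)
qed

lemma cocycle_add: "cocycle (a + b) = cocycle a + cocycle b"
  by (simp add: cocycle_def alpha_simps br_simps jtau_simps distrib_left sum.distrib)

lemma cocycle_mult: "cocycle (a * b) = alpha a * cocycle b + alpha b * cocycle a"
  by (simp add: cocycle_def alpha_simps br_leibniz jtau_simps algebra_simps sum.distrib sum_distrib_left)

lemma cf_cocycle: "cf (cocycle a) [] = to_fract (\<tau> a)"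
  by (simp add: cocycle_def cf_simps cf_map_jet cf_sum cf_mult_simps primitive alpha_def cf_taylor fract_deriv(2)[OF tau])

lemma cocycle_scalar: "cocycle (scale c 1) = 0"
proof -
  have "cf (cocycle (scale c 1)) w = 0" for w
  proof (cases w)
    case Nil
    then show ?thesis using tau by (simp add: cf_cocycle exact_derivs_iff)
  next
    case (Cons t v)
    have "cf (jtau (alpha (scale c 1))) (t # v) = cf (jtau (shift t (alpha (scale c 1)))) v"
      by (simp add: shift_map_jet[symmetric] cf_shift)
    then show ?thesis
      by (simp add: Cons cocycle_def cf_simps br_scalar alpha_simps shift_alpha_scalar jtau_zero)
  qed
  then show ?thesis by (intro jet_eqI) (simp add: cf_simps)
qed

text \<open>\<open>jtau\<close> is applied to the formula for the bracket by \<open>sig\<close>. The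
  sums \<open>R1\<close> and \<open>R2\<close>, where it falls on an argument, agree on both sides;
  \<open>Q\<close>, where it falls on \<open>sig\<close>, arises once on the left and twice on the
  right, and the primitive makes up the difference.\<close>

lemma cocycle_br: "cocycle (br a b) = hvf a (cocycle b) - hvf b (cocycle a)"
proof -
  define A where "A = (\<lambda>t a. alpha (br (y t) a))"
  define s where "s = (\<lambda>u t. taylor (sig u t))"
  define Q where "Q = (\<lambda>a b. \<Sum>u<d. \<Sum>t<d. jtau (s u t) * A u a * A t b)"
  define R1 where "R1 = (\<lambda>a b. \<Sum>u<d. \<Sum>t<d. s u t * jtau (A u a) * A t b)"
  define R2 where "R2 = (\<lambda>a b. \<Sum>u<d. \<Sum>t<d. s u t * A u a * jtau (A t b))"
  have hvf: "hvf a f = - (\<Sum>u<d. A u a * shift u f)" for a f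
  proof -
    have "alpha (br a (y u)) = - A u a" for u using br_anti[of a "y u"] by (simp add: A_def alpha_simps)
    then show ?thesis by (simp add: hvf_def sum_negf)
  qed
  have alpha_br: "alpha (br a b) = - (\<Sum>u<d. \<Sum>t<d. s u t * A u a * A t b)" for a b
    unfolding alpha_def br_sig[of a b] taylor_uminus taylor_sum taylor_mult s_def A_def ..
  have shift_alpha: "shift u (alpha b) = (\<Sum>t<d. s u t * A t b)" if "u < d" for u b
    using that by (simp add: alpha_def shift_taylor X_to_fract taylor_sum taylor_mult s_def A_def)
  have santi: "s t u = - s u t" if "u < d" "t < d" for t u
    using sig_anti[OF that] by (simp add: s_def taylor_uminus)
  have 1: "jtau (alpha (br a b)) = - Q a b - R1 a b - R2 a b"
  proof -
    have "jtau (\<Sum>u<d. \<Sum>t<d. s u t * A u a * A t b) = Q a b + R1 a b + R2 a b"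
      unfolding jtau_sum jtau_simps Q_def R1_def R2_def
      by (simp only: sum.distrib[symmetric], intro sum.cong refl) (simp add: algebra_simps)
    then show ?thesis unfolding alpha_br jtau_uminus by simp
  qed
  have 2: "hvf a (jtau (alpha b)) = - R2 a b - Q a b" for a b
  proof -
    have "(\<Sum>u<d. A u a * shift u (jtau (alpha b))) = (\<Sum>u<d. A u a * (\<Sum>t<d. s u t * jtau (A t b) + A t b * jtau (s u t)))"
      by (intro sum.cong refl) (simp add: shift_map_jet shift_alpha jtau_sum jtau_simps)
    also have "\<dots> = R2 a b + Q a b"
      by (simp add: R2_def Q_def sum_distrib_left sum.distrib algebra_simps)
    finally show ?thesis by (simp add: hvf)
  qed
  have R: "R2 b a = - R1 a b"
  proof -
    have "R2 b a = (\<Sum>u<d. \<Sum>t<d. s t u * A t b * jtau (A u a))" unfolding R2_def by (rule sum.swap)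
    also have "\<dots> = (\<Sum>u<d. \<Sum>t<d. - (s u t * jtau (A u a) * A t b))"
    proof (intro sum.cong refl)
      fix u t assume "u \<in> {..<d}" "t \<in> {..<d}"
      then have "s t u = - s u t" by (intro santi) auto
      then show "s t u * A t b * jtau (A u a) = - (s u t * jtau (A u a) * A t b)" by (simp only: mult_minus_left) simp
    qed
    finally show ?thesis by (simp add: R1_def sum_negf)
  qed
  have Qs: "Q b a = - Q a b"
  proof -
    have "Q b a = (\<Sum>u<d. \<Sum>t<d. jtau (s t u) * A t b * A u a)" unfolding Q_def by (rule sum.swap)
    also have "\<dots> = (\<Sum>u<d. \<Sum>t<d. - (jtau (s u t) * A u a * A t b))"
    proof (intro sum.cong refl)
      fix u t assume "u \<in> {..<d}" "t \<in> {..<d}"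
      then have "s t u = - s u t" by (intro santi) auto
      then show "jtau (s t u) * A t b * A u a = - (jtau (s u t) * A u a * A t b)" by (simp only: jtau_uminus mult_minus_left) simp
    qed
    finally show ?thesis by (simp add: Q_def sum_negf)
  qed
  define W where "W = (\<lambda>a. \<Sum>t<d. primitive t * A t a)"
  have hW: "hvf a (W b) = (\<Sum>t<d. hvf a (primitive t) * A t b) + (\<Sum>t<d. primitive t * alpha (br a (br (y t) b)))" for a b
    by (simp add: W_def hvf_sum hvf_simps sum.distrib A_def hvf_alpha)
  have Wbr: "W (br a b) = (\<Sum>t<d. primitive t * alpha (br a (br (y t) b))) - (\<Sum>t<d. primitive t * alpha (br b (br (y t) a)))"
  proof -
    have "br (y t) (br a b) = br a (br (y t) b) - br b (br (y t) a)" for t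
      unfolding br_anti[of "y t" "br a b"] br_br_left unfolding br_anti[of b "y t"] br_anti[of a "y t"]
      by (simp add: br_minus)
    then show ?thesis by (simp add: W_def A_def alpha_simps right_diff_distrib sum_subtractf)
  qed
  have hl: "(\<Sum>t<d. hvf b (primitive t) * A t a) = - (\<Sum>u<d. \<Sum>t<d. shift t (primitive u) * A u a * A t b)"
    "(\<Sum>t<d. hvf a (primitive t) * A t b) = - (\<Sum>u<d. \<Sum>t<d. shift u (primitive t) * A u a * A t b)"
  proof -
    show "(\<Sum>t<d. hvf b (primitive t) * A t a) = - (\<Sum>u<d. \<Sum>t<d. shift t (primitive u) * A u a * A t b)"
      by (simp add: hvf sum_negf sum_distrib_right sum_distrib_left ac_simps)
    show "(\<Sum>t<d. hvf a (primitive t) * A t b) = - (\<Sum>u<d. \<Sum>t<d. shift u (primitive t) * A u a * A t b)"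
      by (subst sum.swap) (simp add: hvf sum_negf sum_distrib_right sum_distrib_left ac_simps)
  qed
  have "(\<Sum>u<d. \<Sum>t<d. shift u (primitive t) * A u a * A t b) - (\<Sum>u<d. \<Sum>t<d. shift t (primitive u) * A u a * A t b)
      = (\<Sum>u<d. \<Sum>t<d. (shift u (primitive t) - shift t (primitive u)) * A u a * A t b)"
    by (simp add: sum_subtractf[symmetric] left_diff_distrib)
  also have "\<dots> = Q a b"
    unfolding Q_def s_def by (intro sum.cong refl) (simp add: primitive(1))
  finally have 3: "W (br a b) - hvf a (W b) + hvf b (W a) = Q a b"
    unfolding Wbr hW hl by (simp add: algebra_simps)
  have c: "cocycle a = jtau (alpha a) - W a" for a by (simp add: cocycle_def W_def A_def)
  show ?thesis
    unfolding c hvf_simps 1 2 R Qs using 3 by (simp add: algebra_simps)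
qed

section \<open>The enveloping algebra acting on jets\<close>

definition jscale :: "'k \<Rightarrow> 'a fract jet \<Rightarrow> 'a fract jet" where
  "jscale c b = alpha (scale c 1) * b"

text \<open>The zero bracket makes the jets a Poisson algebra over \<open>K\<close>, so that the
  facts about \<open>End_ring\<close> proved for Poisson algebras apply to them.\<close>

lemma jet_poisson_algebra: "poisson_algebra jscale (\<lambda>_ _. 0)"
proof -
  have jscale: "jscale (c + e) b = jscale c b + jscale e b" "jscale (c * e) b = jscale c (jscale e b)"
    "jscale 1 b = b" "jscale c (b + b') = jscale c b + jscale c b'" for c e b b'
  proof -
    have "scale (c * e) 1 = scale c 1 * scale e 1" by (simp add: scale_mult_left)
    then show "jscale (c * e) b = jscale c (jscale e b)" by (simp add: jscale_def alpha_simps mult.assoc)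
  qed (simp_all add: jscale_def alpha_simps scale_left_distrib algebra_simps)
  have vs: "vector_space jscale"
    by unfold_locales (simp_all add: jscale[symmetric] mult.commute, simp_all add: jscale)
  have ca: "comm_algebra jscale"
    by (intro comm_algebra.intro comm_algebra_axioms.intro vs) (simp add: jscale_def mult.assoc)
  have "jscale c 0 = 0" for c by (simp add: jscale_def)
  then show ?thesis
    by (intro poisson_algebra.intro poisson_algebra_axioms.intro ca) (simp_all add: Vector_Spaces.linear_iff vs)
qed

definition jbeta :: "'a \<Rightarrow> 'a fract jet \<Rightarrow> 'a fract jet" where
  "jbeta a b = hvf a b + cocycle a * b"

text \<open>The Hamiltonian fields alone form such a triple. Adding multiplication by
  \<open>cocycle a\<close> respects the bracket relation by \<open>cocycle_br\<close> and the
  product relation by \<open>cocycle_mult\<close>, and it commutes with all multiplications.\<close>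

lemma jet_triple: "poisson_triple scale br (End_ring jscale) jscale (\<lambda>a b. alpha a * b) jbeta"
proof -
  interpret J: poisson_algebra jscale "\<lambda>_ _. 0" by (rule jet_poisson_algebra)
  have mult_in: "(\<lambda>b. f * b) \<in> carrier (End_ring jscale)" for f
    by (simp add: J.End_ring_carrier jscale_def algebra_simps)
  have scale_in: "jscale c \<in> carrier (End_ring jscale)" for c
    using mult_in[of "alpha (scale c 1)"] by (simp add: jscale_def[abs_def])
  have beta_in: "jbeta a \<in> carrier (End_ring jscale)" for a
    by (simp add: J.End_ring_carrier jbeta_def hvf_simps(1) jscale_def hvf_scalar distrib_left mult.left_commute)
  have comp_in: "f \<circ> g \<in> carrier (End_ring jscale)"
    if "f \<in> carrier (End_ring jscale)" "g \<in> carrier (End_ring jscale)" for f g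
    using that by (auto simp: J.End_ring_carrier)
  have sc: "alpha (scale (c + e) 1) = alpha (scale c 1) + alpha (scale e 1)"
    "alpha (scale (c * e) 1) = alpha (scale c 1) * alpha (scale e 1)" for c e
  proof -
    have "scale (c * e) 1 = scale c 1 * scale e 1" by (simp add: scale_mult_left)
    then show "alpha (scale (c * e) 1) = alpha (scale c 1) * alpha (scale e 1)" by (simp add: alpha_simps)
  qed (simp add: scale_left_distrib alpha_simps)
  have asc: "alpha (scale c a) = alpha (scale c 1) * alpha a" for c a
    unfolding scale_eq_mult[of c a] by (rule alpha_simps)
  show ?thesis
  proof (intro poisson_triple.intro poisson_triple_axioms.intro J.End_ring_ring)
    show "jscale \<in> ring_hom class_ring (End_ring jscale)"
      by (rule ring_hom_memI) (auto simp: scale_in J.End_ring_simps fun_eq_iff jscale_def sc alpha_simps algebra_simps)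
    show "(\<lambda>a b. alpha a * b) \<in> ring_hom class_ring (End_ring jscale)"
      by (rule ring_hom_memI) (simp_all add: mult_in J.End_ring_simps fun_eq_iff alpha_simps distrib_right mult.assoc)
    fix f c assume "f \<in> carrier (End_ring jscale)"
    then show "jscale c \<otimes>\<^bsub>End_ring jscale\<^esub> f = f \<otimes>\<^bsub>End_ring jscale\<^esub> jscale c"
      by (auto simp: J.End_ring_simps J.End_ring_carrier)
  next
    fix a b c
    show "jbeta (br a b) = jbeta a \<otimes>\<^bsub>End_ring jscale\<^esub> jbeta b \<ominus>\<^bsub>End_ring jscale\<^esub> jbeta b \<otimes>\<^bsub>End_ring jscale\<^esub> jbeta a"
      by (simp add: J.End_ring_simps J.End_ring_minus comp_in beta_in fun_eq_iff)
        (simp add: jbeta_def hvf_simps hvf_br cocycle_br algebra_simps)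
    show "jbeta a \<otimes>\<^bsub>End_ring jscale\<^esub> (\<lambda>f. alpha b * f) \<ominus>\<^bsub>End_ring jscale\<^esub> (\<lambda>f. alpha b * f) \<otimes>\<^bsub>End_ring jscale\<^esub> jbeta a = (\<lambda>f. alpha (br a b) * f)"
      by (simp add: J.End_ring_simps J.End_ring_minus comp_in beta_in mult_in fun_eq_iff)
        (simp add: jbeta_def hvf_simps hvf_alpha algebra_simps)
    show "jbeta (a * b) = (\<lambda>f. alpha a * f) \<otimes>\<^bsub>End_ring jscale\<^esub> jbeta b \<oplus>\<^bsub>End_ring jscale\<^esub> (\<lambda>f. alpha b * f) \<otimes>\<^bsub>End_ring jscale\<^esub> jbeta a"
      by (simp add: J.End_ring_simps fun_eq_iff jbeta_def hvf_simps cocycle_mult algebra_simps)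
    show "jbeta (a + b) = jbeta a \<oplus>\<^bsub>End_ring jscale\<^esub> jbeta b"
      by (simp add: J.End_ring_simps fun_eq_iff jbeta_def hvf_simps cocycle_add algebra_simps)
    have cs: "cocycle (scale c a) = alpha (scale c 1) * cocycle a" for c
      unfolding scale_eq_mult[of c a] cocycle_mult cocycle_scalar by simp
    show "jbeta (scale c a) = jscale c \<otimes>\<^bsub>End_ring jscale\<^esub> jbeta a" for c
      by (simp add: J.End_ring_simps fun_eq_iff jbeta_def jscale_def hvf_scalar_left cs algebra_simps)
    show "(\<lambda>f. alpha (scale c a) * f) = jscale c \<otimes>\<^bsub>End_ring jscale\<^esub> (\<lambda>f. alpha a * f)" for c
      unfolding asc[of c a] by (simp add: J.End_ring_simps fun_eq_iff jscale_def mult.assoc)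
  qed (rule beta_in)
qed

text \<open>Apply the relation to the jet \<open>1\<close> and compare constant terms.\<close>

lemma symbol_relation:
  fixes d' e :: nat
  assumes rel: "mul m * ham a \<approx> (\<Sum>t<d'. mul (g t) * (\<Sum>r<e. mul (h r t) * ham (z r)))"
  shows "m * \<tau> a = (\<Sum>t<d'. g t * (\<Sum>r<e. h r t * \<tau> (z r)))"
proof -
  interpret J: poisson_algebra jscale "\<lambda>_ _. 0" by (rule jet_poisson_algebra)
  interpret T: poisson_triple scale br "End_ring jscale" jscale "\<lambda>a b. alpha a * b" jbeta by (rule jet_triple)
  define rep where "rep = (\<lambda>u. free_eval (End_ring jscale) jscale (\<lambda>a b. alpha a * b) jbeta u)"
  have rep: "rep (u + v) f = rep u f + rep v f" "rep (u * v) f = rep u (rep v f)"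
    "rep (mul b) f = alpha b * f" "rep (ham b) f = jbeta b f" "rep 0 f = 0" for u v b f
    unfolding rep_def T.free_eval_add T.free_eval_mult T.free_eval_gen T.free_eval_zero
    by (simp_all add: J.End_ring_simps)
  have rep_sum: "rep (sum F I) f = (\<Sum>i\<in>I. rep (F i) f)" for F and I :: "nat set" and f
    by (induction I rule: infinite_finite_induct) (simp_all add: rep)
  let ?u = "mul m * ham a" and ?v = "\<Sum>t<d'. mul (g t) * (\<Sum>r<e. mul (h r t) * ham (z r))"
  have "rep (?u - ?v) 1 = 0"
    using T.free_eval_ideal[OF rel[unfolded ueq_def]] by (simp add: rep_def J.End_ring_simps)
  then have "rep ?u 1 = rep ?v 1" using rep(1)[of "?u - ?v" ?v 1] by simp
  then have "alpha m * cocycle a = (\<Sum>t<d'. alpha (g t) * (\<Sum>r<e. alpha (h r t) * cocycle (z r)))"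
    unfolding rep_sum rep by (simp add: jbeta_def hvf_simps)
  then have "cf (alpha m * cocycle a) [] = cf (\<Sum>t<d'. alpha (g t) * (\<Sum>r<e. alpha (h r t) * cocycle (z r))) []"
    by (rule arg_cong)
  then have "to_fract (m * \<tau> a) = to_fract (\<Sum>t<d'. g t * (\<Sum>r<e. h r t * \<tau> (z r)))"
    by (simp add: cf_mult_simps cf_sum cf_cocycle alpha_def cf_taylor to_fract_sum)
  then show ?thesis by (rule injD[OF inj_to_fract])
qed

end

section \<open>The two implications\<close>

context ess_poisson
begin

lemma kappa_zero_derivs:
  assumes d: "d = poisson_rank br x n" and kappa: "kappa scale br x n d = {\<zero>\<^bsub>U scale br\<^esub>}"
    and "is": "is \<in> incr_tuples n d" and js: "js \<in> incr_tuples n d" and mu: "minor br x is js \<noteq> 0"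
    and \<tau>: "\<tau> \<in> derivs scale {0}"
  shows "minor br x is js * \<tau> a = (\<Sum>t<d. \<tau> (x (js ! t)) * (\<Sum>s<d. minor_cofactor br x is js s t * br (x (is ! s)) a))"
proof -
  let ?\<mu> = "minor br x is js" and ?D = "\<lambda>t a. \<Sum>s<d. minor_cofactor br x is js s t * br (x (is ! s)) a"
  have len: "length is = d" "length js = d" using "is" js by (simp_all add: incr_tuples_def)
  have mu': "minor br x js is \<noteq> 0" using mu minor_swap[of js "is"] len by simp
  have nz: "js \<in> nonzero_tuples br x n d" using "is" js mu' by (auto simp: nonzero_tuples_def)
  have unique: "\<sigma> a = 0" if \<sigma>: "\<sigma> \<in> derivs scale {0}" and zero: "\<And>t. t < d \<Longrightarrow> \<sigma> (x (js ! t)) = 0" for \<sigma> a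
  proof -
    \<comment> \<open>The leaf requires a principal minor: as \<open>js\<close> occurs in a nonzero
      minor of size \<open>d\<close>, \<open>minor br x js js\<close> is nonzero as well.\<close>
    interpret L: poisson_leaf_deriv scale br x n d js \<sigma>
      by unfold_locales
        (use d len(2) js minor_of_nonzero_tuples[OF d nz nz] \<sigma> in \<open>simp_all add: incr_tuples_def\<close>)
    \<comment> \<open>After the exchange of rows and columns the right-hand side involves \<sigma>
      only at the \<open>x (js ! s)\<close>, where it vanishes.\<close>
    have "minor br x js is * \<sigma> a = (\<Sum>t<d. br a (x (is ! t)) * (\<Sum>s<d. minor_cofactor br x js is s t * \<sigma> (x (js ! s))))"
      by (rule L.symbol_relation) (use kappa_zero_ham[OF kappa js "is" mu'] len in \<open>simp add: ham_row_def\<close>)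
    then show ?thesis using zero mu' by simp
  qed
  \<comment> \<open>The error of the asserted expansion, which vanishes at the
    \<open>x (js ! t)\<close> by the cofactor identities.\<close>
  let ?\<sigma> = "\<lambda>a. ?\<mu> * \<tau> a + (- 1) * (\<Sum>t<d. \<tau> (x (js ! t)) * ?D t a)"
  have "?\<sigma> \<in> derivs scale {0}"
    by (intro exact_derivs_comb2 exact_derivs_sum br_right_deriv \<tau>)
  moreover have "?\<sigma> (x (js ! u)) = 0" if u: "u < d" for u
  proof -
    have "(\<Sum>t<d. \<tau> (x (js ! t)) * ?D t (x (js ! u))) = (\<Sum>t<d. if t = u then \<tau> (x (js ! t)) * ?\<mu> else 0)"
      using u by (intro sum.cong refl) (simp add: minor_cofactor_column[OF len])
    then show ?thesis using u by simp
  qed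
  ultimately have "?\<sigma> a = 0" by (rule unique)
  then show ?thesis by simp
qed

lemma ring_iso_PD:
  assumes "inj_on (poisson_pi scale br) (carrier (U scale br))"
  shows "poisson_pi scale br \<in> ring_iso (U scale br) (poisson_diff_ops scale br)"
proof -
  have c: "carrier (poisson_diff_ops scale br) = poisson_pi scale br ` carrier (U scale br)"
    unfolding poisson_pi_image by (simp add: poisson_diff_ops_def)
  have "poisson_pi scale br \<in> ring_hom (U scale br) (poisson_diff_ops scale br)"
  proof (rule ring_hom_memI)
    show "poisson_pi scale br y \<in> carrier (poisson_diff_ops scale br)" if "y \<in> carrier (U scale br)" for y
      unfolding c using that by (rule imageI)
  qed (simp_all add: poisson_diff_ops_def ring_hom_mult[OF poisson_pi(1)] ring_hom_add[OF poisson_pi(1)]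
      ring_hom_one[OF poisson_pi(1)])
  then show ?thesis using assms by (auto simp: ring_iso_def bij_betw_def c)
qed

lemma kernel_trivial:
  assumes "inj_on (poisson_pi scale br) (carrier (U scale br))"
  shows "a_kernel (U scale br) (diff_ops scale) (poisson_pi scale br) = {\<zero>\<^bsub>U scale br\<^esub>}"
proof -
  have zero: "poisson_pi scale br (proj 0) = (\<lambda>_. 0)"
    unfolding poisson_pi_proj by (simp add: ev_simps fun_eq_iff)
  have z: "\<zero>\<^bsub>diff_ops scale\<^esub> = (\<lambda>_. 0)" by (simp add: diff_ops_def End_ring_simps)
  have "{y \<in> carrier (U scale br). poisson_pi scale br y = (\<lambda>_. 0)} = {proj 0}"
  proof (intro equalityI subsetI)
    fix y assume "y \<in> {y \<in> carrier (U scale br). poisson_pi scale br y = (\<lambda>_. 0)}"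
    then have y: "y \<in> carrier (U scale br)" "poisson_pi scale br y = poisson_pi scale br (proj 0)"
      by (simp_all only: zero mem_Collect_eq)
    then have "y = proj 0" by (intro inj_onD[OF assms _ _ proj_mem])
    then show "y \<in> {proj 0}" by (simp only: singletonI)
  next
    fix y assume "y \<in> {proj 0}"
    then have "y = proj 0" by (rule singletonD)
    then show "y \<in> {y \<in> carrier (U scale br). poisson_pi scale br y = (\<lambda>_. 0)}"
      by (simp only: mem_Collect_eq zero proj_mem simp_thms)
  qed
  then show ?thesis unfolding a_kernel_def' z proj_zero .
qed

lemma isomorphism_of_conditions:
  assumes d: "d = poisson_rank br x n" and kappa: "kappa scale br x n d = {\<zero>\<^bsub>U scale br\<^esub>}"
    and min: "minors_ideal br x n d = UNIV"
  shows "poisson_diff_ops scale br = diff_ops scale" "poisson_pi scale br \<in> ring_iso (U scale br) (diff_ops scale)"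
proof -
  show eq: "poisson_diff_ops scale br = diff_ops scale"
    by (rule poisson_diff_ops_eq[OF kappa_zero_derivs[OF d kappa] min])
  show "poisson_pi scale br \<in> ring_iso (U scale br) (diff_ops scale)"
    using ring_iso_PD[OF poisson_pi_injective[OF kappa min]] unfolding eq .
qed

lemma conditions_of_isomorphism:
  assumes d: "d = poisson_rank br x n" and reg: "regular_domain TYPE('a)"
    and iso: "poisson_pi scale br \<in> ring_iso (U scale br) (diff_ops scale)"
  shows "kappa scale br x n d = {\<zero>\<^bsub>U scale br\<^esub>}" "minors_ideal br x n d = UNIV"
proof -
  have inj: "inj_on (poisson_pi scale br) (carrier (U scale br))"
    and img: "poisson_pi scale br ` carrier (U scale br) = carrier (diff_ops scale)"
    using iso by (simp_all add: ring_iso_def bij_betw_def)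
  show "kappa scale br x n d = {\<zero>\<^bsub>U scale br\<^esub>}" by (rule kappa_zero[OF d inj])
  show "minors_ideal br x n d = UNIV"
  proof (rule minors_ideal_full[OF d reg])
    fix D assume "D \<in> derivs scale {0}"
    \<comment> \<open>A derivation has order 1, hence index 2; surjectivity then makes it a Poisson
      differential operator.\<close>
    then have "D \<in> dop scale (Suc 1)" using deriv_dop[of D] by (simp only: numeral_2_eq_2 One_nat_def)
    then have "D \<in> (\<Union>k. diff_ops_upto scale k)" unfolding dop_Suc by blast
    moreover have "carrier (diff_ops scale) = (\<Union>k. diff_ops_upto scale k)" by (simp add: diff_ops_def)
    ultimately show "D \<in> PD" unfolding poisson_pi_image[symmetric] img by simp
  qed
qed

end

section \<open>Localizations of affine algebras as essentially finite algebras\<close>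

lemma ess_finite_localization:
  fixes scale :: "'k::field_char_0 \<Rightarrow> 'a::idom \<Rightarrow> 'a" and \<phi> :: "((nat \<Rightarrow>\<^sub>0 nat) \<Rightarrow>\<^sub>0 'k) set \<Rightarrow> 'a"
  assumes comm_algebra: "comm_algebra scale" and I: "ideal I (mpoly_ring n)"
    and loc: "is_localization (mpoly_ring n Quot I) S class_ring \<phi>"
    and const: "\<And>c. \<phi> (I +>\<^bsub>mpoly_ring n\<^esub> pconst c) = scale c 1"
    and x: "\<And>i. i < n \<Longrightarrow> x i = \<phi> (I +>\<^bsub>mpoly_ring n\<^esub> pvar i)"
  shows "ess_finite_algebra scale x n"
proof -
  interpret comm_algebra scale by (rule comm_algebra)
  let ?P = "mpoly_ring n :: ((nat \<Rightarrow>\<^sub>0 nat) \<Rightarrow>\<^sub>0 'k) ring" and ?G = "generated_by (x ` {..<n})"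
  interpret I: ideal I ?P by (rule I)
  interpret q: ring_hom_ring ?P "?P Quot I" "\<lambda>p. I +>\<^bsub>?P\<^esub> p" by (rule I.rcos_ring_hom_ring)
  have phi: "\<phi> \<in> ring_hom (?P Quot I) class_ring" using loc by (simp add: is_localization_def)
  have gen: "\<phi> (I +>\<^bsub>?P\<^esub> p) \<in> ?G" if "p \<in> carrier ?P" for p
    using that
  proof (induction p rule: mpoly_ring_induct)
    case (pconst c)
    show ?case unfolding const by (rule generated_by.scalar)
  next
    case (pvar i)
    then have "\<phi> (I +>\<^bsub>?P\<^esub> pvar i) \<in> x ` {..<n}" by (intro image_eqI[of _ _ i]) (simp_all add: x)
    then show ?case by (rule generated_by.gen)
  next
    case (add p q)
    have "I +>\<^bsub>?P\<^esub> (p + q) = (I +>\<^bsub>?P\<^esub> p) \<oplus>\<^bsub>?P Quot I\<^esub> (I +>\<^bsub>?P\<^esub> q)"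
      using q.hom_add[OF add(1,2)] by (simp add: mpoly_ring_def)
    then have "\<phi> (I +>\<^bsub>?P\<^esub> (p + q)) = \<phi> (I +>\<^bsub>?P\<^esub> p) + \<phi> (I +>\<^bsub>?P\<^esub> q)"
      using ring_hom_add[OF phi q.hom_closed[OF add(1)] q.hom_closed[OF add(2)]] by simp
    then show ?case using add(3,4) generated_by.add by simp
  next
    case (mult p q)
    have "I +>\<^bsub>?P\<^esub> (p * q) = (I +>\<^bsub>?P\<^esub> p) \<otimes>\<^bsub>?P Quot I\<^esub> (I +>\<^bsub>?P\<^esub> q)"
      using q.hom_mult[OF mult(1,2)] by (simp add: mpoly_ring_def)
    then have "\<phi> (I +>\<^bsub>?P\<^esub> (p * q)) = \<phi> (I +>\<^bsub>?P\<^esub> p) * \<phi> (I +>\<^bsub>?P\<^esub> q)"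
      using ring_hom_mult[OF phi q.hom_closed[OF mult(1)] q.hom_closed[OF mult(2)]] by simp
    then show ?case using mult(3,4) generated_by.mult by simp
  qed
  have carrier: "\<exists>p\<in>carrier ?P. r = I +>\<^bsub>?P\<^esub> p" if "r \<in> carrier (?P Quot I)" for r
  proof -
    have "r \<in> (\<Union>p\<in>carrier ?P. {I +>\<^bsub>?P\<^esub> p})"
      using that by (simp only: FactRing_def A_RCOSETS_def' partial_object.simps)
    then show ?thesis by (rule UN_E) (rule bexI, simp_all)
  qed
  show ?thesis
  proof
    fix a
    have "\<exists>r\<in>carrier (?P Quot I). \<exists>s\<in>S. a * \<phi> s = \<phi> r" using loc by (simp add: is_localization_def)
    then obtain r s where rs: "r \<in> carrier (?P Quot I)" "s \<in> S" "a * \<phi> s = \<phi> r" by blast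
    have s: "s \<in> carrier (?P Quot I)" using loc rs(2) submonoid.subset unfolding is_localization_def by blast
    have "\<phi> s \<in> Units class_ring" using loc rs(2) by (simp add: is_localization_def)
    then obtain t where "\<phi> s * t = 1" by (auto simp: Units_def mult.commute)
    then have "\<phi> s dvd 1" by (intro dvdI[of _ _ t]) simp
    moreover have "\<phi> s \<in> ?G" "\<phi> r \<in> ?G" using carrier[OF s] carrier[OF rs(1)] gen by blast+
    ultimately show "\<exists>s\<in>?G. a * s \<in> ?G \<and> s dvd 1" using rs(3) by (intro bexI[of _ "\<phi> s"]) simp_all
  qed
qed

theorem theorem1p11:
  fixes scale :: "'k::field_char_0 \<Rightarrow> 'a::idom \<Rightarrow> 'a"
    and br :: "'a \<Rightarrow> 'a \<Rightarrow> 'a"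
    and n d :: nat
    and fs :: "((nat \<Rightarrow>\<^sub>0 nat) \<Rightarrow>\<^sub>0 'k) list"
    and I :: "((nat \<Rightarrow>\<^sub>0 nat) \<Rightarrow>\<^sub>0 'k) set"
    and S :: "((nat \<Rightarrow>\<^sub>0 nat) \<Rightarrow>\<^sub>0 'k) set set"
    and \<phi> :: "((nat \<Rightarrow>\<^sub>0 nat) \<Rightarrow>\<^sub>0 'k) set \<Rightarrow> 'a"
    and x :: "nat \<Rightarrow> 'a"
  assumes poisson: "poisson_algebra scale br"
    and generators: "set fs \<subseteq> carrier (mpoly_ring n)" "I = Idl\<^bsub>mpoly_ring n\<^esub> (set fs)"
    and prime: "primeideal I (mpoly_ring n)"
    and not_maximal: "\<not> maximalideal I (mpoly_ring n)"
    and localization: "is_localization (mpoly_ring n Quot I) S class_ring \<phi>"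
    and algebra_map: "\<And>c. \<phi> (I +>\<^bsub>mpoly_ring n\<^esub> pconst c) = scale c 1"
    and regular: "regular_domain TYPE('a)"
    and coordinates: "\<And>i. i < n \<Longrightarrow> x i = \<phi> (I +>\<^bsub>mpoly_ring n\<^esub> pvar i)"
    and rank: "d = poisson_rank br x n"
  shows "(poisson_pi scale br \<in> ring_iso (U scale br) (diff_ops scale)
          \<longleftrightarrow> kappa scale br x n d = {\<zero>\<^bsub>U scale br\<^esub>} \<and> minors_ideal br x n d = UNIV)
       \<and> (poisson_pi scale br \<in> ring_iso (U scale br) (diff_ops scale)
          \<or> (kappa scale br x n d = {\<zero>\<^bsub>U scale br\<^esub>} \<and> minors_ideal br x n d = UNIV)
          \<longrightarrow> a_kernel (U scale br) (diff_ops scale) (poisson_pi scale br) = {\<zero>\<^bsub>U scale br\<^esub>}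
            \<and> poisson_pi scale br \<in> ring_iso (U scale br) (poisson_diff_ops scale br)
            \<and> poisson_diff_ops scale br = diff_ops scale)"
proof -
  interpret P: poisson_algebra scale br by (rule poisson)
  have I: "ideal I (mpoly_ring n)" using prime by (rule primeideal.axioms)
  have ess: "ess_finite_algebra scale x n"
    by (rule ess_finite_localization[OF P.comm_algebra_axioms I localization algebra_map coordinates])
  interpret ess_poisson scale br x n by (rule ess_poisson.intro[OF poisson ess])
  let ?iso = "poisson_pi scale br \<in> ring_iso (U scale br) (diff_ops scale)"
  let ?cond = "kappa scale br x n d = {\<zero>\<^bsub>U scale br\<^esub>} \<and> minors_ideal br x n d = UNIV"
  have eq: "?iso \<longleftrightarrow> ?cond" using conditions_of_isomorphism[OF rank regular] isomorphism_of_conditions(2)[OF rank] by blast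
  moreover have "a_kernel (U scale br) (diff_ops scale) (poisson_pi scale br) = {\<zero>\<^bsub>U scale br\<^esub>}
            \<and> poisson_pi scale br \<in> ring_iso (U scale br) (poisson_diff_ops scale br)
            \<and> poisson_diff_ops scale br = diff_ops scale" if c: ?cond
  proof -
    have inj: "inj_on (poisson_pi scale br) (carrier (U scale br))" using poisson_pi_injective c by blast
    show ?thesis using kernel_trivial[OF inj] ring_iso_PD[OF inj] isomorphism_of_conditions(1)[OF rank] c by blast
  qed
  ultimately show ?thesis by blast
qed

end
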